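(* Let $\rho^{AB}$ be a density operator on a finite-dimensional Hilbert space $\mathcal{H}_A\otimes\mathcal{H}_B$, let $\phi^{RAB}=|\phi\rangle\langle\phi|^{RAB}$ be its canonical purification, let $\mathsf{X}$ be a finite reconstruction alphabet, and let $\mathcal{W}:\mathsf{X}\to\mathcal{D}(\mathcal{H}_R\otimes\mathcal{H}_B)$, $x\mapsto\mathcal{W}^{RB}_x$, be a classical-quantum posterior channel. Define $$\mathcal{A}(\rho^{AB},\mathcal{W}):=\Big\{P_X\in\mathcal{P}(\mathsf{X}):\ \sum_{x\in\mathsf{X}}P_X(x)\,\mathcal{W}^{RB}_x=\mathrm{Tr}_A\{\phi^{RAB}\}\Big\}.$$ If $\mathcal{A}(\rho^{AB},\mathcal{W})$ is non-empty, then every rate $R$ satisfying $$R\ \ge\ I(X;RB)_\sigma-I(X;B)_\sigma=I(X;R|B)_\sigma$$ for some $P_X\in\mathcal{A}(\rho^{AB},\mathcal{W})$ is achievable (in the sense defined in the context), where the quantum mutual informations are computed with respect to the classical-quantum state $$\sigma^{XRB}:=\sum_{x\in\mathsf{X}}P_X(x)\,|x\rangle\langle x|^X\otimes\mathcal{W}^{RB}_x,$$ with $\{|x\rangle\}_{x\in\mathsf{X}}$ an orthonormal basis of a Hilbert space $\mathcal{H}_X$ of dimension $|\mathsf{X}|$.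
   Context: $\mathcal{D}(\mathcal{H})$ denotes the set of density operators on $\mathcal{H}$, $\mathcal{P}(\mathsf{X})$ the set of probability distributions on $\mathsf{X}$, and $[\Theta]=\{1,\dots,\Theta\}$. The system $R$ is a reference system (isomorphic to $AB$) purifying $\rho^{AB}$. For $x^n=(x_1,\dots,x_n)\in\mathsf{X}^n$, $\mathcal{W}^{RB}_{x^n}:=\bigotimes_{i=1}^n\mathcal{W}^{RB}_{x_i}$ on $R^nB^n$. An $(n,\Theta)$ lossy quantum-classical compression protocol with quantum side information consists of: (i) an encoding POVM $\{\Omega_m\}_{m=1}^{\Theta}$ on $\mathcal{H}_A^{\otimes n}$; (ii) for each $m\in[\Theta]$, a decoding POVM $\{\Lambda^{(m)}_k\}_{k=1}^{\bar\Theta}$ on $\mathcal{H}_B^{\otimes n}$ (for some positive integer $\bar\Theta$); (iii) a decoding map $f:[\Theta]\times[\bar\Theta]\to\mathsf{X}^n$, written $f(m,k)=x^n(m,k)$. For each $(m,k)$ define the unnormalized operator on $R^nB^n$ $$\tau^{R^nB^n}_{m,k}:=\big(I^{R^n}\otimes\sqrt{\Lambda^{(m)}_k}\big)\,\mathrm{Tr}_{A^n}\{(I^{R^nB^n}\otimes\Omega_m)(\phi^{RAB})^{\otimes n}\}\,\big(I^{R^n}\otimes\sqrt{\Lambda^{(m)}_k}\big),$$ and $Q(m,k):=\mathrm{Tr}\{\tau_{m,k}\}=\mathrm{Tr}\{(\Omega_m\otimes\Lambda^{(m)}_k)(\rho^{AB})^{\otimes n}\}$. The error of the protocol is $$\Xi:=\Big\|\sum_{m,k}|x^n(m,k)\rangle\langle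 x^n(m,k)|\otimes\tau^{R^nB^n}_{m,k}-\sum_{m,k}Q(m,k)\,|x^n(m,k)\rangle\langle x^n(m,k)|\otimes\mathcal{W}^{RB}_{x^n(m,k)}\Big\|_1,$$ with $\{|x^n\rangle\}$ the product orthonormal basis of $\mathcal{H}_X^{\otimes n}$. A rate $R$ is achievable if for every $\epsilon>0$ and all sufficiently large $n$ there is an $(n,\Theta)$ such protocol with $\frac1n\log\Theta\le R+\epsilon$ and $\Xi\le\epsilon$. *)

theory Defs
  imports Complex_Main "HOL-Library.FuncSet"
begin

text \<open>An operator on the Hilbert space with orthonormal basis indexed by the finite set I
  is represented by its matrix  i j \<mapsto> M i j  (only entries with i, j in I matter).\<close>

type_synonym 'i op = "'i \<Rightarrow> 'i \<Rightarrow> complex"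

definition op_mult :: "'i set \<Rightarrow> 'i op \<Rightarrow> 'i op \<Rightarrow> 'i op" where
  "op_mult I A B = (\<lambda>i j. \<Sum>k\<in>I. A i k * B k j)"

definition op_adj :: "'i op \<Rightarrow> 'i op" where
  "op_adj A = (\<lambda>i j. cnj (A j i))"

definition op_trace :: "'i set \<Rightarrow> 'i op \<Rightarrow> complex" where
  "op_trace I A = (\<Sum>i\<in>I. A i i)"

definition op_id :: "'i op" where
  "op_id = (\<lambda>i j. if i = j then 1 else 0)"

definition op_eq_on :: "'i set \<Rightarrow> 'i op \<Rightarrow> 'i op \<Rightarrow> bool" where
  "op_eq_on I A B \<longleftrightarrow> (\<forall>i\<in>I. \<forall>j\<in>I. A i j = B i j)"

definition hermitian_on :: "'i set \<Rightarrow> 'i op \<Rightarrow> bool" where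
  "hermitian_on I A \<longleftrightarrow> (\<forall>i\<in>I. \<forall>j\<in>I. A i j = cnj (A j i))"

definition psd_on :: "'i set \<Rightarrow> 'i op \<Rightarrow> bool" where
  "psd_on I A \<longleftrightarrow> hermitian_on I A \<and>
     (\<forall>v :: 'i \<Rightarrow> complex. let q = (\<Sum>i\<in>I. \<Sum>j\<in>I. cnj (v i) * A i j * v j)
                              in Im q = 0 \<and> Re q \<ge> 0)"

definition density_on :: "'i set \<Rightarrow> 'i op \<Rightarrow> bool" where
  "density_on I A \<longleftrightarrow> psd_on I A \<and> op_trace I A = 1"

definition unitary_on :: "'i set \<Rightarrow> 'i op \<Rightarrow> bool" where
  "unitary_on I U \<longleftrightarrow> op_eq_on I (op_mult I U (op_adj U)) op_id"

definition psd_sqrt :: "'i set \<Rightarrow> 'i op \<Rightarrow> 'i op" where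
  "psd_sqrt I M = (THE S. psd_on I S \<and> op_eq_on I (op_mult I S S) M \<and>
                        (\<forall>i j. i \<notin> I \<or> j \<notin> I \<longrightarrow> S i j = 0))"

definition trace_norm :: "'i set \<Rightarrow> 'i op \<Rightarrow> real" where
  "trace_norm I A = Re (op_trace I (psd_sqrt I (op_mult I (op_adj A) A)))"

text \<open>Von Neumann entropy (base-2 logarithm; note 0 * log 2 0 = 0 in Isabelle),
  via a spectral decomposition  \<rho> = U diag(d) U^*.\<close>
definition vn_entropy :: "'i set \<Rightarrow> 'i op \<Rightarrow> real" where
  "vn_entropy I \<rho> = (SOME s. \<exists>U (d :: 'i \<Rightarrow> real). unitary_on I U \<and>
      (\<forall>i\<in>I. \<forall>j\<in>I. \<rho> i j = (\<Sum>k\<in>I. U i k * complex_of_real (d k) * cnj (U j k))) \<and>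
      s = (\<Sum>k\<in>I. - (d k * log 2 (d k))))"

definition povm_on :: "'i set \<Rightarrow> nat set \<Rightarrow> (nat \<Rightarrow> 'i op) \<Rightarrow> bool" where
  "povm_on I M E \<longleftrightarrow> (\<forall>m\<in>M. psd_on I (E m)) \<and>
      op_eq_on I (\<lambda>i j. \<Sum>m\<in>M. E m i j) op_id"

definition prob_dist :: "('x::finite \<Rightarrow> real) \<Rightarrow> bool" where
  "prob_dist P \<longleftrightarrow> (\<forall>x. P x \<ge> 0) \<and> (\<Sum>x\<in>UNIV. P x) = 1"

text \<open>Sequences of length n over a finite alphabet: index set of the n-fold tensor power.\<close>
definition seqs :: "nat \<Rightarrow> (nat \<Rightarrow> 'a) set" where
  "seqs n = PiE {..<n} (\<lambda>_. UNIV)"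

text \<open>System A has basis indexed by 'a, B by 'b, and R (isomorphic to AB) by 'a \<times> 'b.
  Index of RAB: (r, a, b).  Index of RB: (r, b).\<close>

text \<open>Canonical purification |\<phi>\<rangle> = \<Sum>_r |r\<rangle>_R \<otimes> sqrt(\<rho>)|r\<rangle>_AB,
  i.e. \<psi>(r,a,b) = sqrt(\<rho>)((a,b), r).\<close>
definition purif_vec :: "('a::finite \<times> 'b::finite) op \<Rightarrow> ('a \<times> 'b) \<times> 'a \<times> 'b \<Rightarrow> complex" where
  "purif_vec \<rho> = (\<lambda>(r, a, b). psd_sqrt UNIV \<rho> (a, b) r)"

definition purif :: "('a::finite \<times> 'b::finite) op \<Rightarrow> (('a \<times> 'b) \<times> 'a \<times> 'b) op" where
  "purif \<rho> = (\<lambda>u v. purif_vec \<rho> u * cnj (purif_vec \<rho> v))"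

definition purif_RB :: "('a::finite \<times> 'b::finite) op \<Rightarrow> (('a \<times> 'b) \<times> 'b) op" where
  "purif_RB \<rho> = (\<lambda>(r, b) (r', b'). \<Sum>a\<in>UNIV. purif \<rho> (r, a, b) (r', a, b'))"

definition admissible ::
  "('a::finite \<times> 'b::finite) op \<Rightarrow> ('x::finite \<Rightarrow> (('a \<times> 'b) \<times> 'b) op) \<Rightarrow> ('x \<Rightarrow> real) set" where
  "admissible \<rho> W = {P. prob_dist P \<and>
      op_eq_on UNIV (\<lambda>u u'. \<Sum>x\<in>UNIV. complex_of_real (P x) * W x u u') (purif_RB \<rho>)}"

definition cq_state :: "('x::finite \<Rightarrow> real) \<Rightarrow> ('x \<Rightarrow> ('r \<times> 'b) op) \<Rightarrow> ('x \<times> ('r \<times> 'b)) op" where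
  "cq_state P W = (\<lambda>(x, u) (x', u'). if x = x' then complex_of_real (P x) * W x u u' else 0)"

definition marg_X :: "('x \<times> ('r::finite \<times> 'b::finite)) op \<Rightarrow> 'x op" where
  "marg_X \<sigma> = (\<lambda>x x'. \<Sum>u\<in>UNIV. \<sigma> (x, u) (x', u))"

definition marg_RB :: "('x::finite \<times> ('r \<times> 'b)) op \<Rightarrow> ('r \<times> 'b) op" where
  "marg_RB \<sigma> = (\<lambda>u u'. \<Sum>x\<in>UNIV. \<sigma> (x, u) (x, u'))"

definition marg_XB :: "('x \<times> ('r::finite \<times> 'b)) op \<Rightarrow> ('x \<times> 'b) op" where
  "marg_XB \<sigma> = (\<lambda>(x, b) (x', b'). \<Sum>r\<in>UNIV. \<sigma> (x, (r, b)) (x', (r, b')))"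

definition marg_B :: "('x::finite \<times> ('r::finite \<times> 'b)) op \<Rightarrow> 'b op" where
  "marg_B \<sigma> = (\<lambda>b b'. \<Sum>x\<in>UNIV. \<Sum>r\<in>UNIV. \<sigma> (x, (r, b)) (x, (r, b')))"

definition mi_X_RB :: "('x::finite \<times> ('r::finite \<times> 'b::finite)) op \<Rightarrow> real" where
  "mi_X_RB \<sigma> = vn_entropy UNIV (marg_X \<sigma>) + vn_entropy UNIV (marg_RB \<sigma>) - vn_entropy UNIV \<sigma>"

definition mi_X_B :: "('x::finite \<times> ('r::finite \<times> 'b::finite)) op \<Rightarrow> real" where
  "mi_X_B \<sigma> = vn_entropy UNIV (marg_X \<sigma>) + vn_entropy UNIV (marg_B \<sigma>) - vn_entropy UNIV (marg_XB \<sigma>)"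

definition purif_pow :: "('a::finite \<times> 'b::finite) op \<Rightarrow> nat \<Rightarrow>
    ((nat \<Rightarrow> 'a \<times> 'b) \<times> (nat \<Rightarrow> 'a) \<times> (nat \<Rightarrow> 'b)) op" where
  "purif_pow \<rho> n = (\<lambda>(r, a, b) (r', a', b').
      \<Prod>k<n. purif \<rho> (r k, a k, b k) (r' k, a' k, b' k))"

text \<open>Tr_{A^n} {(I \<otimes> \<Omega>) \<phi>^{\<otimes>n}}, an operator on R^n B^n.\<close>
definition enc_state :: "('a::finite \<times> 'b::finite) op \<Rightarrow> nat \<Rightarrow> (nat \<Rightarrow> 'a) op \<Rightarrow>
    ((nat \<Rightarrow> 'a \<times> 'b) \<times> (nat \<Rightarrow> 'b)) op" where
  "enc_state \<rho> n Om = (\<lambda>(r, b) (r', b'). \<Sum>a\<in>seqs n. \<Sum>a''\<in>seqs n.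
      Om a a'' * purif_pow \<rho> n (r, a'', b) (r', a, b'))"

definition post_state :: "nat \<Rightarrow> ((nat \<Rightarrow> 'r) \<times> (nat \<Rightarrow> 'b)) op \<Rightarrow> (nat \<Rightarrow> 'b) op \<Rightarrow>
    ((nat \<Rightarrow> 'r) \<times> (nat \<Rightarrow> 'b)) op" where
  "post_state n T Lam = (let S = psd_sqrt (seqs n) Lam in
     (\<lambda>(r, b) (r', b'). \<Sum>c\<in>seqs n. \<Sum>c'\<in>seqs n. S b c * T (r, c) (r', c') * S c' b'))"

definition W_pow :: "('x \<Rightarrow> ('r \<times> 'b) op) \<Rightarrow> nat \<Rightarrow> (nat \<Rightarrow> 'x) \<Rightarrow> ((nat \<Rightarrow> 'r) \<times> (nat \<Rightarrow> 'b)) op" where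
  "W_pow W n xs = (\<lambda>(r, b) (r', b'). \<Prod>k<n. W (xs k) (r k, b k) (r' k, b' k))"

definition protocol_error ::
  "('a::finite \<times> 'b::finite) op \<Rightarrow> ('x::finite \<Rightarrow> (('a \<times> 'b) \<times> 'b) op) \<Rightarrow> nat \<Rightarrow> nat \<Rightarrow> nat \<Rightarrow>
   (nat \<Rightarrow> (nat \<Rightarrow> 'a) op) \<Rightarrow> (nat \<Rightarrow> nat \<Rightarrow> (nat \<Rightarrow> 'b) op) \<Rightarrow> (nat \<Rightarrow> nat \<Rightarrow> (nat \<Rightarrow> 'x)) \<Rightarrow> real" where
  "protocol_error \<rho> W n Th Thb Om Lam f =
     (let tau = (\<lambda>m k. post_state n (enc_state \<rho> n (Om m)) (Lam m k));
          Q = (\<lambda>m k. op_trace (seqs n \<times> seqs n) (tau m k))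
      in trace_norm (seqs n \<times> (seqs n \<times> seqs n))
          (\<lambda>(y, u) (y', u'). \<Sum>m\<in>{1..Th}. \<Sum>k\<in>{1..Thb}.
              (if y = f m k \<and> y' = f m k
               then tau m k u u' - Q m k * W_pow W n (f m k) u u' else 0)))"

definition is_protocol ::
  "nat \<Rightarrow> nat \<Rightarrow> nat \<Rightarrow> (nat \<Rightarrow> (nat \<Rightarrow> 'a::finite) op) \<Rightarrow> (nat \<Rightarrow> nat \<Rightarrow> (nat \<Rightarrow> 'b::finite) op) \<Rightarrow>
   (nat \<Rightarrow> nat \<Rightarrow> (nat \<Rightarrow> 'x::finite)) \<Rightarrow> bool" where
  "is_protocol n Th Thb Om Lam f \<longleftrightarrow>
     Th \<ge> 1 \<and> Thb \<ge> 1 \<and>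
     povm_on (seqs n) {1..Th} Om \<and>
     (\<forall>m\<in>{1..Th}. povm_on (seqs n) {1..Thb} (Lam m)) \<and>
     (\<forall>m\<in>{1..Th}. \<forall>k\<in>{1..Thb}. f m k \<in> seqs n)"

definition achievable ::
  "('a::finite \<times> 'b::finite) op \<Rightarrow> ('x::finite \<Rightarrow> (('a \<times> 'b) \<times> 'b) op) \<Rightarrow> real \<Rightarrow> bool" where
  "achievable \<rho> W R \<longleftrightarrow> (\<forall>\<epsilon>>0. \<exists>N. \<forall>n\<ge>N. \<exists>Th Thb Om Lam f.
      is_protocol n Th Thb Om Lam (f :: nat \<Rightarrow> nat \<Rightarrow> (nat \<Rightarrow> 'x)) \<and>
      log 2 (real Th) / real n \<le> R + \<epsilon> \<and>
      protocol_error \<rho> W n Th Thb Om Lam f \<le> \<epsilon>)"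

end

theory Submission
  imports Defs "HOL-Analysis.Analysis" "HOL-Library.Function_Algebras" "HOL-Computational_Algebra.Polynomial"
begin

text \<open>Draw \<open>MK\<close> codewords independently from \<open>P\<^sup>n\<close> and arrange them in \<open>M\<close> bins of size \<open>K\<close>. If
  \<open>log (MK)\<close> exceeds \<open>n I(X;RB)\<close>, the uniform mixture of the codeword states is close to
  \<open>Tr\<^sub>A \<phi>\<close> on \<open>R\<^sup>n B\<^sup>n\<close> (soft covering: project onto typical subspaces and bound a
  Hilbert-Schmidt variance), so that, by Uhlmann's theorem in the form given by the Powers--Stormer
  inequality, measuring \<open>A\<^sup>n\<close> approximately prepares a random codeword state on \<open>R\<^sup>n B\<^sup>n\<close>. The encoder
  sends only the bin. If \<open>log K\<close> is below \<open>n I(X;B)\<close>, sequential decoding on \<open>B\<^sup>n\<close> finds the codeword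
  within its bin, and by the gentle measurement lemma it hardly disturbs the state. Typicality is a
  Chernoff bound on products of eigenvalues. Since \<open>M\<close> has to be at least 1, the rate bound also
  needs \<open>I(X;RB) \<ge> I(X;B)\<close>.

  Trace norms are handled by duality throughout: differences of states are tested against
  contractions \<open>C\<close>.\<close>

subsection \<open>Rectangular matrices over finite index sets\<close>

text \<open>A state is carried by a factor \<open>G\<close>, as the product of \<open>G\<close> with
  \<open>adj G\<close>. Testing a difference of states against a contraction then reduces to
  Cauchy-Schwarz on factors (\<open>contr_tr_bound\<close>), so every quantitative estimate concerns
  squared Hilbert-Schmidt norms \<open>hs\<close>; the trace norm is unfolded only in
  \<open>trace_norm_hermitian\<close>. A partial trace over R is a reshaping of the factor
  (\<open>red\<close>), and one over A is a product of the purification, read as a matrix with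
  columns indexed by A, with its adjoint. One code has to serve covering and decoding at once, so
  the expected failures of both kinds are added before a code is selected. The analysis compares
  with the uniform weight 1/(MK), whereas the protocol error uses the actual outcome probabilities;
  the exchange doubles the bound. The fourth root of \<open>\<epsilon>\<close> in the coding bound
  has two sources: covering loses one root by gentle measurement and the encoder another by
  Powers--Stormer; decoding loses one in the union bound and another by gentle measurement.\<close>

definition mm :: "('i \<Rightarrow> 'k \<Rightarrow> complex) \<Rightarrow> 'k set \<Rightarrow> ('k \<Rightarrow> 'j \<Rightarrow> complex) \<Rightarrow> 'i \<Rightarrow> 'j \<Rightarrow> complex"
    ("(_ /\<star>\<^bsub>_\<^esub> _)" [71, 0, 70] 70)
  where "(A \<star>\<^bsub>K\<^esub> B) = (\<lambda>i j. \<Sum>k\<in>K. A i k * B k j)"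

definition adj :: "('i \<Rightarrow> 'j \<Rightarrow> complex) \<Rightarrow> 'j \<Rightarrow> 'i \<Rightarrow> complex"
  where "adj A = (\<lambda>j i. cnj (A i j))"

definition smul :: "complex \<Rightarrow> ('i \<Rightarrow> 'j \<Rightarrow> complex) \<Rightarrow> 'i \<Rightarrow> 'j \<Rightarrow> complex"
  where "smul c A = (\<lambda>i j. c * A i j)"

lemma smul_apply [simp]: "smul c A i j = c * A i j"
  by (simp add: smul_def)

text \<open>The squared norm, without the root: it is the trace of a Gram matrix and additive over
  orthogonal parts. With the column type \<open>unit\<close> it is the squared norm of a
  vector.\<close>

definition hs :: "'i set \<Rightarrow> 'j set \<Rightarrow> ('i \<Rightarrow> 'j \<Rightarrow> complex) \<Rightarrow> real"
  where "hs I J A = (\<Sum>i\<in>I. \<Sum>j\<in>J. (cmod (A i j))\<^sup>2)"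

abbreviation tr :: "'i set \<Rightarrow> ('i \<Rightarrow> 'i \<Rightarrow> complex) \<Rightarrow> complex"
  where "tr \<equiv> op_trace"

lemma sum_fun_apply: "(\<Sum>l\<in>L. F l) i = (\<Sum>l\<in>L. F l i)"
  by (induction L rule: infinite_finite_induct) auto

lemma op_mult_mm: "op_mult I A B = A \<star>\<^bsub>I\<^esub> B"
  by (simp add: op_mult_def mm_def)

lemma op_adj_adj: "op_adj A = adj A"
  by (simp add: op_adj_def adj_def)

text \<open>As a simp rule this makes right-nested products the normal form, so regroupings, for
  instance to expose a Gram product, are written with explicit parentheses.\<close>

lemma mm_assoc [simp]: "(A \<star>\<^bsub>K\<^esub> B) \<star>\<^bsub>L\<^esub> C = A \<star>\<^bsub>K\<^esub> B \<star>\<^bsub>L\<^esub> C"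
proof (intro ext)
  fix i j
  have "((A \<star>\<^bsub>K\<^esub> B) \<star>\<^bsub>L\<^esub> C) i j = (\<Sum>l\<in>L. \<Sum>k\<in>K. A i k * B k l * C l j)"
    by (simp add: mm_def sum_distrib_right)
  also have "\<dots> = (\<Sum>k\<in>K. \<Sum>l\<in>L. A i k * B k l * C l j)"
    by (rule sum.swap)
  also have "\<dots> = (A \<star>\<^bsub>K\<^esub> B \<star>\<^bsub>L\<^esub> C) i j"
    by (simp add: mm_def sum_distrib_left mult.assoc)
  finally show "((A \<star>\<^bsub>K\<^esub> B) \<star>\<^bsub>L\<^esub> C) i j = (A \<star>\<^bsub>K\<^esub> B \<star>\<^bsub>L\<^esub> C) i j" .
qed

lemma adj_adj [simp]: "adj (adj A) = A"
  by (simp add: adj_def)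

lemma adj_mm [simp]: "adj (A \<star>\<^bsub>K\<^esub> B) = adj B \<star>\<^bsub>K\<^esub> adj A"
  by (simp add: adj_def mm_def mult.commute fun_eq_iff)

lemma adj_add [simp]: "adj (A + B) = adj A + adj B"
  and adj_diff [simp]: "adj (A - B) = adj A - adj B"
  and adj_smul [simp]: "adj (smul c A) = smul (cnj c) (adj A)"
  by (simp_all add: adj_def fun_eq_iff smul_def)

lemma mm_add_left: "(A + B) \<star>\<^bsub>K\<^esub> C = A \<star>\<^bsub>K\<^esub> C + B \<star>\<^bsub>K\<^esub> C"
  and mm_add_right: "A' \<star>\<^bsub>K\<^esub> (B' + C') = A' \<star>\<^bsub>K\<^esub> B' + A' \<star>\<^bsub>K\<^esub> C'"
  and mm_diff_left: "(A - B) \<star>\<^bsub>K\<^esub> C = A \<star>\<^bsub>K\<^esub> C - B \<star>\<^bsub>K\<^esub> C"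
  and mm_diff_right: "A' \<star>\<^bsub>K\<^esub> (B' - C') = A' \<star>\<^bsub>K\<^esub> B' - A' \<star>\<^bsub>K\<^esub> C'"
  by (simp_all add: mm_def fun_eq_iff algebra_simps sum.distrib sum_subtractf)

lemma mm_smul_left [simp]: "smul c A \<star>\<^bsub>K\<^esub> B = smul c (A \<star>\<^bsub>K\<^esub> B)"
  and mm_smul_right [simp]: "A \<star>\<^bsub>K\<^esub> smul c B = smul c (A \<star>\<^bsub>K\<^esub> B)"
  by (simp_all add: mm_def fun_eq_iff smul_def sum_distrib_left algebra_simps)

lemma mm_sum_left: "(\<Sum>l\<in>L. F l) \<star>\<^bsub>K\<^esub> B = (\<Sum>l\<in>L. F l \<star>\<^bsub>K\<^esub> B)"
proof -
  have "(\<Sum>k\<in>K. \<Sum>l\<in>L. F l i k * B k j) = (\<Sum>l\<in>L. \<Sum>k\<in>K. F l i k * B k j)" for i j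
    by (rule sum.swap)
  then show ?thesis
    by (simp add: mm_def fun_eq_iff sum_fun_apply sum_distrib_right)
qed

lemma mm_sum_right: "A \<star>\<^bsub>K\<^esub> (\<Sum>l\<in>L. F l) = (\<Sum>l\<in>L. A \<star>\<^bsub>K\<^esub> F l)"
proof -
  have "(\<Sum>k\<in>K. \<Sum>l\<in>L. A i k * F l k j) = (\<Sum>l\<in>L. \<Sum>k\<in>K. A i k * F l k j)" for i j
    by (rule sum.swap)
  then show ?thesis
    by (simp add: mm_def fun_eq_iff sum_fun_apply sum_distrib_left)
qed

lemmas mm_distrib = mm_add_left mm_add_right mm_diff_left mm_diff_right

lemma mm_cong:
  "(\<And>k. k \<in> K \<Longrightarrow> A i k = A' i k) \<Longrightarrow> (\<And>k. k \<in> K \<Longrightarrow> B k j = B' k j)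
   \<Longrightarrow> (A \<star>\<^bsub>K\<^esub> B) i j = (A' \<star>\<^bsub>K\<^esub> B') i j"
  by (simp add: mm_def)

lemma mm_op_id_left: "finite I \<Longrightarrow> i \<in> I \<Longrightarrow> (op_id \<star>\<^bsub>I\<^esub> A) i j = A i j"
  and mm_op_id_right: "finite I \<Longrightarrow> k \<in> I \<Longrightarrow> (B \<star>\<^bsub>I\<^esub> op_id) j k = B j k"
  by (simp_all add: mm_def op_id_def if_distrib[of "\<lambda>x. x * _"] if_distrib[of "\<lambda>x. _ * x"] cong: if_cong)

lemma tr_cong: "(\<And>i. i \<in> I \<Longrightarrow> A i i = B i i) \<Longrightarrow> tr I A = tr I B"
  by (simp add: op_trace_def)

lemma tr_add: "tr I (A + B) = tr I A + tr I B"
  and tr_diff: "tr I (A - B) = tr I A - tr I B"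
  and tr_smul: "tr I (smul c A) = c * tr I A"
  by (simp_all add: op_trace_def sum.distrib sum_subtractf smul_def sum_distrib_left)

lemma tr_sum: "tr I (\<Sum>l\<in>L. F l) = (\<Sum>l\<in>L. tr I (F l))"
  unfolding op_trace_def sum_fun_apply by (rule sum.swap)

lemma tr_mm_commute: "tr I (A \<star>\<^bsub>J\<^esub> B) = tr J (B \<star>\<^bsub>I\<^esub> A)"
proof -
  have "tr I (A \<star>\<^bsub>J\<^esub> B) = (\<Sum>i\<in>I. \<Sum>j\<in>J. A i j * B j i)"
    by (simp add: op_trace_def mm_def)
  also have "\<dots> = (\<Sum>j\<in>J. \<Sum>i\<in>I. A i j * B j i)" by (rule sum.swap)
  also have "\<dots> = tr J (B \<star>\<^bsub>I\<^esub> A)"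
    by (simp add: op_trace_def mm_def mult.commute)
  finally show ?thesis .
qed

lemma tr_adj: "tr I (adj A) = cnj (tr I A)"
  by (simp add: op_trace_def adj_def)

lemma hs_cong: "(\<And>i j. i \<in> I \<Longrightarrow> j \<in> J \<Longrightarrow> A i j = B i j) \<Longrightarrow> hs I J A = hs I J B"
  by (simp add: hs_def)

lemma hs_nonneg [simp]: "hs I J A \<ge> 0"
  by (simp add: hs_def sum_nonneg)

lemma hs_adj [simp]: "hs I J (adj A) = hs J I A"
  unfolding hs_def adj_def by (subst sum.swap) simp

lemma hs_tr: "tr J (adj A \<star>\<^bsub>I\<^esub> A) = complex_of_real (hs I J A)"
proof -
  have "tr J (adj A \<star>\<^bsub>I\<^esub> A) = (\<Sum>j\<in>J. \<Sum>i\<in>I. cnj (A i j) * A i j)"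
    by (simp add: op_trace_def mm_def adj_def)
  also have "\<dots> = (\<Sum>i\<in>I. \<Sum>j\<in>J. cnj (A i j) * A i j)" by (rule sum.swap)
  also have "\<dots> = complex_of_real (hs I J A)"
    unfolding hs_def by (simp add: complex_norm_square mult.commute del: of_real_power)
  finally show ?thesis .
qed

lemma hs_tr': "tr I (A \<star>\<^bsub>J\<^esub> adj A) = complex_of_real (hs I J A)"
  using hs_tr[of I "adj A" J] by simp

lemma hs_eq_0_iff: "finite I \<Longrightarrow> finite J \<Longrightarrow> hs I J A = 0 \<longleftrightarrow> (\<forall>i\<in>I. \<forall>j\<in>J. A i j = 0)"
  by (simp add: hs_def sum_nonneg_eq_0_iff sum_nonneg)

lemma hs_L2: "hs I J A = (L2_set (\<lambda>(i, j). cmod (A i j)) (I \<times> J))\<^sup>2"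
  unfolding hs_def L2_set_def
  by (subst real_sqrt_pow2) (auto simp: sum.cartesian_product intro!: sum_nonneg sum.cong)

lemma sqrt_hs: "sqrt (hs I J A) = L2_set (\<lambda>(i, j). cmod (A i j)) (I \<times> J)"
  unfolding hs_L2 by simp

lemma sqrt_hs_triangle: "sqrt (hs I J (A + B)) \<le> sqrt (hs I J A) + sqrt (hs I J B)"
proof -
  have "sqrt (hs I J (A + B)) \<le> L2_set (\<lambda>u. (case u of (i,j) \<Rightarrow> cmod (A i j)) + (case u of (i,j) \<Rightarrow> cmod (B i j))) (I \<times> J)"
    unfolding sqrt_hs by (rule L2_set_mono) (auto intro: norm_triangle_ineq)
  also have "\<dots> \<le> sqrt (hs I J A) + sqrt (hs I J B)"
    unfolding sqrt_hs by (rule L2_set_triangle_ineq)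
  finally show ?thesis .
qed

lemma hs_minus_commute: "hs I J (A - B) = hs I J (B - A)"
  by (simp add: hs_def norm_minus_commute)

lemma sqrt_hs_triangle_diff: "sqrt (hs I J (A - B)) \<le> sqrt (hs I J A) + sqrt (hs I J B)"
  using sqrt_hs_triangle[of I J A "0 - B"] hs_minus_commute[of I J 0 B] by simp

lemma hs_add_le: "hs I J (A + B) \<le> 2 * hs I J A + 2 * hs I J B"
proof -
  have "hs I J (A + B) = (sqrt (hs I J (A + B)))\<^sup>2" by simp
  also have "\<dots> \<le> (sqrt (hs I J A) + sqrt (hs I J B))\<^sup>2"
    by (intro power_mono sqrt_hs_triangle) simp
  also have "\<dots> \<le> 2 * (sqrt (hs I J A))\<^sup>2 + 2 * (sqrt (hs I J B))\<^sup>2"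
    using zero_le_power2[of "sqrt (hs I J A) - sqrt (hs I J B)"]
    unfolding power2_sum power2_diff by linarith
  finally show ?thesis by simp
qed

lemma hs_smul: "hs I J (smul c A) = (cmod c)\<^sup>2 * hs I J A"
  by (simp add: hs_def smul_def norm_mult power_mult_distrib sum_distrib_left)

lemma Cauchy_Schwarz_tr:
  "cmod (tr I (A \<star>\<^bsub>J\<^esub> B)) \<le> sqrt (hs I J A) * sqrt (hs J I B)"
proof -
  have "cmod (tr I (A \<star>\<^bsub>J\<^esub> B)) \<le> (\<Sum>i\<in>I. \<Sum>j\<in>J. cmod (A i j) * cmod (B j i))"
    unfolding op_trace_def mm_def
    by (intro order_trans[OF norm_sum] sum_mono) (simp add: norm_mult)
  also have "\<dots> = (\<Sum>u\<in>I \<times> J. \<bar>case u of (i,j) \<Rightarrow> cmod (A i j)\<bar> * \<bar>case u of (i,j) \<Rightarrow> cmod (adj B i j)\<bar>)"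
    by (simp add: sum.cartesian_product adj_def) (rule sum.cong; auto)
  also have "\<dots> \<le> L2_set (\<lambda>(i,j). cmod (A i j)) (I \<times> J) * L2_set (\<lambda>(i,j). cmod (adj B i j)) (I \<times> J)"
    by (rule L2_set_mult_ineq)
  also have "\<dots> = sqrt (hs I J A) * sqrt (hs I J (adj B))"
    unfolding sqrt_hs ..
  finally show ?thesis by simp
qed

lemma sum_sqrt_mult_le:
  assumes "\<And>l. l \<in> L \<Longrightarrow> a l \<ge> 0" "\<And>l. l \<in> L \<Longrightarrow> b l \<ge> 0"
  shows "(\<Sum>l\<in>L. sqrt (a l) * sqrt (b l)) \<le> sqrt (\<Sum>l\<in>L. a l) * sqrt (\<Sum>l\<in>L. b l)"
proof -
  have "(\<Sum>l\<in>L. sqrt (a l) * sqrt (b l)) = (\<Sum>l\<in>L. \<bar>sqrt (a l)\<bar> * \<bar>sqrt (b l)\<bar>)"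
    using assms by (intro sum.cong) auto
  also have "\<dots> \<le> L2_set (\<lambda>l. sqrt (a l)) L * L2_set (\<lambda>l. sqrt (b l)) L"
    by (rule L2_set_mult_ineq)
  also have "\<dots> = sqrt (\<Sum>l\<in>L. a l) * sqrt (\<Sum>l\<in>L. b l)"
    using assms by (simp add: L2_set_def)
  finally show ?thesis .
qed

subsection \<open>Contractions and isometries\<close>

text \<open>Operator norm at most 1. Test vectors are one-column matrices, so that the calculus of
  products and \<open>hs\<close> applies to them unchanged.\<close>

definition contr :: "'i set \<Rightarrow> 'j set \<Rightarrow> ('i \<Rightarrow> 'j \<Rightarrow> complex) \<Rightarrow> bool" where
  "contr I J C \<longleftrightarrow> (\<forall>v :: 'j \<Rightarrow> unit \<Rightarrow> complex. hs I UNIV (C \<star>\<^bsub>J\<^esub> v) \<le> hs J UNIV v)"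

lemma hs_columns: "hs I K M = (\<Sum>k\<in>K. hs I UNIV (\<lambda>i (_::unit). M i k))"
  unfolding hs_def by (subst sum.swap) (simp add: UNIV_unit)

text \<open>A Hilbert-Schmidt norm is a sum over columns, so the bound on vectors passes to matrices
  with any column set.\<close>

lemma hs_contr:
  assumes "contr I J C"
  shows "hs I K (C \<star>\<^bsub>J\<^esub> A) \<le> hs J K A"
proof -
  have "hs I K (C \<star>\<^bsub>J\<^esub> A) = (\<Sum>k\<in>K. hs I UNIV (C \<star>\<^bsub>J\<^esub> (\<lambda>i (_::unit). A i k)))"
    by (subst hs_columns) (simp add: mm_def)
  also have "\<dots> \<le> (\<Sum>k\<in>K. hs J UNIV (\<lambda>i (_::unit). A i k))"
    using assms by (intro sum_mono) (simp add: contr_def)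
  also have "\<dots> = hs J K A" by (rule hs_columns[symmetric])
  finally show ?thesis .
qed

lemma contr_mm: "contr I J A \<Longrightarrow> contr J K B \<Longrightarrow> contr I K (A \<star>\<^bsub>J\<^esub> B)"
  unfolding contr_def[of I K] by (auto intro: order_trans[OF hs_contr hs_contr])

text \<open>For \<open>u = C v\<close> the assumption says that the squared norm of
  \<open>C v\<close> is at most the norm of \<open>C v\<close> times that of \<open>v\<close>; one
  factor cancels.\<close>

lemma contr_bilinearI:
  assumes "\<And>(u :: 'i \<Rightarrow> unit \<Rightarrow> complex) (v :: 'j \<Rightarrow> unit \<Rightarrow> complex).
      cmod (tr UNIV (adj u \<star>\<^bsub>I\<^esub> C \<star>\<^bsub>J\<^esub> v)) \<le> sqrt (hs I UNIV u) * sqrt (hs J UNIV v)"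
  shows "contr I J C"
  unfolding contr_def
proof
  fix v :: "'j \<Rightarrow> unit \<Rightarrow> complex"
  let ?w = "C \<star>\<^bsub>J\<^esub> v"
  have "hs I UNIV ?w = cmod (tr UNIV (adj ?w \<star>\<^bsub>I\<^esub> ?w))"
    by (subst hs_tr) simp
  also have "\<dots> \<le> sqrt (hs I UNIV ?w) * sqrt (hs J UNIV v)" using assms[of ?w v] by simp
  finally have *: "hs I UNIV ?w \<le> sqrt (hs I UNIV ?w) * sqrt (hs J UNIV v)" .
  show "hs I UNIV ?w \<le> hs J UNIV v"
  proof (cases "hs I UNIV ?w = 0")
    case False
    then have pos: "sqrt (hs I UNIV ?w) > 0" using hs_nonneg[of I UNIV ?w] by (simp add: less_le del: hs_nonneg)
    have "sqrt (hs I UNIV ?w) * sqrt (hs I UNIV ?w) \<le> sqrt (hs I UNIV ?w) * sqrt (hs J UNIV v)"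
      using * by simp
    then have "sqrt (hs I UNIV ?w) \<le> sqrt (hs J UNIV v)"
      using pos mult_le_cancel_left_pos by blast
    then show ?thesis by simp
  qed simp
qed

lemma contr_adj:
  assumes "contr I J C"
  shows "contr J I (adj C)"
proof (rule contr_bilinearI)
  fix u :: "'b \<Rightarrow> unit \<Rightarrow> complex" and v :: "'a \<Rightarrow> unit \<Rightarrow> complex"
  have "adj u \<star>\<^bsub>J\<^esub> adj C \<star>\<^bsub>I\<^esub> v = adj (adj v \<star>\<^bsub>I\<^esub> C \<star>\<^bsub>J\<^esub> u)" by simp
  then have "cmod (tr UNIV (adj u \<star>\<^bsub>J\<^esub> adj C \<star>\<^bsub>I\<^esub> v)) = cmod (tr UNIV (adj v \<star>\<^bsub>I\<^esub> (C \<star>\<^bsub>J\<^esub> u)))"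
    by (simp only: tr_adj complex_mod_cnj)
  also have "\<dots> \<le> sqrt (hs UNIV I (adj v)) * sqrt (hs I UNIV (C \<star>\<^bsub>J\<^esub> u))"
    by (rule Cauchy_Schwarz_tr)
  also have "\<dots> \<le> sqrt (hs I UNIV v) * sqrt (hs J UNIV u)"
    using hs_contr[OF assms, of UNIV u] by (simp add: mult_left_mono)
  finally show "cmod (tr UNIV (adj u \<star>\<^bsub>J\<^esub> adj C \<star>\<^bsub>I\<^esub> v)) \<le> sqrt (hs J UNIV u) * sqrt (hs I UNIV v)"
    by (simp add: mult.commute)
qed

lemma contr_smul: "cmod c \<le> 1 \<Longrightarrow> contr I J C \<Longrightarrow> contr I J (smul c C)"
  unfolding contr_def
  by (auto simp: hs_smul power_le_one intro!: order_trans[OF mult_left_le_one_le])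

lemma contr_id: "finite I \<Longrightarrow> contr I I op_id"
  unfolding contr_def
  by (metis (mono_tags, lifting) hs_cong mm_op_id_left order_refl)

lemma contr_cong:
  assumes "\<And>i j. i \<in> I \<Longrightarrow> j \<in> J \<Longrightarrow> C i j = D i j"
  shows "contr I J C \<longleftrightarrow> contr I J D"
proof -
  have "hs I UNIV (C \<star>\<^bsub>J\<^esub> v) = hs I UNIV (D \<star>\<^bsub>J\<^esub> v)" for v :: "'b \<Rightarrow> unit \<Rightarrow> complex"
    by (intro hs_cong mm_cong assms) auto
  then show ?thesis by (simp add: contr_def)
qed

text \<open>Trace-norm duality in the form used throughout: the trace norm of a product of two
  matrices is at most the product of their Hilbert-Schmidt norms.\<close>

lemma contr_tr_bound:
  assumes "contr I I C"
  shows "cmod (tr I (C \<star>\<^bsub>I\<^esub> A \<star>\<^bsub>Z\<^esub> B)) \<le> sqrt (hs I Z A) * sqrt (hs Z I B)"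
proof -
  have "cmod (tr I (C \<star>\<^bsub>I\<^esub> A \<star>\<^bsub>Z\<^esub> B)) \<le> sqrt (hs I Z (C \<star>\<^bsub>I\<^esub> A)) * sqrt (hs Z I B)"
    using Cauchy_Schwarz_tr[of I "C \<star>\<^bsub>I\<^esub> A" Z B] by simp
  also have "\<dots> \<le> sqrt (hs I Z A) * sqrt (hs Z I B)"
    by (intro mult_right_mono real_sqrt_le_mono hs_contr[OF assms]) simp
  finally show ?thesis .
qed

text \<open>Orthonormal columns indexed by \<open>Z\<close>. A subset of the columns is again such a
  family, and \<open>u\<close> times \<open>adj u\<close> over that subset is the projection onto
  their span; this is how the spectral projections below arise.\<close>

definition isom :: "'i set \<Rightarrow> 'z set \<Rightarrow> ('i \<Rightarrow> 'z \<Rightarrow> complex) \<Rightarrow> bool" where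
  "isom I Z u \<longleftrightarrow> op_eq_on Z (adj u \<star>\<^bsub>I\<^esub> u) op_id"

lemma isom_cancel:
  assumes "isom I Z u" "finite Z" "z \<in> Z"
  shows "(adj u \<star>\<^bsub>I\<^esub> u \<star>\<^bsub>Z\<^esub> M) z j = M z j"
proof -
  have "(adj u \<star>\<^bsub>I\<^esub> u \<star>\<^bsub>Z\<^esub> M) z j = ((adj u \<star>\<^bsub>I\<^esub> u) \<star>\<^bsub>Z\<^esub> M) z j" by simp
  also have "\<dots> = (op_id \<star>\<^bsub>Z\<^esub> M) z j"
    using assms by (intro mm_cong) (auto simp: isom_def op_eq_on_def)
  also have "\<dots> = M z j" using assms by (simp add: mm_op_id_left)
  finally show ?thesis .
qed

lemma isom_mono: "isom I Z u \<Longrightarrow> Z' \<subseteq> Z \<Longrightarrow> isom I Z' u"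
  by (auto simp: isom_def op_eq_on_def)

lemma hs_isom:
  assumes "isom I Z u" "finite Z"
  shows "hs I J (u \<star>\<^bsub>Z\<^esub> M) = hs Z J M"
proof -
  have "complex_of_real (hs I J (u \<star>\<^bsub>Z\<^esub> M)) = tr J (adj M \<star>\<^bsub>Z\<^esub> (adj u \<star>\<^bsub>I\<^esub> u \<star>\<^bsub>Z\<^esub> M))"
    by (simp flip: hs_tr)
  also have "\<dots> = tr J (adj M \<star>\<^bsub>Z\<^esub> M)"
    by (intro tr_cong mm_cong isom_cancel assms refl)
  also have "\<dots> = complex_of_real (hs Z J M)" by (rule hs_tr)
  finally show ?thesis by (simp only: of_real_eq_iff)
qed

lemma contr_isom: "isom I Z u \<Longrightarrow> finite Z \<Longrightarrow> contr I Z u"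
  by (simp add: contr_def hs_isom)

lemma hs_self_isom:
  assumes "isom I Z u" "finite Z"
  shows "hs I Z u = card Z"
proof -
  have "complex_of_real (hs I Z u) = tr Z op_id"
    unfolding hs_tr[symmetric] using assms by (intro tr_cong) (auto simp: isom_def op_eq_on_def)
  also have "\<dots> = of_nat (card Z)" by (simp add: op_trace_def op_id_def)
  finally show ?thesis by (metis of_real_eq_iff of_real_of_nat_eq)
qed

lemma hs_pythagoras:
  assumes "isom I Z u" "finite Z"
  shows "hs I J (M - u \<star>\<^bsub>Z\<^esub> adj u \<star>\<^bsub>I\<^esub> M) = hs I J M - hs Z J (adj u \<star>\<^bsub>I\<^esub> M)"
proof -
  let ?N = "adj u \<star>\<^bsub>I\<^esub> M"
  have "complex_of_real (hs I J (M - u \<star>\<^bsub>Z\<^esub> ?N)) =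
      tr J (adj M \<star>\<^bsub>I\<^esub> M) - tr J (adj M \<star>\<^bsub>I\<^esub> u \<star>\<^bsub>Z\<^esub> ?N) - tr J (adj ?N \<star>\<^bsub>Z\<^esub> ?N)
      + tr J (adj ?N \<star>\<^bsub>Z\<^esub> (adj u \<star>\<^bsub>I\<^esub> u \<star>\<^bsub>Z\<^esub> ?N))"
    unfolding hs_tr[symmetric] adj_diff adj_mm adj_adj mm_distrib tr_diff mm_assoc by (simp only: diff_diff_eq2 diff_add_eq)
  also have "tr J (adj ?N \<star>\<^bsub>Z\<^esub> (adj u \<star>\<^bsub>I\<^esub> u \<star>\<^bsub>Z\<^esub> ?N)) = tr J (adj ?N \<star>\<^bsub>Z\<^esub> ?N)"
    by (intro tr_cong mm_cong isom_cancel assms refl)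
  also have "tr J (adj M \<star>\<^bsub>I\<^esub> u \<star>\<^bsub>Z\<^esub> ?N) = tr J (adj ?N \<star>\<^bsub>Z\<^esub> ?N)" by simp
  finally have "complex_of_real (hs I J (M - u \<star>\<^bsub>Z\<^esub> ?N)) = complex_of_real (hs I J M - hs Z J ?N)"
    by (simp only: of_real_diff diff_add_cancel hs_tr)
  then show ?thesis by (simp only: of_real_eq_iff)
qed

text \<open>Dimension count: subtracting from the identity its projection onto the range of
  \<open>u\<close> leaves squared norm \<open>card I - card Z\<close>, which is zero.\<close>

lemma isom_square_right:
  assumes "isom I Z u" "finite I" "finite Z" "card Z = card I"
  shows "op_eq_on I (u \<star>\<^bsub>Z\<^esub> adj u) op_id"
proof -
  have "hs I I op_id = hs Z I (adj u \<star>\<^bsub>I\<^esub> op_id)"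
  proof -
    have "hs Z I (adj u \<star>\<^bsub>I\<^esub> op_id) = hs Z I (adj u)"
      using assms by (intro hs_cong mm_op_id_right)
    also have "\<dots> = card I" using hs_self_isom[OF assms(1,3)] assms(4) by simp
    also have "\<dots> = hs I I op_id"
      using assms(2) by (simp add: hs_def op_id_def if_distrib[of cmod] if_distrib[of "\<lambda>x. x\<^sup>2"] cong: if_cong)
    finally show ?thesis by simp
  qed
  then have "hs I I (op_id - u \<star>\<^bsub>Z\<^esub> adj u \<star>\<^bsub>I\<^esub> op_id) = 0"
    by (simp add: hs_pythagoras assms)
  then have "\<forall>i\<in>I. \<forall>j\<in>I. op_id i j = ((u \<star>\<^bsub>Z\<^esub> adj u) \<star>\<^bsub>I\<^esub> op_id) i j"
    using assms by (auto simp: hs_eq_0_iff)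
  then show ?thesis
    using assms(2) by (simp add: op_eq_on_def mm_op_id_right del: mm_assoc)
qed

text \<open>\<open>unitary_on\<close> asserts only that \<open>U\<close> times its adjoint is the
  identity; the other order follows from the dimension count for \<open>adj U\<close>.\<close>

lemma isom_unitary: "finite I \<Longrightarrow> unitary_on I U \<Longrightarrow> isom I I U"
  using isom_square_right[of I I "adj U"]
  by (auto simp: unitary_on_def op_mult_mm op_adj_adj isom_def)

subsection \<open>Spectral theorem\<close>

lemma hermitian_mm_adj: "hermitian_on I A \<longleftrightarrow> op_eq_on I (adj A) A"
  by (auto simp: hermitian_on_def op_eq_on_def adj_def)

text \<open>First-order optimality: near t = 0 a nonzero linear term would outweigh the quadratic
  one.\<close>

lemma quadratic_nonneg_imp_linear_zero:
  fixes b c :: real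
  assumes "\<And>t. 0 \<le> 2 * t * b + t\<^sup>2 * c"
  shows "b = 0"
proof (rule ccontr)
  assume b: "b \<noteq> 0"
  \<comment> \<open>At this \<open>t\<close> the majorant with \<open>\<bar>c\<bar> + 1\<close> in
    place of \<open>c\<close> equals -b^2 / (|c| + 1); the added 1 keeps the denominator
    positive.\<close>
  define t where "t = - b / (\<bar>c\<bar> + 1)"
  have c1: "\<bar>c\<bar> + 1 > 0" by simp
  have "0 \<le> 2 * t * b + t\<^sup>2 * c" by (rule assms)
  also have "\<dots> \<le> 2 * t * b + t\<^sup>2 * (\<bar>c\<bar> + 1)"
    by (intro add_left_mono mult_left_mono) auto
  also have "\<dots> = - (b\<^sup>2 / (\<bar>c\<bar> + 1))"
  proof -
    have "2 * (- b / s) * b + (- b / s)\<^sup>2 * s = - (b\<^sup>2 / s)" if "s > 0" for s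
      using that by (simp add: field_simps power2_eq_square)
    from this[OF c1] show ?thesis by (simp add: t_def)
  qed
  also have "\<dots> < 0" using b c1 by simp
  finally show False by simp
qed

text \<open>Vectors are functions on the whole type, which may be infinite. Requiring them to vanish
  off \<open>I\<close> makes the sphere a closed subset of a product of balls and singletons,
  compact by Tychonoff's theorem.\<close>

lemma compact_unit_sphere_functions:
  fixes I :: "'i set"
  assumes "finite I"
  shows "compact {v :: 'i \<Rightarrow> complex. (\<forall>i. i \<notin> I \<longrightarrow> v i = 0) \<and> (\<Sum>i\<in>I. (cmod (v i))\<^sup>2) = 1}"
proof -
  let ?S = "{v :: 'i \<Rightarrow> complex. (\<forall>i. i \<notin> I \<longrightarrow> v i = 0) \<and> (\<Sum>i\<in>I. (cmod (v i))\<^sup>2) = 1}"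
  let ?P = "PiE UNIV (\<lambda>i. if i \<in> I then cball (0::complex) 1 else {0})"
  have "compactin (product_topology (\<lambda>i. euclidean) UNIV) ?P"
    by (subst compactin_PiE) auto
  then have c: "compact ?P"
    by (simp add: euclidean_product_topology)
  have "closed {v :: 'i \<Rightarrow> complex. (\<Sum>i\<in>I. (cmod (v i))\<^sup>2) = 1}"
    by (intro closed_Collect_eq continuous_intros continuous_on_product_coordinates)
  then have "compact (?P \<inter> {v :: 'i \<Rightarrow> complex. (\<Sum>i\<in>I. (cmod (v i))\<^sup>2) = 1})"
    by (intro compact_Int_closed c)
  also have "?P \<inter> {v :: 'i \<Rightarrow> complex. (\<Sum>i\<in>I. (cmod (v i))\<^sup>2) = 1} = ?S"
  proof (intro set_eqI iffI)
    fix v assume "v \<in> ?S"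
    then have v: "\<And>i. i \<notin> I \<Longrightarrow> v i = 0" "(\<Sum>i\<in>I. (cmod (v i))\<^sup>2) = 1" by auto
    have "cmod (v i) \<le> 1" if "i \<in> I" for i
    proof -
      have "(cmod (v i))\<^sup>2 \<le> (\<Sum>i\<in>I. (cmod (v i))\<^sup>2)"
        using assms that by (intro member_le_sum) auto
      then show ?thesis using v(2) by (metis abs_norm_cancel abs_square_le_1)
    qed
    then show "v \<in> ?P \<inter> {v. (\<Sum>i\<in>I. (cmod (v i))\<^sup>2) = 1}" using v by auto
  qed (auto simp: PiE_iff split: if_splits)
  finally show ?thesis .
qed

text \<open>A maximizer \<open>v\<close> of the quadratic form of \<open>A\<close> on the unit
  vectors orthogonal to the first \<open>m\<close> eigenvectors is a further eigenvector. With
  \<open>\<mu>\<close> the maximum, the form \<open>B\<close> of \<open>\<mu> - A\<close> is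
  nonnegative on the orthogonal complement and vanishes at \<open>v\<close>. Hence its linear term
  at \<open>v\<close> is zero in the direction of the residual \<open>\<mu> v - A v\<close>, and
  that term is the squared norm of the residual.\<close>

lemma next_eigenvector:
  fixes A :: "'i op" and u :: "'i \<Rightarrow> nat \<Rightarrow> complex"
  assumes fin: "finite I" and herm: "hermitian_on I A"
    and iso: "isom I {..<m} u" and m: "m < card I"
    and eig: "\<And>i j. i \<in> I \<Longrightarrow> j < m \<Longrightarrow> (A \<star>\<^bsub>I\<^esub> u) i j = complex_of_real (l j) * u i j"
  shows "\<exists>(v :: 'i \<Rightarrow> unit \<Rightarrow> complex) \<mu>. hs I UNIV v = 1 \<and>
      (\<forall>j<m. (adj u \<star>\<^bsub>I\<^esub> v) j () = 0) \<and> (\<forall>i\<in>I. (A \<star>\<^bsub>I\<^esub> v) i () = complex_of_real \<mu> * v i ())"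
proof -
  define col :: "('i \<Rightarrow> complex) \<Rightarrow> 'i \<Rightarrow> unit \<Rightarrow> complex" where "col v = (\<lambda>i _. v i)" for v
  define q :: "('i \<Rightarrow> unit \<Rightarrow> complex) \<Rightarrow> real" where "q w = Re (tr UNIV (adj w \<star>\<^bsub>I\<^esub> A \<star>\<^bsub>I\<^esub> w))" for w
  define S where "S = {v :: 'i \<Rightarrow> complex. (\<forall>i. i \<notin> I \<longrightarrow> v i = 0) \<and> (\<Sum>i\<in>I. (cmod (v i))\<^sup>2) = 1}"
  define K where "K = S \<inter> (\<Inter>j\<in>{..<m}. {v. (\<Sum>i\<in>I. cnj (u i j) * v i) = 0})"
  have "closed (\<Inter>j\<in>{..<m}. {v. (\<Sum>i\<in>I. cnj (u i j) * v i) = 0})"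
    by (intro closed_INT ballI closed_Collect_eq continuous_intros continuous_on_product_coordinates)
  then have K: "compact K"
    unfolding K_def S_def by (intro compact_Int_closed compact_unit_sphere_functions[OF fin])
  have hs_col: "hs I UNIV (col v) = (\<Sum>i\<in>I. (cmod (v i))\<^sup>2)" for v
    by (simp add: hs_def col_def UNIV_unit)
  have adj_col: "(adj u \<star>\<^bsub>I\<^esub> col v) j k = (\<Sum>i\<in>I. cnj (u i j) * v i)" for v j k
    by (simp add: mm_def adj_def col_def)
  have inK: "(\<lambda>i. if i \<in> I then v i / sqrt (hs I UNIV (col v)) else 0) \<in> K"
    if v: "\<And>j. j < m \<Longrightarrow> (\<Sum>i\<in>I. cnj (u i j) * v i) = 0" "hs I UNIV (col v) \<noteq> 0" for v
  proof -
    have "(\<Sum>i\<in>I. (cmod (v i / sqrt (hs I UNIV (col v))))\<^sup>2) = hs I UNIV (col v) / hs I UNIV (col v)"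
      unfolding norm_divide power_divide sum_divide_distrib[symmetric] hs_col[symmetric] by simp
    also have "\<dots> = 1" using v(2) by simp
    finally have "(\<Sum>i\<in>I. (cmod (if i \<in> I then v i / sqrt (hs I UNIV (col v)) else 0))\<^sup>2) = 1"
      by simp
    moreover have "(\<Sum>i\<in>I. cnj (u i j) * (if i \<in> I then v i / sqrt (hs I UNIV (col v)) else 0)) = 0"
      if "j < m" for j
    proof -
      have "(\<Sum>i\<in>I. cnj (u i j) * (if i \<in> I then v i / sqrt (hs I UNIV (col v)) else 0))
          = (\<Sum>i\<in>I. cnj (u i j) * v i) / sqrt (hs I UNIV (col v))"
        unfolding sum_divide_distrib by (intro sum.cong) auto
      then show ?thesis using v(1)[OF that] by simp
    qed
    ultimately show ?thesis by (simp add: K_def S_def)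
  qed
  \<comment> \<open>The projection onto the complement of \<open>m < card I\<close> orthonormal
    vectors has squared norm \<open>card I - m > 0\<close>, so one of its columns is nonzero;
    normalized it lies in \<open>K\<close>.\<close>
  have "K \<noteq> {}"
  proof -
    have "hs I I (op_id - u \<star>\<^bsub>{..<m}\<^esub> adj u \<star>\<^bsub>I\<^esub> op_id) = real (card I) - real m"
    proof -
      have "hs {..<m} I (adj u \<star>\<^bsub>I\<^esub> op_id) = hs {..<m} I (adj u)"
        using fin by (intro hs_cong mm_op_id_right)
      also have "\<dots> = m" using hs_self_isom[OF iso] by simp
      finally have "hs {..<m} I (adj u \<star>\<^bsub>I\<^esub> op_id) = m" .
      moreover have "hs I I op_id = card I"
        using fin by (simp add: hs_def op_id_def if_distrib[of cmod] if_distrib[of "\<lambda>x. x\<^sup>2"] cong: if_cong)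
      ultimately show ?thesis by (simp add: hs_pythagoras iso)
    qed
    then have "hs I I (op_id - u \<star>\<^bsub>{..<m}\<^esub> adj u \<star>\<^bsub>I\<^esub> op_id) \<noteq> 0" using m by simp
    then obtain k where k: "k \<in> I" "hs I UNIV (\<lambda>i (_::unit). (op_id - u \<star>\<^bsub>{..<m}\<^esub> adj u \<star>\<^bsub>I\<^esub> op_id) i k) \<noteq> 0"
    proof -
      have "(\<Sum>k\<in>I. hs I UNIV (\<lambda>i (_::unit). (op_id - u \<star>\<^bsub>{..<m}\<^esub> adj u \<star>\<^bsub>I\<^esub> op_id) i k)) \<noteq> 0"
        using \<open>hs I I _ \<noteq> 0\<close> hs_columns[of I I] by metis
      then show thesis using that by (meson sum.neutral)
    qed
    define w where "w i = (op_id - u \<star>\<^bsub>{..<m}\<^esub> adj u \<star>\<^bsub>I\<^esub> op_id) i k" for i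
    have "(\<Sum>i\<in>I. cnj (u i j) * w i) = 0" if "j < m" for j
    proof -
      have "(\<Sum>i\<in>I. cnj (u i j) * w i) = (adj u \<star>\<^bsub>I\<^esub> (op_id - u \<star>\<^bsub>{..<m}\<^esub> adj u \<star>\<^bsub>I\<^esub> op_id)) j k"
        by (simp add: mm_def adj_def w_def)
      also have "\<dots> = (adj u \<star>\<^bsub>I\<^esub> op_id) j k - (adj u \<star>\<^bsub>I\<^esub> u \<star>\<^bsub>{..<m}\<^esub> adj u \<star>\<^bsub>I\<^esub> op_id) j k"
        by (simp add: mm_diff_right)
      also have "\<dots> = 0" using that by (simp add: isom_cancel[OF iso])
      finally show ?thesis .
    qed
    moreover have "hs I UNIV (col w) \<noteq> 0" using k(2) by (simp add: col_def w_def[abs_def])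
    ultimately show ?thesis using inK by blast
  qed
  moreover have "continuous_on K (\<lambda>v. q (col v))"
    unfolding q_def op_trace_def mm_def adj_def col_def
    by (intro continuous_intros continuous_on_subset[OF continuous_on_product_coordinates]) auto
  ultimately obtain v0 where v0: "v0 \<in> K" and max: "\<And>v. v \<in> K \<Longrightarrow> q (col v) \<le> q (col v0)"
    using continuous_attains_sup[OF K, of "\<lambda>v. q (col v)"] by auto
  define \<mu> where "\<mu> = q (col v0)"
  define v where "v = col v0"
  have v1: "hs I UNIV v = 1" using v0 by (simp add: v_def hs_col K_def S_def)
  have v2: "(adj u \<star>\<^bsub>I\<^esub> v) j k = 0" if "j < m" for j k
    using v0 that by (simp add: v_def adj_col K_def)
  define B where "B w x = tr UNIV (adj w \<star>\<^bsub>I\<^esub> (smul \<mu> x - A \<star>\<^bsub>I\<^esub> x))" for w x :: "'i \<Rightarrow> unit \<Rightarrow> complex"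
  have Bself: "Re (B w w) = \<mu> * hs I UNIV w - q w" for w
    by (simp add: B_def mm_diff_right tr_diff tr_smul hs_tr q_def)
  have Bnn: "Re (B w w) \<ge> 0" if w: "\<And>j. j < m \<Longrightarrow> (adj u \<star>\<^bsub>I\<^esub> w) j () = 0" for w
  proof (cases "hs I UNIV w = 0")
    case True
    then have "w i k = 0" if "i \<in> I" for i k using fin that by (simp add: hs_eq_0_iff)
    then have "adj w \<star>\<^bsub>I\<^esub> A \<star>\<^bsub>I\<^esub> w = 0" by (simp add: mm_def adj_def fun_eq_iff)
    then have "q w = 0" by (simp add: q_def op_trace_def)
    then show ?thesis using True by (simp add: Bself)
  next
    case False
    define x where "x i = w i ()" for i
    have wx: "w = col x" by (simp add: col_def x_def fun_eq_iff)
    let ?r = "sqrt (hs I UNIV (col x))"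
    have r: "?r \<noteq> 0" using False by (simp add: wx)
    have "q (col (\<lambda>i. if i \<in> I then x i / ?r else 0)) \<le> \<mu>"
      unfolding \<mu>_def using w False by (intro max inK) (auto simp: wx adj_col)
    moreover have "q (col (\<lambda>i. if i \<in> I then x i / ?r else 0)) = q (smul (1 / ?r) w)"
      unfolding q_def wx op_trace_def mm_def adj_def col_def smul_def
      by (intro arg_cong[where f=Re] sum.cong refl arg_cong2[where f="(*)"]) auto
    moreover have "q (smul (1 / ?r) w) = q w / (?r * ?r)"
      unfolding q_def adj_smul mm_smul_left mm_smul_right tr_smul by simp
    ultimately have "q w / hs I UNIV w \<le> \<mu>" by (simp add: wx)
    then have "q w \<le> \<mu> * hs I UNIV w"
      using False hs_nonneg[of I UNIV w] by (simp add: divide_le_eq less_le del: hs_nonneg)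
    then show ?thesis by (simp add: Bself)
  qed
  have Bv: "Re (B v v) = 0" by (simp add: Bself v1) (simp add: \<mu>_def v_def)
  define w where "w = smul \<mu> v - A \<star>\<^bsub>I\<^esub> v"
  \<comment> \<open>\<open>A\<close> maps each earlier eigenvector to a multiple of itself, so the
    residual stays orthogonal to all of them and is an admissible direction.\<close>
  have orth: "(adj u \<star>\<^bsub>I\<^esub> w) j () = 0" if j: "j < m" for j
  proof -
    have "(adj u \<star>\<^bsub>I\<^esub> A \<star>\<^bsub>I\<^esub> v) j () = ((adj u \<star>\<^bsub>I\<^esub> A) \<star>\<^bsub>I\<^esub> v) j ()" by simp
    also have "\<dots> = (smul (l j) (adj u) \<star>\<^bsub>I\<^esub> v) j ()"
    proof (rule mm_cong)
      fix i assume i: "i \<in> I"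
      have "(adj u \<star>\<^bsub>I\<^esub> A) j i = cnj ((adj A \<star>\<^bsub>I\<^esub> u) i j)"
        by (simp add: mm_def adj_def mult.commute)
      also have "(adj A \<star>\<^bsub>I\<^esub> u) i j = (A \<star>\<^bsub>I\<^esub> u) i j"
        using herm i by (intro mm_cong) (auto simp: hermitian_mm_adj op_eq_on_def)
      finally show "(adj u \<star>\<^bsub>I\<^esub> A) j i = smul (l j) (adj u) j i"
        using eig[OF i j] by (simp add: smul_def adj_def)
    qed simp
    also have "\<dots> = 0" using v2[OF j] by simp
    finally show ?thesis using v2[OF j] by (simp add: w_def mm_diff_right)
  qed
  have "Re (B w v) = 0"
  proof (rule quadratic_nonneg_imp_linear_zero)
    fix t :: real
    have Bsym: "Re (B v w) = Re (B w v)"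
    proof -
      have "B v w = cnj (tr UNIV (adj w \<star>\<^bsub>I\<^esub> (smul \<mu> v - adj A \<star>\<^bsub>I\<^esub> v)))"
        unfolding B_def tr_adj[symmetric] by (simp add: mm_distrib)
      also have "tr UNIV (adj w \<star>\<^bsub>I\<^esub> (smul \<mu> v - adj A \<star>\<^bsub>I\<^esub> v)) = B w v"
        unfolding B_def using herm
        by (intro tr_cong mm_cong)
           (auto simp: hermitian_mm_adj op_eq_on_def intro!: mm_cong arg_cong2[where f="(-)"])
      finally show ?thesis by simp
    qed
    have "0 \<le> Re (B (v + smul t w) (v + smul t w))"
      by (rule Bnn) (simp add: mm_add_right v2 orth)
    also have "B (v + smul t w) (v + smul t w) = B v v + t * B v w + t * B w v + t\<^sup>2 * B w w"
    proof -
      have e: "smul \<mu> (v + smul t w) - A \<star>\<^bsub>I\<^esub> (v + smul t w)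
          = (smul \<mu> v - A \<star>\<^bsub>I\<^esub> v) + smul t (smul \<mu> w - A \<star>\<^bsub>I\<^esub> w)"
        by (simp add: mm_add_right fun_eq_iff algebra_simps)
      show ?thesis
        unfolding B_def e by (simp only: adj_add adj_smul mm_add_left mm_add_right mm_smul_left
            mm_smul_right tr_add tr_smul) (simp add: power2_eq_square algebra_simps)
    qed
    finally show "0 \<le> 2 * t * Re (B w v) + t\<^sup>2 * Re (B w w)"
      by (simp add: Bv Bsym flip: of_real_power)
  qed
  then have "hs I UNIV w = 0" unfolding B_def w_def[symmetric] hs_tr by simp
  then have "\<forall>i\<in>I. (A \<star>\<^bsub>I\<^esub> v) i () = complex_of_real \<mu> * v i ()"
    using fin by (auto simp: hs_eq_0_iff w_def)
  with v1 v2 show ?thesis by blast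
qed

lemma orthonormal_eigenvectors:
  fixes A :: "'i op"
  assumes fin: "finite I" and herm: "hermitian_on I A" and "m \<le> card I"
  shows "\<exists>(u :: 'i \<Rightarrow> nat \<Rightarrow> complex) l. isom I {..<m} u \<and>
      (\<forall>i\<in>I. \<forall>j<m. (A \<star>\<^bsub>I\<^esub> u) i j = complex_of_real (l j) * u i j)"
  using assms(3)
proof (induction m)
  case 0
  show ?case by (simp add: isom_def op_eq_on_def)
next
  case (Suc m)
  then obtain u :: "'i \<Rightarrow> nat \<Rightarrow> complex" and l where u: "isom I {..<m} u"
      "\<forall>i\<in>I. \<forall>j<m. (A \<star>\<^bsub>I\<^esub> u) i j = complex_of_real (l j) * u i j" by auto
  obtain v :: "'i \<Rightarrow> unit \<Rightarrow> complex" and \<mu> where v: "hs I UNIV v = 1"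
      "\<forall>j<m. (adj u \<star>\<^bsub>I\<^esub> v) j () = 0" "\<forall>i\<in>I. (A \<star>\<^bsub>I\<^esub> v) i () = complex_of_real \<mu> * v i ()"
    using next_eigenvector[OF fin herm u(1), of l] Suc.prems u(2) by auto
  define u' where "u' i j = (if j = m then v i () else u i j)" for i j
  have vv: "(\<Sum>i\<in>I. cnj (v i ()) * v i ()) = 1"
    using hs_tr[of UNIV v I] v(1) by (simp add: op_trace_def UNIV_unit mm_def adj_def)
  have vu: "(\<Sum>i\<in>I. cnj (v i ()) * u i j) = 0" if "j < m" for j
  proof -
    have "(\<Sum>i\<in>I. cnj (v i ()) * u i j) = cnj ((adj u \<star>\<^bsub>I\<^esub> v) j ())"
      by (simp add: mm_def adj_def mult.commute)
    then show ?thesis using v(2) that by simp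
  qed
  have "isom I {..<Suc m} u'"
    using u(1) v(2) vv vu
    by (auto simp: isom_def op_eq_on_def mm_def adj_def u'_def op_id_def less_Suc_eq)
  moreover have "\<forall>i\<in>I. \<forall>j<Suc m. (A \<star>\<^bsub>I\<^esub> u') i j = complex_of_real ((l(m := \<mu>)) j) * u' i j"
    using u(2) v(3) by (auto simp: mm_def u'_def less_Suc_eq)
  ultimately show ?case by blast
qed

text \<open>The eigenvalues have an index set of their own, possibly of another type and smaller
  than the dimension, so truncated decompositions have the same form as full ones.\<close>

definition spec :: "'z set \<Rightarrow> ('i \<Rightarrow> 'z \<Rightarrow> complex) \<Rightarrow> ('z \<Rightarrow> real) \<Rightarrow> 'i op" where
  "spec Z u d = (\<lambda>i j. \<Sum>z\<in>Z. u i z * complex_of_real (d z) * cnj (u j z))"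

text \<open>The eigenvectors come numbered by naturals; they are relabelled by \<open>I\<close>
  itself because \<open>unitary_on\<close> and the definition of entropy speak of square
  matrices.\<close>

theorem spectral_theorem:
  fixes A :: "'i op"
  assumes fin: "finite I" and herm: "hermitian_on I A"
  obtains U :: "'i op" and d where "isom I I U" "unitary_on I U"
    "op_eq_on I A (spec I U d)"
proof -
  obtain u :: "'i \<Rightarrow> nat \<Rightarrow> complex" and l where u: "isom I {..<card I} u"
      "\<forall>i\<in>I. \<forall>j<card I. (A \<star>\<^bsub>I\<^esub> u) i j = complex_of_real (l j) * u i j"
    using orthonormal_eigenvectors[OF fin herm order_refl] by blast
  obtain h where h: "bij_betw h I {..<card I}"
    using fin by (metis atLeast0LessThan ex_bij_betw_finite_nat)
  have hI: "h k < card I" if "k \<in> I" for k using h that by (auto simp: bij_betw_def)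
  define U where "U i k = u i (h k)" for i k
  define d where "d k = l (h k)" for k
  have iso: "isom I I U"
    using u(1) h hI unfolding isom_def op_eq_on_def mm_def adj_def U_def op_id_def
    by (auto simp: bij_betw_def inj_on_eq_iff)
  have com: "op_eq_on I (U \<star>\<^bsub>I\<^esub> adj U) op_id"
    using isom_square_right[OF iso fin fin refl] .
  have "A i j = (\<Sum>k\<in>I. U i k * complex_of_real (d k) * cnj (U j k))" if "i \<in> I" "j \<in> I" for i j
  proof -
    have "A i j = (A \<star>\<^bsub>I\<^esub> op_id) i j" using that fin by (simp add: mm_op_id_right)
    also have "\<dots> = (A \<star>\<^bsub>I\<^esub> (U \<star>\<^bsub>I\<^esub> adj U)) i j"
      using com that by (intro mm_cong) (auto simp: op_eq_on_def)
    also have "\<dots> = ((A \<star>\<^bsub>I\<^esub> U) \<star>\<^bsub>I\<^esub> adj U) i j" by simp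
    also have "\<dots> = ((\<lambda>i k. d k * U i k) \<star>\<^bsub>I\<^esub> adj U) i j"
      using u(2) hI that by (intro mm_cong) (auto simp: U_def[abs_def] d_def mm_def)
    finally show ?thesis by (simp add: mm_def adj_def mult.commute)
  qed
  moreover have "unitary_on I U" using com by (simp add: unitary_on_def op_mult_mm op_adj_adj)
  ultimately show thesis using iso that[of U d] by (simp add: op_eq_on_def spec_def)
qed

section \<open>Equality of matrices on an index set\<close>

lemma op_eq_on_sym: "op_eq_on I A B \<Longrightarrow> op_eq_on I B A"
  by (simp add: op_eq_on_def)

lemma op_eq_on_trans: "op_eq_on I A B \<Longrightarrow> op_eq_on I B C \<Longrightarrow> op_eq_on I A C"
  by (simp add: op_eq_on_def)

lemma op_eq_on_refl: "op_eq_on I A A"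
  by (simp add: op_eq_on_def)

lemma op_eq_on_mm: "op_eq_on I A A' \<Longrightarrow> op_eq_on I B B' \<Longrightarrow> op_eq_on I (A \<star>\<^bsub>I\<^esub> B) (A' \<star>\<^bsub>I\<^esub> B')"
  by (auto simp: op_eq_on_def intro!: mm_cong)

lemma op_eq_on_diff: "op_eq_on I A A' \<Longrightarrow> op_eq_on I B B' \<Longrightarrow> op_eq_on I (A - B) (A' - B')"
  by (simp add: op_eq_on_def)

lemma op_eq_on_tr: "op_eq_on I A B \<Longrightarrow> tr I A = tr I B"
  by (intro tr_cong) (simp add: op_eq_on_def)

lemma op_eq_on_hs: "op_eq_on I A B \<Longrightarrow> hs I I A = hs I I B"
  by (intro hs_cong) (simp add: op_eq_on_def)

subsection \<open>Functions of Hermitian matrices\<close>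

lemma spec_mm: "spec Z u d = (\<lambda>i z. u i z * complex_of_real (d z)) \<star>\<^bsub>Z\<^esub> adj u"
  by (simp add: spec_def mm_def adj_def)

lemma adj_spec [simp]: "adj (spec Z u d) = spec Z u d"
  by (simp add: spec_def adj_def fun_eq_iff mult_ac)

lemma spec_cong: "(\<And>z. z \<in> Z \<Longrightarrow> d z = e z) \<Longrightarrow> spec Z u d = spec Z u e"
  by (simp add: spec_def fun_eq_iff)

lemma spec_mult:
  assumes "isom I Z u" "finite Z"
  shows "spec Z u d \<star>\<^bsub>I\<^esub> spec Z u e = spec Z u (\<lambda>z. d z * e z)"
proof (intro ext)
  fix i j
  let ?g = "\<lambda>i z. u i z * complex_of_real (d z)" and ?h = "\<lambda>z j. complex_of_real (e z) * cnj (u j z)"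
  have "spec Z u d \<star>\<^bsub>I\<^esub> spec Z u e = ?g \<star>\<^bsub>Z\<^esub> (adj u \<star>\<^bsub>I\<^esub> u \<star>\<^bsub>Z\<^esub> ?h)"
    by (simp add: spec_mm) (simp add: mm_def adj_def mult.assoc)
  then have "(spec Z u d \<star>\<^bsub>I\<^esub> spec Z u e) i j = (?g \<star>\<^bsub>Z\<^esub> (adj u \<star>\<^bsub>I\<^esub> u \<star>\<^bsub>Z\<^esub> ?h)) i j"
    by simp
  also have "\<dots> = (?g \<star>\<^bsub>Z\<^esub> ?h) i j"
    by (intro mm_cong refl isom_cancel assms)
  also have "\<dots> = spec Z u (\<lambda>z. d z * e z) i j"
    by (simp add: mm_def spec_def mult_ac)
  finally show "(spec Z u d \<star>\<^bsub>I\<^esub> spec Z u e) i j = spec Z u (\<lambda>z. d z * e z) i j" .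
qed

lemma tr_spec_mm: "tr I (spec Z u d \<star>\<^bsub>I\<^esub> A) = (\<Sum>z\<in>Z. d z * (adj u \<star>\<^bsub>I\<^esub> A \<star>\<^bsub>I\<^esub> u) z z)"
proof -
  have "tr I (spec Z u d \<star>\<^bsub>I\<^esub> A) = tr Z (adj u \<star>\<^bsub>I\<^esub> A \<star>\<^bsub>I\<^esub> (\<lambda>i z. u i z * complex_of_real (d z)))"
    unfolding spec_mm mm_assoc by (subst tr_mm_commute) simp
  also have "\<dots> = (\<Sum>z\<in>Z. d z * (adj u \<star>\<^bsub>I\<^esub> A \<star>\<^bsub>I\<^esub> u) z z)"
    by (simp add: op_trace_def mm_def sum_distrib_left mult_ac)
  finally show ?thesis .
qed

lemma tr_spec:
  assumes "isom I Z u"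
  shows "tr I (spec Z u d) = (\<Sum>z\<in>Z. complex_of_real (d z))"
proof -
  have "tr I (spec Z u d) = tr Z (adj u \<star>\<^bsub>I\<^esub> (\<lambda>i z. u i z * complex_of_real (d z)))"
    unfolding spec_mm by (rule tr_mm_commute)
  also have "\<dots> = (\<Sum>z\<in>Z. d z * (adj u \<star>\<^bsub>I\<^esub> u) z z)"
    by (simp add: op_trace_def mm_def sum_distrib_left mult_ac)
  also have "\<dots> = (\<Sum>z\<in>Z. complex_of_real (d z))"
    using assms by (intro sum.cong) (auto simp: isom_def op_eq_on_def op_id_def)
  finally show ?thesis .
qed

lemma hs_spec:
  assumes "isom I Z u" "finite Z"
  shows "hs I I (spec Z u d) = (\<Sum>z\<in>Z. (d z)\<^sup>2)"
proof -
  have "complex_of_real (hs I I (spec Z u d)) = tr I (spec Z u (\<lambda>z. (d z)\<^sup>2))"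
    using spec_mult[OF assms, of d d] by (simp add: power2_eq_square flip: hs_tr)
  also have "\<dots> = complex_of_real (\<Sum>z\<in>Z. (d z)\<^sup>2)" using tr_spec[OF assms(1)] by simp
  finally show ?thesis by (simp only: of_real_eq_iff)
qed

lemma contr_spec:
  assumes "isom I Z u" "finite Z" "\<And>z. z \<in> Z \<Longrightarrow> \<bar>d z\<bar> \<le> 1"
  shows "contr I I (spec Z u d)"
  unfolding contr_def
proof
  fix v :: "'a \<Rightarrow> unit \<Rightarrow> complex"
  let ?w = "adj u \<star>\<^bsub>I\<^esub> v"
  have "spec Z u d \<star>\<^bsub>I\<^esub> v = u \<star>\<^bsub>Z\<^esub> (\<lambda>z k. complex_of_real (d z) * ?w z k)"
    unfolding spec_mm mm_assoc by (simp add: mm_def[of _ Z] mult.assoc)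
  then have "hs I UNIV (spec Z u d \<star>\<^bsub>I\<^esub> v) = hs Z UNIV (\<lambda>z k. complex_of_real (d z) * ?w z k)"
    using hs_isom[OF assms(1,2)] by simp
  also have "\<dots> \<le> hs Z UNIV ?w"
    unfolding hs_def using assms(3)
    by (intro sum_mono power_mono) (auto simp: norm_mult mult_left_le_one_le)
  also have "\<dots> \<le> hs I UNIV v"
    by (intro hs_contr contr_adj contr_isom assms)
  finally show "hs I UNIV (spec Z u d \<star>\<^bsub>I\<^esub> v) \<le> hs I UNIV v" .
qed

text \<open>Eigenvectors scaled by the roots of the eigenvalues. Unlike the symmetric square root,
  this factor has one column per eigenvalue, so discarding eigenvalues means setting columns to
  zero.\<close>

definition root_factor :: "('i \<Rightarrow> 'z \<Rightarrow> complex) \<Rightarrow> ('z \<Rightarrow> real) \<Rightarrow> 'i \<Rightarrow> 'z \<Rightarrow> complex" where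
  "root_factor u d = (\<lambda>i z. u i z * complex_of_real (sqrt (d z)))"

lemma spec_gram:
  assumes "\<And>z. z \<in> Z \<Longrightarrow> d z \<ge> 0"
  shows "spec Z u d = root_factor u d \<star>\<^bsub>Z\<^esub> adj (root_factor u d)"
proof -
  have "complex_of_real (sqrt (d z)) * complex_of_real (sqrt (d z)) = complex_of_real (d z)" if "z \<in> Z" for z
    using assms[OF that] by (simp flip: of_real_mult)
  then show ?thesis
    by (auto intro!: sum.cong simp: spec_def root_factor_def mm_def adj_def fun_eq_iff mult_ac)
qed

subsection \<open>Positive semidefinite matrices\<close>

lemma quadratic_form:
  "(\<Sum>i\<in>I. \<Sum>j\<in>I. cnj (v i) * A i j * v j) = tr UNIV (adj (\<lambda>i (_::unit). v i) \<star>\<^bsub>I\<^esub> A \<star>\<^bsub>I\<^esub> (\<lambda>i _. v i))"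
  by (simp add: op_trace_def mm_def adj_def UNIV_unit sum_distrib_left mult_ac)

lemma psd_on_alt:
  "psd_on I A \<longleftrightarrow> hermitian_on I A \<and>
    (\<forall>v :: 'i \<Rightarrow> complex. \<exists>r\<ge>0. (\<Sum>i\<in>I. \<Sum>j\<in>I. cnj (v i) * A i j * v j) = complex_of_real r)"
proof -
  have "Im q = 0 \<and> Re q \<ge> 0 \<longleftrightarrow> (\<exists>r\<ge>0. q = complex_of_real r)" for q
    by (auto simp: complex_eq_iff)
  then show ?thesis unfolding psd_on_def Let_def by (simp only:)
qed

lemma psd_on_cong:
  assumes "op_eq_on I A B" "psd_on I A"
  shows "psd_on I B"
proof -
  have "(\<Sum>i\<in>I. \<Sum>j\<in>I. cnj (v i) * B i j * v j) = (\<Sum>i\<in>I. \<Sum>j\<in>I. cnj (v i) * A i j * v j)" for v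
    using assms(1) by (simp add: op_eq_on_def)
  moreover have "hermitian_on I B"
    using assms unfolding psd_on_def hermitian_on_def op_eq_on_def by metis
  ultimately show ?thesis using assms(2) by (simp add: psd_on_def)
qed

lemma psd_hermitian: "psd_on I A \<Longrightarrow> hermitian_on I A"
  by (simp add: psd_on_def)

lemma hermitian_on_diff: "hermitian_on I A \<Longrightarrow> hermitian_on I B \<Longrightarrow> hermitian_on I (A - B)"
  unfolding hermitian_mm_adj adj_diff by (rule op_eq_on_diff)

lemma psd_on_gram: "psd_on I (g \<star>\<^bsub>Z\<^esub> adj g)"
proof -
  have "hermitian_on I (g \<star>\<^bsub>Z\<^esub> adj g)"
    by (simp add: hermitian_on_def mm_def adj_def mult.commute)
  moreover have "(\<Sum>i\<in>I. \<Sum>j\<in>I. cnj (v i) * (g \<star>\<^bsub>Z\<^esub> adj g) i j * v j)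
      = complex_of_real (hs Z UNIV (adj g \<star>\<^bsub>I\<^esub> (\<lambda>i (_::unit). v i)))" for v
    unfolding quadratic_form by (simp flip: hs_tr)
  ultimately show ?thesis unfolding psd_on_alt using hs_nonneg by blast
qed

lemma psd_on_spec: "(\<And>z. z \<in> Z \<Longrightarrow> d z \<ge> 0) \<Longrightarrow> psd_on I (spec Z u d)"
  by (simp add: spec_gram psd_on_gram)

lemma psd_diag_nonneg:
  assumes "psd_on I A"
  shows "Im ((adj u \<star>\<^bsub>I\<^esub> A \<star>\<^bsub>I\<^esub> u) k k) = 0" "Re ((adj u \<star>\<^bsub>I\<^esub> A \<star>\<^bsub>I\<^esub> u) k k) \<ge> 0"
proof -
  have "(adj u \<star>\<^bsub>I\<^esub> A \<star>\<^bsub>I\<^esub> u) k k = (\<Sum>i\<in>I. \<Sum>j\<in>I. cnj (u i k) * A i j * u j k)"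
    by (simp add: mm_def adj_def sum_distrib_left mult_ac)
  then show "Im ((adj u \<star>\<^bsub>I\<^esub> A \<star>\<^bsub>I\<^esub> u) k k) = 0" "Re ((adj u \<star>\<^bsub>I\<^esub> A \<star>\<^bsub>I\<^esub> u) k k) \<ge> 0"
    using assms by (auto simp: psd_on_def Let_def)
qed

lemma spec_diag:
  assumes "isom I Z u" "finite Z" "z \<in> Z"
  shows "(adj u \<star>\<^bsub>I\<^esub> spec Z u d \<star>\<^bsub>I\<^esub> u) z z = complex_of_real (d z)"
proof -
  have "(adj u \<star>\<^bsub>I\<^esub> spec Z u d \<star>\<^bsub>I\<^esub> u) z z
      = (\<Sum>y\<in>Z. (adj u \<star>\<^bsub>I\<^esub> u) z y * complex_of_real (d y) * (adj u \<star>\<^bsub>I\<^esub> u) y z)"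
  proof -
    have "adj u \<star>\<^bsub>I\<^esub> spec Z u d \<star>\<^bsub>I\<^esub> u = (adj u \<star>\<^bsub>I\<^esub> (\<lambda>i z. u i z * complex_of_real (d z))) \<star>\<^bsub>Z\<^esub> (adj u \<star>\<^bsub>I\<^esub> u)"
      by (simp add: spec_mm)
    also have "adj u \<star>\<^bsub>I\<^esub> (\<lambda>i z. u i z * complex_of_real (d z)) = (\<lambda>z y. (adj u \<star>\<^bsub>I\<^esub> u) z y * complex_of_real (d y))"
      by (simp add: mm_def fun_eq_iff sum_distrib_left mult_ac)
    finally show ?thesis by (simp add: mm_def[of _ Z])
  qed
  also have "\<dots> = (\<Sum>y\<in>Z. op_id z y * complex_of_real (d y) * op_id y z)"
    using assms by (intro sum.cong) (auto simp: isom_def op_eq_on_def)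
  also have "\<dots> = (\<Sum>y\<in>Z. if y = z then complex_of_real (d y) else 0)"
    by (intro sum.cong) (auto simp: op_id_def)
  also have "\<dots> = complex_of_real (d z)" using assms by simp
  finally show ?thesis .
qed

lemma op_eq_on_conj: "op_eq_on I A B \<Longrightarrow> adj u \<star>\<^bsub>I\<^esub> A \<star>\<^bsub>I\<^esub> u = adj u \<star>\<^bsub>I\<^esub> B \<star>\<^bsub>I\<^esub> u"
  by (auto simp: fun_eq_iff op_eq_on_def intro!: mm_cong)

theorem psd_spectral:
  fixes A :: "'i op"
  assumes fin: "finite I" and psd: "psd_on I A"
  obtains U :: "'i op" and d where "isom I I U" "unitary_on I U" "op_eq_on I A (spec I U d)"
    "\<And>k. k \<in> I \<Longrightarrow> d k \<ge> 0"
proof -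
  obtain U :: "'i op" and d where U: "isom I I U" "unitary_on I U" "op_eq_on I A (spec I U d)"
    by (rule spectral_theorem[OF fin psd_hermitian[OF psd]]) blast
  have "d k \<ge> 0" if "k \<in> I" for k
    using psd_diag_nonneg(2)[OF psd, of U k] spec_diag[OF U(1) fin that, of d] op_eq_on_conj[OF U(3), of U]
    by simp
  then show thesis using U that by blast
qed

lemma psd_gram:
  fixes A :: "'i op"
  assumes "finite I" "psd_on I A"
  obtains g :: "'i op" where "op_eq_on I A (g \<star>\<^bsub>I\<^esub> adj g)"
proof -
  obtain U :: "'i op" and d where U: "op_eq_on I A (spec I U d)" "\<And>k. k \<in> I \<Longrightarrow> d k \<ge> 0"
    by (rule psd_spectral[OF assms]) blast
  have "spec I U d = root_factor U d \<star>\<^bsub>I\<^esub> adj (root_factor U d)"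
    using U(2) by (rule spec_gram)
  with U(1) that show thesis by simp
qed

text \<open>The Powers--Stormer inequality, with the trace norm replaced by a test contraction
  (the sign of \<^term>\<open>S - T\<close>).\<close>

lemma Powers_Stormer:
  fixes S T :: "'i op"
  assumes fin: "finite I" and S: "psd_on I S" and T: "psd_on I T"
  obtains C where "contr I I C" "hs I I (S - T) \<le> cmod (tr I (C \<star>\<^bsub>I\<^esub> (S \<star>\<^bsub>I\<^esub> S - T \<star>\<^bsub>I\<^esub> T)))"
proof -
  have herm: "hermitian_on I (S - T)" by (intro hermitian_on_diff psd_hermitian S T)
  obtain U :: "'i op" and x where U: "isom I I U" "op_eq_on I (S - T) (spec I U x)"
    by (rule spectral_theorem[OF fin herm]) blast
  define s where "s k = Re ((adj U \<star>\<^bsub>I\<^esub> S \<star>\<^bsub>I\<^esub> U) k k)" for k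
  define t where "t k = Re ((adj U \<star>\<^bsub>I\<^esub> T \<star>\<^bsub>I\<^esub> U) k k)" for k
  have sk: "(adj U \<star>\<^bsub>I\<^esub> S \<star>\<^bsub>I\<^esub> U) k k = complex_of_real (s k)" "s k \<ge> 0" for k
    using psd_diag_nonneg[OF S, of U k] by (auto simp: s_def complex_eq_iff)
  have tk: "(adj U \<star>\<^bsub>I\<^esub> T \<star>\<^bsub>I\<^esub> U) k k = complex_of_real (t k)" "t k \<ge> 0" for k
    using psd_diag_nonneg[OF T, of U k] by (auto simp: t_def complex_eq_iff)
  have xk: "x k = s k - t k" if "k \<in> I" for k
  proof -
    have "complex_of_real (x k) = (adj U \<star>\<^bsub>I\<^esub> (S - T) \<star>\<^bsub>I\<^esub> U) k k"
      using spec_diag[OF U(1) fin that, of x] op_eq_on_conj[OF U(2), of U] by simp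
    also have "\<dots> = complex_of_real (s k - t k)"
      by (simp add: mm_distrib sk tk)
    finally show ?thesis by (simp only: of_real_eq_iff)
  qed
  define C where "C = spec I U (\<lambda>k. sgn (x k))"
  let ?X = "spec I U x" and ?A = "spec I U (\<lambda>k. \<bar>x k\<bar>)"
  have CX: "C \<star>\<^bsub>I\<^esub> ?X = ?A" "?X \<star>\<^bsub>I\<^esub> C = ?A"
    unfolding C_def by (simp_all add: spec_mult[OF U(1) fin] abs_sgn mult.commute)
  have "contr I I C"
    unfolding C_def by (intro contr_spec U fin) (simp add: sgn_if)
  moreover have "hs I I (S - T) \<le> cmod (tr I (C \<star>\<^bsub>I\<^esub> (S \<star>\<^bsub>I\<^esub> S - T \<star>\<^bsub>I\<^esub> T)))"
  proof -
    let ?Y = "S + T"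
    have half: "x = y" if "2 * x = y + y" for x y :: complex
      using that by simp
    have trA: "tr I (?A \<star>\<^bsub>I\<^esub> ?Y) = complex_of_real (\<Sum>k\<in>I. \<bar>x k\<bar> * (s k + t k))"
      unfolding tr_spec_mm by (simp add: mm_distrib sk tk)
    \<comment> \<open>Noncommuting difference of squares: 2(S^2 - T^2) = (S - T)(S + T) + (S + T)(S
      - T). In both terms \<open>C\<close> can be brought next to \<open>S - T\<close>, which it
      turns into the absolute value \<open>?A\<close>.\<close>
    have "2 * tr I (C \<star>\<^bsub>I\<^esub> (S \<star>\<^bsub>I\<^esub> S - T \<star>\<^bsub>I\<^esub> T)) =
        tr I (C \<star>\<^bsub>I\<^esub> (S - T) \<star>\<^bsub>I\<^esub> ?Y) + tr I (C \<star>\<^bsub>I\<^esub> ?Y \<star>\<^bsub>I\<^esub> (S - T))"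
      by (simp add: mm_distrib tr_add tr_diff)
    also have "tr I (C \<star>\<^bsub>I\<^esub> (S - T) \<star>\<^bsub>I\<^esub> ?Y) = tr I ((C \<star>\<^bsub>I\<^esub> ?X) \<star>\<^bsub>I\<^esub> ?Y)"
      unfolding mm_assoc by (intro op_eq_on_tr op_eq_on_mm U op_eq_on_refl)
    also have "\<dots> = complex_of_real (\<Sum>k\<in>I. \<bar>x k\<bar> * (s k + t k))"
      unfolding CX trA ..
    also have "tr I (C \<star>\<^bsub>I\<^esub> ?Y \<star>\<^bsub>I\<^esub> (S - T)) = tr I (C \<star>\<^bsub>I\<^esub> ?Y \<star>\<^bsub>I\<^esub> ?X)"
      by (intro op_eq_on_tr op_eq_on_mm U op_eq_on_refl)
    also have "\<dots> = tr I ((?X \<star>\<^bsub>I\<^esub> C) \<star>\<^bsub>I\<^esub> ?Y)"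
      using tr_mm_commute[of I "C \<star>\<^bsub>I\<^esub> ?Y" I ?X] by simp
    also have "\<dots> = complex_of_real (\<Sum>k\<in>I. \<bar>x k\<bar> * (s k + t k))"
      unfolding CX trA ..
    finally have "tr I (C \<star>\<^bsub>I\<^esub> (S \<star>\<^bsub>I\<^esub> S - T \<star>\<^bsub>I\<^esub> T)) = complex_of_real (\<Sum>k\<in>I. \<bar>x k\<bar> * (s k + t k))"
      by (rule half)
    then have "cmod (tr I (C \<star>\<^bsub>I\<^esub> (S \<star>\<^bsub>I\<^esub> S - T \<star>\<^bsub>I\<^esub> T))) = \<bar>\<Sum>k\<in>I. \<bar>x k\<bar> * (s k + t k)\<bar>"
      by (simp only: norm_of_real)
    also have "\<dots> \<ge> (\<Sum>k\<in>I. \<bar>x k\<bar> * (s k + t k))" by simp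
    also have "(\<Sum>k\<in>I. \<bar>x k\<bar> * (s k + t k)) \<ge> (\<Sum>k\<in>I. (x k)\<^sup>2)"
    proof (intro sum_mono)
      fix k assume "k \<in> I"
      \<comment> \<open>Positivity of \<open>S\<close> and \<open>T\<close> enters here: nonnegative
        diagonal entries satisfy |s - t| \<le> s + t.\<close>
      then have "\<bar>x k\<bar> \<le> s k + t k" using xk sk(2)[of k] tk(2)[of k] by auto
      then have "\<bar>x k\<bar> * \<bar>x k\<bar> \<le> \<bar>x k\<bar> * (s k + t k)" by (intro mult_left_mono) auto
      then show "(x k)\<^sup>2 \<le> \<bar>x k\<bar> * (s k + t k)" by (simp add: power2_eq_square)
    qed
    also have "(\<Sum>k\<in>I. (x k)\<^sup>2) = hs I I (S - T)"
      using hs_spec[OF U(1) fin, of x] op_eq_on_hs[OF U(2)] by simp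
    finally show ?thesis .
  qed
  ultimately show thesis by (rule that)
qed

text \<open>For equal squares the right-hand side of the Powers--Stormer inequality is zero, hence
  so is the distance of the roots.\<close>

lemma psd_sqrt_unique:
  assumes "finite I" "psd_on I S" "psd_on I T" "op_eq_on I (S \<star>\<^bsub>I\<^esub> S) (T \<star>\<^bsub>I\<^esub> T)"
  shows "op_eq_on I S T"
proof -
  obtain C where C: "hs I I (S - T) \<le> cmod (tr I (C \<star>\<^bsub>I\<^esub> (S \<star>\<^bsub>I\<^esub> S - T \<star>\<^bsub>I\<^esub> T)))"
    by (rule Powers_Stormer[OF assms(1-3)]) blast
  have "tr I (C \<star>\<^bsub>I\<^esub> (S \<star>\<^bsub>I\<^esub> S - T \<star>\<^bsub>I\<^esub> T)) = tr I (C \<star>\<^bsub>I\<^esub> (\<lambda>_ _. 0))"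
    using assms(4) by (intro op_eq_on_tr op_eq_on_mm op_eq_on_refl) (simp add: op_eq_on_def)
  also have "\<dots> = 0" by (simp add: op_trace_def mm_def)
  finally have "hs I I (S - T) = 0" using C hs_nonneg[of I I "S - T"] by simp
  then show ?thesis using assms(1) by (simp add: hs_eq_0_iff op_eq_on_def)
qed

text \<open>The description in \<open>psd_sqrt\<close> determines a function only because it
  prescribes zeros outside \<open>I\<close>; the root is therefore \<open>T\<close> cut off
  there.\<close>

lemma psd_sqrt_eqI:
  assumes fin: "finite I" and T: "psd_on I T" and eq: "op_eq_on I (T \<star>\<^bsub>I\<^esub> T) M"
  shows "psd_sqrt I M = (\<lambda>i j. if i \<in> I \<and> j \<in> I then T i j else 0)"
proof -
  let ?T = "\<lambda>i j. if i \<in> I \<and> j \<in> I then T i j else 0"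
  have TT: "op_eq_on I T ?T" by (simp add: op_eq_on_def)
  have 1: "psd_on I ?T" by (rule psd_on_cong[OF TT T])
  have 2: "op_eq_on I (?T \<star>\<^bsub>I\<^esub> ?T) M"
    using op_eq_on_mm[OF TT TT] eq by (simp add: op_eq_on_def)
  have 3: "S = ?T" if S: "psd_on I S" "op_eq_on I (S \<star>\<^bsub>I\<^esub> S) M" "\<forall>i j. i \<notin> I \<or> j \<notin> I \<longrightarrow> S i j = 0" for S
  proof -
    have "op_eq_on I S ?T"
      using psd_sqrt_unique[OF fin S(1) 1] op_eq_on_trans[OF S(2) op_eq_on_sym[OF 2]] by blast
    with S(3) show ?thesis by (auto simp: fun_eq_iff op_eq_on_def)
  qed
  show ?thesis
    unfolding psd_sqrt_def op_mult_mm
  proof (rule the_equality)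
    show "psd_on I ?T \<and> op_eq_on I (?T \<star>\<^bsub>I\<^esub> ?T) M \<and> (\<forall>i j. i \<notin> I \<or> j \<notin> I \<longrightarrow> ?T i j = 0)"
      by (intro conjI 1 2) auto
  qed (elim conjE, rule 3)
qed

lemma psd_sqrt_spec:
  fixes M :: "'i op"
  assumes fin: "finite I" and M: "op_eq_on I M (spec Z u d)" and u: "isom I Z u" "finite Z"
    and d: "\<And>k. k \<in> Z \<Longrightarrow> d k \<ge> 0"
  shows "op_eq_on I (psd_sqrt I M) (spec Z u (\<lambda>k. sqrt (d k)))"
proof -
  have "spec Z u (\<lambda>k. sqrt (d k)) \<star>\<^bsub>I\<^esub> spec Z u (\<lambda>k. sqrt (d k)) = spec Z u d"
    unfolding spec_mult[OF u] using d by (intro spec_cong) simp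
  then have "psd_sqrt I M = (\<lambda>i j. if i \<in> I \<and> j \<in> I then spec Z u (\<lambda>k. sqrt (d k)) i j else 0)"
    using M d by (intro psd_sqrt_eqI[OF fin] psd_on_spec) (auto simp: op_eq_on_sym)
  then show ?thesis by (simp add: op_eq_on_def)
qed

text \<open>The trace norm is the sum of the absolute eigenvalues, and the sign of \<open>F\<close>
  is a contraction that attains it.\<close>

lemma trace_norm_hermitian:
  assumes fin: "finite I" and F: "hermitian_on I F"
  obtains C where "contr I I C" "trace_norm I F = Re (tr I (C \<star>\<^bsub>I\<^esub> F))"
proof -
  obtain U d where U: "isom I I U" "unitary_on I U" "op_eq_on I F (spec I U d)"
    by (rule spectral_theorem[OF fin F])
  have aF: "op_eq_on I (adj F) (spec I U d)"
    using U(3) F by (auto simp: hermitian_mm_adj op_eq_on_def)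
  have "op_eq_on I (op_mult I (op_adj F) F) (spec I U (\<lambda>k. (d k)\<^sup>2))"
    unfolding op_mult_mm op_adj_adj using op_eq_on_mm[OF aF U(3)]
    by (simp add: spec_mult[OF U(1) fin] power2_eq_square)
  then have "op_eq_on I (psd_sqrt I (op_mult I (op_adj F) F)) (spec I U (\<lambda>k. \<bar>d k\<bar>))"
    using psd_sqrt_spec[OF fin _ U(1) fin] by fastforce
  then have "tr I (psd_sqrt I (op_mult I (op_adj F) F)) = tr I (spec I U (\<lambda>k. \<bar>d k\<bar>))"
    by (rule op_eq_on_tr)
  also have "spec I U (\<lambda>k. \<bar>d k\<bar>) = spec I U (\<lambda>k. sgn (d k)) \<star>\<^bsub>I\<^esub> spec I U d"
    by (simp add: spec_mult[OF U(1) fin] abs_sgn mult.commute)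
  also have "tr I \<dots> = tr I (spec I U (\<lambda>k. sgn (d k)) \<star>\<^bsub>I\<^esub> F)"
    by (intro op_eq_on_tr op_eq_on_mm op_eq_on_refl op_eq_on_sym[OF U(3)])
  finally have "trace_norm I F = Re (tr I (spec I U (\<lambda>k. sgn (d k)) \<star>\<^bsub>I\<^esub> F))"
    by (simp add: trace_norm_def)
  moreover have "contr I I (spec I U (\<lambda>k. sgn (d k)))"
    by (intro contr_spec U(1) fin) (simp add: sgn_if)
  ultimately show thesis using that by blast
qed

subsection \<open>Von Neumann entropy\<close>

lemma poly_interpolation:
  fixes f :: "real \<Rightarrow> real"
  assumes "finite V"
  shows "\<exists>p. \<forall>x\<in>V. poly p x = f x"
  using assms
proof induction
  case (insert a V)
  then obtain p where p: "\<forall>x\<in>V. poly p x = f x" by blast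
  define q where "q = (\<Prod>v\<in>V. [:- v, 1:])"
  have q0: "poly q x = 0" if "x \<in> V" for x
    using insert.hyps that by (auto simp: q_def poly_prod)
  have qa: "poly q a \<noteq> 0" using insert.hyps by (auto simp: q_def poly_prod)
  have "\<forall>x\<in>insert a V. poly (p + smult ((f a - poly p a) / poly q a) q) x = f x"
    using p q0 qa by auto
  then show ?case by blast
qed auto

text \<open>On the finitely many values that occur, \<open>f\<close> agrees with a polynomial, whose
  constant term is 0 because \<open>f 0 = 0\<close>. Hence the two families may contain different
  numbers of zeros.\<close>

lemma power_sums_determine_sums:
  fixes d :: "'z \<Rightarrow> real" and e :: "'y \<Rightarrow> real"
  assumes fin: "finite Z" "finite Y" and f0: "f 0 = 0"
    and pow: "\<And>k. (\<Sum>z\<in>Z. d z ^ Suc k) = (\<Sum>y\<in>Y. e y ^ Suc k)"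
  shows "(\<Sum>z\<in>Z. f (d z)) = (\<Sum>y\<in>Y. f (e y) :: real)"
proof -
  obtain p where p: "\<forall>x\<in>insert 0 (d ` Z \<union> e ` Y). poly p x = f x"
    using poly_interpolation[of "insert 0 (d ` Z \<union> e ` Y)" f] fin by auto
  have c0: "coeff p 0 = 0" using p f0 by (simp add: poly_0_coeff_0)
  have pp: "(\<Sum>z\<in>Z. poly p (g z)) = (\<Sum>i\<le>degree p. coeff p i * (\<Sum>z\<in>Z. g z ^ i))" for g :: "'w \<Rightarrow> real" and Z
    unfolding poly_altdef sum_distrib_left by (rule sum.swap)
  have "(\<Sum>z\<in>Z. f (d z)) = (\<Sum>z\<in>Z. poly p (d z))" using p by simp
  also have "\<dots> = (\<Sum>y\<in>Y. poly p (e y))"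
    unfolding pp
  proof (intro sum.cong refl)
    fix i
    show "coeff p i * (\<Sum>z\<in>Z. d z ^ i) = coeff p i * (\<Sum>y\<in>Y. e y ^ i)"
    proof (cases i)
      case (Suc k)
      then show ?thesis by (simp only: pow)
    qed (simp add: c0)
  qed
  also have "\<dots> = (\<Sum>y\<in>Y. f (e y))" using p by simp
  finally show ?thesis .
qed

text \<open>Shifted by one: \<open>mpow I A k\<close> is the power with exponent
  \<open>k + 1\<close>. Exponent 0 would count the zero eigenvalues.\<close>

primrec mpow :: "'i set \<Rightarrow> 'i op \<Rightarrow> nat \<Rightarrow> 'i op" where
  "mpow I A 0 = A" | "mpow I A (Suc k) = A \<star>\<^bsub>I\<^esub> mpow I A k"

lemma mpow_cong: "op_eq_on I A B \<Longrightarrow> op_eq_on I (mpow I A k) (mpow I B k)"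
  by (induction k) (simp_all add: op_eq_on_mm)

lemma mpow_spec: "isom I Z u \<Longrightarrow> finite Z \<Longrightarrow> mpow I (spec Z u d) k = spec Z u (\<lambda>z. d z ^ Suc k)"
  by (induction k) (simp_all add: spec_mult)

text \<open>\<open>vn_entropy\<close> selects an arbitrary spectral decomposition. The traces of the
  powers of \<open>A\<close> are the power sums of the eigenvalues in any decomposition, so all of
  them give the same value, including those with rectangular \<open>u\<close>.\<close>

lemma vn_entropy_spec:
  fixes A :: "'i op" and u :: "'i \<Rightarrow> 'z \<Rightarrow> complex"
  assumes fin: "finite I" "finite Z" and u: "isom I Z u" and A: "op_eq_on I A (spec Z u d)"
  shows "vn_entropy I A = (\<Sum>z\<in>Z. - (d z * log 2 (d z)))"
proof -
  let ?Q = "\<lambda>s. \<exists>U (e :: 'i \<Rightarrow> real). unitary_on I U \<and>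
      (\<forall>i\<in>I. \<forall>j\<in>I. A i j = (\<Sum>k\<in>I. U i k * complex_of_real (e k) * cnj (U j k))) \<and>
      s = (\<Sum>k\<in>I. - (e k * log 2 (e k)))"
  have "hermitian_on I A"
    using A adj_spec[of Z u d] unfolding hermitian_mm_adj op_eq_on_def by (metis adj_def)
  then obtain U :: "'i op" and e where "unitary_on I U" "op_eq_on I A (spec I U e)"
    by (rule spectral_theorem[OF fin(1)]) blast
  then have "?Q (\<Sum>k\<in>I. - (e k * log 2 (e k)))" by (auto simp: op_eq_on_def spec_def)
  then have "?Q (vn_entropy I A)" unfolding vn_entropy_def by (rule someI)
  then obtain U :: "'i op" and e where U: "unitary_on I U" "op_eq_on I A (spec I U e)"
      and s: "vn_entropy I A = (\<Sum>k\<in>I. - (e k * log 2 (e k)))"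
    by (auto simp: op_eq_on_def spec_def)
  have iU: "isom I I U" by (rule isom_unitary[OF fin(1) U(1)])
  have "(\<Sum>k\<in>I. e k ^ Suc n) = (\<Sum>z\<in>Z. d z ^ Suc n)" for n
  proof -
    have "complex_of_real (\<Sum>k\<in>I. e k ^ Suc n) = tr I (mpow I (spec I U e) n)"
      unfolding mpow_spec[OF iU fin(1)] tr_spec[OF iU] by simp
    also have "\<dots> = tr I (mpow I (spec Z u d) n)"
      using U(2) A by (intro op_eq_on_tr mpow_cong) (metis op_eq_on_sym op_eq_on_trans)
    also have "\<dots> = complex_of_real (\<Sum>z\<in>Z. d z ^ Suc n)"
      unfolding mpow_spec[OF u fin(2)] tr_spec[OF u] by simp
    finally show ?thesis by (simp only: of_real_eq_iff)
  qed
  then show ?thesis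
    unfolding s using fin by (intro power_sums_determine_sums[where f="\<lambda>x. - (x * log 2 x)"]) auto
qed

section \<open>Closure properties of positive semidefinite matrices\<close>

lemma psd_on_add:
  assumes "psd_on I A" "psd_on I B"
  shows "psd_on I (A + B)"
  unfolding psd_on_alt
proof (intro conjI allI)
  show "hermitian_on I (A + B)"
    using assms unfolding psd_on_def hermitian_mm_adj by (simp add: op_eq_on_def)
  fix v :: "'a \<Rightarrow> complex"
  obtain r s where "r \<ge> 0" "s \<ge> 0" "(\<Sum>i\<in>I. \<Sum>j\<in>I. cnj (v i) * A i j * v j) = complex_of_real r"
      "(\<Sum>i\<in>I. \<Sum>j\<in>I. cnj (v i) * B i j * v j) = complex_of_real s"
    using assms unfolding psd_on_alt by metis
  then have "r + s \<ge> 0 \<and> (\<Sum>i\<in>I. \<Sum>j\<in>I. cnj (v i) * (A + B) i j * v j) = complex_of_real (r + s)"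
    by (simp add: algebra_simps sum.distrib)
  then show "\<exists>t\<ge>0. (\<Sum>i\<in>I. \<Sum>j\<in>I. cnj (v i) * (A + B) i j * v j) = complex_of_real t" by blast
qed

lemma psd_on_conj: "finite J \<Longrightarrow> psd_on J E \<Longrightarrow> psd_on I (adj V \<star>\<^bsub>J\<^esub> E \<star>\<^bsub>J\<^esub> V)"
proof -
  assume "finite J" "psd_on J E"
  then obtain g :: "'a \<Rightarrow> 'a \<Rightarrow> complex" where g: "op_eq_on J E (g \<star>\<^bsub>J\<^esub> adj g)" by (rule psd_gram)
  have "adj V \<star>\<^bsub>J\<^esub> E \<star>\<^bsub>J\<^esub> V = (adj V \<star>\<^bsub>J\<^esub> g) \<star>\<^bsub>J\<^esub> adj (adj V \<star>\<^bsub>J\<^esub> g)"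
    using op_eq_on_conj[OF g, of V] by simp
  then show ?thesis by (simp only: psd_on_gram)
qed

lemma psd_on_sum: "finite L \<Longrightarrow> (\<And>l. l \<in> L \<Longrightarrow> psd_on I (F l)) \<Longrightarrow> psd_on I (\<Sum>l\<in>L. F l)"
proof (induction L rule: finite_induct)
  case empty
  have "psd_on I ((\<lambda>_ (_::unit). 0) \<star>\<^bsub>UNIV\<^esub> adj (\<lambda>_ _. 0))" by (rule psd_on_gram)
  then show ?case by (simp add: mm_def zero_fun_def)
qed (auto intro: psd_on_add)

lemma psd_on_smul:
  assumes "psd_on I A" "c \<ge> 0"
  shows "psd_on I (smul (complex_of_real c) A)"
  unfolding psd_on_alt
proof (intro conjI allI)
  show "hermitian_on I (smul (complex_of_real c) A)"
    using assms unfolding psd_on_def hermitian_mm_adj by (simp add: op_eq_on_def)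
  fix v :: "'a \<Rightarrow> complex"
  obtain r where r: "r \<ge> 0" "(\<Sum>i\<in>I. \<Sum>j\<in>I. cnj (v i) * A i j * v j) = complex_of_real r"
    using assms unfolding psd_on_alt by metis
  have "(\<Sum>i\<in>I. \<Sum>j\<in>I. cnj (v i) * smul (complex_of_real c) A i j * v j)
      = c * (\<Sum>i\<in>I. \<Sum>j\<in>I. cnj (v i) * A i j * v j)"
    by (simp add: sum_distrib_left mult_ac)
  with r assms(2) have "c * r \<ge> 0 \<and>
      (\<Sum>i\<in>I. \<Sum>j\<in>I. cnj (v i) * smul (complex_of_real c) A i j * v j) = complex_of_real (c * r)" by simp
  then show "\<exists>t\<ge>0. (\<Sum>i\<in>I. \<Sum>j\<in>I. cnj (v i) * smul (complex_of_real c) A i j * v j) = complex_of_real t"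
    by blast
qed

text \<open>The quadratic form is the squared norm of \<open>v\<close> minus that of
  \<open>V v\<close>. This operator completes a partial measurement to a POVM.\<close>

lemma psd_id_minus:
  assumes fin: "finite A" and V: "contr J A V"
  shows "psd_on A (op_id - adj V \<star>\<^bsub>J\<^esub> V)"
  unfolding psd_on_alt
proof (intro conjI allI)
  show "hermitian_on A (op_id - adj V \<star>\<^bsub>J\<^esub> V)"
  proof -
    have "adj op_id = (op_id :: 'a op)" by (simp add: adj_def op_id_def fun_eq_iff)
    then show ?thesis unfolding hermitian_mm_adj adj_diff adj_mm adj_adj by (simp only: op_eq_on_refl)
  qed
  fix v :: "'a \<Rightarrow> complex"
  let ?v = "\<lambda>i (_::unit). v i"
  have "adj ?v \<star>\<^bsub>A\<^esub> op_id \<star>\<^bsub>A\<^esub> ?v = adj ?v \<star>\<^bsub>A\<^esub> ?v"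
    by (intro ext mm_cong refl) (simp add: mm_op_id_left fin)
  then have "(\<Sum>i\<in>A. \<Sum>j\<in>A. cnj (v i) * (op_id - adj V \<star>\<^bsub>J\<^esub> V) i j * v j) =
      tr UNIV (adj ?v \<star>\<^bsub>A\<^esub> ?v) - tr UNIV (adj (V \<star>\<^bsub>A\<^esub> ?v) \<star>\<^bsub>J\<^esub> V \<star>\<^bsub>A\<^esub> ?v)"
    unfolding quadratic_form[where A="op_id - adj V \<star>\<^bsub>J\<^esub> V"]
    by (simp only: mm_distrib tr_diff mm_assoc adj_mm)
  also have "\<dots> = complex_of_real (hs A UNIV ?v - hs J UNIV (V \<star>\<^bsub>A\<^esub> ?v))"
    unfolding hs_tr by simp
  finally show "\<exists>r\<ge>0. (\<Sum>i\<in>A. \<Sum>j\<in>A. cnj (v i) * (op_id - adj V \<star>\<^bsub>J\<^esub> V) i j * v j) = complex_of_real r"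
    using hs_contr[OF V, of UNIV ?v] by (metis diff_ge_0_iff_ge)
qed

text \<open>A separate contraction for each \<open>l\<close> amounts to a block-diagonal test of a
  classical-quantum operator; Cauchy-Schwarz is applied a second time, over
  \<open>l\<close>.\<close>

lemma family_tr_bound:
  assumes "\<And>l. l \<in> L \<Longrightarrow> contr I I (C l)"
  shows "cmod (\<Sum>l\<in>L. tr I (C l \<star>\<^bsub>I\<^esub> A l \<star>\<^bsub>Z\<^esub> B l))
      \<le> sqrt (\<Sum>l\<in>L. hs I Z (A l)) * sqrt (\<Sum>l\<in>L. hs Z I (B l))"
proof -
  have "cmod (\<Sum>l\<in>L. tr I (C l \<star>\<^bsub>I\<^esub> A l \<star>\<^bsub>Z\<^esub> B l)) \<le> (\<Sum>l\<in>L. sqrt (hs I Z (A l)) * sqrt (hs Z I (B l)))"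
    by (intro order_trans[OF norm_sum] sum_mono contr_tr_bound assms)
  also have "\<dots> \<le> sqrt (\<Sum>l\<in>L. hs I Z (A l)) * sqrt (\<Sum>l\<in>L. hs Z I (B l))"
    by (intro sum_sqrt_mult_le) auto
  finally show ?thesis .
qed

lemma contr_tr_gram: "contr I I C \<Longrightarrow> cmod (tr I (C \<star>\<^bsub>I\<^esub> G \<star>\<^bsub>Z\<^esub> adj G)) \<le> hs I Z G"
  using contr_tr_bound[of I C G Z "adj G"] by simp

text \<open>With \<open>D = G - S G\<close> the difference of the states is \<open>D\<close> times
  \<open>adj G\<close> plus \<open>S G\<close> times \<open>adj D\<close>. Each term contains
  \<open>D\<close>, which is small when \<open>S\<close> hardly changes the state.\<close>

lemma gentle_measurement:
  assumes C: "contr I I C" and S: "contr I I S"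
  shows "cmod (tr I (C \<star>\<^bsub>I\<^esub> (G \<star>\<^bsub>Z\<^esub> adj G - S \<star>\<^bsub>I\<^esub> G \<star>\<^bsub>Z\<^esub> adj G \<star>\<^bsub>I\<^esub> adj S)))
      \<le> 2 * (sqrt (hs I Z (G - S \<star>\<^bsub>I\<^esub> G)) * sqrt (hs I Z G))"
proof -
  let ?D = "G - S \<star>\<^bsub>I\<^esub> G"
  have eq: "G \<star>\<^bsub>Z\<^esub> adj G - S \<star>\<^bsub>I\<^esub> G \<star>\<^bsub>Z\<^esub> adj G \<star>\<^bsub>I\<^esub> adj S = ?D \<star>\<^bsub>Z\<^esub> adj G + (S \<star>\<^bsub>I\<^esub> G) \<star>\<^bsub>Z\<^esub> adj ?D"
    by (simp add: mm_distrib)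
  have "cmod (tr I (C \<star>\<^bsub>I\<^esub> ?D \<star>\<^bsub>Z\<^esub> adj G)) \<le> sqrt (hs I Z ?D) * sqrt (hs I Z G)"
    using contr_tr_bound[OF C, of ?D Z "adj G"] by simp
  moreover have "cmod (tr I (C \<star>\<^bsub>I\<^esub> (S \<star>\<^bsub>I\<^esub> G) \<star>\<^bsub>Z\<^esub> adj ?D)) \<le> sqrt (hs I Z G) * sqrt (hs I Z ?D)"
    using contr_tr_bound[OF C, of "S \<star>\<^bsub>I\<^esub> G" Z "adj ?D"] hs_contr[OF S, of Z G]
    by (simp add: order_trans[OF _ mult_right_mono] del: adj_diff adj_mm)
  ultimately show ?thesis
    unfolding eq mm_add_right tr_add
    by (smt (verit, best) mult.commute norm_triangle_ineq)
qed

subsection \<open>Orthogonal projections\<close>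

text \<open>Equations between whole functions, not just on \<open>I\<close>, so that they can be
  used for rewriting. They hold for the products of \<open>u\<close> with
  \<open>adj u\<close>.\<close>

definition projn :: "'i set \<Rightarrow> 'i op \<Rightarrow> bool" where
  "projn I P \<longleftrightarrow> adj P = P \<and> P \<star>\<^bsub>I\<^esub> P = P"

lemma projn_mm [simp]: "projn I P \<Longrightarrow> P \<star>\<^bsub>I\<^esub> P \<star>\<^bsub>I\<^esub> M = P \<star>\<^bsub>I\<^esub> M"
  by (metis mm_assoc projn_def)

lemma projn_isom:
  assumes "isom I Z u" "finite Z"
  shows "projn I (u \<star>\<^bsub>Z\<^esub> adj u)"
proof -
  have "u \<star>\<^bsub>Z\<^esub> (adj u \<star>\<^bsub>I\<^esub> u \<star>\<^bsub>Z\<^esub> adj u) = u \<star>\<^bsub>Z\<^esub> adj u"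
    by (intro ext mm_cong refl isom_cancel assms)
  then show ?thesis by (simp add: projn_def)
qed

lemma hs_projn:
  assumes "projn I P"
  shows "hs I Z (M - P \<star>\<^bsub>I\<^esub> M) = hs I Z M - hs I Z (P \<star>\<^bsub>I\<^esub> M)"
proof -
  have a: "adj P = P" using assms by (simp add: projn_def)
  have "complex_of_real (hs I Z (M - P \<star>\<^bsub>I\<^esub> M))
      = complex_of_real (hs I Z M) - tr Z (adj M \<star>\<^bsub>I\<^esub> P \<star>\<^bsub>I\<^esub> M)"
    unfolding hs_tr[symmetric] adj_diff adj_mm a mm_distrib tr_diff mm_assoc projn_mm[OF assms] by simp
  also have "tr Z (adj M \<star>\<^bsub>I\<^esub> P \<star>\<^bsub>I\<^esub> M) = complex_of_real (hs I Z (P \<star>\<^bsub>I\<^esub> M))"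
    unfolding hs_tr[symmetric] adj_mm a mm_assoc projn_mm[OF assms] ..
  finally have "complex_of_real (hs I Z (M - P \<star>\<^bsub>I\<^esub> M))
      = complex_of_real (hs I Z M - hs I Z (P \<star>\<^bsub>I\<^esub> M))" by (simp only: of_real_diff)
  then show ?thesis by (simp only: of_real_eq_iff)
qed

lemma hs_projn_le: "projn I P \<Longrightarrow> hs I Z (P \<star>\<^bsub>I\<^esub> M) \<le> hs I Z M"
  using hs_projn[of I P Z M] hs_nonneg[of I Z "M - P \<star>\<^bsub>I\<^esub> M"] by linarith

lemma contr_projn: "projn I P \<Longrightarrow> contr I I P"
  by (simp add: contr_def hs_projn_le)

lemma hs_projn_diff_le: "projn I P \<Longrightarrow> hs I Z (M - P \<star>\<^bsub>I\<^esub> M) \<le> hs I Z M"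
  by (simp add: hs_projn)

subsection \<open>Sequential decoding\<close>

text \<open>The unnormalized state after the tests \<open>P 1\<close>, ..., \<open>P k\<close> have
  all rejected.\<close>

primrec seq_state :: "'i set \<Rightarrow> (nat \<Rightarrow> 'i op) \<Rightarrow> ('i \<Rightarrow> 'z \<Rightarrow> complex) \<Rightarrow> nat \<Rightarrow> 'i \<Rightarrow> 'z \<Rightarrow> complex" where
  "seq_state I P M 0 = M"
| "seq_state I P M (Suc k) = seq_state I P M k - P (Suc k) \<star>\<^bsub>I\<^esub> seq_state I P M k"

lemma seq_state_mm: "seq_state I P M k \<star>\<^bsub>J\<^esub> G = seq_state I P (M \<star>\<^bsub>J\<^esub> G) k"
  by (induction k) (simp_all only: seq_state.simps mm_diff_left mm_assoc)

text \<open>A form of Sen's noncommutative union bound. \<open>M\<close> minus the finally accepted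
  vector telescopes into the vectors picked up by the wrong tests and the part lost at the last one.
  Paired with \<open>M\<close>, each summand is at most a product of two norms: the first kind are
  the disturbances on the right-hand side, and the squares of the second kind telescope to at most
  \<open>hs I Z M\<close>.\<close>

lemma noncommutative_union_bound:
  assumes P: "\<And>k. k \<in> {1..Suc K} \<Longrightarrow> projn I (P k)"
  shows "hs I Z M - hs I Z (P (Suc K) \<star>\<^bsub>I\<^esub> seq_state I P M K)
    \<le> 2 * sqrt (hs I Z M) * sqrt ((\<Sum>k\<in>{1..K}. hs I Z (P k \<star>\<^bsub>I\<^esub> M)) + hs I Z (M - P (Suc K) \<star>\<^bsub>I\<^esub> M))"
proof -
  let ?\<psi> = "seq_state I P M"
  let ?x = "P (Suc K) \<star>\<^bsub>I\<^esub> ?\<psi> K"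
  have adjP: "adj (P k) = P k" if "k \<in> {1..Suc K}" for k using P[OF that] by (simp add: projn_def)
  have drop: "hs I Z (P (Suc k) \<star>\<^bsub>I\<^esub> ?\<psi> k) = hs I Z (?\<psi> k) - hs I Z (?\<psi> (Suc k))" if "k < K" for k
    using hs_projn[OF P, of "Suc k" Z "?\<psi> k"] that by simp
  have ip: "cmod (tr Z (adj M \<star>\<^bsub>I\<^esub> P (Suc k) \<star>\<^bsub>I\<^esub> ?\<psi> k))
      \<le> sqrt (hs I Z (P (Suc k) \<star>\<^bsub>I\<^esub> M)) * sqrt (hs I Z (?\<psi> k) - hs I Z (?\<psi> (Suc k)))" if k: "k < K" for k
  proof -
    have "adj M \<star>\<^bsub>I\<^esub> P (Suc k) \<star>\<^bsub>I\<^esub> ?\<psi> k = adj (P (Suc k) \<star>\<^bsub>I\<^esub> M) \<star>\<^bsub>I\<^esub> P (Suc k) \<star>\<^bsub>I\<^esub> ?\<psi> k"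
      using k P[of "Suc k"] by (simp add: adjP)
    then show ?thesis
      using Cauchy_Schwarz_tr[of Z "adj (P (Suc k) \<star>\<^bsub>I\<^esub> M)" I "P (Suc k) \<star>\<^bsub>I\<^esub> ?\<psi> k"]
      unfolding hs_adj drop[OF k] by (simp del: adj_mm)
  qed
  have last: "cmod (tr Z (adj M \<star>\<^bsub>I\<^esub> (?\<psi> K - ?x)))
      \<le> sqrt (hs I Z (M - P (Suc K) \<star>\<^bsub>I\<^esub> M)) * sqrt (hs I Z (?\<psi> K) - hs I Z ?x)"
  proof -
    have PK: "projn I (P (Suc K))" using P by simp
    \<comment> \<open>\<open>?\<psi> K - ?x\<close> lies in the complement of
      \<open>P (Suc K)\<close>, so only the component of \<open>M\<close> in that complement
      contributes.\<close>
    have "adj (M - P (Suc K) \<star>\<^bsub>I\<^esub> M) \<star>\<^bsub>I\<^esub> (?\<psi> K - ?x) = adj M \<star>\<^bsub>I\<^esub> (?\<psi> K - ?x)"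
      unfolding adj_diff adj_mm adjP[of "Suc K", simplified] mm_distrib mm_assoc projn_mm[OF PK] by simp
    then show ?thesis
      using Cauchy_Schwarz_tr[of Z "adj (M - P (Suc K) \<star>\<^bsub>I\<^esub> M)" I "?\<psi> K - ?x"]
      unfolding hs_adj by (simp only: hs_projn[OF PK, of Z "?\<psi> K"])
  qed
  have tel: "M - ?x = (\<Sum>k<K. P (Suc k) \<star>\<^bsub>I\<^esub> ?\<psi> k) + (?\<psi> K - ?x)"
  proof -
    have "M - ?\<psi> k = (\<Sum>j<k. P (Suc j) \<star>\<^bsub>I\<^esub> ?\<psi> j)" for k
    proof (induction k)
      case (Suc k)
      have "M - ?\<psi> (Suc k) = (M - ?\<psi> k) + P (Suc k) \<star>\<^bsub>I\<^esub> ?\<psi> k" by (simp only: seq_state.simps algebra_simps)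
      then show ?case by (simp only: Suc.IH sum.lessThan_Suc)
    qed simp
    from this[of K] show ?thesis by (metis diff_add_cancel add_diff_eq)
  qed
  define s where "s = (\<Sum>k\<in>{1..K}. hs I Z (P k \<star>\<^bsub>I\<^esub> M)) + hs I Z (M - P (Suc K) \<star>\<^bsub>I\<^esub> M)"
  \<comment> \<open>Index \<open>K\<close> stands for the final test, which should accept; the
    smaller indices are the tests that should reject.\<close>
  define a where "a k = (if k < K then hs I Z (P (Suc k) \<star>\<^bsub>I\<^esub> M) else hs I Z (M - P (Suc K) \<star>\<^bsub>I\<^esub> M))" for k
  define b where "b k = (if k < K then hs I Z (?\<psi> k) - hs I Z (?\<psi> (Suc k)) else hs I Z (?\<psi> K) - hs I Z ?x)" for k
  have b0: "b k \<ge> 0" if "k < Suc K" for k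
    using that drop hs_nonneg hs_projn_le[OF P, of "Suc K" Z "?\<psi> K"]
    by (auto simp: b_def) (metis hs_nonneg diff_ge_0_iff_ge)
  have suma: "(\<Sum>k<Suc K. a k) = s"
  proof -
    have "(\<Sum>k<K. hs I Z (P (Suc k) \<star>\<^bsub>I\<^esub> M)) = (\<Sum>k\<in>{1..K}. hs I Z (P k \<star>\<^bsub>I\<^esub> M))"
      by (rule sum.reindex_bij_witness[of _ "\<lambda>k. k - 1" Suc]) auto
    then show ?thesis by (simp add: a_def s_def)
  qed
  have sumb: "(\<Sum>k<Suc K. b k) \<le> hs I Z M"
  proof -
    have "(\<Sum>k<n. hs I Z (?\<psi> k) - hs I Z (?\<psi> (Suc k))) = hs I Z (?\<psi> 0) - hs I Z (?\<psi> n)" for n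
      by (rule sum_lessThan_telescope')
    from this[of K] have "(\<Sum>k<Suc K. b k) = hs I Z M - hs I Z ?x" by (simp add: b_def)
    then show ?thesis using hs_nonneg[of I Z ?x] by linarith
  qed
  have "cmod (tr Z (adj M \<star>\<^bsub>I\<^esub> (M - ?x))) \<le> (\<Sum>k<K. cmod (tr Z (adj M \<star>\<^bsub>I\<^esub> P (Suc k) \<star>\<^bsub>I\<^esub> ?\<psi> k)))
      + cmod (tr Z (adj M \<star>\<^bsub>I\<^esub> (?\<psi> K - ?x)))"
    unfolding tel mm_add_right mm_sum_right tr_add tr_sum
    by (intro order_trans[OF norm_triangle_ineq] add_mono norm_sum) simp
  also have "\<dots> \<le> (\<Sum>k<K. sqrt (a k) * sqrt (b k)) + sqrt (a K) * sqrt (b K)"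
    using ip last by (intro add_mono sum_mono) (auto simp: a_def b_def)
  also have "\<dots> = (\<Sum>k<Suc K. sqrt (a k) * sqrt (b k))" by simp
  also have "\<dots> \<le> sqrt (\<Sum>k<Suc K. a k) * sqrt (\<Sum>k<Suc K. b k)"
    using b0 by (intro sum_sqrt_mult_le) (auto simp: a_def)
  also have "\<dots> \<le> sqrt s * sqrt (hs I Z M)"
    unfolding suma using sumb
    by (intro mult_left_mono real_sqrt_le_mono) (auto simp: s_def intro!: add_nonneg_nonneg sum_nonneg)
  finally have main: "cmod (tr Z (adj M \<star>\<^bsub>I\<^esub> (M - ?x))) \<le> sqrt s * sqrt (hs I Z M)" .
  have "hs I Z M - sqrt (hs I Z M) * sqrt (hs I Z ?x) \<le> hs I Z M - cmod (tr Z (adj M \<star>\<^bsub>I\<^esub> ?x))"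
    using Cauchy_Schwarz_tr[of Z "adj M" I ?x] by simp
  also have "\<dots> \<le> cmod (tr Z (adj M \<star>\<^bsub>I\<^esub> (M - ?x)))"
    using norm_triangle_ineq2[of "tr Z (adj M \<star>\<^bsub>I\<^esub> M)" "tr Z (adj M \<star>\<^bsub>I\<^esub> ?x)"]
    by (simp add: mm_diff_right tr_diff hs_tr)
  finally have fin: "hs I Z M - sqrt (hs I Z M) * sqrt (hs I Z ?x) \<le> sqrt s * sqrt (hs I Z M)"
    using main by linarith
  \<comment> \<open>The inequality of arithmetic and geometric means passes from a product of norms
    to a difference of squared norms, at the cost of the factor 2.\<close>
  have "2 * (sqrt (hs I Z M) * sqrt (hs I Z ?x)) \<le> hs I Z M + hs I Z ?x"
    using sum_squares_bound[of "sqrt (hs I Z M)" "sqrt (hs I Z ?x)"] by simp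
  with fin show ?thesis unfolding s_def[symmetric] by (simp add: mult.commute mult.left_commute)
qed

text \<open>\<open>Pi\<close> is measured, then \<open>P 1\<close>, \<open>P 2\<close>, ... in turn
  until one accepts. What remains undecided, failure of \<open>Pi\<close> or of all tests, is
  assigned to outcome 1: adding a positive operator can only increase a success probability, and
  exactly \<open>K\<close> outcomes remain.\<close>

theorem sequential_decoder:
  fixes Pi :: "'i op" and P :: "nat \<Rightarrow> 'i op"
  assumes fin: "finite I" and Pi: "projn I Pi" and P: "\<And>k. k \<in> {1..K} \<Longrightarrow> projn I (P k)" and K: "K \<ge> 1"
  obtains \<Lambda> where "povm_on I {1..K} \<Lambda>"
    "\<And>k (Z :: 'z set) G. k \<in> {1..K} \<Longrightarrow> hs I Z G = 1 \<Longrightarrow>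
       1 - Re (tr I (\<Lambda> k \<star>\<^bsub>I\<^esub> G \<star>\<^bsub>Z\<^esub> adj G)) \<le> hs I Z (G - Pi \<star>\<^bsub>I\<^esub> G)
         + 2 * sqrt ((\<Sum>j\<in>{1..<k}. hs I Z (P j \<star>\<^bsub>I\<^esub> Pi \<star>\<^bsub>I\<^esub> G)) + 2 * hs I Z (G - P k \<star>\<^bsub>I\<^esub> G) + 2 * hs I Z (G - Pi \<star>\<^bsub>I\<^esub> G))"
proof -
  define N where "N = seq_state I P Pi"
  define X where "X k = P k \<star>\<^bsub>I\<^esub> N (k - 1)" for k
  define Rm where "Rm = (op_id - adj Pi \<star>\<^bsub>I\<^esub> Pi) + adj (N K) \<star>\<^bsub>I\<^esub> N K"
  define \<Lambda> where "\<Lambda> k = adj (X k) \<star>\<^bsub>I\<^esub> X k + (if k = 1 then Rm else 0)" for k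
  have psdR: "psd_on I Rm"
    unfolding Rm_def using psd_on_gram[of I "adj (N K)" I]
    by (intro psd_on_add psd_id_minus fin contr_projn Pi) simp
  have psdX: "psd_on I (adj (X k) \<star>\<^bsub>I\<^esub> X k)" for k
    using psd_on_gram[of I "adj (X k)" I] by simp
  \<comment> \<open>The acceptance operators telescope, because each projective test splits the
    surviving part into an accepted and a rejected part.\<close>
  have tel: "(\<Sum>k\<in>{1..k}. adj (X k) \<star>\<^bsub>I\<^esub> X k) = adj Pi \<star>\<^bsub>I\<^esub> Pi - adj (N k) \<star>\<^bsub>I\<^esub> N k" if "k \<le> K" for k
    using that
  proof (induction k)
    case 0
    show ?case by (simp add: N_def)
  next
    case (Suc k)
    have Pk: "projn I (P (Suc k))" "adj (P (Suc k)) = P (Suc k)"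
      using P[of "Suc k"] Suc.prems by (auto simp: projn_def)
    have "adj (N (Suc k)) \<star>\<^bsub>I\<^esub> N (Suc k) = adj (N k) \<star>\<^bsub>I\<^esub> N k - adj (N k) \<star>\<^bsub>I\<^esub> P (Suc k) \<star>\<^bsub>I\<^esub> N k"
      unfolding N_def seq_state.simps adj_diff adj_mm Pk(2) mm_distrib mm_assoc projn_mm[OF Pk(1)] by simp
    moreover have "adj (X (Suc k)) \<star>\<^bsub>I\<^esub> X (Suc k) = adj (N k) \<star>\<^bsub>I\<^esub> P (Suc k) \<star>\<^bsub>I\<^esub> N k"
      by (simp add: X_def Pk)
    moreover have "(\<Sum>k\<in>{1..Suc k}. adj (X k) \<star>\<^bsub>I\<^esub> X k) = (\<Sum>k\<in>{1..k}. adj (X k) \<star>\<^bsub>I\<^esub> X k) + adj (X (Suc k)) \<star>\<^bsub>I\<^esub> X (Suc k)"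
      by (subst sum.cl_ivl_Suc) simp
    ultimately show ?case using Suc.IH Suc.prems
      by (simp only: Suc_leD diff_diff_eq2 diff_add_eq)
  qed
  have "povm_on I {1..K} \<Lambda>"
    unfolding povm_on_def
  proof (intro conjI ballI)
    fix k show "psd_on I (\<Lambda> k)" by (auto simp: \<Lambda>_def intro: psd_on_add psdX psdR)
  next
    have "(\<Sum>k\<in>{1..K}. \<Lambda> k) = (\<Sum>k\<in>{1..K}. adj (X k) \<star>\<^bsub>I\<^esub> X k) + (\<Sum>k\<in>{1..K}. if k = 1 then Rm else 0)"
      unfolding \<Lambda>_def by (rule sum.distrib)
    also have "(\<Sum>k\<in>{1..K}. if k = 1 then Rm else 0) = Rm" using K by (simp add: sum.delta)
    also have "(\<Sum>k\<in>{1..K}. adj (X k) \<star>\<^bsub>I\<^esub> X k) + Rm = op_id" unfolding tel[OF order_refl] Rm_def by simp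
    finally show "op_eq_on I (\<lambda>i j. \<Sum>k\<in>{1..K}. \<Lambda> k i j) op_id"
      by (simp add: op_eq_on_def fun_eq_iff sum_fun_apply)
  qed
  moreover have "1 - Re (tr I (\<Lambda> k \<star>\<^bsub>I\<^esub> G \<star>\<^bsub>Z\<^esub> adj G)) \<le> hs I Z (G - Pi \<star>\<^bsub>I\<^esub> G)
         + 2 * sqrt ((\<Sum>j\<in>{1..<k}. hs I Z (P j \<star>\<^bsub>I\<^esub> Pi \<star>\<^bsub>I\<^esub> G)) + 2 * hs I Z (G - P k \<star>\<^bsub>I\<^esub> G) + 2 * hs I Z (G - Pi \<star>\<^bsub>I\<^esub> G))"
    if k: "k \<in> {1..K}" and G: "hs I Z G = 1" for k Z and G :: "'i \<Rightarrow> 'z \<Rightarrow> complex"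
  proof -
    obtain k' where k': "k = Suc k'" using k by (cases k) auto
    let ?M = "Pi \<star>\<^bsub>I\<^esub> G"
    let ?s = "(\<Sum>j\<in>{1..<k}. hs I Z (P j \<star>\<^bsub>I\<^esub> ?M)) + 2 * hs I Z (G - P k \<star>\<^bsub>I\<^esub> G) + 2 * hs I Z (G - ?M)"
    have trG: "tr I ((adj A \<star>\<^bsub>I\<^esub> A) \<star>\<^bsub>I\<^esub> G \<star>\<^bsub>Z\<^esub> adj G) = complex_of_real (hs I Z (A \<star>\<^bsub>I\<^esub> G))" for A :: "'i op"
    proof -
      have "tr I ((adj A \<star>\<^bsub>I\<^esub> A) \<star>\<^bsub>I\<^esub> G \<star>\<^bsub>Z\<^esub> adj G) = tr I ((adj A \<star>\<^bsub>I\<^esub> A \<star>\<^bsub>I\<^esub> G) \<star>\<^bsub>Z\<^esub> adj G)" by simp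
      also have "\<dots> = tr Z (adj (A \<star>\<^bsub>I\<^esub> G) \<star>\<^bsub>I\<^esub> (A \<star>\<^bsub>I\<^esub> G))" by (subst tr_mm_commute) simp
      finally show ?thesis by (simp only: hs_tr)
    qed
    have Rm0: "Re (tr I (Rm \<star>\<^bsub>I\<^esub> G \<star>\<^bsub>Z\<^esub> adj G)) \<ge> 0"
    proof -
      obtain g :: "'i op" where g: "op_eq_on I Rm (g \<star>\<^bsub>I\<^esub> adj g)"
        by (rule psd_gram[OF fin psdR])
      have "tr I (Rm \<star>\<^bsub>I\<^esub> G \<star>\<^bsub>Z\<^esub> adj G) = tr I ((adj (adj g) \<star>\<^bsub>I\<^esub> adj g) \<star>\<^bsub>I\<^esub> G \<star>\<^bsub>Z\<^esub> adj G)"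
        using op_eq_on_mm[OF g op_eq_on_refl] by (intro op_eq_on_tr) (simp del: mm_assoc)
      then show ?thesis unfolding trG by simp
    qed
    have X: "X k \<star>\<^bsub>I\<^esub> G = P k \<star>\<^bsub>I\<^esub> seq_state I P ?M k'"
      by (simp add: X_def N_def k' seq_state_mm)
    have "Re (tr I (\<Lambda> k \<star>\<^bsub>I\<^esub> G \<star>\<^bsub>Z\<^esub> adj G)) = hs I Z (X k \<star>\<^bsub>I\<^esub> G) + (if k = 1 then Re (tr I (Rm \<star>\<^bsub>I\<^esub> G \<star>\<^bsub>Z\<^esub> adj G)) else 0)"
      unfolding \<Lambda>_def mm_add_left tr_add trG by (simp add: op_trace_def mm_def)
    then have ge: "Re (tr I (\<Lambda> k \<star>\<^bsub>I\<^esub> G \<star>\<^bsub>Z\<^esub> adj G)) \<ge> hs I Z (P k \<star>\<^bsub>I\<^esub> seq_state I P ?M k')"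
      using Rm0 unfolding X by (simp split: if_splits)
    have M1: "hs I Z ?M \<le> 1" using hs_projn_le[OF Pi, of Z G] G by simp
    \<comment> \<open>The right test is good for \<open>G\<close> but is applied to
      \<open>?M\<close>. The identity M - PM = (G - PG) - (1 - P)(G - M) transfers its error, with
      factors 2 from squaring a sum.\<close>
    have "hs I Z (?M - P k \<star>\<^bsub>I\<^esub> ?M) \<le> 2 * hs I Z (G - P k \<star>\<^bsub>I\<^esub> G) + 2 * hs I Z (G - ?M)"
    proof -
      have "?M - P k \<star>\<^bsub>I\<^esub> ?M = (G - P k \<star>\<^bsub>I\<^esub> G) + (P k \<star>\<^bsub>I\<^esub> (G - ?M) - (G - ?M))"
        by (simp add: mm_diff_right)
      then have "hs I Z (?M - P k \<star>\<^bsub>I\<^esub> ?M) \<le> 2 * hs I Z (G - P k \<star>\<^bsub>I\<^esub> G) + 2 * hs I Z (P k \<star>\<^bsub>I\<^esub> (G - ?M) - (G - ?M))"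
        by (simp only: hs_add_le)
      moreover have "hs I Z (P k \<star>\<^bsub>I\<^esub> (G - ?M) - (G - ?M)) \<le> hs I Z (G - ?M)"
        by (subst hs_minus_commute) (intro hs_projn_diff_le P k)
      ultimately show ?thesis by linarith
    qed
    then have s: "(\<Sum>j\<in>{1..k'}. hs I Z (P j \<star>\<^bsub>I\<^esub> ?M)) + hs I Z (?M - P k \<star>\<^bsub>I\<^esub> ?M) \<le> ?s"
      by (simp add: k' atLeastLessThanSuc_atLeastAtMost)
    have "hs I Z ?M - hs I Z (P k \<star>\<^bsub>I\<^esub> seq_state I P ?M k')
        \<le> 2 * sqrt (hs I Z ?M) * sqrt ((\<Sum>j\<in>{1..k'}. hs I Z (P j \<star>\<^bsub>I\<^esub> ?M)) + hs I Z (?M - P k \<star>\<^bsub>I\<^esub> ?M))"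
      unfolding k' by (rule noncommutative_union_bound) (use k k' P in auto)
    also have "\<dots> \<le> 2 * 1 * sqrt ?s"
      using M1 s by (intro mult_mono real_sqrt_le_mono) (auto intro!: add_nonneg_nonneg sum_nonneg)
    finally have "hs I Z ?M - hs I Z (P k \<star>\<^bsub>I\<^esub> seq_state I P ?M k') \<le> 2 * sqrt ?s" by simp
    moreover have "hs I Z ?M = 1 - hs I Z (G - ?M)"
      using hs_projn[OF Pi, of Z G] G by simp
    ultimately show ?thesis using ge by linarith
  qed
  ultimately show thesis by (rule that)
qed

section \<open>Zero, identity and sums in products\<close>

lemma adj_op_id [simp]: "adj op_id = op_id"
  by (simp add: adj_def op_id_def fun_eq_iff)

lemma mm_zero [simp]: "0 \<star>\<^bsub>K\<^esub> B = 0" "A \<star>\<^bsub>K\<^esub> 0 = 0"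
  by (simp_all add: mm_def fun_eq_iff)

lemma tr_zero [simp]: "tr I 0 = 0"
  by (simp add: op_trace_def)

lemma spec_unitary_one:
  assumes "unitary_on J U"
  shows "op_eq_on J (spec J U (\<lambda>_. 1)) op_id"
  using assms by (simp add: spec_mm unitary_on_def op_mult_mm op_adj_adj)

lemma op_eq_on_id_left: "finite J \<Longrightarrow> op_eq_on J B op_id \<Longrightarrow> op_eq_on J (B \<star>\<^bsub>J\<^esub> M) M"
  using op_eq_on_mm[of J B op_id M M] by (auto simp: op_eq_on_def mm_op_id_left)

lemma op_eq_on_id_right: "finite J \<Longrightarrow> op_eq_on J B op_id \<Longrightarrow> op_eq_on J (M \<star>\<^bsub>J\<^esub> B) M"
  using op_eq_on_mm[of J M M B op_id] by (auto simp: op_eq_on_def mm_op_id_right)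

lemma mm_op_id_mid: "finite J \<Longrightarrow> A \<star>\<^bsub>J\<^esub> op_id \<star>\<^bsub>J\<^esub> B = A \<star>\<^bsub>J\<^esub> B"
  by (intro ext mm_cong refl) (simp add: mm_op_id_left)

lemma op_eq_on_add: "op_eq_on I A A' \<Longrightarrow> op_eq_on I B B' \<Longrightarrow> op_eq_on I (A + B) (A' + B')"
  by (simp add: op_eq_on_def)

lemma op_eq_on_sum: "(\<And>l. l \<in> L \<Longrightarrow> op_eq_on I (F l) (G l)) \<Longrightarrow> op_eq_on I (\<Sum>l\<in>L. F l) (\<Sum>l\<in>L. G l)"
  by (simp add: op_eq_on_def sum_fun_apply)

subsection \<open>Encoding by a purified posterior ensemble\<close>

text \<open>\<open>V\<close> is a partial isometry with range projection \<open>Q\<close>. The bound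
  is immediate for \<open>adj V\<close> and passes to \<open>V\<close> by taking adjoints.\<close>

lemma contr_of_mm_adj_projn:
  assumes "projn J Q" "V \<star>\<^bsub>A\<^esub> adj V = Q"
  shows "contr J A V"
proof -
  have "contr A J (adj V)"
    unfolding contr_def
  proof
    fix v :: "'a \<Rightarrow> unit \<Rightarrow> complex"
    have a: "adj Q = Q" using assms(1) by (simp add: projn_def)
    have "complex_of_real (hs A UNIV (adj V \<star>\<^bsub>J\<^esub> v)) = tr UNIV (adj v \<star>\<^bsub>J\<^esub> (V \<star>\<^bsub>A\<^esub> adj V) \<star>\<^bsub>J\<^esub> v)"
      unfolding hs_tr[symmetric] by simp
    also have "\<dots> = tr UNIV (adj (Q \<star>\<^bsub>J\<^esub> v) \<star>\<^bsub>J\<^esub> (Q \<star>\<^bsub>J\<^esub> v))"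
      unfolding adj_mm a mm_assoc projn_mm[OF assms(1)] assms(2) ..
    also have "\<dots> = complex_of_real (hs J UNIV (Q \<star>\<^bsub>J\<^esub> v))" by (rule hs_tr)
    finally show "hs A UNIV (adj V \<star>\<^bsub>J\<^esub> v) \<le> hs J UNIV v"
      using hs_projn_le[OF assms(1), of UNIV v] by (simp only: of_real_eq_iff)
  qed
  from contr_adj[OF this] show ?thesis by simp
qed

text \<open>Uhlmann's theorem in explicit form: if \<^term>\<open>Phi\<close> purifies a state close to the ensemble
  average \<open>H\<close>, then the measurement that would prepare the ensemble from the purification
  \<open>H\<^sup>1\<^sup>/\<^sup>2 V\<close> of \<open>H\<close> nearly prepares it from \<^term>\<open>Phi\<close> \<open>= (Phi Phi\<^sup>*)\<^sup>1\<^sup>/\<^sup>2 V\<close>. Admixing a little of the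
  identity makes \<open>H\<close> invertible.\<close>

theorem encoding_measurement:
  fixes Phi :: "'j \<Rightarrow> 'a \<Rightarrow> complex" and w :: "'l \<Rightarrow> 'j op"
  assumes fin: "finite J" "finite A" "finite L" and l0: "l0 \<in> L"
    and psd: "\<And>l. l \<in> L \<Longrightarrow> psd_on J (w l)"
    and tr1: "hs J A Phi = 1" and trw: "tr J (\<Sum>l\<in>L. w l) = 1"
    and th: "0 < \<theta>" "\<theta> \<le> 1"
    and cover: "\<And>C. contr J J C \<Longrightarrow> cmod (tr J (C \<star>\<^bsub>J\<^esub> ((\<Sum>l\<in>L. w l) - Phi \<star>\<^bsub>A\<^esub> adj Phi))) \<le> \<theta>"
  obtains Om where "\<And>l. l \<in> L \<Longrightarrow> psd_on A (Om l)" "op_eq_on A (\<Sum>l\<in>L. Om l) op_id"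
    "\<And>C. (\<And>l. l \<in> L \<Longrightarrow> contr J J (C l)) \<Longrightarrow>
       cmod (\<Sum>l\<in>L. tr J (C l \<star>\<^bsub>J\<^esub> (Phi \<star>\<^bsub>A\<^esub> Om l \<star>\<^bsub>A\<^esub> adj Phi - w l))) \<le> 5 * sqrt \<theta>"
proof -
  \<comment> \<open>Chosen so that the admixture of \<open>\<eta>\<close> times the identity has
    trace at most \<open>\<theta>\<close>.\<close>
  define \<eta> where "\<eta> = \<theta> / (real (card J) + 1)"
  have \<eta>: "\<eta> > 0" "\<eta> * card J \<le> \<theta>"
    using th by (auto simp: \<eta>_def field_simps add_pos_nonneg)
  \<comment> \<open>The whole admixture goes to the single label \<open>l0\<close>, so it
    contributes only one extra term to the final sum.\<close>
  define w' where "w' l = w l + (if l = l0 then smul \<eta> op_id else 0)" for l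
  define H where "H = (\<Sum>l\<in>L. w' l)"
  have H: "H = (\<Sum>l\<in>L. w l) + smul \<eta> op_id"
    using fin l0 unfolding H_def w'_def sum.distrib by simp
  have psd_id: "psd_on J op_id"
  proof -
    have "op_eq_on J ((op_id :: 'j op) \<star>\<^bsub>J\<^esub> adj op_id) op_id"
      by (simp add: op_eq_on_def mm_op_id_left fin)
    then show ?thesis by (rule psd_on_cong[OF _ psd_on_gram])
  qed
  have psd': "psd_on J (w' l)" if "l \<in> L" for l
    using that psd \<eta> by (auto simp: w'_def intro!: psd_on_add psd_on_smul psd_id)
  then have "\<exists>g :: 'j op. op_eq_on J (w' l) (g \<star>\<^bsub>J\<^esub> adj g)" if "l \<in> L" for l
    using psd_gram[OF fin(1)] that by metis
  then obtain g :: "'l \<Rightarrow> 'j op" where g: "\<And>l. l \<in> L \<Longrightarrow> op_eq_on J (w' l) (g l \<star>\<^bsub>J\<^esub> adj (g l))"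
    by metis
  have psdH: "psd_on J H" unfolding H_def by (intro psd_on_sum fin psd')
  obtain U :: "'j op" and d where U: "isom J J U" "unitary_on J U" and Hd: "op_eq_on J H (spec J U d)"
    by (rule psd_spectral[OF fin(1) psdH])
  have d: "d k > 0" if k: "k \<in> J" for k
  proof -
    have "complex_of_real (d k) = (adj U \<star>\<^bsub>J\<^esub> H \<star>\<^bsub>J\<^esub> U) k k"
      using spec_diag[OF U(1) fin(1) k, of d] op_eq_on_conj[OF Hd, of U] by simp
    also have "\<dots> = (adj U \<star>\<^bsub>J\<^esub> (\<Sum>l\<in>L. w l) \<star>\<^bsub>J\<^esub> U) k k + \<eta> * (adj U \<star>\<^bsub>J\<^esub> U) k k"
      unfolding H mm_add_left mm_add_right mm_smul_left mm_smul_right mm_assoc[symmetric]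
      by (simp add: mm_op_id_mid fin)
    also have "(adj U \<star>\<^bsub>J\<^esub> U) k k = 1" using U(1) k by (simp add: isom_def op_eq_on_def op_id_def)
    finally have "d k = Re ((adj U \<star>\<^bsub>J\<^esub> (\<Sum>l\<in>L. w l) \<star>\<^bsub>J\<^esub> U) k k) + \<eta>"
      by (metis Re_complex_of_real mult.right_neutral plus_complex.sel(1))
    moreover have "Re ((adj U \<star>\<^bsub>J\<^esub> (\<Sum>l\<in>L. w l) \<star>\<^bsub>J\<^esub> U) k k) \<ge> 0"
      by (intro psd_diag_nonneg psd_on_sum fin psd)
    ultimately show ?thesis using \<eta> by linarith
  qed
  define S where "S = spec J U (\<lambda>k. sqrt (d k))"
  define Si where "Si = spec J U (\<lambda>k. 1 / sqrt (d k))"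
  have adjS: "adj S = S" "adj Si = Si" by (simp_all add: S_def Si_def)
  have SSi: "S \<star>\<^bsub>J\<^esub> Si = spec J U (\<lambda>_. 1)" "Si \<star>\<^bsub>J\<^esub> S = spec J U (\<lambda>_. 1)"
    unfolding S_def Si_def spec_mult[OF U(1) fin(1)] by (intro spec_cong; use d in force)+
  have one: "op_eq_on J (spec J U (\<lambda>_. 1)) op_id" by (rule spec_unitary_one[OF U(2)])
  have SS: "op_eq_on J (S \<star>\<^bsub>J\<^esub> S) H"
  proof -
    have "S \<star>\<^bsub>J\<^esub> S = spec J U d"
      unfolding S_def spec_mult[OF U(1) fin(1)] by (intro spec_cong) (simp add: d abs_of_pos)
    then show ?thesis using op_eq_on_sym[OF Hd] by simp
  qed
  \<comment> \<open>\<open>E l\<close> is the pretty good measurement of the ensemble: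
    \<open>w' l\<close> multiplied from both sides by the inverse root of \<open>H\<close>. The
    factor \<open>F l\<close> is kept for Cauchy-Schwarz.\<close>
  define F where "F l = Si \<star>\<^bsub>J\<^esub> g l" for l
  define E where "E l = F l \<star>\<^bsub>J\<^esub> adj (F l)" for l
  have sumE: "(\<Sum>l\<in>L. E l) = spec J U (\<lambda>_. 1)"
  proof -
    have "op_eq_on J (\<Sum>l\<in>L. g l \<star>\<^bsub>J\<^esub> adj (g l)) H"
      unfolding H_def by (rule op_eq_on_sum) (rule op_eq_on_sym, rule g)
    then have "op_eq_on J (\<Sum>l\<in>L. g l \<star>\<^bsub>J\<^esub> adj (g l)) (S \<star>\<^bsub>J\<^esub> S)"
      by (rule op_eq_on_trans[OF _ op_eq_on_sym[OF SS]])
    from op_eq_on_conj[OF this, of Si]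
    have "adj Si \<star>\<^bsub>J\<^esub> (\<Sum>l\<in>L. g l \<star>\<^bsub>J\<^esub> adj (g l)) \<star>\<^bsub>J\<^esub> Si = (Si \<star>\<^bsub>J\<^esub> S) \<star>\<^bsub>J\<^esub> (S \<star>\<^bsub>J\<^esub> Si)"
      by (simp add: adjS)
    also have "\<dots> = spec J U (\<lambda>_. 1)"
      unfolding SSi spec_mult[OF U(1) fin(1)] by simp
    finally show ?thesis by (simp add: E_def F_def adjS mm_sum_left mm_sum_right)
  qed
  have SES: "op_eq_on J (S \<star>\<^bsub>J\<^esub> E l \<star>\<^bsub>J\<^esub> S) (w' l)" if l: "l \<in> L" for l
  proof -
    have eq: "S \<star>\<^bsub>J\<^esub> E l \<star>\<^bsub>J\<^esub> S = (S \<star>\<^bsub>J\<^esub> Si) \<star>\<^bsub>J\<^esub> (g l \<star>\<^bsub>J\<^esub> adj (g l)) \<star>\<^bsub>J\<^esub> (Si \<star>\<^bsub>J\<^esub> S)"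
      by (simp add: E_def F_def adjS)
    have "op_eq_on J (S \<star>\<^bsub>J\<^esub> E l \<star>\<^bsub>J\<^esub> S) ((g l \<star>\<^bsub>J\<^esub> adj (g l)) \<star>\<^bsub>J\<^esub> (Si \<star>\<^bsub>J\<^esub> S))"
      unfolding eq unfolding SSi by (rule op_eq_on_id_left[OF fin(1) one])
    moreover have "op_eq_on J ((g l \<star>\<^bsub>J\<^esub> adj (g l)) \<star>\<^bsub>J\<^esub> (Si \<star>\<^bsub>J\<^esub> S)) (g l \<star>\<^bsub>J\<^esub> adj (g l))"
      unfolding SSi by (rule op_eq_on_id_right[OF fin(1) one])
    ultimately show ?thesis by (rule op_eq_on_trans[OF _ op_eq_on_trans[OF _ op_eq_on_sym[OF g[OF l]]]])
  qed
  let ?om = "Phi \<star>\<^bsub>A\<^esub> adj Phi"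
  obtain V0 :: "'j op" and e where V0: "isom J J V0" "unitary_on J V0" and ome: "op_eq_on J ?om (spec J V0 e)"
      and e0: "\<And>k. k \<in> J \<Longrightarrow> e k \<ge> 0"
    by (rule psd_spectral[OF fin(1) psd_on_gram[of J Phi A]]) blast
  define So where "So = spec J V0 (\<lambda>k. sqrt (e k))"
  \<comment> \<open>Pseudo-inverse of the root \<open>So\<close>; with it \<open>V\<close> is the
    partial isometry in the polar decomposition of \<open>Phi\<close>.\<close>
  define Pinv where "Pinv = spec J V0 (\<lambda>k. if e k = 0 then 0 else 1 / sqrt (e k))"
  define Q where "Q = spec J V0 (\<lambda>k. if e k = 0 then 0 else 1)"
  define V where "V = Pinv \<star>\<^bsub>J\<^esub> Phi"
  have adjP: "adj Pinv = Pinv" "adj So = So" "adj Q = Q" by (simp_all add: Pinv_def So_def Q_def)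
  have SoSo: "So \<star>\<^bsub>J\<^esub> So = spec J V0 e"
    unfolding So_def spec_mult[OF V0(1) fin(1)] by (intro spec_cong) (use e0 in simp)
  have PhiV: "op_eq_on J (Phi \<star>\<^bsub>A\<^esub> adj V) So"
  proof -
    have "op_eq_on J (?om \<star>\<^bsub>J\<^esub> Pinv) (spec J V0 e \<star>\<^bsub>J\<^esub> Pinv)"
      by (intro op_eq_on_mm ome op_eq_on_refl)
    moreover have "spec J V0 e \<star>\<^bsub>J\<^esub> Pinv = So"
      unfolding So_def Pinv_def spec_mult[OF V0(1) fin(1)]
      by (intro spec_cong) (use e0 in \<open>auto simp: real_div_sqrt\<close>)
    ultimately show ?thesis by (simp add: V_def adjP)
  qed
  have VPhi: "op_eq_on J (V \<star>\<^bsub>A\<^esub> adj Phi) So"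
  proof -
    have "adj (Phi \<star>\<^bsub>A\<^esub> adj V) = V \<star>\<^bsub>A\<^esub> adj Phi" by simp
    moreover have "op_eq_on J (adj (Phi \<star>\<^bsub>A\<^esub> adj V)) (adj So)"
      using PhiV unfolding op_eq_on_def adj_def by simp
    ultimately show ?thesis by (simp add: adjP)
  qed
  have contrV: "contr J A V"
  proof (rule contr_of_mm_adj_projn)
    have "(\<lambda>k. (if e k = 0 then 0 else 1) * (if e k = 0 then 0 else 1)) = (\<lambda>k. if e k = 0 then 0 else (1::real))" by auto
    then show "projn J Q" by (simp add: projn_def Q_def spec_mult[OF V0(1) fin(1)])
    have "V \<star>\<^bsub>A\<^esub> adj V = adj Pinv \<star>\<^bsub>J\<^esub> ?om \<star>\<^bsub>J\<^esub> Pinv" by (simp add: V_def adjP)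
    also have "\<dots> = Pinv \<star>\<^bsub>J\<^esub> spec J V0 e \<star>\<^bsub>J\<^esub> Pinv"
      using op_eq_on_conj[OF ome, of Pinv] unfolding adjP .
    also have "\<dots> = Q"
      unfolding Pinv_def Q_def spec_mult[OF V0(1) fin(1)] by (intro spec_cong) (use e0 in \<open>force simp: real_div_sqrt\<close>)
    finally show "V \<star>\<^bsub>A\<^esub> adj V = Q" .
  qed
  \<comment> \<open>The defect \<open>op_id - adj V V\<close> completes the measurement and is given
    to \<open>l0\<close>. It is invisible from \<open>Phi\<close>: inserted between
    \<open>Phi\<close> and \<open>adj Phi\<close> it gives zero on \<open>J\<close>.\<close>
  define Om where "Om l = adj V \<star>\<^bsub>J\<^esub> E l \<star>\<^bsub>J\<^esub> V + (if l = l0 then op_id - adj V \<star>\<^bsub>J\<^esub> V else 0)" for l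
  have 1: "psd_on A (Om l)" for l
  proof -
    have "psd_on A (adj V \<star>\<^bsub>J\<^esub> E l \<star>\<^bsub>J\<^esub> V)" unfolding E_def by (intro psd_on_conj fin psd_on_gram)
    then show ?thesis using psd_on_add[OF _ psd_id_minus[OF fin(2) contrV]] by (auto simp: Om_def)
  qed
  have "(\<Sum>l\<in>L. Om l) = adj V \<star>\<^bsub>J\<^esub> (\<Sum>l\<in>L. E l) \<star>\<^bsub>J\<^esub> V + (op_id - adj V \<star>\<^bsub>J\<^esub> V)"
    using fin l0 unfolding Om_def sum.distrib by (simp add: mm_sum_left mm_sum_right)
  also have "adj V \<star>\<^bsub>J\<^esub> (\<Sum>l\<in>L. E l) \<star>\<^bsub>J\<^esub> V = adj V \<star>\<^bsub>J\<^esub> V"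
    unfolding sumE using op_eq_on_conj[OF one, of V] by (simp add: mm_op_id_mid fin)
  finally have 2: "op_eq_on A (\<Sum>l\<in>L. Om l) op_id" by (simp add: op_eq_on_def)
  have PhiOm: "op_eq_on J (Phi \<star>\<^bsub>A\<^esub> Om l \<star>\<^bsub>A\<^esub> adj Phi) (So \<star>\<^bsub>J\<^esub> E l \<star>\<^bsub>J\<^esub> So)" for l
  proof -
    have a: "op_eq_on J ((Phi \<star>\<^bsub>A\<^esub> adj V) \<star>\<^bsub>J\<^esub> E l \<star>\<^bsub>J\<^esub> (V \<star>\<^bsub>A\<^esub> adj Phi)) (So \<star>\<^bsub>J\<^esub> E l \<star>\<^bsub>J\<^esub> So)"
      by (intro op_eq_on_mm PhiV VPhi op_eq_on_refl)
    have "op_eq_on J (?om - (Phi \<star>\<^bsub>A\<^esub> adj V) \<star>\<^bsub>J\<^esub> (V \<star>\<^bsub>A\<^esub> adj Phi)) (spec J V0 e - So \<star>\<^bsub>J\<^esub> So)"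
      by (intro op_eq_on_mm op_eq_on_diff PhiV VPhi ome)
    then have b: "op_eq_on J (?om - (Phi \<star>\<^bsub>A\<^esub> adj V) \<star>\<^bsub>J\<^esub> (V \<star>\<^bsub>A\<^esub> adj Phi)) 0"
      by (simp add: SoSo)
    have eq: "Phi \<star>\<^bsub>A\<^esub> Om l \<star>\<^bsub>A\<^esub> adj Phi = (Phi \<star>\<^bsub>A\<^esub> adj V) \<star>\<^bsub>J\<^esub> E l \<star>\<^bsub>J\<^esub> (V \<star>\<^bsub>A\<^esub> adj Phi)
        + (if l = l0 then ?om - (Phi \<star>\<^bsub>A\<^esub> adj V) \<star>\<^bsub>J\<^esub> (V \<star>\<^bsub>A\<^esub> adj Phi) else 0)"
      unfolding Om_def by (simp add: mm_distrib mm_op_id_mid fin)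
    have "op_eq_on J (Phi \<star>\<^bsub>A\<^esub> Om l \<star>\<^bsub>A\<^esub> adj Phi) (So \<star>\<^bsub>J\<^esub> E l \<star>\<^bsub>J\<^esub> So + 0)"
      unfolding eq using b by (intro op_eq_on_add a) (auto simp: op_eq_on_refl)
    then show ?thesis by simp
  qed
  have 3: "cmod (\<Sum>l\<in>L. tr J (C l \<star>\<^bsub>J\<^esub> (Phi \<star>\<^bsub>A\<^esub> Om l \<star>\<^bsub>A\<^esub> adj Phi - w l))) \<le> 5 * sqrt \<theta>"
    if C: "\<And>l. l \<in> L \<Longrightarrow> contr J J (C l)" for C
  proof -
    let ?X = "So - S"
    have sumF: "(\<Sum>l\<in>L. hs J J (B \<star>\<^bsub>J\<^esub> F l)) = hs J J B" for B
    proof -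
      have "complex_of_real (\<Sum>l\<in>L. hs J J (B \<star>\<^bsub>J\<^esub> F l)) = (\<Sum>l\<in>L. tr J (B \<star>\<^bsub>J\<^esub> E l \<star>\<^bsub>J\<^esub> adj B))"
        unfolding of_real_sum hs_tr'[symmetric] by (simp add: E_def)
      also have "\<dots> = tr J (B \<star>\<^bsub>J\<^esub> (\<Sum>l\<in>L. E l) \<star>\<^bsub>J\<^esub> adj B)"
        by (simp add: tr_sum mm_sum_left mm_sum_right)
      also have "\<dots> = tr J (B \<star>\<^bsub>J\<^esub> adj B)"
        unfolding sumE by (intro op_eq_on_tr op_eq_on_mm op_eq_on_refl op_eq_on_id_left fin one)
      finally show ?thesis by (simp only: hs_tr' of_real_eq_iff)
    qed
    have sumF': "(\<Sum>l\<in>L. hs J J (adj (F l) \<star>\<^bsub>J\<^esub> B)) = hs J J B" for B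
    proof -
      have "hs J J (adj (F l) \<star>\<^bsub>J\<^esub> B) = hs J J (adj B \<star>\<^bsub>J\<^esub> F l)" for l
        by (subst hs_adj[symmetric]) simp
      then show ?thesis by (simp add: sumF)
    qed
    have hsSo: "hs J J So = 1"
    proof -
      have "complex_of_real (hs J J So) = tr J (So \<star>\<^bsub>J\<^esub> So)" by (simp add: hs_tr'[symmetric] adjP)
      also have "\<dots> = tr J ?om" unfolding SoSo by (rule op_eq_on_tr[OF op_eq_on_sym[OF ome]])
      also have "\<dots> = 1" by (simp add: hs_tr' tr1)
      finally show ?thesis by simp
    qed
    have tr_id: "tr J op_id = of_nat (card J)" by (simp add: op_trace_def op_id_def)
    have hsS: "hs J J S = 1 + \<eta> * card J"
    proof -
      have "complex_of_real (hs J J S) = tr J (S \<star>\<^bsub>J\<^esub> S)" by (simp add: hs_tr'[symmetric] adjS)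
      also have "\<dots> = tr J H" by (rule op_eq_on_tr[OF SS])
      also have "\<dots> = complex_of_real (1 + \<eta> * card J)" by (simp add: H tr_add tr_smul trw tr_id)
      finally show ?thesis by (simp only: of_real_eq_iff)
    qed
    have hs_id: "hs J J op_id = card J"
    proof -
      have "complex_of_real (hs J J op_id) = tr J (op_id \<star>\<^bsub>J\<^esub> op_id)"
        by (simp add: hs_tr'[symmetric])
      also have "\<dots> = of_nat (card J)" unfolding tr_id[symmetric] by (intro tr_cong mm_op_id_left fin)
      finally show ?thesis by (metis of_real_eq_iff of_real_of_nat_eq)
    qed
    have tr_eta: "cmod (tr J (D \<star>\<^bsub>J\<^esub> smul \<eta> op_id)) \<le> \<theta>" if "contr J J D" for D
    proof -
      have "tr J (D \<star>\<^bsub>J\<^esub> smul \<eta> op_id) = \<eta> * tr J (D \<star>\<^bsub>J\<^esub> op_id \<star>\<^bsub>J\<^esub> op_id)"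
        by (simp add: tr_smul) (intro disjI2 op_eq_on_tr op_eq_on_mm op_eq_on_refl op_eq_on_sym[OF op_eq_on_id_left] fin)
      moreover have "cmod (tr J (D \<star>\<^bsub>J\<^esub> op_id \<star>\<^bsub>J\<^esub> op_id)) \<le> card J"
        using contr_tr_bound[OF that, of op_id J op_id] by (simp add: hs_id)
      ultimately show ?thesis using \<eta> by (simp add: norm_mult mult_left_mono order_trans[OF mult_left_mono \<eta>(2)])
    qed
    \<comment> \<open>Powers--Stormer for the roots of \<open>?om\<close> and \<open>H\<close>: one
      \<open>\<theta>\<close> is the covering error, the other the admixture.\<close>
    have hsX: "hs J J ?X \<le> 2 * \<theta>"
    proof -
      have psdS: "psd_on J So" "psd_on J S"
        unfolding So_def S_def by (intro psd_on_spec; use e0 d in \<open>force intro: less_imp_le\<close>)+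
      obtain D where D: "contr J J D" "hs J J ?X \<le> cmod (tr J (D \<star>\<^bsub>J\<^esub> (So \<star>\<^bsub>J\<^esub> So - S \<star>\<^bsub>J\<^esub> S)))"
        by (rule Powers_Stormer[OF fin(1) psdS])
      have "op_eq_on J (So \<star>\<^bsub>J\<^esub> So - S \<star>\<^bsub>J\<^esub> S) (?om - H)"
        using SS op_eq_on_sym[OF ome] unfolding SoSo by (intro op_eq_on_diff)
      then have "tr J (D \<star>\<^bsub>J\<^esub> (So \<star>\<^bsub>J\<^esub> So - S \<star>\<^bsub>J\<^esub> S)) = tr J (D \<star>\<^bsub>J\<^esub> (?om - H))"
        by (intro op_eq_on_tr op_eq_on_mm op_eq_on_refl)
      also have "\<dots> = - tr J (D \<star>\<^bsub>J\<^esub> ((\<Sum>l\<in>L. w l) - ?om)) - tr J (D \<star>\<^bsub>J\<^esub> smul \<eta> op_id)"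
        unfolding H mm_diff_right mm_add_right tr_add tr_diff by (simp only: minus_diff_eq diff_diff_eq)
      also have "cmod \<dots> \<le> \<theta> + \<theta>"
        using cover[OF D(1)] tr_eta[OF D(1)] by (intro order_trans[OF norm_triangle_ineq4]) simp
      finally show ?thesis using D(2) by linarith
    qed
    \<comment> \<open>From So E So - S E S = (So - S) E So + S E (So - S): each term contains the
      small difference of the roots.\<close>
    have split: "tr J (C l \<star>\<^bsub>J\<^esub> (Phi \<star>\<^bsub>A\<^esub> Om l \<star>\<^bsub>A\<^esub> adj Phi - w l)) =
        tr J (C l \<star>\<^bsub>J\<^esub> (?X \<star>\<^bsub>J\<^esub> F l) \<star>\<^bsub>J\<^esub> (adj (F l) \<star>\<^bsub>J\<^esub> So)) + tr J (C l \<star>\<^bsub>J\<^esub> (S \<star>\<^bsub>J\<^esub> F l) \<star>\<^bsub>J\<^esub> (adj (F l) \<star>\<^bsub>J\<^esub> ?X))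
        + (if l = l0 then tr J (C l \<star>\<^bsub>J\<^esub> smul \<eta> op_id) else 0)" if l: "l \<in> L" for l
    proof -
      have "tr J (C l \<star>\<^bsub>J\<^esub> (Phi \<star>\<^bsub>A\<^esub> Om l \<star>\<^bsub>A\<^esub> adj Phi - w l)) =
          tr J (C l \<star>\<^bsub>J\<^esub> (Phi \<star>\<^bsub>A\<^esub> Om l \<star>\<^bsub>A\<^esub> adj Phi - w' l)) + tr J (C l \<star>\<^bsub>J\<^esub> (w' l - w l))"
        by (simp add: mm_diff_right tr_diff)
      also have "tr J (C l \<star>\<^bsub>J\<^esub> (w' l - w l)) = (if l = l0 then tr J (C l \<star>\<^bsub>J\<^esub> smul \<eta> op_id) else 0)"
      proof (cases "l = l0")
        case False
        then have "w' l - w l = 0" by (simp add: w'_def)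
        then show ?thesis using False by simp
      qed (simp add: w'_def)
      also have "tr J (C l \<star>\<^bsub>J\<^esub> (Phi \<star>\<^bsub>A\<^esub> Om l \<star>\<^bsub>A\<^esub> adj Phi - w' l)) = tr J (C l \<star>\<^bsub>J\<^esub> (So \<star>\<^bsub>J\<^esub> E l \<star>\<^bsub>J\<^esub> So - S \<star>\<^bsub>J\<^esub> E l \<star>\<^bsub>J\<^esub> S))"
        by (intro op_eq_on_tr op_eq_on_mm op_eq_on_diff op_eq_on_refl PhiOm op_eq_on_sym[OF SES] l)
      also have "So \<star>\<^bsub>J\<^esub> E l \<star>\<^bsub>J\<^esub> So - S \<star>\<^bsub>J\<^esub> E l \<star>\<^bsub>J\<^esub> S =
          (?X \<star>\<^bsub>J\<^esub> F l) \<star>\<^bsub>J\<^esub> (adj (F l) \<star>\<^bsub>J\<^esub> So) + (S \<star>\<^bsub>J\<^esub> F l) \<star>\<^bsub>J\<^esub> (adj (F l) \<star>\<^bsub>J\<^esub> ?X)"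
        by (simp add: E_def mm_distrib)
      finally show ?thesis by (simp only: mm_add_right tr_add mm_assoc)
    qed
    have "cmod (\<Sum>l\<in>L. tr J (C l \<star>\<^bsub>J\<^esub> (Phi \<star>\<^bsub>A\<^esub> Om l \<star>\<^bsub>A\<^esub> adj Phi - w l))) \<le>
        cmod (\<Sum>l\<in>L. tr J (C l \<star>\<^bsub>J\<^esub> (?X \<star>\<^bsub>J\<^esub> F l) \<star>\<^bsub>J\<^esub> (adj (F l) \<star>\<^bsub>J\<^esub> So)))
        + cmod (\<Sum>l\<in>L. tr J (C l \<star>\<^bsub>J\<^esub> (S \<star>\<^bsub>J\<^esub> F l) \<star>\<^bsub>J\<^esub> (adj (F l) \<star>\<^bsub>J\<^esub> ?X)))
        + cmod (tr J (C l0 \<star>\<^bsub>J\<^esub> smul \<eta> op_id))"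
    proof -
      have "(\<Sum>l\<in>L. tr J (C l \<star>\<^bsub>J\<^esub> (Phi \<star>\<^bsub>A\<^esub> Om l \<star>\<^bsub>A\<^esub> adj Phi - w l))) =
        (\<Sum>l\<in>L. tr J (C l \<star>\<^bsub>J\<^esub> (?X \<star>\<^bsub>J\<^esub> F l) \<star>\<^bsub>J\<^esub> (adj (F l) \<star>\<^bsub>J\<^esub> So)))
        + (\<Sum>l\<in>L. tr J (C l \<star>\<^bsub>J\<^esub> (S \<star>\<^bsub>J\<^esub> F l) \<star>\<^bsub>J\<^esub> (adj (F l) \<star>\<^bsub>J\<^esub> ?X)))
        + (\<Sum>l\<in>L. if l = l0 then tr J (C l \<star>\<^bsub>J\<^esub> smul \<eta> op_id) else 0)"
        unfolding sum.distrib[symmetric] by (intro sum.cong refl split)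
      also have "(\<Sum>l\<in>L. if l = l0 then tr J (C l \<star>\<^bsub>J\<^esub> smul \<eta> op_id) else 0) = tr J (C l0 \<star>\<^bsub>J\<^esub> smul \<eta> op_id)"
        using fin(3) l0 by (simp only: sum.delta if_True)
      finally show ?thesis
        by (simp only:) (rule order_trans[OF norm_triangle_ineq add_right_mono[OF norm_triangle_ineq]])
    qed
    also have "\<dots> \<le> sqrt (hs J J ?X) * sqrt (hs J J So) + sqrt (hs J J S) * sqrt (hs J J ?X) + \<theta>"
      using family_tr_bound[where L=L and I=J and C=C and A="\<lambda>l. ?X \<star>\<^bsub>J\<^esub> F l" and Z=J and B="\<lambda>l. adj (F l) \<star>\<^bsub>J\<^esub> So", OF C]
        family_tr_bound[where L=L and I=J and C=C and A="\<lambda>l. S \<star>\<^bsub>J\<^esub> F l" and Z=J and B="\<lambda>l. adj (F l) \<star>\<^bsub>J\<^esub> ?X", OF C]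
        tr_eta[OF C[OF l0]]
      unfolding sumF sumF' by (intro add_mono) simp_all
    also have "\<dots> \<le> sqrt (2 * \<theta>) * 1 + sqrt 2 * sqrt (2 * \<theta>) + sqrt \<theta>"
    proof -
      have "hs J J S \<le> 2" using \<eta>(2) th(2) unfolding hsS by linarith
      moreover have "\<theta> \<le> sqrt \<theta>" using th by (intro real_le_rsqrt) (simp add: power2_eq_square mult_left_le)
      ultimately show ?thesis using hsX th by (intro add_mono mult_mono) (auto simp: hsSo)
    qed
    \<comment> \<open>The first product contributes \<open>sqrt 2\<close>, the second 2, the
      admixture 1.\<close>
    also have "\<dots> = (sqrt 2 + 3) * sqrt \<theta>" by (simp add: real_sqrt_mult algebra_simps)
    also have "\<dots> \<le> 5 * sqrt \<theta>"
      using sqrt2_less_2 th by (intro mult_right_mono) auto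
    finally show ?thesis .
  qed
  from 1 2 3 show thesis by (rule that)
qed

subsection \<open>Trace distance of classical-quantum operators\<close>

text \<open>\<open>V l\<close> embeds \<open>J\<close> as the block of the classical symbol
  \<open>f l\<close>, and the optimal test of the whole operator is compressed to that block. Labels
  with the same symbol share a block and receive the same compressed test, so \<open>f\<close> may
  fail to be injective.\<close>

lemma cq_trace_norm:
  fixes f :: "'l \<Rightarrow> 'y" and D :: "'l \<Rightarrow> 'i op"
  assumes fin: "finite Y" "finite J" and herm: "\<And>l. l \<in> L \<Longrightarrow> hermitian_on J (D l)"
    and f: "\<And>l. l \<in> L \<Longrightarrow> f l \<in> Y"
  obtains C where "\<And>l. l \<in> L \<Longrightarrow> contr J J (C l)"
    "trace_norm (Y \<times> J) (\<lambda>(y, u) (y', u'). \<Sum>l\<in>L. if y = f l \<and> y' = f l then D l u u' else 0)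
      = Re (\<Sum>l\<in>L. tr J (C l \<star>\<^bsub>J\<^esub> D l))"
proof -
  let ?F = "\<lambda>(y, u) (y', u'). \<Sum>l\<in>L. if y = f l \<and> y' = f l then D l u u' else 0"
  define V :: "'l \<Rightarrow> 'y \<times> 'i \<Rightarrow> 'i \<Rightarrow> complex" where "V l = (\<lambda>(y, u) v. if y = f l \<and> u = v then 1 else 0)" for l
  have V: "isom (Y \<times> J) J (V l)" if "l \<in> L" for l
  proof -
    have "(adj (V l) \<star>\<^bsub>Y \<times> J\<^esub> V l) v v' = op_id v v'" if "v \<in> J" "v' \<in> J" for v v'
    proof -
      have "(adj (V l) \<star>\<^bsub>Y \<times> J\<^esub> V l) v v' = (\<Sum>z\<in>Y \<times> J. if z = (f l, v) then (if v = v' then 1 else 0) else 0)"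
        unfolding mm_def adj_def V_def by (intro sum.cong) (auto simp: case_prod_beta prod_eq_iff)
      also have "\<dots> = op_id v v'" using fin f[OF \<open>l \<in> L\<close>] that by (simp add: op_id_def)
      finally show ?thesis .
    qed
    then show ?thesis by (simp add: isom_def op_eq_on_def)
  qed
  have VDV: "(V l \<star>\<^bsub>J\<^esub> D l \<star>\<^bsub>J\<^esub> adj (V l)) (y,u) (y',u') = (if y = f l \<and> y' = f l then D l u u' else 0)"
    if "u \<in> J" "u' \<in> J" for l y u y' u'
  proof -
    have "(V l \<star>\<^bsub>J\<^esub> D l \<star>\<^bsub>J\<^esub> adj (V l)) (y,u) (y',u')
       = (\<Sum>v\<in>J. \<Sum>v'\<in>J. V l (y,u) v * D l v v' * cnj (V l (y',u') v'))"
      by (simp add: mm_def adj_def sum_distrib_left mult.assoc)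
    also have "\<dots> = (\<Sum>v\<in>J. if v = u then (\<Sum>v'\<in>J. if v' = u' then (if y = f l \<and> y' = f l then D l v v' else 0) else 0) else 0)"
      by (intro sum.cong refl) (auto simp: V_def intro!: sum.cong sum.neutral[symmetric] cong: if_cong)
    also have "\<dots> = (if y = f l \<and> y' = f l then D l u u' else 0)"
      using fin that by simp
    finally show ?thesis .
  qed
  have F: "op_eq_on (Y \<times> J) ?F (\<Sum>l\<in>L. V l \<star>\<^bsub>J\<^esub> D l \<star>\<^bsub>J\<^esub> adj (V l))"
    using VDV by (auto simp: op_eq_on_def sum_fun_apply)
  have "hermitian_on (Y \<times> J) ?F"
    unfolding hermitian_on_def
  proof (intro ballI)
    fix a b assume ab: "a \<in> Y \<times> J" "b \<in> Y \<times> J"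
    obtain y u y' u' where [simp]: "a = (y,u)" "b = (y',u')" by fastforce
    have uJ: "u \<in> J" "u' \<in> J" using ab by auto
    have "D l u u' = cnj (D l u' u)" if "l \<in> L" for l
      using herm[OF that] uJ unfolding hermitian_on_def by blast
    then have "?F (y,u) (y',u') = (\<Sum>l\<in>L. cnj (if y' = f l \<and> y = f l then D l u' u else 0))"
      by (auto intro!: sum.cong)
    then show "?F a b = cnj (?F b a)" by simp
  qed
  with fin obtain C where C: "contr (Y \<times> J) (Y \<times> J) C" "trace_norm (Y \<times> J) ?F = Re (tr (Y \<times> J) (C \<star>\<^bsub>Y \<times> J\<^esub> ?F))"
    using trace_norm_hermitian[of "Y \<times> J" ?F] by blast
  have "tr (Y \<times> J) (C \<star>\<^bsub>Y \<times> J\<^esub> ?F) = tr (Y \<times> J) (C \<star>\<^bsub>Y \<times> J\<^esub> (\<Sum>l\<in>L. V l \<star>\<^bsub>J\<^esub> D l \<star>\<^bsub>J\<^esub> adj (V l)))"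
    by (intro op_eq_on_tr op_eq_on_mm op_eq_on_refl F)
  also have "\<dots> = (\<Sum>l\<in>L. tr (Y \<times> J) ((C \<star>\<^bsub>Y \<times> J\<^esub> V l \<star>\<^bsub>J\<^esub> D l) \<star>\<^bsub>J\<^esub> adj (V l)))"
    by (simp add: mm_sum_right tr_sum)
  also have "\<dots> = (\<Sum>l\<in>L. tr J ((adj (V l) \<star>\<^bsub>Y \<times> J\<^esub> C \<star>\<^bsub>Y \<times> J\<^esub> V l) \<star>\<^bsub>J\<^esub> D l))"
    by (subst tr_mm_commute) simp
  finally have "trace_norm (Y \<times> J) ?F = Re (\<Sum>l\<in>L. tr J ((adj (V l) \<star>\<^bsub>Y \<times> J\<^esub> C \<star>\<^bsub>Y \<times> J\<^esub> V l) \<star>\<^bsub>J\<^esub> D l))"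
    using C(2) by simp
  moreover have "contr J J (adj (V l) \<star>\<^bsub>Y \<times> J\<^esub> C \<star>\<^bsub>Y \<times> J\<^esub> V l)" if "l \<in> L" for l
    by (intro contr_mm[of J "Y \<times> J"] contr_mm[of "Y \<times> J" "Y \<times> J" C] contr_adj contr_isom V that fin C(1))
  ultimately show thesis by (rule that[rotated])
qed

subsection \<open>Comparing two mixtures\<close>

text \<open>Jensen's inequality for the square root, as an instance of Cauchy-Schwarz.\<close>

lemma weighted_sqrt_le:
  fixes q :: "'x \<Rightarrow> real"
  assumes "\<And>x. x \<in> X \<Longrightarrow> q x \<ge> 0" "(\<Sum>x\<in>X. q x) \<le> 1" "\<And>x. x \<in> X \<Longrightarrow> a x \<ge> 0"
  shows "(\<Sum>x\<in>X. q x * sqrt (a x)) \<le> sqrt (\<Sum>x\<in>X. q x * a x)"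
proof -
  have "(\<Sum>x\<in>X. q x * sqrt (a x)) = (\<Sum>x\<in>X. sqrt (q x) * sqrt (q x * a x))"
    using assms by (intro sum.cong) (auto simp: real_sqrt_mult)
  also have "\<dots> \<le> sqrt (\<Sum>x\<in>X. q x) * sqrt (\<Sum>x\<in>X. q x * a x)"
    using assms by (intro sum_sqrt_mult_le) auto
  also have "\<dots> \<le> 1 * sqrt (\<Sum>x\<in>X. q x * a x)"
    using assms by (intro mult_right_mono) (auto intro!: sum_nonneg)
  finally show ?thesis by simp
qed

text \<open>Meant for \<open>p\<close> the i.i.d. distribution and \<open>q\<close> the empirical
  distribution of a code. Each state is projected by \<open>P\<close> at the price of gentle
  measurement and stripped of its large eigenvalues (\<open>H\<close>). Only for the rest
  \<open>T\<close> is the difference of the mixtures estimated as a whole, so that a variance bound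
  can be applied to it.\<close>

lemma mixture_distance:
  fixes G :: "'x \<Rightarrow> 'i \<Rightarrow> 'z \<Rightarrow> complex" and H :: "'x \<Rightarrow> 'i \<Rightarrow> 'y \<Rightarrow> complex" and p q :: "'x \<Rightarrow> real"
  assumes fin: "finite J" "finite Zg" and u: "isom J Zg u"
    and p: "\<And>x. x \<in> X \<Longrightarrow> p x \<ge> 0" "(\<Sum>x\<in>X. p x) = 1"
    and q: "\<And>x. x \<in> X \<Longrightarrow> q x \<ge> 0" "(\<Sum>x\<in>X. q x) = 1"
    and hsG: "\<And>x. x \<in> X \<Longrightarrow> hs J Z (G x) = 1"
    and split: "\<And>x. x \<in> X \<Longrightarrow> op_eq_on J (G x \<star>\<^bsub>Z\<^esub> adj (G x)) (T x + H x \<star>\<^bsub>Y\<^esub> adj (H x))"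
    and C: "contr J J C"
  defines "P \<equiv> u \<star>\<^bsub>Zg\<^esub> adj u"
  shows "cmod (tr J (C \<star>\<^bsub>J\<^esub> (\<Sum>x\<in>X. smul (q x - p x) (G x \<star>\<^bsub>Z\<^esub> adj (G x))))) \<le>
     2 * sqrt (\<Sum>x\<in>X. q x * hs J Z (G x - P \<star>\<^bsub>J\<^esub> G x)) + 2 * sqrt (\<Sum>x\<in>X. p x * hs J Z (G x - P \<star>\<^bsub>J\<^esub> G x))
     + (\<Sum>x\<in>X. q x * hs J Y (H x)) + (\<Sum>x\<in>X. p x * hs J Y (H x))
     + sqrt (card Zg * hs Zg Zg (\<Sum>x\<in>X. smul (q x - p x) (adj u \<star>\<^bsub>J\<^esub> T x \<star>\<^bsub>J\<^esub> u)))"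
proof -
  have P: "projn J P" "adj P = P" "contr J J P"
    unfolding P_def using projn_isom[OF u fin(2)] by (auto simp: projn_def intro: contr_projn projn_isom u fin)
  let ?W = "\<lambda>x. G x \<star>\<^bsub>Z\<^esub> adj (G x)"
  define A where "A x = tr J (C \<star>\<^bsub>J\<^esub> (?W x - P \<star>\<^bsub>J\<^esub> G x \<star>\<^bsub>Z\<^esub> adj (G x) \<star>\<^bsub>J\<^esub> adj P))" for x
  define B where "B x = tr J (C \<star>\<^bsub>J\<^esub> (P \<star>\<^bsub>J\<^esub> H x) \<star>\<^bsub>Y\<^esub> adj (P \<star>\<^bsub>J\<^esub> H x))" for x
  define K where "K x = tr J (C \<star>\<^bsub>J\<^esub> P \<star>\<^bsub>J\<^esub> T x \<star>\<^bsub>J\<^esub> P)" for x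
  have dec: "tr J (C \<star>\<^bsub>J\<^esub> ?W x) = A x + B x + K x" if x: "x \<in> X" for x
  proof -
    have "P \<star>\<^bsub>J\<^esub> G x \<star>\<^bsub>Z\<^esub> adj (G x) \<star>\<^bsub>J\<^esub> adj P = adj P \<star>\<^bsub>J\<^esub> ?W x \<star>\<^bsub>J\<^esub> P" by (simp add: P)
    also have "\<dots> = adj P \<star>\<^bsub>J\<^esub> (T x + H x \<star>\<^bsub>Y\<^esub> adj (H x)) \<star>\<^bsub>J\<^esub> P"
      by (rule op_eq_on_conj[OF split[OF x]])
    also have "\<dots> = P \<star>\<^bsub>J\<^esub> T x \<star>\<^bsub>J\<^esub> P + (P \<star>\<^bsub>J\<^esub> H x) \<star>\<^bsub>Y\<^esub> adj (P \<star>\<^bsub>J\<^esub> H x)"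
      by (simp add: mm_distrib P)
    finally show ?thesis
      unfolding A_def B_def K_def mm_diff_right tr_diff by (simp only: mm_add_right tr_add) simp
  qed
  have Abound: "cmod (\<Sum>x\<in>X. r x * A x) \<le> 2 * sqrt (\<Sum>x\<in>X. r x * hs J Z (G x - P \<star>\<^bsub>J\<^esub> G x))"
    if r: "\<And>x. x \<in> X \<Longrightarrow> r x \<ge> 0" "(\<Sum>x\<in>X. r x) = 1" for r :: "'x \<Rightarrow> real"
  proof -
    have "cmod (\<Sum>x\<in>X. r x * A x) \<le> (\<Sum>x\<in>X. r x * (2 * sqrt (hs J Z (G x - P \<star>\<^bsub>J\<^esub> G x))))"
    proof (intro order_trans[OF norm_sum] sum_mono)
      fix x assume x: "x \<in> X"
      have "cmod (A x) \<le> 2 * sqrt (hs J Z (G x - P \<star>\<^bsub>J\<^esub> G x))"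
        using gentle_measurement[OF C P(3), of "G x" Z] hsG[OF x] by (simp add: A_def)
      then show "cmod (r x * A x) \<le> r x * (2 * sqrt (hs J Z (G x - P \<star>\<^bsub>J\<^esub> G x)))"
        using r(1)[OF x] by (simp add: norm_mult mult_left_mono)
    qed
    also have "\<dots> = 2 * (\<Sum>x\<in>X. r x * sqrt (hs J Z (G x - P \<star>\<^bsub>J\<^esub> G x)))"
      by (simp add: sum_distrib_left mult_ac)
    also have "\<dots> \<le> 2 * sqrt (\<Sum>x\<in>X. r x * hs J Z (G x - P \<star>\<^bsub>J\<^esub> G x))"
      using r by (intro mult_left_mono weighted_sqrt_le) auto
    finally show ?thesis .
  qed
  have Bbound: "cmod (\<Sum>x\<in>X. r x * B x) \<le> (\<Sum>x\<in>X. r x * hs J Y (H x))"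
    if r: "\<And>x. x \<in> X \<Longrightarrow> r x \<ge> 0" for r :: "'x \<Rightarrow> real"
  proof (intro order_trans[OF norm_sum] sum_mono)
    fix x assume x: "x \<in> X"
    have "cmod (B x) \<le> hs J Y (H x)"
      unfolding B_def by (intro order_trans[OF contr_tr_gram[OF C]] hs_projn_le P)
    then show "cmod (r x * B x) \<le> r x * hs J Y (H x)"
      using r[OF x] by (simp add: norm_mult mult_left_mono)
  qed
  let ?D = "\<Sum>x\<in>X. smul (q x - p x) (adj u \<star>\<^bsub>J\<^esub> T x \<star>\<^bsub>J\<^esub> u)"
  \<comment> \<open>A trace norm is at most the root of the rank times the Hilbert-Schmidt norm;
    compression by \<open>u\<close> makes the rank at most \<open>card Zg\<close>.\<close>
  have Kbound: "cmod (\<Sum>x\<in>X. complex_of_real (q x - p x) * K x) \<le> sqrt (card Zg * hs Zg Zg ?D)"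
  proof -
    have K: "K x = tr Zg ((adj u \<star>\<^bsub>J\<^esub> C \<star>\<^bsub>J\<^esub> u) \<star>\<^bsub>Zg\<^esub> (adj u \<star>\<^bsub>J\<^esub> T x \<star>\<^bsub>J\<^esub> u))" for x
    proof -
      have "K x = tr J ((C \<star>\<^bsub>J\<^esub> u \<star>\<^bsub>Zg\<^esub> adj u \<star>\<^bsub>J\<^esub> T x \<star>\<^bsub>J\<^esub> u) \<star>\<^bsub>Zg\<^esub> adj u)"
        by (simp add: K_def P_def)
      then show ?thesis by (subst (asm) tr_mm_commute) simp
    qed
    have "(\<Sum>x\<in>X. complex_of_real (q x - p x) * K x) = tr Zg ((adj u \<star>\<^bsub>J\<^esub> C \<star>\<^bsub>J\<^esub> u) \<star>\<^bsub>Zg\<^esub> ?D)"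
      unfolding K mm_sum_right tr_sum mm_smul_right tr_smul ..
    then have cs: "cmod (\<Sum>x\<in>X. complex_of_real (q x - p x) * K x)
        \<le> sqrt (hs Zg Zg (adj u \<star>\<^bsub>J\<^esub> C \<star>\<^bsub>J\<^esub> u)) * sqrt (hs Zg Zg ?D)"
      by (simp only: Cauchy_Schwarz_tr)
    have "hs Zg Zg (adj u \<star>\<^bsub>J\<^esub> C \<star>\<^bsub>J\<^esub> u) \<le> hs J Zg (C \<star>\<^bsub>J\<^esub> u)"
      by (intro hs_contr contr_adj contr_isom u fin)
    also have "\<dots> \<le> hs J Zg u" by (rule hs_contr[OF C])
    also have "\<dots> = card Zg" by (rule hs_self_isom[OF u fin(2)])
    finally have "sqrt (hs Zg Zg (adj u \<star>\<^bsub>J\<^esub> C \<star>\<^bsub>J\<^esub> u)) * sqrt (hs Zg Zg ?D) \<le> sqrt (card Zg) * sqrt (hs Zg Zg ?D)"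
      by (intro mult_right_mono real_sqrt_le_mono) simp_all
    with cs show ?thesis unfolding real_sqrt_mult by (rule order_trans)
  qed
  have "tr J (C \<star>\<^bsub>J\<^esub> (\<Sum>x\<in>X. smul (q x - p x) (?W x))) = (\<Sum>x\<in>X. complex_of_real (q x - p x) * (A x + B x + K x))"
    unfolding mm_sum_right tr_sum mm_smul_right tr_smul by (intro sum.cong refl) (simp only: dec)
  also have "\<dots> = (\<Sum>x\<in>X. q x * A x) - (\<Sum>x\<in>X. p x * A x) + ((\<Sum>x\<in>X. q x * B x) - (\<Sum>x\<in>X. p x * B x))
      + (\<Sum>x\<in>X. complex_of_real (q x - p x) * K x)"
    unfolding sum_subtractf[symmetric] sum.distrib[symmetric] by (intro sum.cong refl) (simp add: algebra_simps)
  finally have eq: "tr J (C \<star>\<^bsub>J\<^esub> (\<Sum>x\<in>X. smul (q x - p x) (?W x))) = (\<Sum>x\<in>X. q x * A x) - (\<Sum>x\<in>X. p x * A x) + ((\<Sum>x\<in>X. q x * B x) - (\<Sum>x\<in>X. p x * B x))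
      + (\<Sum>x\<in>X. complex_of_real (q x - p x) * K x)" .
  have "cmod (tr J (C \<star>\<^bsub>J\<^esub> (\<Sum>x\<in>X. smul (q x - p x) (?W x)))) \<le> 2 * sqrt (\<Sum>x\<in>X. q x * hs J Z (G x - P \<star>\<^bsub>J\<^esub> G x)) + 2 * sqrt (\<Sum>x\<in>X. p x * hs J Z (G x - P \<star>\<^bsub>J\<^esub> G x))
     + ((\<Sum>x\<in>X. q x * hs J Y (H x)) + (\<Sum>x\<in>X. p x * hs J Y (H x))) + sqrt (card Zg * hs Zg Zg ?D)"
    unfolding eq by (intro norm_triangle_mono norm_triangle_le_diff add_mono Abound Bbound Kbound p q)
  then show ?thesis by (simp only: add.assoc)
qed

subsection \<open>The error of an encoder followed by decoders\<close>

text \<open>Tests of the decoder's output are tests of its input, so the encoding error carries over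
  unchanged as \<open>e\<close>. Decoding the right codeword disturbs the states by
  \<open>2 * sqrt p\<close>, and the weight of the wrong outcomes adds \<open>p\<close>.\<close>

lemma decoding_error:
  fixes G :: "'m \<Rightarrow> 'k \<Rightarrow> 'i \<Rightarrow> 'z \<Rightarrow> complex" and S :: "'m \<Rightarrow> 'k \<Rightarrow> 'i op" and T :: "'m \<Rightarrow> 'i op"
  assumes fin: "finite J" "finite Ms" "finite Ks"
    and adjS: "\<And>m k. m \<in> Ms \<Longrightarrow> k \<in> Ks \<Longrightarrow> adj (S m k) = S m k"
    and contrS: "\<And>m k. m \<in> Ms \<Longrightarrow> k \<in> Ks \<Longrightarrow> contr J J (S m k)"
    and gent: "\<And>m k. m \<in> Ms \<Longrightarrow> k \<in> Ks \<Longrightarrow> hs J Z (G m k - S m k \<star>\<^bsub>J\<^esub> G m k) \<le> 1 - hs J Z (S m k \<star>\<^bsub>J\<^esub> G m k)"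
    and compl: "\<And>m. m \<in> Ms \<Longrightarrow> op_eq_on J (\<Sum>k\<in>Ks. S m k \<star>\<^bsub>J\<^esub> S m k) op_id"
    and hsG: "\<And>m k. m \<in> Ms \<Longrightarrow> k \<in> Ks \<Longrightarrow> hs J Z (G m k) = 1"
    and c: "c \<ge> 0" "c * (real (card Ms) * real (card Ks)) = 1"
    and enc: "\<And>C. (\<And>m. m \<in> Ms \<Longrightarrow> contr J J (C m)) \<Longrightarrow>
       cmod (\<Sum>m\<in>Ms. tr J (C m \<star>\<^bsub>J\<^esub> (T m - (\<Sum>k\<in>Ks. smul (complex_of_real c) (G m k \<star>\<^bsub>Z\<^esub> adj (G m k)))))) \<le> e"
    and C: "\<And>m k. m \<in> Ms \<Longrightarrow> k \<in> Ks \<Longrightarrow> contr J J (C m k)"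
  defines "p \<equiv> c * (\<Sum>m\<in>Ms. \<Sum>k\<in>Ks. 1 - hs J Z (S m k \<star>\<^bsub>J\<^esub> G m k))"
  shows "cmod (\<Sum>m\<in>Ms. \<Sum>k\<in>Ks. tr J (C m k \<star>\<^bsub>J\<^esub> (S m k \<star>\<^bsub>J\<^esub> T m \<star>\<^bsub>J\<^esub> S m k - smul (complex_of_real c) (G m k \<star>\<^bsub>Z\<^esub> adj (G m k)))))
     \<le> e + 2 * sqrt p + p"
proof -
  have cplx: "(\<Sum>k\<in>Ks. hs J Y (S m k \<star>\<^bsub>J\<^esub> M)) = hs J Y M" if m: "m \<in> Ms" for m Y and M :: "'i \<Rightarrow> 'w \<Rightarrow> complex"
  proof -
    have "complex_of_real (\<Sum>k\<in>Ks. hs J Y (S m k \<star>\<^bsub>J\<^esub> M)) = (\<Sum>k\<in>Ks. tr Y (adj M \<star>\<^bsub>J\<^esub> (S m k \<star>\<^bsub>J\<^esub> S m k) \<star>\<^bsub>J\<^esub> M))"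
      unfolding of_real_sum hs_tr[symmetric] by (intro sum.cong refl) (simp add: adjS m)
    also have "\<dots> = tr Y (adj M \<star>\<^bsub>J\<^esub> (\<Sum>k\<in>Ks. S m k \<star>\<^bsub>J\<^esub> S m k) \<star>\<^bsub>J\<^esub> M)"
      by (simp add: mm_sum_left mm_sum_right tr_sum)
    also have "\<dots> = tr Y (adj M \<star>\<^bsub>J\<^esub> op_id \<star>\<^bsub>J\<^esub> M)"
      unfolding op_eq_on_conj[OF compl[OF m]] ..
    also have "\<dots> = complex_of_real (hs J Y M)" by (simp only: mm_op_id_mid fin hs_tr)
    finally show ?thesis by (simp only: of_real_eq_iff)
  qed
  let ?W = "\<lambda>m k. G m k \<star>\<^bsub>Z\<^esub> adj (G m k)"
  let ?R = "\<lambda>m. T m - (\<Sum>k\<in>Ks. smul (complex_of_real c) (?W m k))"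
  define pe where "pe m k = 1 - hs J Z (S m k \<star>\<^bsub>J\<^esub> G m k)" for m k
  have pe0: "pe m k \<ge> 0" if "m \<in> Ms" "k \<in> Ks" for m k
    using order_trans[OF hs_nonneg gent[OF that]] by (simp add: pe_def)
  have p_pe: "p = (\<Sum>m\<in>Ms. \<Sum>k\<in>Ks. c * pe m k)" by (simp add: p_def pe_def sum_distrib_left)
  \<comment> \<open>The tests as seen before the decoder acts (Heisenberg picture); completeness of
    the measurement keeps the combination a contraction.\<close>
  define CS where "CS m = (\<Sum>k\<in>Ks. S m k \<star>\<^bsub>J\<^esub> C m k \<star>\<^bsub>J\<^esub> S m k)" for m
  have contrCS: "contr J J (CS m)" if m: "m \<in> Ms" for m
  proof (rule contr_bilinearI)
    fix u v :: "'i \<Rightarrow> unit \<Rightarrow> complex"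
    have "cmod (tr UNIV (adj u \<star>\<^bsub>J\<^esub> CS m \<star>\<^bsub>J\<^esub> v)) \<le> (\<Sum>k\<in>Ks. cmod (tr UNIV (adj (S m k \<star>\<^bsub>J\<^esub> u) \<star>\<^bsub>J\<^esub> C m k \<star>\<^bsub>J\<^esub> S m k \<star>\<^bsub>J\<^esub> v)))"
      unfolding CS_def mm_sum_left mm_sum_right tr_sum
      by (intro order_trans[OF norm_sum] sum_mono) (simp add: adjS m)
    also have "\<dots> \<le> (\<Sum>k\<in>Ks. sqrt (hs J UNIV (S m k \<star>\<^bsub>J\<^esub> u)) * sqrt (hs J UNIV (S m k \<star>\<^bsub>J\<^esub> v)))"
    proof (intro sum_mono)
      fix k assume k: "k \<in> Ks"
      have "cmod (tr UNIV (adj (S m k \<star>\<^bsub>J\<^esub> u) \<star>\<^bsub>J\<^esub> C m k \<star>\<^bsub>J\<^esub> S m k \<star>\<^bsub>J\<^esub> v))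
          \<le> sqrt (hs UNIV J (adj (S m k \<star>\<^bsub>J\<^esub> u))) * sqrt (hs J UNIV (C m k \<star>\<^bsub>J\<^esub> S m k \<star>\<^bsub>J\<^esub> v))"
        by (rule Cauchy_Schwarz_tr)
      also have "\<dots> \<le> sqrt (hs UNIV J (adj (S m k \<star>\<^bsub>J\<^esub> u))) * sqrt (hs J UNIV (S m k \<star>\<^bsub>J\<^esub> v))"
        by (intro mult_left_mono real_sqrt_le_mono hs_contr C m k) simp
      finally show "cmod (tr UNIV (adj (S m k \<star>\<^bsub>J\<^esub> u) \<star>\<^bsub>J\<^esub> C m k \<star>\<^bsub>J\<^esub> S m k \<star>\<^bsub>J\<^esub> v))
          \<le> sqrt (hs J UNIV (S m k \<star>\<^bsub>J\<^esub> u)) * sqrt (hs J UNIV (S m k \<star>\<^bsub>J\<^esub> v))"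
        unfolding hs_adj .
    qed
    also have "\<dots> \<le> sqrt (\<Sum>k\<in>Ks. hs J UNIV (S m k \<star>\<^bsub>J\<^esub> u)) * sqrt (\<Sum>k\<in>Ks. hs J UNIV (S m k \<star>\<^bsub>J\<^esub> v))"
      by (intro sum_sqrt_mult_le) auto
    finally show "cmod (tr UNIV (adj u \<star>\<^bsub>J\<^esub> CS m \<star>\<^bsub>J\<^esub> v)) \<le> sqrt (hs J UNIV u) * sqrt (hs J UNIV v)"
      unfolding cplx[OF m] .
  qed
  have trCS: "(\<Sum>k\<in>Ks. tr J (C m k \<star>\<^bsub>J\<^esub> S m k \<star>\<^bsub>J\<^esub> M \<star>\<^bsub>J\<^esub> S m k)) = tr J (CS m \<star>\<^bsub>J\<^esub> M)" for m M
  proof -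
    have "tr J (C m k \<star>\<^bsub>J\<^esub> S m k \<star>\<^bsub>J\<^esub> M \<star>\<^bsub>J\<^esub> S m k) = tr J ((S m k \<star>\<^bsub>J\<^esub> C m k \<star>\<^bsub>J\<^esub> S m k) \<star>\<^bsub>J\<^esub> M)" for k
      using tr_mm_commute[of J "C m k \<star>\<^bsub>J\<^esub> S m k \<star>\<^bsub>J\<^esub> M" J "S m k"] by simp
    then show ?thesis by (simp add: CS_def mm_sum_left tr_sum)
  qed
  \<comment> \<open>The ideal state of bin \<open>m\<close> is a mixture of all its codewords. On
    outcome \<open>k\<close> the codeword \<open>k' = k\<close> gives the disturbance term and the
    codewords \<open>k' \<noteq> k\<close> give the cross terms.\<close>
  have main: "(\<Sum>k\<in>Ks. tr J (C m k \<star>\<^bsub>J\<^esub> (S m k \<star>\<^bsub>J\<^esub> T m \<star>\<^bsub>J\<^esub> S m k - smul (complex_of_real c) (?W m k)))) =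
      tr J (CS m \<star>\<^bsub>J\<^esub> ?R m)
      - c * (\<Sum>k\<in>Ks. tr J (C m k \<star>\<^bsub>J\<^esub> (?W m k - S m k \<star>\<^bsub>J\<^esub> G m k \<star>\<^bsub>Z\<^esub> adj (G m k) \<star>\<^bsub>J\<^esub> adj (S m k))))
      + c * (\<Sum>k\<in>Ks. \<Sum>k'\<in>Ks - {k}. tr J (C m k \<star>\<^bsub>J\<^esub> S m k \<star>\<^bsub>J\<^esub> ?W m k' \<star>\<^bsub>J\<^esub> S m k))" if m: "m \<in> Ms" for m
  proof -
    define a where "a k k' = tr J (C m k \<star>\<^bsub>J\<^esub> S m k \<star>\<^bsub>J\<^esub> ?W m k' \<star>\<^bsub>J\<^esub> S m k)" for k k'
    define b where "b k = tr J (C m k \<star>\<^bsub>J\<^esub> ?W m k)" for k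
    have "tr J (CS m \<star>\<^bsub>J\<^esub> ?R m) = tr J (CS m \<star>\<^bsub>J\<^esub> T m) - (\<Sum>k'\<in>Ks. c * tr J (CS m \<star>\<^bsub>J\<^esub> ?W m k'))"
      by (simp only: mm_diff_right mm_sum_right tr_diff tr_sum mm_smul_right tr_smul)
    also have "\<dots> = (\<Sum>k\<in>Ks. tr J (C m k \<star>\<^bsub>J\<^esub> S m k \<star>\<^bsub>J\<^esub> T m \<star>\<^bsub>J\<^esub> S m k)) - c * (\<Sum>k'\<in>Ks. \<Sum>k\<in>Ks. a k k')"
      unfolding trCS[symmetric] a_def sum_distrib_left[symmetric] ..
    also have "(\<Sum>k'\<in>Ks. \<Sum>k\<in>Ks. a k k') = (\<Sum>k\<in>Ks. \<Sum>k'\<in>Ks. a k k')" by (rule sum.swap)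
    also have "\<dots> = (\<Sum>k\<in>Ks. a k k + (\<Sum>k'\<in>Ks - {k}. a k k'))"
      by (intro sum.cong refl sum.remove fin)
    also have "\<dots> = (\<Sum>k\<in>Ks. a k k) + (\<Sum>k\<in>Ks. \<Sum>k'\<in>Ks - {k}. a k k')" by (rule sum.distrib)
    finally have R: "tr J (CS m \<star>\<^bsub>J\<^esub> ?R m) = (\<Sum>k\<in>Ks. tr J (C m k \<star>\<^bsub>J\<^esub> S m k \<star>\<^bsub>J\<^esub> T m \<star>\<^bsub>J\<^esub> S m k))
        - c * ((\<Sum>k\<in>Ks. a k k) + (\<Sum>k\<in>Ks. \<Sum>k'\<in>Ks - {k}. a k k'))" .
    have L: "(\<Sum>k\<in>Ks. tr J (C m k \<star>\<^bsub>J\<^esub> (S m k \<star>\<^bsub>J\<^esub> T m \<star>\<^bsub>J\<^esub> S m k - smul (complex_of_real c) (?W m k))))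
       = (\<Sum>k\<in>Ks. tr J (C m k \<star>\<^bsub>J\<^esub> S m k \<star>\<^bsub>J\<^esub> T m \<star>\<^bsub>J\<^esub> S m k)) - c * (\<Sum>k\<in>Ks. b k)"
      by (simp only: mm_diff_right tr_diff mm_smul_right tr_smul sum_subtractf sum_distrib_left b_def)
    have M: "(\<Sum>k\<in>Ks. tr J (C m k \<star>\<^bsub>J\<^esub> (?W m k - S m k \<star>\<^bsub>J\<^esub> G m k \<star>\<^bsub>Z\<^esub> adj (G m k) \<star>\<^bsub>J\<^esub> adj (S m k))))
       = (\<Sum>k\<in>Ks. b k) - (\<Sum>k\<in>Ks. a k k)"
      unfolding sum_subtractf[symmetric]
      by (intro sum.cong refl) (simp only: mm_diff_right tr_diff a_def b_def adjS[OF m] mm_assoc)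
    show ?thesis unfolding R L M a_def[symmetric] by (simp add: algebra_simps)
  qed
  have gentle: "cmod (tr J (C m k \<star>\<^bsub>J\<^esub> (?W m k - S m k \<star>\<^bsub>J\<^esub> G m k \<star>\<^bsub>Z\<^esub> adj (G m k) \<star>\<^bsub>J\<^esub> adj (S m k)))) \<le> 2 * sqrt (pe m k)"
    if mk: "m \<in> Ms" "k \<in> Ks" for m k
  proof -
    have "cmod (tr J (C m k \<star>\<^bsub>J\<^esub> (?W m k - S m k \<star>\<^bsub>J\<^esub> G m k \<star>\<^bsub>Z\<^esub> adj (G m k) \<star>\<^bsub>J\<^esub> adj (S m k))))
        \<le> 2 * (sqrt (hs J Z (G m k - S m k \<star>\<^bsub>J\<^esub> G m k)) * sqrt (hs J Z (G m k)))"
      by (intro gentle_measurement C contrS mk)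
    also have "\<dots> \<le> 2 * sqrt (pe m k)" using gent[OF mk] by (simp add: hsG[OF mk] pe_def)
    finally show ?thesis .
  qed
  \<comment> \<open>By completeness, the weights with which a codeword is taken for some other one
    add up to its error probability.\<close>
  have cross: "cmod (\<Sum>k\<in>Ks. \<Sum>k'\<in>Ks - {k}. tr J (C m k \<star>\<^bsub>J\<^esub> S m k \<star>\<^bsub>J\<^esub> ?W m k' \<star>\<^bsub>J\<^esub> S m k)) \<le> (\<Sum>k\<in>Ks. pe m k)"
    if m: "m \<in> Ms" for m
  proof -
    have "cmod (\<Sum>k\<in>Ks. \<Sum>k'\<in>Ks - {k}. tr J (C m k \<star>\<^bsub>J\<^esub> S m k \<star>\<^bsub>J\<^esub> ?W m k' \<star>\<^bsub>J\<^esub> S m k))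
        \<le> (\<Sum>k\<in>Ks. \<Sum>k'\<in>Ks - {k}. hs J Z (S m k \<star>\<^bsub>J\<^esub> G m k'))"
    proof (intro order_trans[OF norm_sum] sum_mono)
      fix k k' assume "k \<in> Ks" "k' \<in> Ks - {k}"
      then show "cmod (tr J (C m k \<star>\<^bsub>J\<^esub> S m k \<star>\<^bsub>J\<^esub> ?W m k' \<star>\<^bsub>J\<^esub> S m k)) \<le> hs J Z (S m k \<star>\<^bsub>J\<^esub> G m k')"
        using contr_tr_gram[OF C[OF m], of k "S m k \<star>\<^bsub>J\<^esub> G m k'" Z] by (simp add: adjS m)
    qed
    also have "\<dots> = (\<Sum>k\<in>Ks. (\<Sum>k'\<in>Ks. hs J Z (S m k \<star>\<^bsub>J\<^esub> G m k')) - hs J Z (S m k \<star>\<^bsub>J\<^esub> G m k))"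
      by (intro sum.cong refl) (simp add: sum_diff1 fin)
    also have "\<dots> = (\<Sum>k'\<in>Ks. \<Sum>k\<in>Ks. hs J Z (S m k \<star>\<^bsub>J\<^esub> G m k')) - (\<Sum>k\<in>Ks. hs J Z (S m k \<star>\<^bsub>J\<^esub> G m k))"
      by (subst sum.swap) (rule sum_subtractf)
    also have "\<dots> = (\<Sum>k\<in>Ks. pe m k)"
      unfolding cplx[OF m] by (simp add: hsG m pe_def sum_subtractf)
    finally show ?thesis .
  qed
  have sum1: "(\<Sum>m\<in>Ms. \<Sum>k\<in>Ks. c * (2 * sqrt (pe m k))) \<le> 2 * sqrt p"
  proof -
    have "(\<Sum>m\<in>Ms. \<Sum>k\<in>Ks. c * (2 * sqrt (pe m k))) = 2 * (\<Sum>l\<in>Ms \<times> Ks. c * sqrt (pe (fst l) (snd l)))"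
      by (simp add: sum.cartesian_product case_prod_beta sum_distrib_left mult_ac)
    also have "\<dots> \<le> 2 * sqrt (\<Sum>l\<in>Ms \<times> Ks. c * pe (fst l) (snd l))"
      using c pe0 by (intro mult_left_mono weighted_sqrt_le) (auto simp: card_cartesian_product mult.commute)
    also have "\<dots> = 2 * sqrt p" by (simp add: p_pe sum.cartesian_product case_prod_beta)
    finally show ?thesis .
  qed
  have "cmod (\<Sum>m\<in>Ms. \<Sum>k\<in>Ks. tr J (C m k \<star>\<^bsub>J\<^esub> (S m k \<star>\<^bsub>J\<^esub> T m \<star>\<^bsub>J\<^esub> S m k - smul (complex_of_real c) (?W m k))))
     = cmod ((\<Sum>m\<in>Ms. tr J (CS m \<star>\<^bsub>J\<^esub> ?R m))
      - (\<Sum>m\<in>Ms. c * (\<Sum>k\<in>Ks. tr J (C m k \<star>\<^bsub>J\<^esub> (?W m k - S m k \<star>\<^bsub>J\<^esub> G m k \<star>\<^bsub>Z\<^esub> adj (G m k) \<star>\<^bsub>J\<^esub> adj (S m k)))))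
      + (\<Sum>m\<in>Ms. c * (\<Sum>k\<in>Ks. \<Sum>k'\<in>Ks - {k}. tr J (C m k \<star>\<^bsub>J\<^esub> S m k \<star>\<^bsub>J\<^esub> ?W m k' \<star>\<^bsub>J\<^esub> S m k))))"
    unfolding sum_subtractf[symmetric] sum.distrib[symmetric] by (intro arg_cong[where f=cmod] sum.cong refl main)
  also have "\<dots> \<le> e + (\<Sum>m\<in>Ms. \<Sum>k\<in>Ks. c * (2 * sqrt (pe m k))) + (\<Sum>m\<in>Ms. c * (\<Sum>k\<in>Ks. pe m k))"
  proof (intro norm_triangle_mono norm_triangle_le_diff add_mono enc contrCS)
    show "cmod (\<Sum>m\<in>Ms. c * (\<Sum>k\<in>Ks. tr J (C m k \<star>\<^bsub>J\<^esub> (?W m k - S m k \<star>\<^bsub>J\<^esub> G m k \<star>\<^bsub>Z\<^esub> adj (G m k) \<star>\<^bsub>J\<^esub> adj (S m k)))))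
       \<le> (\<Sum>m\<in>Ms. \<Sum>k\<in>Ks. c * (2 * sqrt (pe m k)))"
      unfolding sum_distrib_left
      by (intro order_trans[OF norm_sum] sum_mono) (simp add: norm_mult c mult_left_mono gentle)
    show "cmod (\<Sum>m\<in>Ms. c * (\<Sum>k\<in>Ks. \<Sum>k'\<in>Ks - {k}. tr J (C m k \<star>\<^bsub>J\<^esub> S m k \<star>\<^bsub>J\<^esub> ?W m k' \<star>\<^bsub>J\<^esub> S m k)))
       \<le> (\<Sum>m\<in>Ms. c * (\<Sum>k\<in>Ks. pe m k))"
      by (intro order_trans[OF norm_sum] sum_mono) (simp only: norm_mult norm_of_real abs_of_nonneg c mult_left_mono cross)
  qed
  also have "(\<Sum>m\<in>Ms. c * (\<Sum>k\<in>Ks. pe m k)) = p" by (simp add: p_pe sum_distrib_left)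
  finally show ?thesis using sum1 by linarith
qed

subsection \<open>Operators acting on the second tensor factor\<close>

text \<open>The operator \<open>S\<close> on B tensored with the identity on R.\<close>

definition amp :: "('b \<Rightarrow> 'b \<Rightarrow> complex) \<Rightarrow> 'r \<times> 'b \<Rightarrow> 'r \<times> 'b \<Rightarrow> complex" where
  "amp S = (\<lambda>(r, b) (r', b'). if r = r' then S b b' else 0)"

text \<open>Moves R from the rows to the columns. The Gram matrix of the result is the partial trace
  over R, and an operator on B acts on it by plain left multiplication.\<close>

definition red :: "('r \<times> 'b \<Rightarrow> 'z \<Rightarrow> complex) \<Rightarrow> 'b \<Rightarrow> 'r \<times> 'z \<Rightarrow> complex" where
  "red M = (\<lambda>b (r, z). M (r, b) z)"

lemma hs_red: "hs JB (JR \<times> Z) (red M) = hs (JR \<times> JB) Z M"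
proof -
  have "hs JB (JR \<times> Z) (red M) = (\<Sum>b\<in>JB. \<Sum>r\<in>JR. \<Sum>z\<in>Z. (cmod (M (r, b) z))\<^sup>2)"
    by (simp add: hs_def red_def case_prod_beta sum.cartesian_product)
  also have "\<dots> = (\<Sum>r\<in>JR. \<Sum>b\<in>JB. \<Sum>z\<in>Z. (cmod (M (r, b) z))\<^sup>2)" by (rule sum.swap)
  also have "\<dots> = (\<Sum>(r, b)\<in>JR \<times> JB. \<Sum>z\<in>Z. (cmod (M (r, b) z))\<^sup>2)" by (rule sum.cartesian_product)
  also have "\<dots> = hs (JR \<times> JB) Z M" by (simp add: hs_def case_prod_beta)
  finally show ?thesis .
qed

lemma amp_mm:
  assumes "finite JR" "r \<in> JR"
  shows "(amp S \<star>\<^bsub>JR \<times> JB\<^esub> M) (r, b) j = (\<Sum>b'\<in>JB. S b b' * M (r, b') j)"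
proof -
  have "(amp S \<star>\<^bsub>JR \<times> JB\<^esub> M) (r, b) j = (\<Sum>r'\<in>JR. \<Sum>b'\<in>JB. if r' = r then S b b' * M (r, b') j else 0)"
    unfolding mm_def amp_def by (subst sum.cartesian_product) (auto intro!: sum.cong)
  also have "\<dots> = (\<Sum>r'\<in>JR. if r' = r then (\<Sum>b'\<in>JB. S b b' * M (r, b') j) else 0)"
    by (intro sum.cong) auto
  also have "\<dots> = (\<Sum>b'\<in>JB. S b b' * M (r, b') j)" using assms by simp
  finally show ?thesis .
qed

lemma hs_amp_mm:
  assumes "finite JR"
  shows "hs (JR \<times> JB) Z (amp S \<star>\<^bsub>JR \<times> JB\<^esub> M) = hs JB (JR \<times> Z) (S \<star>\<^bsub>JB\<^esub> red M)"
  unfolding hs_red[symmetric]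
  by (rule hs_cong) (auto simp: red_def amp_mm assms mm_def[of S])

lemma hs_diff_amp_mm:
  assumes "finite JR"
  shows "hs (JR \<times> JB) Z (M - amp S \<star>\<^bsub>JR \<times> JB\<^esub> M) = hs JB (JR \<times> Z) (red M - S \<star>\<^bsub>JB\<^esub> red M)"
  unfolding hs_red[symmetric]
  by (rule hs_cong) (auto simp: red_def amp_mm assms mm_def[of S])

lemma contr_amp: "finite JR \<Longrightarrow> contr JB JB S \<Longrightarrow> contr (JR \<times> JB) (JR \<times> JB) (amp S)"
  unfolding contr_def[of "JR \<times> JB"] by (simp add: hs_amp_mm) (metis hs_contr hs_red)

lemma adj_amp [simp]: "adj (amp S) = amp (adj S)"
  by (auto simp: amp_def adj_def fun_eq_iff)

lemma amp_amp:
  assumes "finite JR"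
  shows "op_eq_on (JR \<times> JB) (amp S \<star>\<^bsub>JR \<times> JB\<^esub> amp T) (amp (S \<star>\<^bsub>JB\<^esub> T))"
  using assms by (auto simp: op_eq_on_def amp_mm) (auto simp: amp_def mm_def)

lemma amp_cong: "op_eq_on JB S T \<Longrightarrow> op_eq_on (JR \<times> JB) (amp S) (amp T)"
  by (auto simp: op_eq_on_def amp_def)

lemma amp_op_id: "amp op_id = op_id"
  by (auto simp: amp_def op_id_def fun_eq_iff)

lemma amp_sum: "amp (\<Sum>l\<in>L. F l) = (\<Sum>l\<in>L. amp (F l))"
  by (auto simp: amp_def fun_eq_iff sum_fun_apply)

subsection \<open>Square roots of measurement operators\<close>

text \<open>The last claim is the operator form of (1 - sqrt d)^2 \<le> 1 - d for eigenvalues d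
  between 0 and 1: the disturbance is at most the loss of weight.\<close>

lemma povm_sqrt:
  fixes \<Lambda> :: "nat \<Rightarrow> 'i op"
  assumes fin: "finite I" "finite M" and povm: "povm_on I M \<Lambda>" and k: "k \<in> M"
  shows "op_eq_on I (psd_sqrt I (\<Lambda> k) \<star>\<^bsub>I\<^esub> psd_sqrt I (\<Lambda> k)) (\<Lambda> k)"
    "adj (psd_sqrt I (\<Lambda> k)) = psd_sqrt I (\<Lambda> k)"
    "contr I I (psd_sqrt I (\<Lambda> k))"
    "\<And>G (Z :: 'z set). hs I Z (G - psd_sqrt I (\<Lambda> k) \<star>\<^bsub>I\<^esub> G) \<le> hs I Z G - hs I Z (psd_sqrt I (\<Lambda> k) \<star>\<^bsub>I\<^esub> G)"
proof -
  have psd: "psd_on I (\<Lambda> j)" if "j \<in> M" for j using povm that by (simp add: povm_on_def)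
  have sum: "op_eq_on I (\<Sum>j\<in>M. \<Lambda> j) op_id"
    using povm by (simp add: povm_on_def op_eq_on_def sum_fun_apply)
  obtain U :: "'i op" and d where U: "isom I I U" and \<Lambda>: "op_eq_on I (\<Lambda> k) (spec I U d)"
      and d: "\<And>k. k \<in> I \<Longrightarrow> d k \<ge> 0"
    by (rule psd_spectral[OF fin(1) psd[OF k]]) blast
  \<comment> \<open>\<open>\<Lambda> k\<close> is dominated by the sum of all outcomes, which is the
    identity.\<close>
  have d1: "d i \<le> 1" if i: "i \<in> I" for i
  proof -
    let ?q = "\<lambda>j. (adj U \<star>\<^bsub>I\<^esub> \<Lambda> j \<star>\<^bsub>I\<^esub> U) i i"
    have "d i = Re (?q k)"
      using spec_diag[OF U fin(1) i, of d] op_eq_on_conj[OF \<Lambda>, of U] by simp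
    also have "\<dots> \<le> (\<Sum>j\<in>M. Re (?q j))"
      using psd_diag_nonneg(2)[OF psd] fin k by (intro member_le_sum) auto
    also have "\<dots> = Re ((adj U \<star>\<^bsub>I\<^esub> (\<Sum>j\<in>M. \<Lambda> j) \<star>\<^bsub>I\<^esub> U) i i)"
      by (simp add: mm_sum_left mm_sum_right sum_fun_apply)
    also have "\<dots> = Re ((adj U \<star>\<^bsub>I\<^esub> U) i i)"
      unfolding op_eq_on_conj[OF sum] mm_op_id_mid[OF fin(1)] ..
    also have "\<dots> = 1" using U i by (simp add: isom_def op_eq_on_def op_id_def)
    finally show ?thesis .
  qed
  \<comment> \<open>\<open>?R\<close> is the root of \<open>?S\<close>; it turns the inner product
    of \<open>G\<close> with \<open>?S G\<close> into the squared norm of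
    \<open>?R G\<close>.\<close>
  let ?S = "spec I U (\<lambda>i. sqrt (d i))" and ?R = "spec I U (\<lambda>i. sqrt (sqrt (d i)))"
  have S: "op_eq_on I (psd_sqrt I (\<Lambda> k)) ?S" by (rule psd_sqrt_spec[OF fin(1) \<Lambda> U fin(1) d])
  have SS: "?S \<star>\<^bsub>I\<^esub> ?S = spec I U d"
    unfolding spec_mult[OF U fin(1)] by (intro spec_cong) (use d in simp)
  have RR: "?R \<star>\<^bsub>I\<^esub> ?R = ?S"
    unfolding spec_mult[OF U fin(1)] by (intro spec_cong) (use d in simp)
  show "op_eq_on I (psd_sqrt I (\<Lambda> k) \<star>\<^bsub>I\<^esub> psd_sqrt I (\<Lambda> k)) (\<Lambda> k)"
    using op_eq_on_mm[OF S S] unfolding SS by (rule op_eq_on_trans[OF _ op_eq_on_sym[OF \<Lambda>]])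
  have Sc: "contr I I ?S" using d d1 by (intro contr_spec U fin) auto
  then show "contr I I (psd_sqrt I (\<Lambda> k))"
    using contr_cong[of I I "psd_sqrt I (\<Lambda> k)" ?S] S by (simp add: op_eq_on_def)
  have full: "psd_sqrt I (\<Lambda> k) = (\<lambda>i j. if i \<in> I \<and> j \<in> I then ?S i j else 0)"
  proof (rule psd_sqrt_eqI[OF fin(1)])
    show "psd_on I ?S" using d by (intro psd_on_spec) simp
    show "op_eq_on I (?S \<star>\<^bsub>I\<^esub> ?S) (\<Lambda> k)" unfolding SS by (rule op_eq_on_sym[OF \<Lambda>])
  qed
  have "cnj (?S i j) = ?S j i" for i j using adj_spec[of I U "\<lambda>i. sqrt (d i)"] by (metis adj_def)
  then show "adj (psd_sqrt I (\<Lambda> k)) = psd_sqrt I (\<Lambda> k)"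
    unfolding full adj_def by (auto simp: fun_eq_iff)
  fix G :: "'i \<Rightarrow> 'z \<Rightarrow> complex" and Z :: "'z set"
  have eqG: "(psd_sqrt I (\<Lambda> k) \<star>\<^bsub>I\<^esub> G) i z = (?S \<star>\<^bsub>I\<^esub> G) i z" if "i \<in> I" for i z
    using S that by (intro mm_cong) (auto simp: op_eq_on_def)
  have e1: "complex_of_real (hs I Z (G - ?S \<star>\<^bsub>I\<^esub> G)) = complex_of_real (hs I Z G) - 2 * tr Z (adj G \<star>\<^bsub>I\<^esub> ?S \<star>\<^bsub>I\<^esub> G)
      + complex_of_real (hs I Z (?S \<star>\<^bsub>I\<^esub> G))"
    unfolding hs_tr[symmetric] by (simp only: adj_diff adj_mm adj_spec mm_distrib tr_diff mm_assoc) simp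
  have e2: "tr Z (adj G \<star>\<^bsub>I\<^esub> ?S \<star>\<^bsub>I\<^esub> G) = complex_of_real (hs I Z (?R \<star>\<^bsub>I\<^esub> G))"
    unfolding hs_tr[symmetric] RR[symmetric] by simp
  have "complex_of_real (hs I Z (G - ?S \<star>\<^bsub>I\<^esub> G))
      = complex_of_real (hs I Z G - 2 * hs I Z (?R \<star>\<^bsub>I\<^esub> G) + hs I Z (?S \<star>\<^bsub>I\<^esub> G))"
    by (simp only: e1 e2 of_real_add of_real_diff of_real_mult of_real_numeral)
  then have "hs I Z (G - ?S \<star>\<^bsub>I\<^esub> G) = hs I Z G - 2 * hs I Z (?R \<star>\<^bsub>I\<^esub> G) + hs I Z (?S \<star>\<^bsub>I\<^esub> G)"
    by (simp only: of_real_eq_iff)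
  moreover have "hs I Z (?S \<star>\<^bsub>I\<^esub> G) \<le> hs I Z (?R \<star>\<^bsub>I\<^esub> G)"
  proof -
    have "contr I I ?R" using d d1 by (intro contr_spec U fin) auto
    from hs_contr[OF this, of Z "?R \<star>\<^bsub>I\<^esub> G"] show ?thesis unfolding RR[symmetric] by simp
  qed
  moreover have "hs I Z (G - psd_sqrt I (\<Lambda> k) \<star>\<^bsub>I\<^esub> G) = hs I Z (G - ?S \<star>\<^bsub>I\<^esub> G)"
    "hs I Z (psd_sqrt I (\<Lambda> k) \<star>\<^bsub>I\<^esub> G) = hs I Z (?S \<star>\<^bsub>I\<^esub> G)"
    using eqG by (auto intro!: hs_cong)
  ultimately show "hs I Z (G - psd_sqrt I (\<Lambda> k) \<star>\<^bsub>I\<^esub> G) \<le> hs I Z G - hs I Z (psd_sqrt I (\<Lambda> k) \<star>\<^bsub>I\<^esub> G)"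
    by linarith
qed

subsection \<open>Random codes\<close>

text \<open>Independence of the codewords, expressed as distributivity of a product over
  sums.\<close>

lemma code_sum_prod:
  fixes p :: "'x \<Rightarrow> 'c::comm_semiring_1"
  assumes "finite L" "finite X"
  shows "(\<Sum>c\<in>PiE L (\<lambda>_. X). (\<Prod>l\<in>L. p (c l)) * (\<Prod>l\<in>L. h l (c l))) = (\<Prod>l\<in>L. \<Sum>x\<in>X. p x * h l x)"
  by (subst prod_sum_PiE) (auto simp: assms prod.distrib)

context
  fixes L :: "'l set" and X :: "'x set" and p :: "'x \<Rightarrow> real"
  assumes fin: "finite L" "finite X" and p0: "\<forall>x\<in>X. p x \<ge> 0" and p1: "(\<Sum>x\<in>X. p x) = 1"
begin

abbreviation codes :: "('l \<Rightarrow> 'x) set" where "codes \<equiv> PiE L (\<lambda>_. X)"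

definition code_wt :: "('l \<Rightarrow> 'x) \<Rightarrow> real" where "code_wt c = (\<Prod>l\<in>L. p (c l))"

lemma finite_codes: "finite codes" using fin by (intro finite_PiE) auto

lemma code_wt_nonneg: "c \<in> codes \<Longrightarrow> code_wt c \<ge> 0"
  unfolding code_wt_def by (intro prod_nonneg) (use p0 in \<open>auto dest: PiE_mem\<close>)

lemma code_wt_sum: "(\<Sum>c\<in>codes. code_wt c) = 1"
  using code_sum_prod[OF fin, of p "\<lambda>_ _. 1"] by (simp add: code_wt_def p1)

lemma code_marginal:
  assumes l: "l \<in> L"
  shows "(\<Sum>c\<in>codes. code_wt c * f (c l)) = (\<Sum>x\<in>X. p x * f x)"
proof -
  have "(\<Sum>c\<in>codes. code_wt c * f (c l)) = (\<Sum>c\<in>codes. code_wt c * (\<Prod>i\<in>L. if i = l then f (c i) else 1))"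
    using fin l by (simp add: prod.delta)
  also have "\<dots> = (\<Prod>i\<in>L. \<Sum>x\<in>X. p x * (if i = l then f x else 1))"
    unfolding code_wt_def using code_sum_prod[OF fin, of p "\<lambda>i x. if i = l then f x else 1"] by simp
  also have "\<dots> = (\<Prod>i\<in>L. if i = l then (\<Sum>x\<in>X. p x * f x) else 1)"
    by (intro prod.cong) (auto simp: p1)
  also have "\<dots> = (\<Sum>x\<in>X. p x * f x)" using fin l by (simp add: prod.delta)
  finally show ?thesis .
qed

text \<open>\<open>f (c l) (c l')\<close> is not a product over positions. Summing over the value
  \<open>x\<close> of \<open>c l\<close> with an indicator makes it one, and independence applies to
  each summand.\<close>

lemma code_pair_marginal:
  assumes l: "l \<in> L" "l' \<in> L" "l \<noteq> l'"
  shows "(\<Sum>c\<in>codes. code_wt c * f (c l) (c l')) = (\<Sum>x\<in>X. \<Sum>y\<in>X. p x * p y * f x y)"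
proof -
  let ?h = "\<lambda>x i y. if i = l then (if y = x then 1 else 0) else if i = l' then f x y else 1"
  have "code_wt c * f (c l) (c l') = (\<Sum>x\<in>X. code_wt c * (\<Prod>i\<in>L. ?h x i (c i)))" if c: "c \<in> codes" for c
  proof -
    have prod: "(\<Prod>i\<in>L. ?h x i (c i)) = (if c l = x then f x (c l') else 0)" for x
    proof -
      have "(\<Prod>i\<in>L. ?h x i (c i)) = ?h x l (c l) * (?h x l' (c l') * (\<Prod>i\<in>L - {l} - {l'}. ?h x i (c i)))"
        using fin l by (subst prod.remove[of L l]) (auto simp: prod.remove[of "L - {l}" l'])
      also have "(\<Prod>i\<in>L - {l} - {l'}. ?h x i (c i)) = 1" by (intro prod.neutral) auto
      finally show ?thesis using l by simp
    qed
    have "c l \<in> X" using c l by (auto dest: PiE_mem)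
    then show ?thesis unfolding prod using fin by (simp add: if_distrib[of "\<lambda>x. _ * x"] cong: if_cong)
  qed
  then have "(\<Sum>c\<in>codes. code_wt c * f (c l) (c l')) = (\<Sum>x\<in>X. \<Sum>c\<in>codes. code_wt c * (\<Prod>i\<in>L. ?h x i (c i)))"
    by (subst sum.swap) simp
  also have "\<dots> = (\<Sum>x\<in>X. \<Prod>i\<in>L. \<Sum>y\<in>X. p y * ?h x i y)"
    unfolding code_wt_def using code_sum_prod[OF fin, of p "?h _"] by simp
  also have "\<dots> = (\<Sum>x\<in>X. p x * (\<Sum>y\<in>X. p y * f x y))"
  proof (intro sum.cong refl)
    fix x assume x: "x \<in> X"
    have "(\<Prod>i\<in>L. \<Sum>y\<in>X. p y * ?h x i y) = (\<Sum>y\<in>X. p y * ?h x l y) * ((\<Sum>y\<in>X. p y * ?h x l' y)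
        * (\<Prod>i\<in>L - {l} - {l'}. \<Sum>y\<in>X. p y * ?h x i y))"
      using fin l by (subst prod.remove[of L l]) (auto simp: prod.remove[of "L - {l}" l'])
    also have "(\<Prod>i\<in>L - {l} - {l'}. \<Sum>y\<in>X. p y * ?h x i y) = 1" by (intro prod.neutral) (auto simp: p1)
    also have "(\<Sum>y\<in>X. p y * ?h x l y) = p x"
      using fin x by (simp add: if_distrib[of "\<lambda>x. _ * x"] cong: if_cong)
    finally show "(\<Prod>i\<in>L. \<Sum>y\<in>X. p y * ?h x i y) = p x * (\<Sum>y\<in>X. p y * f x y)" using l by simp
  qed
  finally show ?thesis by (simp add: sum_distrib_left mult.assoc)
qed

text \<open>Empirical distribution of a code, repeated codewords counted with multiplicity. It turns
  a uniform sum over the code into a weighted sum over \<open>X\<close> that is comparable with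
  \<open>p\<close>.\<close>

definition emp :: "('l \<Rightarrow> 'x) \<Rightarrow> 'x \<Rightarrow> real" where
  "emp c x = (\<Sum>l\<in>L. if c l = x then 1 else 0) / real (card L)"

lemma emp_nonneg: "emp c x \<ge> 0"
  by (simp add: emp_def sum_nonneg)

lemma emp_sum:
  assumes "c \<in> codes"
  shows "(\<Sum>x\<in>X. emp c x * f x) = (\<Sum>l\<in>L. f (c l)) / real (card L)"
proof -
  have "(\<Sum>x\<in>X. emp c x * f x) = (\<Sum>x\<in>X. \<Sum>l\<in>L. if c l = x then f x else 0) / real (card L)"
    by (simp add: emp_def sum_divide_distrib sum_distrib_right sum_distrib_left if_distrib[of "\<lambda>y. y * _"] if_distrib[of "\<lambda>y. y / _"] cong: if_cong)
  also have "(\<Sum>x\<in>X. \<Sum>l\<in>L. if c l = x then f x else 0) = (\<Sum>l\<in>L. \<Sum>x\<in>X. if c l = x then f x else 0)"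
    by (rule sum.swap)
  also have "\<dots> = (\<Sum>l\<in>L. f (c l))" using fin assms by (intro sum.cong) (auto simp: PiE_iff)
  finally show ?thesis .
qed

lemma emp_sum_op:
  assumes "c \<in> codes"
  shows "(\<Sum>x\<in>X. smul (complex_of_real (emp c x)) (F x)) = (\<Sum>l\<in>L. smul (complex_of_real (1 / real (card L))) (F (c l)))"
proof (intro ext)
  fix i j
  have "(\<Sum>x\<in>X. complex_of_real (emp c x) * F x i j) = (\<Sum>x\<in>X. \<Sum>l\<in>L. if c l = x then complex_of_real (1 / real (card L)) * F x i j else 0)"
  proof (intro sum.cong refl)
    fix x
    have "complex_of_real (emp c x) = (\<Sum>l\<in>L. if c l = x then complex_of_real (1 / real (card L)) else 0)"
      unfolding emp_def sum_divide_distrib of_real_sum by (intro sum.cong) auto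
    then show "complex_of_real (emp c x) * F x i j = (\<Sum>l\<in>L. if c l = x then complex_of_real (1 / real (card L)) * F x i j else 0)"
      by (simp only: sum_distrib_right) (intro sum.cong, auto)
  qed
  also have "\<dots> = (\<Sum>l\<in>L. \<Sum>x\<in>X. if c l = x then complex_of_real (1 / real (card L)) * F x i j else 0)"
    by (rule sum.swap)
  also have "\<dots> = (\<Sum>l\<in>L. complex_of_real (1 / real (card L)) * F (c l) i j)"
    using fin assms by (intro sum.cong) (auto simp: PiE_iff)
  finally show "(\<Sum>x\<in>X. smul (complex_of_real (emp c x)) (F x)) i j
      = (\<Sum>l\<in>L. smul (complex_of_real (1 / real (card L))) (F (c l))) i j"
    by (simp add: sum_fun_apply)
qed

lemma code_emp_mean:
  assumes "L \<noteq> {}"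
  shows "(\<Sum>c\<in>codes. code_wt c * (\<Sum>x\<in>X. emp c x * f x)) = (\<Sum>x\<in>X. p x * f x)"
proof -
  have "(\<Sum>c\<in>codes. code_wt c * (\<Sum>x\<in>X. emp c x * f x)) = (\<Sum>c\<in>codes. \<Sum>l\<in>L. code_wt c * f (c l)) / real (card L)"
    by (simp add: emp_sum sum_divide_distrib sum_distrib_left)
  also have "(\<Sum>c\<in>codes. \<Sum>l\<in>L. code_wt c * f (c l)) = (\<Sum>l\<in>L. \<Sum>c\<in>codes. code_wt c * f (c l))" by (rule sum.swap)
  also have "\<dots> = real (card L) * (\<Sum>x\<in>X. p x * f x)" by (simp add: code_marginal)
  finally show ?thesis using assms fin by simp
qed

text \<open>Codewords are pairwise independent, so after centering the mixed terms vanish and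
  \<open>card L\<close> equal variances remain; each is at most the second moment.\<close>

lemma code_variance:
  fixes y :: "'x \<Rightarrow> complex"
  assumes ne: "L \<noteq> {}"
  shows "(\<Sum>c\<in>codes. code_wt c * (cmod (\<Sum>x\<in>X. complex_of_real (emp c x - p x) * y x))\<^sup>2)
     \<le> (\<Sum>x\<in>X. p x * (cmod (y x))\<^sup>2) / real (card L)"
proof -
  let ?N = "real (card L)"
  have N: "?N > 0" using ne fin by (simp add: card_gt_0_iff)
  define m where "m = (\<Sum>x\<in>X. complex_of_real (p x) * y x)"
  define z where "z x = y x - m" for x
  have zm: "(\<Sum>x\<in>X. complex_of_real (p x) * z x) = 0"
  proof -
    have "(\<Sum>x\<in>X. complex_of_real (p x)) = 1" using p1 by (metis of_real_1 of_real_sum)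
    then show ?thesis
      by (simp add: z_def right_diff_distrib sum_subtractf flip: sum_distrib_right) (simp add: m_def)
  qed
  have rep: "(\<Sum>x\<in>X. complex_of_real (emp c x - p x) * y x) = (\<Sum>l\<in>L. z (c l)) / ?N" if c: "c \<in> codes" for c
  proof -
    have "(\<Sum>x\<in>X. complex_of_real (emp c x - p x) * y x) = (\<Sum>x\<in>X. smul (complex_of_real (emp c x)) (\<lambda>_ _. y x)) () () - m"
      by (simp add: sum_fun_apply left_diff_distrib sum_subtractf m_def)
    also have "(\<Sum>x\<in>X. smul (complex_of_real (emp c x)) (\<lambda>_ _. y x)) () () = (\<Sum>l\<in>L. y (c l)) / ?N"
      unfolding emp_sum_op[OF c] by (simp add: sum_fun_apply sum_divide_distrib)
    also have "\<dots> - m = (\<Sum>l\<in>L. z (c l)) / ?N"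
      using N by (simp add: z_def sum_subtractf diff_divide_distrib)
    finally show ?thesis .
  qed
  have sq: "(cmod (\<Sum>l\<in>L. z (c l)))\<^sup>2 = (\<Sum>l\<in>L. \<Sum>l'\<in>L. Re (z (c l) * cnj (z (c l'))))" for c
  proof -
    have "complex_of_real ((cmod (\<Sum>l\<in>L. z (c l)))\<^sup>2) = (\<Sum>l\<in>L. \<Sum>l'\<in>L. z (c l) * cnj (z (c l')))"
      unfolding complex_norm_square by (simp add: sum_product)
    then have "(cmod (\<Sum>l\<in>L. z (c l)))\<^sup>2 = Re (\<Sum>l\<in>L. \<Sum>l'\<in>L. z (c l) * cnj (z (c l')))"
      by (metis Re_complex_of_real)
    then show ?thesis by simp
  qed
  have cross: "(\<Sum>c\<in>codes. code_wt c * Re (z (c l) * cnj (z (c l'))))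
      = (if l = l' then (\<Sum>x\<in>X. p x * (cmod (z x))\<^sup>2) else 0)" if l: "l \<in> L" "l' \<in> L" for l l'
  proof (cases "l = l'")
    case True
    have "Re (z x * cnj (z x)) = (cmod (z x))\<^sup>2" for x
      by (metis Re_complex_of_real complex_norm_square)
    then show ?thesis using True code_marginal[OF l(1), of "\<lambda>x. Re (z x * cnj (z x))"] by (simp del: complex_mult_cnj)
  next
    case False
    have "(\<Sum>c\<in>codes. code_wt c * Re (z (c l) * cnj (z (c l')))) = (\<Sum>x\<in>X. \<Sum>y\<in>X. p x * p y * Re (z x * cnj (z y)))"
      by (rule code_pair_marginal[OF l False, of "\<lambda>x y. Re (z x * cnj (z y))"])
    also have "\<dots> = Re ((\<Sum>x\<in>X. complex_of_real (p x) * z x) * cnj (\<Sum>x\<in>X. complex_of_real (p x) * z x))"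
      by (simp add: sum_product Re_sum algebra_simps)
    also have "\<dots> = 0" by (simp add: zm)
    finally show ?thesis using False by simp
  qed
  have "(\<Sum>c\<in>codes. code_wt c * (cmod (\<Sum>x\<in>X. complex_of_real (emp c x - p x) * y x))\<^sup>2)
      = (\<Sum>c\<in>codes. code_wt c * (cmod (\<Sum>l\<in>L. z (c l)))\<^sup>2) / ?N\<^sup>2"
    unfolding sum_divide_distrib by (intro sum.cong refl) (subst rep, assumption, simp add: norm_divide power_divide)
  also have "(\<Sum>c\<in>codes. code_wt c * (cmod (\<Sum>l\<in>L. z (c l)))\<^sup>2)
      = (\<Sum>l\<in>L. \<Sum>l'\<in>L. \<Sum>c\<in>codes. code_wt c * Re (z (c l) * cnj (z (c l'))))"
  proof -
    have "(\<Sum>c\<in>codes. code_wt c * (cmod (\<Sum>l\<in>L. z (c l)))\<^sup>2)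
       = (\<Sum>c\<in>codes. \<Sum>l\<in>L. \<Sum>l'\<in>L. code_wt c * Re (z (c l) * cnj (z (c l'))))"
      unfolding sq by (simp only: sum_distrib_left)
    also have "\<dots> = (\<Sum>l\<in>L. \<Sum>c\<in>codes. \<Sum>l'\<in>L. code_wt c * Re (z (c l) * cnj (z (c l'))))" by (rule sum.swap)
    also have "\<dots> = (\<Sum>l\<in>L. \<Sum>l'\<in>L. \<Sum>c\<in>codes. code_wt c * Re (z (c l) * cnj (z (c l'))))"
      by (intro sum.cong refl sum.swap)
    finally show ?thesis .
  qed
  also have "\<dots> = (\<Sum>l\<in>L. \<Sum>l'\<in>L. if l = l' then (\<Sum>x\<in>X. p x * (cmod (z x))\<^sup>2) else 0)"
    by (intro sum.cong refl cross)
  also have "\<dots> = ?N * (\<Sum>x\<in>X. p x * (cmod (z x))\<^sup>2)" using fin by simp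
  also have "\<dots> / ?N\<^sup>2 = (\<Sum>x\<in>X. p x * (cmod (z x))\<^sup>2) / ?N" using N by (simp add: power2_eq_square)
  also have "\<dots> \<le> (\<Sum>x\<in>X. p x * (cmod (y x))\<^sup>2) / ?N"
  proof (intro divide_right_mono)
    have "(cmod (y x))\<^sup>2 = (cmod (z x))\<^sup>2 + 2 * Re (z x * cnj m) + (cmod m)\<^sup>2" for x
      unfolding z_def cmod_power2 by (simp add: power2_eq_square algebra_simps)
    then have "(\<Sum>x\<in>X. p x * (cmod (y x))\<^sup>2) = (\<Sum>x\<in>X. p x * (cmod (z x))\<^sup>2)
        + 2 * Re ((\<Sum>x\<in>X. complex_of_real (p x) * z x) * cnj m) + (\<Sum>x\<in>X. p x) * (cmod m)\<^sup>2"
      by (simp add: sum_distrib_right sum_distrib_left sum.distrib[symmetric] Re_sum) (intro sum.cong refl, simp add: algebra_simps)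
    then show "(\<Sum>x\<in>X. p x * (cmod (z x))\<^sup>2) \<le> (\<Sum>x\<in>X. p x * (cmod (y x))\<^sup>2)"
      by (simp add: zm p1)
  qed simp
  finally show ?thesis .
qed

text \<open>A squared Hilbert-Schmidt norm is a sum over entries, so the scalar variance bound
  applies to each entry.\<close>

lemma code_hs_variance:
  fixes Y :: "'x \<Rightarrow> 'i \<Rightarrow> 'j \<Rightarrow> complex"
  assumes ne: "L \<noteq> {}"
  shows "(\<Sum>c\<in>codes. code_wt c * hs I J (\<Sum>x\<in>X. smul (complex_of_real (emp c x - p x)) (Y x)))
     \<le> (\<Sum>x\<in>X. p x * hs I J (Y x)) / real (card L)"
proof -
  have "(\<Sum>c\<in>codes. code_wt c * hs I J (\<Sum>x\<in>X. smul (complex_of_real (emp c x - p x)) (Y x)))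
     = (\<Sum>c\<in>codes. \<Sum>i\<in>I. \<Sum>j\<in>J. code_wt c * (cmod (\<Sum>x\<in>X. complex_of_real (emp c x - p x) * Y x i j))\<^sup>2)"
    by (simp add: hs_def sum_distrib_left sum_fun_apply)
  also have "\<dots> = (\<Sum>i\<in>I. \<Sum>c\<in>codes. \<Sum>j\<in>J. code_wt c * (cmod (\<Sum>x\<in>X. complex_of_real (emp c x - p x) * Y x i j))\<^sup>2)"
    by (rule sum.swap)
  also have "\<dots> = (\<Sum>i\<in>I. \<Sum>j\<in>J. \<Sum>c\<in>codes. code_wt c * (cmod (\<Sum>x\<in>X. complex_of_real (emp c x - p x) * Y x i j))\<^sup>2)"
    by (intro sum.cong refl sum.swap)
  also have "\<dots> \<le> (\<Sum>i\<in>I. \<Sum>j\<in>J. (\<Sum>x\<in>X. p x * (cmod (Y x i j))\<^sup>2) / real (card L))"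
    by (intro sum_mono code_variance ne)
  also have "\<dots> = (\<Sum>x\<in>X. p x * hs I J (Y x)) / real (card L)"
  proof -
    have "(\<Sum>i\<in>I. \<Sum>j\<in>J. \<Sum>x\<in>X. p x * (cmod (Y x i j))\<^sup>2) = (\<Sum>i\<in>I. \<Sum>x\<in>X. \<Sum>j\<in>J. p x * (cmod (Y x i j))\<^sup>2)"
      by (intro sum.cong refl sum.swap)
    also have "\<dots> = (\<Sum>x\<in>X. \<Sum>i\<in>I. \<Sum>j\<in>J. p x * (cmod (Y x i j))\<^sup>2)" by (rule sum.swap)
    finally show ?thesis by (simp add: hs_def sum_distrib_left sum_divide_distrib[symmetric])
  qed
  finally show ?thesis .
qed

lemma exists_code:
  assumes "(\<Sum>c\<in>codes. code_wt c * f c) \<le> b"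
  shows "\<exists>c\<in>codes. f c \<le> b"
proof (rule ccontr)
  assume "\<not> ?thesis"
  then have gt: "\<And>c. c \<in> codes \<Longrightarrow> f c > b" by force
  have "b = (\<Sum>c\<in>codes. code_wt c * b)" by (simp add: code_wt_sum flip: sum_distrib_right)
  also have "\<dots> < (\<Sum>c\<in>codes. code_wt c * f c)"
  proof (rule sum_strict_mono_ex1)
    show "\<forall>c\<in>codes. code_wt c * b \<le> code_wt c * f c"
      by (intro ballI mult_left_mono code_wt_nonneg less_imp_le[OF gt])
    obtain c where "c \<in> codes" "code_wt c \<noteq> 0"
      using code_wt_sum by (metis sum.neutral zero_neq_one)
    then have "code_wt c > 0" using code_wt_nonneg[of c] by simp
    then show "\<exists>c\<in>codes. code_wt c * b < code_wt c * f c"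
      using gt \<open>c \<in> codes\<close> by (intro bexI[of _ c] mult_strict_left_mono)
  qed (rule finite_codes)
  finally show False using assms by simp
qed

end

subsection \<open>One-shot coding theorem\<close>

lemma gram_red:
  assumes "finite JR"
  shows "tr JB (\<Lambda> \<star>\<^bsub>JB\<^esub> red G \<star>\<^bsub>JR \<times> Z\<^esub> adj (red G)) = tr (JR \<times> Z) (adj (red G) \<star>\<^bsub>JB\<^esub> \<Lambda> \<star>\<^bsub>JB\<^esub> red G)"
  using tr_mm_commute[of JB "\<Lambda> \<star>\<^bsub>JB\<^esub> red G" "JR \<times> Z" "adj (red G)"] by simp

text \<open>\<open>a1\<close> to \<open>a3\<close> are the covering conditions and \<open>a4\<close>
  to \<open>a6\<close> the decoding conditions, averaged over \<open>p\<close>. They bound the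
  expected failures of a random code whose position \<open>(m, k)\<close> holds the
  \<open>k\<close>-th codeword of bin \<open>m\<close>.\<close>

theorem one_shot_coding:
  fixes JR :: "'r set" and JB :: "'b set" and A :: "'a set" and X :: "'x set" and Z :: "'z set"
    and G :: "'x \<Rightarrow> 'r \<times> 'b \<Rightarrow> 'z \<Rightarrow> complex" and H :: "'x \<Rightarrow> 'r \<times> 'b \<Rightarrow> 'y \<Rightarrow> complex" and p :: "'x \<Rightarrow> real"
    and Phi :: "'r \<times> 'b \<Rightarrow> 'a \<Rightarrow> complex" and u :: "'r \<times> 'b \<Rightarrow> 'w \<Rightarrow> complex" and QB :: "'x \<Rightarrow> 'b op"
    and M K :: nat
  assumes fin: "finite JR" "finite JB" "finite A" "finite X" "finite Zg"
    and p: "\<And>x. x \<in> X \<Longrightarrow> p x \<ge> 0" "(\<Sum>x\<in>X. p x) = 1"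
    and hsG: "\<And>x. x \<in> X \<Longrightarrow> hs (JR \<times> JB) Z (G x) = 1"
    and Phi: "op_eq_on (JR \<times> JB) (Phi \<star>\<^bsub>A\<^esub> adj Phi) (\<Sum>x\<in>X. smul (complex_of_real (p x)) (G x \<star>\<^bsub>Z\<^esub> adj (G x)))"
    and u: "isom (JR \<times> JB) Zg u"
    and split: "\<And>x. x \<in> X \<Longrightarrow> op_eq_on (JR \<times> JB) (G x \<star>\<^bsub>Z\<^esub> adj (G x)) (T x + H x \<star>\<^bsub>Y\<^esub> adj (H x))"
    and PB: "projn JB PB" and QB: "\<And>x. x \<in> X \<Longrightarrow> projn JB (QB x)"
    and MK: "M \<ge> 1" "K \<ge> 1" and \<epsilon>: "0 < \<epsilon>" "\<epsilon> \<le> 1 / 441"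
    and a1: "(\<Sum>x\<in>X. p x * hs (JR \<times> JB) Z (G x - (u \<star>\<^bsub>Zg\<^esub> adj u) \<star>\<^bsub>JR \<times> JB\<^esub> G x)) \<le> \<epsilon>"
    and a2: "(\<Sum>x\<in>X. p x * hs (JR \<times> JB) Y (H x)) \<le> \<epsilon>"
    and a3: "card Zg * (\<Sum>x\<in>X. p x * hs Zg Zg (adj u \<star>\<^bsub>JR \<times> JB\<^esub> T x \<star>\<^bsub>JR \<times> JB\<^esub> u)) \<le> \<epsilon> * (real M * real K)"
    and a4: "(\<Sum>x\<in>X. p x * hs JB (JR \<times> Z) (red (G x) - PB \<star>\<^bsub>JB\<^esub> red (G x))) \<le> \<epsilon>"
    and a5: "(\<Sum>x\<in>X. p x * hs JB (JR \<times> Z) (red (G x) - QB x \<star>\<^bsub>JB\<^esub> red (G x))) \<le> \<epsilon>"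
    and a6: "(real K - 1) * (\<Sum>x\<in>X. \<Sum>y\<in>X. p x * p y * hs JB (JR \<times> Z) (QB x \<star>\<^bsub>JB\<^esub> PB \<star>\<^bsub>JB\<^esub> red (G y))) \<le> \<epsilon>"
  obtains Om \<Lambda> f where "povm_on A {1..M} Om" "\<And>m. m \<in> {1..M} \<Longrightarrow> povm_on JB {1..K} (\<Lambda> m)"
    "\<And>m k. m \<in> {1..M} \<Longrightarrow> k \<in> {1..K} \<Longrightarrow> f m k \<in> X"
    "\<And>C. (\<And>m k. m \<in> {1..M} \<Longrightarrow> k \<in> {1..K} \<Longrightarrow> contr (JR \<times> JB) (JR \<times> JB) (C m k)) \<Longrightarrow>
      cmod (\<Sum>m\<in>{1..M}. \<Sum>k\<in>{1..K}. tr (JR \<times> JB) (C m k \<star>\<^bsub>JR \<times> JB\<^esub>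
        (amp (psd_sqrt JB (\<Lambda> m k)) \<star>\<^bsub>JR \<times> JB\<^esub> (Phi \<star>\<^bsub>A\<^esub> Om m \<star>\<^bsub>A\<^esub> adj Phi) \<star>\<^bsub>JR \<times> JB\<^esub> amp (psd_sqrt JB (\<Lambda> m k))
         - smul (complex_of_real (1 / (real M * real K))) (G (f m k) \<star>\<^bsub>Z\<^esub> adj (G (f m k)))))) \<le> 50 * sqrt (sqrt \<epsilon>)"
proof -
  let ?J = "JR \<times> JB" and ?L = "{1..M} \<times> {1..K}"
  let ?N = "real M * real K"
  let ?P = "u \<star>\<^bsub>Zg\<^esub> adj u"
  let ?W = "\<lambda>x. G x \<star>\<^bsub>Z\<^esub> adj (G x)"
  let ?Zr = "JR \<times> Z"
  have finJ: "finite ?J" and finL: "finite ?L" and cardL: "real (card ?L) = ?N" and neL: "?L \<noteq> {}"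
    using fin MK by auto
  have N: "?N > 0" using MK by simp
  have p0: "\<forall>x\<in>X. p x \<ge> 0" using p(1) by blast
  note code = finL fin(4) p0 p(2)
  let ?cw = "code_wt ?L p" and ?em = "emp ?L" and ?codes = "PiE ?L (\<lambda>_. X)"
  define \<delta> where "\<delta> x = hs ?J Z (G x - ?P \<star>\<^bsub>?J\<^esub> G x)" for x
  define dB where "dB x = hs JB ?Zr (red (G x) - PB \<star>\<^bsub>JB\<^esub> red (G x))" for x
  define rB where "rB x = hs JB ?Zr (red (G x) - QB x \<star>\<^bsub>JB\<^esub> red (G x))" for x
  define \<gamma> where "\<gamma> x y = hs JB ?Zr (QB x \<star>\<^bsub>JB\<^esub> PB \<star>\<^bsub>JB\<^esub> red (G y))" for x y
  define f1 where "f1 c = (\<Sum>x\<in>X. ?em c x * \<delta> x)" for c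
  define f2 where "f2 c = (\<Sum>x\<in>X. ?em c x * hs ?J Y (H x))" for c
  define f3 where "f3 c = card Zg * hs Zg Zg (\<Sum>x\<in>X. smul (complex_of_real (?em c x - p x)) (adj u \<star>\<^bsub>?J\<^esub> T x \<star>\<^bsub>?J\<^esub> u))" for c
  define f4 where "f4 c = (\<Sum>x\<in>X. ?em c x * dB x)" for c
  \<comment> \<open>The decoder of a bin tries the codewords in order, so only the earlier ones,
    \<open>j < snd l\<close>, can be accepted by mistake before the right one is tested.\<close>
  define cr where "cr c = (\<Sum>l\<in>?L. \<Sum>j\<in>{1..<snd l}. \<gamma> (c (fst l, j)) (c l)) / ?N" for c
  define f6 where "f6 c = (\<Sum>x\<in>X. ?em c x * rB x)" for c
  define f5 where "f5 c = cr c + 2 * f6 c + 2 * f4 c" for c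
  have E1: "(\<Sum>c\<in>?codes. ?cw c * f1 c) \<le> \<epsilon>"
    unfolding f1_def code_emp_mean[OF code neL] using a1 by (simp add: \<delta>_def)
  have E2: "(\<Sum>c\<in>?codes. ?cw c * f2 c) \<le> \<epsilon>"
    unfolding f2_def code_emp_mean[OF code neL] using a2 by simp
  have E3: "(\<Sum>c\<in>?codes. ?cw c * f3 c) \<le> \<epsilon>"
  proof -
    have "(\<Sum>c\<in>?codes. ?cw c * f3 c) = card Zg * (\<Sum>c\<in>?codes. ?cw c * hs Zg Zg (\<Sum>x\<in>X. smul (complex_of_real (?em c x - p x)) (adj u \<star>\<^bsub>?J\<^esub> T x \<star>\<^bsub>?J\<^esub> u)))"
      unfolding f3_def sum_distrib_left by (intro sum.cong refl) (simp only: mult_ac)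
    also have "\<dots> \<le> card Zg * ((\<Sum>x\<in>X. p x * hs Zg Zg (adj u \<star>\<^bsub>?J\<^esub> T x \<star>\<^bsub>?J\<^esub> u)) / real (card ?L))"
      by (intro mult_left_mono code_hs_variance code neL) simp
    also have "\<dots> \<le> \<epsilon>" unfolding cardL using a3 N by (simp add: field_simps)
    finally show ?thesis .
  qed
  have E4: "(\<Sum>c\<in>?codes. ?cw c * f4 c) \<le> \<epsilon>"
    unfolding f4_def code_emp_mean[OF code neL] using a4 by (simp add: dB_def)
  have E5: "(\<Sum>c\<in>?codes. ?cw c * f5 c) \<le> 5 * \<epsilon>"
  proof -
    let ?g = "\<Sum>x\<in>X. \<Sum>y\<in>X. p x * p y * \<gamma> x y"
    have g0: "?g \<ge> 0" by (intro sum_nonneg mult_nonneg_nonneg p) (auto simp: \<gamma>_def)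
    have cr: "(\<Sum>c\<in>?codes. ?cw c * cr c) = (\<Sum>c\<in>?codes. \<Sum>l\<in>?L. \<Sum>j\<in>{1..<snd l}. ?cw c * \<gamma> (c (fst l, j)) (c l)) / ?N"
      unfolding cr_def sum_divide_distrib sum_distrib_left by simp
    have "(\<Sum>c\<in>?codes. \<Sum>l\<in>?L. \<Sum>j\<in>{1..<snd l}. ?cw c * \<gamma> (c (fst l, j)) (c l))
        = (\<Sum>l\<in>?L. \<Sum>j\<in>{1..<snd l}. \<Sum>c\<in>?codes. ?cw c * \<gamma> (c (fst l, j)) (c l))"
      by (subst sum.swap) (intro sum.cong refl sum.swap)
    also have "\<dots> = (\<Sum>l\<in>?L. \<Sum>j\<in>{1..<snd l}. ?g)"
    proof (intro sum.cong refl)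
      fix l j assume lj: "l \<in> ?L" "j \<in> {1..<snd l}"
      then have "(fst l, j) \<in> ?L" "(fst l, j) \<noteq> l" by auto
      then show "(\<Sum>c\<in>?codes. ?cw c * \<gamma> (c (fst l, j)) (c l)) = ?g"
        using lj by (intro code_pair_marginal[OF code]) auto
    qed
    also have "\<dots> \<le> (\<Sum>l\<in>?L. (real K - 1) * ?g)"
    proof (intro sum_mono)
      fix l assume "l \<in> ?L"
      then have "real (snd l - 1) \<le> real K - 1" by auto
      then show "(\<Sum>j\<in>{1..<snd l}. ?g) \<le> (real K - 1) * ?g" using g0 by (simp add: mult_right_mono)
    qed
    also have "\<dots> = ?N * ((real K - 1) * ?g)" by (simp only: sum_constant cardL)
    also have "\<dots> \<le> ?N * \<epsilon>"
      using a6 N unfolding \<gamma>_def by (intro mult_left_mono) auto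
    finally have "(\<Sum>c\<in>?codes. ?cw c * cr c) \<le> \<epsilon>"
      unfolding cr pos_divide_le_eq[OF N] by (simp only: mult.commute)
    moreover have "(\<Sum>c\<in>?codes. ?cw c * f6 c) \<le> \<epsilon>"
      unfolding f6_def code_emp_mean[OF code neL] using a5 by (simp add: rB_def)
    moreover have "(\<Sum>c\<in>?codes. ?cw c * f5 c) = (\<Sum>c\<in>?codes. ?cw c * cr c)
        + 2 * (\<Sum>c\<in>?codes. ?cw c * f6 c) + 2 * (\<Sum>c\<in>?codes. ?cw c * f4 c)"
      unfolding f5_def sum_distrib_left[of 2] sum.distrib[symmetric] by (intro sum.cong refl) (simp only: algebra_simps)
    ultimately show ?thesis using E4 by linarith
  qed
  \<comment> \<open>Four expectations of \<open>\<epsilon>\<close> and one of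
    \<open>5 * \<epsilon>\<close>. All summands are nonnegative, so for the selected code each of
    them is at most \<open>9 * \<epsilon>\<close>.\<close>
  have "(\<Sum>c\<in>?codes. ?cw c * (f1 c + f2 c + f3 c + f4 c + f5 c)) \<le> 9 * \<epsilon>"
    using E1 E2 E3 E4 E5 by (simp add: distrib_left sum.distrib)
  then obtain c where c: "c \<in> ?codes" and tot: "f1 c + f2 c + f3 c + f4 c + f5 c \<le> 9 * \<epsilon>"
    using exists_code[OF code] by meson
  have em0: "?em c x \<ge> 0" for x by (rule emp_nonneg[OF code])
  have nn: "f1 c \<ge> 0" "f2 c \<ge> 0" "f3 c \<ge> 0" "f4 c \<ge> 0" "f5 c \<ge> 0"
  proof -
    show "f1 c \<ge> 0" "f2 c \<ge> 0" and f4: "f4 c \<ge> 0"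
      unfolding f1_def f2_def f4_def by (intro sum_nonneg mult_nonneg_nonneg em0; simp add: \<delta>_def dB_def)+
    show "f3 c \<ge> 0" by (simp add: f3_def)
    have "cr c \<ge> 0" by (auto simp: cr_def \<gamma>_def intro!: divide_nonneg_nonneg sum_nonneg)
    moreover have "f6 c \<ge> 0"
      unfolding f6_def by (intro sum_nonneg mult_nonneg_nonneg em0) (simp add: rB_def)
    ultimately show "f5 c \<ge> 0" using f4 by (simp add: f5_def)
  qed
  have le9: "f1 c \<le> 9 * \<epsilon>" "f2 c \<le> 9 * \<epsilon>" "f3 c \<le> 9 * \<epsilon>" "f4 c \<le> 9 * \<epsilon>" "f5 c \<le> 9 * \<epsilon>"
    using nn tot by linarith+
  have em1: "(\<Sum>x\<in>X. ?em c x) = 1"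
    using emp_sum[OF code c, of "\<lambda>_. 1"] MK by simp
  define f where "f m k = c (m, k)" for m k
  have fX: "f m k \<in> X" if "m \<in> {1..M}" "k \<in> {1..K}" for m k
    using c that by (auto simp: f_def PiE_iff)
  define w where "w l = smul (complex_of_real (1 / ?N)) (?W (c l))" for l
  have sumw: "(\<Sum>l\<in>?L. w l) = (\<Sum>x\<in>X. smul (complex_of_real (?em c x)) (?W x))"
    unfolding emp_sum_op[OF code c] cardL w_def ..
  have se: "sqrt \<epsilon> \<ge> 0" "\<epsilon> \<le> sqrt \<epsilon> * (1/21)" "sqrt (9 * \<epsilon>) = 3 * sqrt \<epsilon>"
  proof -
    have "sqrt \<epsilon> \<le> 1/21" using \<epsilon> by (intro real_le_lsqrt) (auto simp: power2_eq_square)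
    then have "sqrt \<epsilon> * sqrt \<epsilon> \<le> sqrt \<epsilon> * (1/21)" using \<epsilon> by (intro mult_left_mono) auto
    then show "\<epsilon> \<le> sqrt \<epsilon> * (1/21)" using \<epsilon> by simp
    show "sqrt (9 * \<epsilon>) = 3 * sqrt \<epsilon>"
      by (simp add: real_sqrt_mult real_sqrt_unique)
  qed (use \<epsilon> in simp)
  \<comment> \<open>The covering estimate needs the coefficient 6 + 2 + 10/21 + 3, well below 21;
    since 441 = 21^2, the bound on \<open>\<epsilon>\<close> gives
    \<open>\<theta> \<le> 1\<close>.\<close>
  define \<theta> where "\<theta> = 21 * sqrt \<epsilon>"
  have th: "0 < \<theta>" "\<theta> \<le> 1"
  proof -
    show "0 < \<theta>" using \<epsilon> by (simp add: \<theta>_def)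
    have "sqrt \<epsilon> \<le> 1/21" using \<epsilon> by (intro real_le_lsqrt) (auto simp: power2_eq_square)
    then show "\<theta> \<le> 1" by (simp add: \<theta>_def)
  qed
  have cover: "cmod (tr ?J (C \<star>\<^bsub>?J\<^esub> ((\<Sum>l\<in>?L. w l) - Phi \<star>\<^bsub>A\<^esub> adj Phi))) \<le> \<theta>" if C: "contr ?J ?J C" for C
  proof -
    have "tr ?J (C \<star>\<^bsub>?J\<^esub> ((\<Sum>l\<in>?L. w l) - Phi \<star>\<^bsub>A\<^esub> adj Phi))
       = tr ?J (C \<star>\<^bsub>?J\<^esub> ((\<Sum>x\<in>X. smul (complex_of_real (?em c x)) (?W x)) - (\<Sum>x\<in>X. smul (complex_of_real (p x)) (?W x))))"
      unfolding sumw by (intro op_eq_on_tr op_eq_on_mm op_eq_on_diff op_eq_on_refl Phi)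
    also have "(\<Sum>x\<in>X. smul (complex_of_real (?em c x)) (?W x)) - (\<Sum>x\<in>X. smul (complex_of_real (p x)) (?W x))
       = (\<Sum>x\<in>X. smul (complex_of_real (?em c x - p x)) (?W x))"
      unfolding sum_subtractf[symmetric] by (intro sum.cong refl) (simp add: fun_eq_iff algebra_simps)
    finally have eq: "tr ?J (C \<star>\<^bsub>?J\<^esub> ((\<Sum>l\<in>?L. w l) - Phi \<star>\<^bsub>A\<^esub> adj Phi)) = tr ?J (C \<star>\<^bsub>?J\<^esub> (\<Sum>x\<in>X. smul (complex_of_real (?em c x - p x)) (?W x)))" .
    have "cmod (tr ?J (C \<star>\<^bsub>?J\<^esub> ((\<Sum>l\<in>?L. w l) - Phi \<star>\<^bsub>A\<^esub> adj Phi))) \<le>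
      2 * sqrt (f1 c) + 2 * sqrt (\<Sum>x\<in>X. p x * \<delta> x) + f2 c + (\<Sum>x\<in>X. p x * hs ?J Y (H x)) + sqrt (f3 c)"
      unfolding eq f1_def f2_def f3_def \<delta>_def
      by (rule mixture_distance[OF finJ fin(5) u p em0 em1 hsG split C])
    also have "\<dots> \<le> 2 * sqrt (9 * \<epsilon>) + 2 * sqrt \<epsilon> + 9 * \<epsilon> + \<epsilon> + sqrt (9 * \<epsilon>)"
      using a1 a2 le9 by (intro add_mono mult_left_mono real_sqrt_le_mono) (auto simp: \<delta>_def)
    also have "\<dots> \<le> \<theta>" using se by (simp add: \<theta>_def)
    finally show ?thesis .
  qed
  have psdw: "psd_on ?J (w l)" for l
    unfolding w_def by (intro psd_on_smul psd_on_gram) simp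
  have trW: "tr ?J (?W x) = 1" if "x \<in> X" for x by (simp add: hs_tr' hsG that)
  have tr1: "hs ?J A Phi = 1"
  proof -
    have "complex_of_real (hs ?J A Phi) = (\<Sum>x\<in>X. complex_of_real (p x))"
      unfolding hs_tr'[symmetric] op_eq_on_tr[OF Phi] tr_sum tr_smul by (intro sum.cong refl) (simp add: trW)
    then show ?thesis using p(2) by (metis of_real_eq_iff of_real_sum)
  qed
  have trw: "tr ?J (\<Sum>l\<in>?L. w l) = 1"
  proof -
    have "tr ?J (\<Sum>l\<in>?L. w l) = (\<Sum>x\<in>X. complex_of_real (?em c x))"
      unfolding sumw tr_sum tr_smul by (intro sum.cong refl) (simp add: trW)
    then show ?thesis using em1 by (metis of_real_1 of_real_sum)
  qed
  have l0: "(1, 1) \<in> ?L" using MK by simp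
  obtain Om0 where Om0: "\<And>l. l \<in> ?L \<Longrightarrow> psd_on A (Om0 l)" "op_eq_on A (\<Sum>l\<in>?L. Om0 l) op_id"
    and enc0: "\<And>C. (\<And>l. l \<in> ?L \<Longrightarrow> contr ?J ?J (C l)) \<Longrightarrow>
       cmod (\<Sum>l\<in>?L. tr ?J (C l \<star>\<^bsub>?J\<^esub> (Phi \<star>\<^bsub>A\<^esub> Om0 l \<star>\<^bsub>A\<^esub> adj Phi - w l))) \<le> 5 * sqrt \<theta>"
    using encoding_measurement[where J="?J" and A=A and L="?L" and Phi=Phi and w=w and \<theta>=\<theta>, OF finJ fin(3) finL l0 psdw tr1 trw th cover]
    by blast
  \<comment> \<open>Merging the outcomes of a bin: the encoder reports \<open>m\<close> and
    withholds \<open>k\<close>.\<close>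
  define Om where "Om m = (\<Sum>k\<in>{1..K}. Om0 (m, k))" for m
  have sumL: "(\<Sum>m\<in>{1..M}. \<Sum>k\<in>{1..K}. F (m, k)) = (\<Sum>l\<in>?L. F l)" for F :: "nat \<times> nat \<Rightarrow> 'v::comm_monoid_add"
    by (simp add: sum.cartesian_product)
  have povmOm: "povm_on A {1..M} Om"
  proof -
    have "(\<Sum>m\<in>{1..M}. Om m) = (\<Sum>l\<in>?L. Om0 l)" unfolding Om_def by (rule sumL)
    then have "op_eq_on A (\<Sum>m\<in>{1..M}. Om m) op_id" using Om0(2) by simp
    moreover have "psd_on A (Om m)" if "m \<in> {1..M}" for m
      unfolding Om_def using that by (intro psd_on_sum Om0) auto
    ultimately show ?thesis by (simp add: povm_on_def op_eq_on_def sum_fun_apply)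
  qed
  have "\<exists>\<Lambda>. povm_on JB {1..K} \<Lambda> \<and> (\<forall>k\<in>{1..K}. 1 - Re (tr JB (\<Lambda> k \<star>\<^bsub>JB\<^esub> red (G (f m k)) \<star>\<^bsub>?Zr\<^esub> adj (red (G (f m k)))))
      \<le> dB (f m k) + 2 * sqrt ((\<Sum>j\<in>{1..<k}. \<gamma> (f m j) (f m k)) + 2 * rB (f m k) + 2 * dB (f m k)))"
    if m: "m \<in> {1..M}" for m
  proof -
    have Q: "projn JB (QB (f m k))" if "k \<in> {1..K}" for k by (intro QB fX m that)
    obtain \<Lambda> where \<Lambda>: "povm_on JB {1..K} \<Lambda>"
      "\<And>k (Z :: ('r \<times> 'z) set) G. k \<in> {1..K} \<Longrightarrow> hs JB Z G = 1 \<Longrightarrow>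
       1 - Re (tr JB (\<Lambda> k \<star>\<^bsub>JB\<^esub> G \<star>\<^bsub>Z\<^esub> adj G)) \<le> hs JB Z (G - PB \<star>\<^bsub>JB\<^esub> G)
         + 2 * sqrt ((\<Sum>j\<in>{1..<k}. hs JB Z (QB (f m j) \<star>\<^bsub>JB\<^esub> PB \<star>\<^bsub>JB\<^esub> G)) + 2 * hs JB Z (G - QB (f m k) \<star>\<^bsub>JB\<^esub> G) + 2 * hs JB Z (G - PB \<star>\<^bsub>JB\<^esub> G))"
      using sequential_decoder[where I=JB and Pi=PB and P="\<lambda>k. QB (f m k)" and K=K, OF fin(2) PB Q MK(2)] by blast
    show ?thesis
    proof (intro exI[of _ \<Lambda>] conjI ballI \<Lambda>(1))
      fix k assume k: "k \<in> {1..K}"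
      have "hs JB ?Zr (red (G (f m k))) = 1" unfolding hs_red by (intro hsG fX m k)
      from \<Lambda>(2)[OF k this]
      show "1 - Re (tr JB (\<Lambda> k \<star>\<^bsub>JB\<^esub> red (G (f m k)) \<star>\<^bsub>?Zr\<^esub> adj (red (G (f m k)))))
          \<le> dB (f m k) + 2 * sqrt ((\<Sum>j\<in>{1..<k}. \<gamma> (f m j) (f m k)) + 2 * rB (f m k) + 2 * dB (f m k))"
        unfolding dB_def rB_def \<gamma>_def .
    qed
  qed
  then obtain \<Lambda> where \<Lambda>: "\<And>m. m \<in> {1..M} \<Longrightarrow> povm_on JB {1..K} (\<Lambda> m)"
    and dec: "\<And>m k. m \<in> {1..M} \<Longrightarrow> k \<in> {1..K} \<Longrightarrow> 1 - Re (tr JB (\<Lambda> m k \<star>\<^bsub>JB\<^esub> red (G (f m k)) \<star>\<^bsub>?Zr\<^esub> adj (red (G (f m k)))))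
      \<le> dB (f m k) + 2 * sqrt ((\<Sum>j\<in>{1..<k}. \<gamma> (f m j) (f m k)) + 2 * rB (f m k) + 2 * dB (f m k))"
    by metis
  define sq where "sq m k = psd_sqrt JB (\<Lambda> m k)" for m k
  define S where "S m k = (amp (sq m k) :: ('r \<times> 'b) op)" for m k
  note sqrt_props = povm_sqrt[OF fin(2) finite_atLeastAtMost \<Lambda>, folded sq_def]
  have hsS: "hs ?J Z (S m k \<star>\<^bsub>?J\<^esub> G (f m k)) = Re (tr JB (\<Lambda> m k \<star>\<^bsub>JB\<^esub> red (G (f m k)) \<star>\<^bsub>?Zr\<^esub> adj (red (G (f m k)))))"
    if mk: "m \<in> {1..M}" "k \<in> {1..K}" for m k
  proof -
    have "complex_of_real (hs JB ?Zr (sq m k \<star>\<^bsub>JB\<^esub> red (G (f m k))))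
        = tr ?Zr (adj (red (G (f m k))) \<star>\<^bsub>JB\<^esub> (sq m k \<star>\<^bsub>JB\<^esub> sq m k) \<star>\<^bsub>JB\<^esub> red (G (f m k)))"
      unfolding hs_tr[symmetric] by (simp add: sqrt_props(2)[OF mk])
    also have "\<dots> = tr ?Zr (adj (red (G (f m k))) \<star>\<^bsub>JB\<^esub> \<Lambda> m k \<star>\<^bsub>JB\<^esub> red (G (f m k)))"
      unfolding op_eq_on_conj[OF sqrt_props(1)[OF mk]] ..
    finally show ?thesis
      unfolding S_def hs_amp_mm[OF fin(1)] gram_red[OF fin(1)] by (metis Re_complex_of_real)
  qed
  have C1: "adj (S m k) = S m k" "contr ?J ?J (S m k)" if mk: "m \<in> {1..M}" "k \<in> {1..K}" for m k
    unfolding S_def using sqrt_props(2,3)[OF mk] by (auto intro: contr_amp fin)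
  have gent: "hs ?J Z (G (f m k) - S m k \<star>\<^bsub>?J\<^esub> G (f m k)) \<le> 1 - hs ?J Z (S m k \<star>\<^bsub>?J\<^esub> G (f m k))"
    if mk: "m \<in> {1..M}" "k \<in> {1..K}" for m k
    using sqrt_props(4)[OF mk, of "?Zr" "red (G (f m k))"] hsG[OF fX[OF mk]]
    unfolding S_def hs_amp_mm[OF fin(1)] hs_diff_amp_mm[OF fin(1)] hs_red by simp
  have compl: "op_eq_on ?J (\<Sum>k\<in>{1..K}. S m k \<star>\<^bsub>?J\<^esub> S m k) op_id" if m: "m \<in> {1..M}" for m
  proof -
    have "op_eq_on ?J (\<Sum>k\<in>{1..K}. S m k \<star>\<^bsub>?J\<^esub> S m k) (\<Sum>k\<in>{1..K}. amp (\<Lambda> m k))"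
      unfolding S_def
      by (rule op_eq_on_sum) (rule op_eq_on_trans[OF amp_amp[OF fin(1)] amp_cong[OF sqrt_props(1)[OF m]]])
    moreover have "op_eq_on ?J (\<Sum>k\<in>{1..K}. amp (\<Lambda> m k)) op_id"
    proof -
      have "op_eq_on JB (\<Sum>k\<in>{1..K}. \<Lambda> m k) op_id"
        using \<Lambda>[OF m] by (simp add: povm_on_def op_eq_on_def sum_fun_apply)
      from amp_cong[OF this, of JR] show ?thesis unfolding amp_sum amp_op_id .
    qed
    ultimately show ?thesis by (rule op_eq_on_trans)
  qed
  have enc: "cmod (\<Sum>m\<in>{1..M}. tr ?J (C m \<star>\<^bsub>?J\<^esub> (Phi \<star>\<^bsub>A\<^esub> Om m \<star>\<^bsub>A\<^esub> adj Phi
      - (\<Sum>k\<in>{1..K}. smul (complex_of_real (1 / ?N)) (?W (f m k)))))) \<le> 5 * sqrt \<theta>"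
    if C: "\<And>m. m \<in> {1..M} \<Longrightarrow> contr ?J ?J (C m)" for C
  proof -
    have "Phi \<star>\<^bsub>A\<^esub> Om m \<star>\<^bsub>A\<^esub> adj Phi - (\<Sum>k\<in>{1..K}. smul (complex_of_real (1 / ?N)) (?W (f m k)))
       = (\<Sum>k\<in>{1..K}. Phi \<star>\<^bsub>A\<^esub> Om0 (m, k) \<star>\<^bsub>A\<^esub> adj Phi - w (m, k))" for m
      unfolding Om_def mm_sum_left mm_sum_right sum_subtractf w_def f_def ..
    then have "(\<Sum>m\<in>{1..M}. tr ?J (C m \<star>\<^bsub>?J\<^esub> (Phi \<star>\<^bsub>A\<^esub> Om m \<star>\<^bsub>A\<^esub> adj Phi
        - (\<Sum>k\<in>{1..K}. smul (complex_of_real (1 / ?N)) (?W (f m k))))))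
      = (\<Sum>m\<in>{1..M}. \<Sum>k\<in>{1..K}. tr ?J (C (fst (m, k)) \<star>\<^bsub>?J\<^esub> (Phi \<star>\<^bsub>A\<^esub> Om0 (m, k) \<star>\<^bsub>A\<^esub> adj Phi - w (m, k))))"
      by (simp only: mm_sum_right tr_sum fst_conv)
    also have "\<dots> = (\<Sum>l\<in>?L. tr ?J (C (fst l) \<star>\<^bsub>?J\<^esub> (Phi \<star>\<^bsub>A\<^esub> Om0 l \<star>\<^bsub>A\<^esub> adj Phi - w l)))"
      by (rule sumL)
    finally show ?thesis using enc0[of "\<lambda>l. C (fst l)"] C by (simp only: mem_Times_iff)
  qed
  define pb where "pb = 1 / ?N * (\<Sum>m\<in>{1..M}. \<Sum>k\<in>{1..K}. 1 - hs ?J Z (S m k \<star>\<^bsub>?J\<^esub> G (f m k)))"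
  \<comment> \<open>The root of \<open>9 * \<epsilon>\<close>, taken twice, gives 6, and the term
    \<open>9 * \<epsilon>\<close> adds at most 9/21.\<close>
  have pb: "pb \<le> 15 * sqrt \<epsilon>"
  proof -
    let ?s = "\<lambda>l. (\<Sum>j\<in>{1..<snd l}. \<gamma> (c (fst l, j)) (c l)) + 2 * rB (c l) + 2 * dB (c l)"
    have s0: "?s l \<ge> 0" for l by (auto simp: \<gamma>_def rB_def dB_def intro!: add_nonneg_nonneg sum_nonneg)
    have "pb \<le> 1 / ?N * (\<Sum>m\<in>{1..M}. \<Sum>k\<in>{1..K}. dB (f m k) + 2 * sqrt ((\<Sum>j\<in>{1..<k}. \<gamma> (f m j) (f m k)) + 2 * rB (f m k) + 2 * dB (f m k)))"
      unfolding pb_def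
    proof (intro mult_left_mono sum_mono)
      fix m k assume mk: "m \<in> {1..M}" "k \<in> {1..K}"
      show "1 - hs ?J Z (S m k \<star>\<^bsub>?J\<^esub> G (f m k)) \<le> dB (f m k) + 2 * sqrt ((\<Sum>j\<in>{1..<k}. \<gamma> (f m j) (f m k)) + 2 * rB (f m k) + 2 * dB (f m k))"
        unfolding hsS[OF mk] by (rule dec[OF mk])
    qed (use N in simp)
    also have "(\<Sum>m\<in>{1..M}. \<Sum>k\<in>{1..K}. dB (f m k) + 2 * sqrt ((\<Sum>j\<in>{1..<k}. \<gamma> (f m j) (f m k)) + 2 * rB (f m k) + 2 * dB (f m k)))
       = (\<Sum>l\<in>?L. dB (c l) + 2 * sqrt (?s l))"
      unfolding sumL[symmetric] by (simp add: f_def)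
    also have "1 / ?N * (\<Sum>l\<in>?L. dB (c l) + 2 * sqrt (?s l)) = f4 c + 2 * (\<Sum>l\<in>?L. 1 / ?N * sqrt (?s l))"
      unfolding f4_def emp_sum[OF code c] cardL
      by (simp add: sum.distrib add_divide_distrib sum_divide_distrib sum_distrib_left)
    also have "\<dots> \<le> f4 c + 2 * sqrt (\<Sum>l\<in>?L. 1 / ?N * ?s l)"
      using s0 N MK by (intro add_left_mono mult_left_mono weighted_sqrt_le) auto
    also have "(\<Sum>l\<in>?L. 1 / ?N * ?s l) = f5 c"
      unfolding f5_def f6_def f4_def cr_def emp_sum[OF code c] cardL
      by (simp add: sum.distrib add_divide_distrib sum_divide_distrib sum_distrib_left)
    also have "f4 c + 2 * sqrt (f5 c) \<le> 9 * \<epsilon> + 2 * sqrt (9 * \<epsilon>)"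
      using le9 by (intro add_mono mult_left_mono real_sqrt_le_mono) auto
    also have "\<dots> \<le> 15 * sqrt \<epsilon>" using se by simp
    finally show ?thesis .
  qed
  have bound: "cmod (\<Sum>m\<in>{1..M}. \<Sum>k\<in>{1..K}. tr ?J (C m k \<star>\<^bsub>?J\<^esub>
        (S m k \<star>\<^bsub>?J\<^esub> (Phi \<star>\<^bsub>A\<^esub> Om m \<star>\<^bsub>A\<^esub> adj Phi) \<star>\<^bsub>?J\<^esub> S m k
         - smul (complex_of_real (1 / ?N)) (?W (f m k))))) \<le> 50 * sqrt (sqrt \<epsilon>)"
    if C: "\<And>m k. m \<in> {1..M} \<Longrightarrow> k \<in> {1..K} \<Longrightarrow> contr ?J ?J (C m k)" for C
  proof -
    have hsGf: "hs ?J Z (G (f m k)) = 1" if "m \<in> {1..M}" "k \<in> {1..K}" for m k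
      by (intro hsG fX that)
    have c1: "1 / ?N \<ge> 0" "1 / ?N * (real (card {1..M}) * real (card {1..K})) = 1" using MK by auto
    have "cmod (\<Sum>m\<in>{1..M}. \<Sum>k\<in>{1..K}. tr ?J (C m k \<star>\<^bsub>?J\<^esub>
        (S m k \<star>\<^bsub>?J\<^esub> (Phi \<star>\<^bsub>A\<^esub> Om m \<star>\<^bsub>A\<^esub> adj Phi) \<star>\<^bsub>?J\<^esub> S m k
         - smul (complex_of_real (1 / ?N)) (?W (f m k))))) \<le> 5 * sqrt \<theta> + 2 * sqrt pb + pb"
      unfolding pb_def
      by (rule decoding_error[where G="\<lambda>m k. G (f m k)", OF finJ finite_atLeastAtMost finite_atLeastAtMost C1 gent compl hsGf c1 enc C])
    also have "\<dots> \<le> 5 * sqrt \<theta> + 2 * sqrt (15 * sqrt \<epsilon>) + 15 * sqrt \<epsilon>"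
      using pb by (intro add_mono mult_left_mono real_sqrt_le_mono) auto
    \<comment> \<open>The three terms contribute at most 25, 8 and 15.\<close>
    also have "\<dots> \<le> 50 * sqrt (sqrt \<epsilon>)"
    proof -
      have a: "sqrt 21 \<le> 5" "sqrt 15 \<le> 4" by (auto intro: real_le_lsqrt)
      have "sqrt \<epsilon> = sqrt (sqrt \<epsilon>) * sqrt (sqrt \<epsilon>)" using \<epsilon> by simp
      also have "\<dots> \<le> sqrt (sqrt \<epsilon>) * 1"
        using \<epsilon> by (intro mult_left_mono) auto
      finally have b: "sqrt \<epsilon> \<le> sqrt (sqrt \<epsilon>)" by simp
      have "sqrt \<theta> \<le> 5 * sqrt (sqrt \<epsilon>)" "sqrt (15 * sqrt \<epsilon>) \<le> 4 * sqrt (sqrt \<epsilon>)"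
        using a \<epsilon> by (auto simp: \<theta>_def real_sqrt_mult intro!: mult_right_mono)
      moreover have "sqrt (sqrt \<epsilon>) \<ge> 0" using \<epsilon> by simp
      ultimately show ?thesis using b by linarith
    qed
    finally show ?thesis .
  qed
  show thesis
    by (rule that[OF povmOm \<Lambda> fX bound[unfolded S_def sq_def]])
qed

subsection \<open>Tensor powers\<close>

text \<open>\<^term>\<open>I\<close> indexes the basis of an \<open>n\<close>-fold tensor power and \<^term>\<open>cf i k\<close> is the \<open>k\<close>-th
  letter of \<^term>\<open>i\<close>. This covers \<open>B\<^sup>n\<close> (indexed by sequences) and \<open>R\<^sup>n B\<^sup>n\<close> (indexed by pairs of
  sequences) alike.\<close>

definition tensor_index :: "nat \<Rightarrow> 'i set \<Rightarrow> ('i \<Rightarrow> nat \<Rightarrow> 's::finite) \<Rightarrow> bool" where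
  "tensor_index n I cf \<longleftrightarrow> finite I \<and>
     (\<forall>g :: nat \<Rightarrow> 's \<Rightarrow> complex. (\<Sum>i\<in>I. \<Prod>k<n. g k (cf i k)) = (\<Prod>k<n. \<Sum>s\<in>UNIV. g k s))"

lemma tensor_indexD:
  fixes g :: "nat \<Rightarrow> 's::finite \<Rightarrow> complex"
  assumes "tensor_index n I cf"
  shows "(\<Sum>i\<in>I. \<Prod>k<n. g k (cf i k)) = (\<Prod>k<n. \<Sum>s\<in>UNIV. g k s)"
  using assms by (simp add: tensor_index_def)

lemma finite_seqs [simp]: "finite (seqs n :: (nat \<Rightarrow> 'a::finite) set)"
  by (simp add: seqs_def finite_PiE)

lemma sum_seqs_prod:
  fixes g :: "nat \<Rightarrow> 'a::finite \<Rightarrow> 'c::comm_semiring_1"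
  shows "(\<Sum>z\<in>seqs n. \<Prod>k<n. g k (z k)) = (\<Prod>k<n. \<Sum>s\<in>UNIV. g k s)"
  unfolding seqs_def by (subst prod_sum_PiE) auto

lemma sum_seqs_pair_prod:
  fixes g :: "nat \<Rightarrow> 'a::finite \<times> 'b::finite \<Rightarrow> 'c::comm_semiring_1"
  shows "(\<Sum>(r, b)\<in>seqs n \<times> seqs n. \<Prod>k<n. g k (r k, b k)) = (\<Prod>k<n. \<Sum>s\<in>UNIV. g k s)"
proof -
  have "(\<Sum>(r, b)\<in>seqs n \<times> seqs n. \<Prod>k<n. g k (r k, b k)) = (\<Sum>r\<in>seqs n. \<Sum>b\<in>seqs n. \<Prod>k<n. g k (r k, b k))"
    by (simp add: sum.cartesian_product)
  also have "\<dots> = (\<Sum>r\<in>seqs n. \<Prod>k<n. \<Sum>t\<in>UNIV. g k (r k, t))"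
    by (intro sum.cong refl) (rule sum_seqs_prod)
  also have "\<dots> = (\<Prod>k<n. \<Sum>s\<in>UNIV. \<Sum>t\<in>UNIV. g k (s, t))"
    by (rule sum_seqs_prod)
  also have "\<dots> = (\<Prod>k<n. \<Sum>s\<in>UNIV. g k s)"
    by (simp add: sum.cartesian_product)
  finally show ?thesis .
qed

lemma tensor_index_seqs: "tensor_index n (seqs n) (\<lambda>z. z)"
  by (simp add: tensor_index_def sum_seqs_prod)

definition zip_letters :: "(nat \<Rightarrow> 'a) \<times> (nat \<Rightarrow> 'b) \<Rightarrow> nat \<Rightarrow> 'a \<times> 'b" where
  "zip_letters = (\<lambda>(r, b) k. (r k, b k))"

lemma tensor_index_pairs:
  "tensor_index n (seqs n \<times> seqs n) (zip_letters :: _ \<Rightarrow> nat \<Rightarrow> 'a::finite \<times> 'b::finite)"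
  using sum_seqs_pair_prod[where 'c=complex and 'a='a and 'b='b and n=n]
  by (simp add: tensor_index_def zip_letters_def case_prod_beta)

lemma tensor_index_real:
  fixes g :: "nat \<Rightarrow> 's::finite \<Rightarrow> real"
  assumes "tensor_index n I cf"
  shows "(\<Sum>i\<in>I. \<Prod>k<n. g k (cf i k)) = (\<Prod>k<n. \<Sum>s\<in>UNIV. g k s)"
proof -
  have "complex_of_real (\<Sum>i\<in>I. \<Prod>k<n. g k (cf i k)) = (\<Sum>i\<in>I. \<Prod>k<n. (\<lambda>k s. complex_of_real (g k s)) k (cf i k))"
    by simp
  also have "\<dots> = (\<Prod>k<n. \<Sum>s\<in>UNIV. complex_of_real (g k s))"
    by (rule tensor_indexD[OF assms])
  also have "\<dots> = complex_of_real (\<Prod>k<n. \<Sum>s\<in>UNIV. g k s)" by simp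
  finally show ?thesis by (simp only: of_real_eq_iff)
qed

text \<open>The factors may depend on the position \<open>k\<close>, since a codeword state is the
  tensor product of the states of its letters.\<close>

definition tpow :: "('i \<Rightarrow> nat \<Rightarrow> 's) \<Rightarrow> nat \<Rightarrow> (nat \<Rightarrow> 's \<Rightarrow> 'k \<Rightarrow> complex) \<Rightarrow> 'i \<Rightarrow> (nat \<Rightarrow> 'k) \<Rightarrow> complex" where
  "tpow cf n U = (\<lambda>i z. \<Prod>k<n. U k (cf i k) (z k))"

lemma seqs_eq_iff: "z \<in> seqs n \<Longrightarrow> z' \<in> seqs n \<Longrightarrow> z = z' \<longleftrightarrow> (\<forall>k<n. z k = z' k)"
  unfolding seqs_def by (metis PiE_ext lessThan_iff)

lemma isom_tpow:
  fixes U :: "nat \<Rightarrow> 's::finite \<Rightarrow> 'k::finite \<Rightarrow> complex"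
  assumes "tensor_index n I cf" "\<And>k. k < n \<Longrightarrow> isom UNIV UNIV (U k)"
  shows "isom I (seqs n) (tpow cf n U)"
  unfolding isom_def op_eq_on_def
proof (intro ballI)
  fix z z' :: "nat \<Rightarrow> 'k" assume z: "z \<in> seqs n" "z' \<in> seqs n"
  have "(adj (tpow cf n U) \<star>\<^bsub>I\<^esub> tpow cf n U) z z' = (\<Sum>i\<in>I. \<Prod>k<n. cnj (U k (cf i k) (z k)) * U k (cf i k) (z' k))"
    by (simp add: mm_def adj_def tpow_def prod.distrib)
  also have "\<dots> = (\<Prod>k<n. \<Sum>s\<in>UNIV. cnj (U k s (z k)) * U k s (z' k))"
    by (rule tensor_indexD[OF assms(1), of "\<lambda>k s. cnj (U k s (z k)) * U k s (z' k)"])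
  also have "\<dots> = (\<Prod>k<n. if z k = z' k then 1 else 0)"
    using assms(2) by (intro prod.cong) (auto simp: isom_def op_eq_on_def mm_def adj_def op_id_def)
  also have "\<dots> = op_id z z'"
    using z by (auto simp: op_id_def seqs_eq_iff prod.neutral intro!: prod_zero)
  finally show "(adj (tpow cf n U) \<star>\<^bsub>I\<^esub> tpow cf n U) z z' = op_id z z'" .
qed

lemma spec_tpow:
  fixes U :: "nat \<Rightarrow> 's::finite \<Rightarrow> 'k::finite \<Rightarrow> complex"
  shows "spec (seqs n) (tpow cf n U) (\<lambda>z. \<Prod>k<n. d k (z k)) i j = (\<Prod>k<n. spec UNIV (U k) (d k) (cf i k) (cf j k))"
proof -
  have "spec (seqs n) (tpow cf n U) (\<lambda>z. \<Prod>k<n. d k (z k)) i j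
     = (\<Sum>z\<in>seqs n. \<Prod>k<n. (\<lambda>k s. U k (cf i k) s * complex_of_real (d k s) * cnj (U k (cf j k) s)) k (z k))"
    by (simp add: spec_def tpow_def prod.distrib)
  also have "\<dots> = (\<Prod>k<n. \<Sum>s\<in>UNIV. U k (cf i k) s * complex_of_real (d k s) * cnj (U k (cf j k) s))"
    by (rule sum_seqs_prod)
  finally show ?thesis by (simp only: spec_def)
qed

subsection \<open>Large deviations\<close>

text \<open>At t = 0 the sum is 1 and its derivative is the mean of \<open>g\<close> minus
  \<open>\<gamma>\<close>, which is negative.\<close>

lemma mgf_lt_1:
  fixes q g :: "'s \<Rightarrow> real"
  assumes "finite S" "(\<Sum>s\<in>S. q s) = 1" "(\<Sum>s\<in>S. q s * g s) < \<gamma>"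
  shows "\<exists>t>0. (\<Sum>s\<in>S. q s * exp (t * (g s - \<gamma>))) < 1"
proof -
  let ?f = "\<lambda>t. \<Sum>s\<in>S. q s * exp (t * (g s - \<gamma>))"
  have "(?f has_real_derivative (\<Sum>s\<in>S. q s * (exp (0 * (g s - \<gamma>)) * (g s - \<gamma>)))) (at 0)"
    by (intro DERIV_sum) (auto intro!: derivative_eq_intros)
  moreover have "(\<Sum>s\<in>S. q s * (exp (0 * (g s - \<gamma>)) * (g s - \<gamma>))) = (\<Sum>s\<in>S. q s * g s) - \<gamma> * (\<Sum>s\<in>S. q s)"
    by (simp add: algebra_simps sum_subtractf sum_distrib_left)
  ultimately have "(?f has_real_derivative ((\<Sum>s\<in>S. q s * g s) - \<gamma>)) (at 0)"
    using assms(2) by simp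
  from DERIV_neg_dec_right[OF this] assms(3)
  obtain h where h: "h > 0" "\<forall>x>0. x < h \<longrightarrow> ?f (0 + x) < ?f 0" by auto
  have "?f 0 = 1" using assms(2) by simp
  then have "?f (0 + h / 2) < 1" using h(2)[rule_format, of "h / 2"] h(1) by simp
  then show ?thesis using h(1) by (intro exI[of _ "h / 2"]) simp
qed

text \<open>Markov's inequality for the exponential, whose mean factorizes over the positions.
  \<open>\<theta>\<close> depends on the letter distribution only, so one rate serves every
  \<open>n\<close> and every index set.\<close>

lemma Chernoff:
  fixes q g :: "'s::finite \<Rightarrow> real"
  assumes q: "\<And>s. q s \<ge> 0" "(\<Sum>s\<in>UNIV. q s) = 1" and g: "(\<Sum>s\<in>UNIV. q s * g s) < \<gamma>"
  obtains \<theta> where "0 \<le> \<theta>" "\<theta> < 1"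
    "\<And>n (I :: 'i set) cf. tensor_index n I cf \<Longrightarrow>
       (\<Sum>i\<in>{i\<in>I. n * \<gamma> < (\<Sum>k<n. g (cf i k))}. \<Prod>k<n. q (cf i k)) \<le> \<theta> ^ n"
proof -
  obtain t where t: "t > 0" and th: "(\<Sum>s\<in>UNIV. q s * exp (t * (g s - \<gamma>))) < 1"
    using mgf_lt_1[OF finite_class.finite_UNIV q(2) g] by blast
  let ?\<theta> = "\<Sum>s\<in>UNIV. q s * exp (t * (g s - \<gamma>))"
  have "(\<Sum>i\<in>{i\<in>I. n * \<gamma> < (\<Sum>k<n. g (cf i k))}. \<Prod>k<n. q (cf i k)) \<le> ?\<theta> ^ n"
    if ti: "tensor_index n I cf" for n and I :: "'i set" and cf
  proof -
    have fin: "finite I" using ti by (simp add: tensor_index_def)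
    have "(\<Sum>i\<in>{i\<in>I. n * \<gamma> < (\<Sum>k<n. g (cf i k))}. \<Prod>k<n. q (cf i k))
        \<le> (\<Sum>i\<in>{i\<in>I. n * \<gamma> < (\<Sum>k<n. g (cf i k))}. \<Prod>k<n. q (cf i k) * exp (t * (g (cf i k) - \<gamma>)))"
    proof (intro sum_mono)
      fix i assume i: "i \<in> {i\<in>I. n * \<gamma> < (\<Sum>k<n. g (cf i k))}"
      have "(\<Prod>k<n. exp (t * (g (cf i k) - \<gamma>))) = exp (t * ((\<Sum>k<n. g (cf i k)) - n * \<gamma>))"
        by (simp add: exp_sum[symmetric] sum_distrib_left[symmetric] sum_subtractf)
      also have "\<dots> \<ge> 1" using i t by simp
      finally have "(\<Prod>k<n. q (cf i k)) * 1 \<le> (\<Prod>k<n. q (cf i k)) * (\<Prod>k<n. exp (t * (g (cf i k) - \<gamma>)))"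
        by (intro mult_left_mono prod_nonneg) (auto simp: q)
      then show "(\<Prod>k<n. q (cf i k)) \<le> (\<Prod>k<n. q (cf i k) * exp (t * (g (cf i k) - \<gamma>)))"
        by (simp add: prod.distrib)
    qed
    also have "\<dots> \<le> (\<Sum>i\<in>I. \<Prod>k<n. q (cf i k) * exp (t * (g (cf i k) - \<gamma>)))"
      using fin q by (intro sum_mono2) (auto intro!: prod_nonneg)
    also have "\<dots> = (\<Prod>k<n. \<Sum>s\<in>UNIV. q s * exp (t * (g s - \<gamma>)))"
      using tensor_index_real[OF ti, of "\<lambda>_ s. q s * exp (t * (g s - \<gamma>))"] by simp
    finally show ?thesis by simp
  qed
  moreover have "?\<theta> \<ge> 0" by (intro sum_nonneg) (simp add: q)
  ultimately show thesis using th that[of ?\<theta>] by blast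
qed

lemma log_prod:
  fixes h :: "nat \<Rightarrow> real"
  assumes "\<And>k. k < n \<Longrightarrow> h k > 0"
  shows "log 2 (\<Prod>k<n. h k) = (\<Sum>k<n. log 2 (h k))" "(\<Prod>k<n. h k) > 0"
proof -
  show "(\<Prod>k<n. h k) > 0" using assms by (intro prod_pos) auto
  show "log 2 (\<Prod>k<n. h k) = (\<Sum>k<n. log 2 (h k))"
    using assms
  proof (induction n)
    case (Suc n)
    have "(\<Prod>k<n. h k) > 0" "h n > 0" using Suc.prems by (auto intro: prod_pos)
    then have "log 2 ((\<Prod>k<n. h k) * h n) = log 2 (\<Prod>k<n. h k) + log 2 (h n)"
      by (simp add: log_mult_pos)
    then show ?case using Suc by simp
  qed simp
qed

lemma sum_le_included_support:
  fixes f :: "'i \<Rightarrow> real"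
  assumes "finite I" "\<And>i. A i \<Longrightarrow> f i \<noteq> 0 \<Longrightarrow> B i" "\<And>i. f i \<ge> 0"
  shows "(\<Sum>i\<in>{i\<in>I. A i}. f i) \<le> (\<Sum>i\<in>{i\<in>I. B i}. f i)"
proof -
  have "(\<Sum>i\<in>{i\<in>I. A i}. f i) = (\<Sum>i\<in>{i\<in>I. A i \<and> f i \<noteq> 0}. f i)"
    using assms(1) by (intro sum.mono_neutral_right) auto
  also have "\<dots> \<le> (\<Sum>i\<in>{i\<in>I. B i}. f i)"
    using assms by (intro sum_mono2) auto
  finally show ?thesis .
qed

text \<open>The weight outside the upper and lower typical sets, where letters of weight \<^term>\<open>q s\<close> carry
  the likelihood \<^term>\<open>h s\<close>. A letter with \<^term>\<open>h s = 0\<close> has weight 0, so that the convention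
  \<^term>\<open>log 2 0 = 0\<close> is harmless.\<close>

lemma typical_tails:
  fixes q h :: "'s::finite \<Rightarrow> real"
  assumes q: "\<And>s. q s \<ge> 0" "(\<Sum>s\<in>UNIV. q s) = 1" and h: "\<And>s. h s \<ge> 0" "\<forall>s. h s = 0 \<longrightarrow> q s = 0"
    and t: "t > 0"
  shows "(\<Sum>s\<in>UNIV. - (q s * log 2 (h s))) < \<gamma> \<Longrightarrow> \<exists>N. \<forall>n\<ge>N. \<forall>(I :: 'i set) cf. tensor_index n I cf \<longrightarrow>
       (\<Sum>i\<in>{i\<in>I. (\<Prod>k<n. h (cf i k)) < 2 powr (- (n * \<gamma>))}. \<Prod>k<n. q (cf i k)) \<le> t"
    and "(\<Sum>s\<in>UNIV. - (q s * log 2 (h s))) > \<gamma> \<Longrightarrow> \<exists>N. \<forall>n\<ge>N. \<forall>(I :: 'i set) cf. tensor_index n I cf \<longrightarrow>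
       (\<Sum>i\<in>{i\<in>I. (\<Prod>k<n. h (cf i k)) > 2 powr (- (n * \<gamma>))}. \<Prod>k<n. q (cf i k)) \<le> t"
proof -
  have ev: "\<exists>N. \<forall>n\<ge>N. \<theta> ^ n \<le> t" if "0 \<le> \<theta>" "\<theta> < 1" for \<theta> :: real
  proof -
    have "(\<lambda>n. \<theta> ^ n) \<longlonglongrightarrow> 0" using that by (intro LIMSEQ_realpow_zero)
    then have "\<forall>\<^sub>F n in sequentially. \<theta> ^ n < t" using t by (rule order_tendstoD)
    then show ?thesis unfolding eventually_sequentially by (meson less_imp_le)
  qed
  \<comment> \<open>On the support of the weights all likelihoods are positive, so the logarithm of
    their product is the sum of the logarithms.\<close>
  have posh: "h (cf i k) > 0" if "(\<Prod>k<n. q (cf i k)) \<noteq> 0" "k < n" for n k :: nat and i :: 'i and cf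
  proof -
    have "q (cf i k) \<noteq> 0"
    proof
      assume "q (cf i k) = 0"
      then have "\<exists>a\<in>{..<n}. q (cf i a) = 0" using that(2) by auto
      then show False using that(1) prod_zero[OF finite_lessThan] by simp
    qed
    then show ?thesis using h(1)[of "cf i k"] h(2) by (auto simp: less_le)
  qed
  {
    assume "(\<Sum>s\<in>UNIV. - (q s * log 2 (h s))) < \<gamma>"
    then have "(\<Sum>s\<in>UNIV. q s * (- log 2 (h s))) < \<gamma>" by simp
    then obtain \<theta> where \<theta>: "0 \<le> \<theta>" "\<theta> < 1"
      "\<And>n (I :: 'i set) cf. tensor_index n I cf \<Longrightarrow>
       (\<Sum>i\<in>{i\<in>I. n * \<gamma> < (\<Sum>k<n. - log 2 (h (cf i k)))}. \<Prod>k<n. q (cf i k)) \<le> \<theta> ^ n"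
      by (rule Chernoff[OF q, where 'i='i]) blast
    obtain N where N: "\<forall>n\<ge>N. \<theta> ^ n \<le> t" using ev[OF \<theta>(1,2)] by blast
    show "\<exists>N. \<forall>n\<ge>N. \<forall>(I :: 'i set) cf. tensor_index n I cf \<longrightarrow>
       (\<Sum>i\<in>{i\<in>I. (\<Prod>k<n. h (cf i k)) < 2 powr (- (n * \<gamma>))}. \<Prod>k<n. q (cf i k)) \<le> t"
    proof (intro exI[of _ N] allI impI)
      fix n and I :: "'i set" and cf :: "'i \<Rightarrow> nat \<Rightarrow> 's" assume n: "n \<ge> N" and ti: "tensor_index n I cf"
      have fin: "finite I" using ti by (simp add: tensor_index_def)
      have "(\<Sum>i\<in>{i\<in>I. (\<Prod>k<n. h (cf i k)) < 2 powr (- (n * \<gamma>))}. \<Prod>k<n. q (cf i k))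
         \<le> (\<Sum>i\<in>{i\<in>I. n * \<gamma> < (\<Sum>k<n. - log 2 (h (cf i k)))}. \<Prod>k<n. q (cf i k))"
      proof (rule sum_le_included_support[OF fin])
        fix i assume i: "(\<Prod>k<n. h (cf i k)) < 2 powr (- (n * \<gamma>))" "(\<Prod>k<n. q (cf i k)) \<noteq> 0"
        note lp = log_prod[of n "\<lambda>k. h (cf i k)", OF posh[where n=n and i=i and cf=cf, OF i(2)]]
        have "log 2 (\<Prod>k<n. h (cf i k)) < - (n * \<gamma>)" using i(1) lp(2) by (simp add: log_less_iff)
        then show "n * \<gamma> < (\<Sum>k<n. - log 2 (h (cf i k)))" using lp(1) by (simp add: sum_negf)
      qed (auto intro!: prod_nonneg q)
      then show "(\<Sum>i\<in>{i\<in>I. (\<Prod>k<n. h (cf i k)) < 2 powr (- (n * \<gamma>))}. \<Prod>k<n. q (cf i k)) \<le> t"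
        using \<theta>(3)[OF ti] N n by force
    qed
  }
  {
    assume "(\<Sum>s\<in>UNIV. - (q s * log 2 (h s))) > \<gamma>"
    then have "(\<Sum>s\<in>UNIV. q s * log 2 (h s)) < - \<gamma>" by (simp add: sum_negf)
    then obtain \<theta> where \<theta>: "0 \<le> \<theta>" "\<theta> < 1"
      "\<And>n (I :: 'i set) cf. tensor_index n I cf \<Longrightarrow>
       (\<Sum>i\<in>{i\<in>I. n * - \<gamma> < (\<Sum>k<n. log 2 (h (cf i k)))}. \<Prod>k<n. q (cf i k)) \<le> \<theta> ^ n"
      by (rule Chernoff[OF q, where 'i='i]) blast
    obtain N where N: "\<forall>n\<ge>N. \<theta> ^ n \<le> t" using ev[OF \<theta>(1,2)] by blast
    show "\<exists>N. \<forall>n\<ge>N. \<forall>(I :: 'i set) cf. tensor_index n I cf \<longrightarrow>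
       (\<Sum>i\<in>{i\<in>I. (\<Prod>k<n. h (cf i k)) > 2 powr (- (n * \<gamma>))}. \<Prod>k<n. q (cf i k)) \<le> t"
    proof (intro exI[of _ N] allI impI)
      fix n and I :: "'i set" and cf :: "'i \<Rightarrow> nat \<Rightarrow> 's" assume n: "n \<ge> N" and ti: "tensor_index n I cf"
      have fin: "finite I" using ti by (simp add: tensor_index_def)
      have "(\<Sum>i\<in>{i\<in>I. (\<Prod>k<n. h (cf i k)) > 2 powr (- (n * \<gamma>))}. \<Prod>k<n. q (cf i k))
         \<le> (\<Sum>i\<in>{i\<in>I. n * - \<gamma> < (\<Sum>k<n. log 2 (h (cf i k)))}. \<Prod>k<n. q (cf i k))"
      proof (rule sum_le_included_support[OF fin])
        fix i assume i: "(\<Prod>k<n. h (cf i k)) > 2 powr (- (n * \<gamma>))" "(\<Prod>k<n. q (cf i k)) \<noteq> 0"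
        note lp = log_prod[of n "\<lambda>k. h (cf i k)", OF posh[where n=n and i=i and cf=cf, OF i(2)]]
        have "log 2 (\<Prod>k<n. h (cf i k)) > - (n * \<gamma>)" using i(1) lp(2) by (simp add: less_log_iff)
        then show "n * - \<gamma> < (\<Sum>k<n. log 2 (h (cf i k)))" using lp(1) by simp
      qed (auto intro!: prod_nonneg q)
      then show "(\<Sum>i\<in>{i\<in>I. (\<Prod>k<n. h (cf i k)) > 2 powr (- (n * \<gamma>))}. \<Prod>k<n. q (cf i k)) \<le> t"
        using \<theta>(3)[OF ti] N n by force
    qed
  }
qed

text \<open>Each counted index carries weight at least \<open>2 powr (- c)\<close> out of a total of
  at most 1.\<close>

lemma card_typical_le:
  fixes f :: "'i \<Rightarrow> real"
  assumes "finite I" "\<And>i. i \<in> I \<Longrightarrow> f i \<ge> 0" "(\<Sum>i\<in>I. f i) \<le> 1"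
  shows "real (card {i\<in>I. 2 powr (- c) \<le> f i}) \<le> 2 powr c"
proof -
  let ?A = "{i\<in>I. 2 powr (- c) \<le> f i}"
  have "real (card ?A) * 2 powr (- c) \<le> (\<Sum>i\<in>?A. f i)"
    using sum_mono[of ?A "\<lambda>_. 2 powr (- c)" f] by simp
  also have "\<dots> \<le> (\<Sum>i\<in>I. f i)" using assms by (intro sum_mono2) auto
  finally have "real (card ?A) * 2 powr (- c) * 2 powr c \<le> 1 * 2 powr c"
    using assms(3) by (intro mult_right_mono) auto
  then show ?thesis by (simp add: powr_minus field_simps)
qed

subsection \<open>Spectral projections\<close>

lemma proj_spec: "u \<star>\<^bsub>Z\<^esub> adj u = spec Z u (\<lambda>_. 1)"
  by (simp add: spec_mm)

lemma hs_proj_mm: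
  assumes "isom I Zg u" "finite Zg"
  shows "complex_of_real (hs I Y ((u \<star>\<^bsub>Zg\<^esub> adj u) \<star>\<^bsub>I\<^esub> M)) = tr I ((u \<star>\<^bsub>Zg\<^esub> adj u) \<star>\<^bsub>I\<^esub> M \<star>\<^bsub>Y\<^esub> adj M)"
proof -
  have P: "projn I (u \<star>\<^bsub>Zg\<^esub> adj u)" by (rule projn_isom[OF assms])
  let ?P = "u \<star>\<^bsub>Zg\<^esub> adj u"
  have a: "adj ?P = ?P" by simp
  have "complex_of_real (hs I Y (?P \<star>\<^bsub>I\<^esub> M)) = tr Y (adj M \<star>\<^bsub>I\<^esub> (?P \<star>\<^bsub>I\<^esub> ?P \<star>\<^bsub>I\<^esub> M))"
    unfolding hs_tr[symmetric] by simp
  also have "\<dots> = tr Y (adj M \<star>\<^bsub>I\<^esub> (?P \<star>\<^bsub>I\<^esub> M))"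
    by (simp only: projn_mm[OF P])
  also have "\<dots> = tr I ((?P \<star>\<^bsub>I\<^esub> M) \<star>\<^bsub>Y\<^esub> adj M)" by (rule tr_mm_commute)
  finally show ?thesis by simp
qed

text \<open>By linearity the average weight inside the projection is its trace against the mixture,
  which is the sum of the retained eigenvalues; the single states need not commute with the
  projection.\<close>

lemma mixture_outside_projection:
  fixes G :: "'x \<Rightarrow> 'i \<Rightarrow> 'y \<Rightarrow> complex" and p :: "'x \<Rightarrow> real"
  assumes fin: "finite Z" "finite X" and u: "isom I Z u" and Zg: "Zg \<subseteq> Z"
    and mix: "op_eq_on I (\<Sum>x\<in>X. smul (complex_of_real (p x)) (G x \<star>\<^bsub>Y\<^esub> adj (G x))) (spec Z u e)"
    and hsG: "\<And>x. x \<in> X \<Longrightarrow> hs I Y (G x) = 1" and p: "(\<Sum>x\<in>X. p x) = 1" and e: "(\<Sum>z\<in>Z. e z) = 1"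
  shows "(\<Sum>x\<in>X. p x * hs I Y (G x - (u \<star>\<^bsub>Zg\<^esub> adj u) \<star>\<^bsub>I\<^esub> G x)) = (\<Sum>z\<in>Z - Zg. e z)"
proof -
  have uZ: "isom I Zg u" by (rule isom_mono[OF u Zg])
  have finZ: "finite Zg" using fin Zg finite_subset by blast
  let ?P = "u \<star>\<^bsub>Zg\<^esub> adj u"
  have "complex_of_real (\<Sum>x\<in>X. p x * hs I Y (?P \<star>\<^bsub>I\<^esub> G x)) = tr I (?P \<star>\<^bsub>I\<^esub> (\<Sum>x\<in>X. smul (complex_of_real (p x)) (G x \<star>\<^bsub>Y\<^esub> adj (G x))))"
    unfolding of_real_sum of_real_mult hs_proj_mm[OF uZ finZ] mm_sum_right tr_sum mm_smul_right tr_smul ..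
  also have "\<dots> = tr I (?P \<star>\<^bsub>I\<^esub> spec Z u e)"
    by (intro op_eq_on_tr op_eq_on_mm op_eq_on_refl mix)
  also have "\<dots> = (\<Sum>z\<in>Zg. (adj u \<star>\<^bsub>I\<^esub> spec Z u e \<star>\<^bsub>I\<^esub> u) z z)"
    unfolding proj_spec tr_spec_mm by simp
  also have "\<dots> = (\<Sum>z\<in>Zg. complex_of_real (e z))"
    using Zg by (intro sum.cong refl spec_diag[OF u fin(1)]) auto
  finally have *: "(\<Sum>x\<in>X. p x * hs I Y (?P \<star>\<^bsub>I\<^esub> G x)) = (\<Sum>z\<in>Zg. e z)"
    by (metis of_real_eq_iff of_real_sum)
  have "(\<Sum>x\<in>X. p x * hs I Y (G x - ?P \<star>\<^bsub>I\<^esub> G x)) = (\<Sum>x\<in>X. p x * (1 - hs I Y (?P \<star>\<^bsub>I\<^esub> G x)))"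
    by (intro sum.cong refl) (simp only: hs_projn[OF projn_isom[OF uZ finZ]] hsG)
  also have "\<dots> = (\<Sum>z\<in>Z. e z) - (\<Sum>z\<in>Zg. e z)"
    using * p e by (simp only: right_diff_distrib sum_subtractf mult_1_right)
  also have "\<dots> = (\<Sum>z\<in>Z - Zg. e z)" using sum_diff[OF fin(1) Zg, of e] by simp
  finally show ?thesis .
qed

text \<open>Operator norm times rank bounds the trace, with no relation between the two
  eigenbases.\<close>

lemma tr_proj_spec_le:
  assumes w: "isom I Zq w" "finite Zq" and u: "isom I Z u" "finite Z"
    and e: "\<And>z. z \<in> Z \<Longrightarrow> 0 \<le> e z" "\<And>z. z \<in> Z \<Longrightarrow> e z \<le> \<beta>" and b: "\<beta> \<ge> 0"
  shows "Re (tr I ((w \<star>\<^bsub>Zq\<^esub> adj w) \<star>\<^bsub>I\<^esub> spec Z u e)) \<le> \<beta> * card Zq"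
proof -
  have col: "(adj u \<star>\<^bsub>I\<^esub> (w \<star>\<^bsub>Zq\<^esub> adj w) \<star>\<^bsub>I\<^esub> u) z z = complex_of_real (\<Sum>y\<in>Zq. (cmod ((adj w \<star>\<^bsub>I\<^esub> u) y z))\<^sup>2)" for z
  proof -
    have "adj u \<star>\<^bsub>I\<^esub> (w \<star>\<^bsub>Zq\<^esub> adj w) \<star>\<^bsub>I\<^esub> u = adj (adj w \<star>\<^bsub>I\<^esub> u) \<star>\<^bsub>Zq\<^esub> (adj w \<star>\<^bsub>I\<^esub> u)" by simp
    then have "(adj u \<star>\<^bsub>I\<^esub> (w \<star>\<^bsub>Zq\<^esub> adj w) \<star>\<^bsub>I\<^esub> u) z z = (\<Sum>y\<in>Zq. cnj ((adj w \<star>\<^bsub>I\<^esub> u) y z) * (adj w \<star>\<^bsub>I\<^esub> u) y z)"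
      by (simp only: mm_def[of _ Zq] adj_def[of "adj w \<star>\<^bsub>I\<^esub> u"])
    then show ?thesis by (simp only: of_real_sum complex_norm_square mult.commute)
  qed
  have "tr I ((w \<star>\<^bsub>Zq\<^esub> adj w) \<star>\<^bsub>I\<^esub> spec Z u e) = tr I (spec Z u e \<star>\<^bsub>I\<^esub> (w \<star>\<^bsub>Zq\<^esub> adj w))"
    by (rule tr_mm_commute)
  also have "\<dots> = complex_of_real (\<Sum>z\<in>Z. e z * (\<Sum>y\<in>Zq. (cmod ((adj w \<star>\<^bsub>I\<^esub> u) y z))\<^sup>2))"
    unfolding tr_spec_mm col of_real_sum of_real_mult ..
  finally have "Re (tr I ((w \<star>\<^bsub>Zq\<^esub> adj w) \<star>\<^bsub>I\<^esub> spec Z u e)) = (\<Sum>z\<in>Z. e z * (\<Sum>y\<in>Zq. (cmod ((adj w \<star>\<^bsub>I\<^esub> u) y z))\<^sup>2))"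
    by (simp only: Re_complex_of_real)
  also have "\<dots> \<le> (\<Sum>z\<in>Z. \<beta> * (\<Sum>y\<in>Zq. (cmod ((adj w \<star>\<^bsub>I\<^esub> u) y z))\<^sup>2))"
    using e by (intro sum_mono mult_right_mono sum_nonneg) auto
  also have "\<dots> = \<beta> * hs Zq Z (adj w \<star>\<^bsub>I\<^esub> u)"
    unfolding hs_def sum_distrib_left[symmetric] by (subst sum.swap) simp
  also have "\<dots> \<le> \<beta> * card Zq"
  proof -
    have "hs Zq Z (adj w \<star>\<^bsub>I\<^esub> u) = hs Z Zq (adj u \<star>\<^bsub>I\<^esub> w)"
      by (subst hs_adj[symmetric]) simp
    also have "\<dots> \<le> hs I Zq w" by (intro hs_contr contr_adj contr_isom u)
    also have "\<dots> = card Zq" by (rule hs_self_isom[OF w])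
    finally show ?thesis using b by (rule mult_left_mono)
  qed
  finally show ?thesis .
qed

section \<open>Products with eigenvector factors\<close>

lemma eq_ReI: "complex_of_real a = z \<Longrightarrow> a = Re z"
  by auto

lemma spec_subset:
  assumes "finite Z" "Zg \<subseteq> Z"
  shows "spec Zg u d = spec Z u (\<lambda>z. if z \<in> Zg then d z else 0)"
  unfolding spec_def using assms by (intro ext sum.mono_neutral_cong_left) auto

lemma hs_root_factor:
  assumes "isom I Z u" "\<And>z. z \<in> Z \<Longrightarrow> d z \<ge> 0"
  shows "hs I Z (root_factor u d) = (\<Sum>z\<in>Z. d z)"
proof -
  have "complex_of_real (hs I Z (root_factor u d)) = tr I (spec Z u d)"
    unfolding hs_tr'[symmetric] by (subst spec_gram) (simp_all add: assms(2))
  also have "\<dots> = complex_of_real (\<Sum>z\<in>Z. d z)" unfolding tr_spec[OF assms(1)] by simp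
  finally show ?thesis by (simp only: of_real_eq_iff)
qed

lemma mm_root_factor: "(M \<star>\<^bsub>I\<^esub> root_factor u d) i z = (M \<star>\<^bsub>I\<^esub> u) i z * complex_of_real (sqrt (d z))"
  by (simp add: mm_def root_factor_def sum_distrib_right mult.assoc)

lemma hs_mm_root_factor:
  assumes "\<And>z. z \<in> Z \<Longrightarrow> d z \<ge> 0"
  shows "hs K Z (M \<star>\<^bsub>I\<^esub> root_factor u d) = (\<Sum>z\<in>Z. d z * (\<Sum>i\<in>K. (cmod ((M \<star>\<^bsub>I\<^esub> u) i z))\<^sup>2))"
proof -
  have "hs K Z (M \<star>\<^bsub>I\<^esub> root_factor u d) = (\<Sum>i\<in>K. \<Sum>z\<in>Z. d z * (cmod ((M \<star>\<^bsub>I\<^esub> u) i z))\<^sup>2)"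
    unfolding hs_def mm_root_factor using assms
    by (intro sum.cong refl) (simp add: norm_mult power_mult_distrib)
  also have "\<dots> = (\<Sum>z\<in>Z. d z * (\<Sum>i\<in>K. (cmod ((M \<star>\<^bsub>I\<^esub> u) i z))\<^sup>2))"
    by (subst sum.swap) (simp add: sum_distrib_left)
  finally show ?thesis .
qed

lemma hs_mm_isom_right:
  assumes "isom I Z u" "finite Z"
  shows "hs K Z (M \<star>\<^bsub>I\<^esub> u) \<le> hs K I M"
proof -
  have "hs K Z (M \<star>\<^bsub>I\<^esub> u) = hs Z K (adj u \<star>\<^bsub>I\<^esub> adj M)" by (subst hs_adj[symmetric]) simp
  also have "\<dots> \<le> hs I K (adj M)" by (intro hs_contr contr_adj contr_isom assms)
  finally show ?thesis by simp
qed

lemma hs_mm_isom_adj_right: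
  assumes "isom I Z u" "finite Z"
  shows "hs K I (M \<star>\<^bsub>Z\<^esub> adj u) = hs K Z M"
proof -
  have "hs K I (M \<star>\<^bsub>Z\<^esub> adj u) = hs I K (u \<star>\<^bsub>Z\<^esub> adj M)" by (subst hs_adj[symmetric]) simp
  also have "\<dots> = hs Z K (adj M)" by (rule hs_isom[OF assms])
  finally show ?thesis by simp
qed

definition trR :: "('r::finite \<times> 'b) op \<Rightarrow> 'b op" where
  "trR M = (\<lambda>b b'. \<Sum>r\<in>UNIV. M (r, b) (r, b'))"

subsection \<open>Tensor powers of a classical-quantum ensemble\<close>

text \<open>Spectral decompositions of the single-letter states whose entropies make up the rate:
  the posterior states, their B marginals, and the averages of both. Fixing them once gives explicit
  decompositions of the n-letter states as tensor powers.\<close>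

locale letter_spectra =
  fixes P :: "'x::finite \<Rightarrow> real" and W :: "'x \<Rightarrow> ('r::finite \<times> 'b::finite) op"
    and U :: "'x \<Rightarrow> 'r \<times> 'b \<Rightarrow> 'k::finite \<Rightarrow> complex" and d :: "'x \<Rightarrow> 'k \<Rightarrow> real"
    and UB :: "'x \<Rightarrow> 'b \<Rightarrow> 'l::finite \<Rightarrow> complex" and dB :: "'x \<Rightarrow> 'l \<Rightarrow> real"
    and V :: "'r \<times> 'b \<Rightarrow> 'm::finite \<Rightarrow> complex" and e :: "'m \<Rightarrow> real"
    and VB :: "'b \<Rightarrow> 'o::finite \<Rightarrow> complex" and eB :: "'o \<Rightarrow> real"
  assumes P0: "\<And>x. P x \<ge> 0" and P1: "(\<Sum>x\<in>UNIV. P x) = 1"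
    and U: "\<And>x. isom UNIV UNIV (U x)" and W: "\<And>x. W x = spec UNIV (U x) (d x)"
    and d0: "\<And>x k. d x k \<ge> 0" and d1: "\<And>x. (\<Sum>k\<in>UNIV. d x k) = 1"
    and UB: "\<And>x. isom UNIV UNIV (UB x)" and WB: "\<And>x. trR (W x) = spec UNIV (UB x) (dB x)"
    and dB0: "\<And>x k. dB x k \<ge> 0" and dB1: "\<And>x. (\<Sum>k\<in>UNIV. dB x k) = 1"
    and V: "isom UNIV UNIV V" and mix: "\<And>u v. (\<Sum>x\<in>UNIV. complex_of_real (P x) * W x u v) = spec UNIV V e u v"
    and e0: "\<And>k. e k \<ge> 0" and e1: "(\<Sum>k\<in>UNIV. e k) = 1"
    and VB: "isom UNIV UNIV VB" and mixB: "\<And>u v. (\<Sum>x\<in>UNIV. complex_of_real (P x) * trR (W x) u v) = spec UNIV VB eB u v"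
    and eB0: "\<And>k. eB k \<ge> 0" and eB1: "(\<Sum>k\<in>UNIV. eB k) = 1"
begin

definition pn :: "nat \<Rightarrow> (nat \<Rightarrow> 'x) \<Rightarrow> real" where "pn n x = (\<Prod>k<n. P (x k))"
definition Uc where "Uc n x = tpow zip_letters n (\<lambda>k. U (x k))"
definition dn :: "nat \<Rightarrow> (nat \<Rightarrow> 'x) \<Rightarrow> (nat \<Rightarrow> 'k) \<Rightarrow> real" where "dn n x z = (\<Prod>k<n. d (x k) (z k))"
definition Gn where "Gn n x = root_factor (Uc n x) (dn n x)"
definition Vn where "Vn n = tpow zip_letters n (\<lambda>_. V)"
definition en :: "nat \<Rightarrow> (nat \<Rightarrow> 'm) \<Rightarrow> real" where "en n z = (\<Prod>k<n. e (z k))"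
definition UBn where "UBn n x = tpow (\<lambda>z. z) n (\<lambda>k. UB (x k))"
definition dBn :: "nat \<Rightarrow> (nat \<Rightarrow> 'x) \<Rightarrow> (nat \<Rightarrow> 'l) \<Rightarrow> real" where "dBn n x z = (\<Prod>k<n. dB (x k) (z k))"
definition VBn where "VBn n = tpow (\<lambda>z. z) n (\<lambda>_. VB)"
definition eBn :: "nat \<Rightarrow> (nat \<Rightarrow> 'o) \<Rightarrow> real" where "eBn n z = (\<Prod>k<n. eB (z k))"

abbreviation J :: "nat \<Rightarrow> ((nat \<Rightarrow> 'r) \<times> (nat \<Rightarrow> 'b)) set" where "J n \<equiv> seqs n \<times> seqs n"

lemma isoms: "isom (J n) (seqs n) (Uc n x)" "isom (J n) (seqs n) (Vn n)"
    "isom (seqs n) (seqs n) (UBn n x)" "isom (seqs n) (seqs n) (VBn n)"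
  unfolding Uc_def Vn_def UBn_def VBn_def
  by (intro isom_tpow tensor_index_pairs tensor_index_seqs U V UB VB)+

lemma nonneg: "pn n x \<ge> 0" "dn n x z \<ge> 0" "en n y \<ge> 0" "dBn n x v \<ge> 0" "eBn n w \<ge> 0"
  by (simp_all add: pn_def dn_def en_def dBn_def eBn_def prod_nonneg P0 d0 e0 dB0 eB0)

lemma sums_1: "(\<Sum>x\<in>seqs n. pn n x) = 1" "(\<Sum>z\<in>seqs n. dn n x z) = 1" "(\<Sum>z\<in>seqs n. en n z) = 1"
    "(\<Sum>z\<in>seqs n. dBn n x z) = 1" "(\<Sum>z\<in>seqs n. eBn n z) = 1"
  unfolding pn_def dn_def en_def dBn_def eBn_def
  using sum_seqs_prod[where n=n and g="\<lambda>_. P"] sum_seqs_prod[where n=n and g="\<lambda>k. d (x k)"] sum_seqs_prod[where n=n and g="\<lambda>_. e"]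
    sum_seqs_prod[where n=n and g="\<lambda>k. dB (x k)"] sum_seqs_prod[where n=n and g="\<lambda>_. eB"]
  by (simp_all add: P1 d1 e1 dB1 eB1)

lemma W_pow_zip: "W_pow W n x i j = (\<Prod>k<n. W (x k) (zip_letters i k) (zip_letters j k))"
  by (simp add: W_pow_def zip_letters_def case_prod_beta)

lemma spec_Uc: "spec (seqs n) (Uc n x) (dn n x) = W_pow W n x"
  unfolding Uc_def dn_def by (intro ext) (simp only: spec_tpow[where d="\<lambda>k. d (x k)"] W_pow_zip W)

lemma Gn_gram: "Gn n x \<star>\<^bsub>seqs n\<^esub> adj (Gn n x) = W_pow W n x"
  unfolding Gn_def by (subst spec_gram[symmetric]) (simp_all add: nonneg spec_Uc)

lemma hs_Gn: "hs (J n) (seqs n) (Gn n x) = 1"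
  unfolding Gn_def by (subst hs_root_factor[OF isoms(1)]) (simp_all add: nonneg sums_1)

lemma mixture_n: "(\<Sum>x\<in>seqs n. smul (complex_of_real (pn n x)) (W_pow W n x)) = spec (seqs n) (Vn n) (en n)"
proof (intro ext)
  fix i j
  have "(\<Sum>x\<in>seqs n. smul (complex_of_real (pn n x)) (W_pow W n x)) i j
     = (\<Sum>x\<in>seqs n. \<Prod>k<n. (\<lambda>k s. complex_of_real (P s) * W s (zip_letters i k) (zip_letters j k)) k (x k))"
    by (simp add: sum_fun_apply W_pow_zip pn_def prod.distrib)
  also have "\<dots> = (\<Prod>k<n. \<Sum>s\<in>UNIV. complex_of_real (P s) * W s (zip_letters i k) (zip_letters j k))"
    by (rule sum_seqs_prod)
  also have "\<dots> = spec (seqs n) (Vn n) (en n) i j"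
    unfolding mix Vn_def en_def by (simp only: spec_tpow[where d="\<lambda>_. e"])
  finally show "(\<Sum>x\<in>seqs n. smul (complex_of_real (pn n x)) (W_pow W n x)) i j = spec (seqs n) (Vn n) (en n) i j" .
qed

lemma red_gram: "(red M \<star>\<^bsub>seqs n \<times> Z\<^esub> adj (red M)) b b' = (\<Sum>r\<in>seqs n. (M \<star>\<^bsub>Z\<^esub> adj M) (r, b) (r, b'))"
  by (simp add: mm_def adj_def red_def sum.cartesian_product case_prod_beta)

lemma red_Gn_gram: "red (Gn n x) \<star>\<^bsub>seqs n \<times> seqs n\<^esub> adj (red (Gn n x)) = spec (seqs n) (UBn n x) (dBn n x)"
proof (intro ext)
  fix b b'
  have "(red (Gn n x) \<star>\<^bsub>seqs n \<times> seqs n\<^esub> adj (red (Gn n x))) b b'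
     = (\<Sum>r\<in>seqs n. \<Prod>k<n. (\<lambda>k s. W (x k) (s, b k) (s, b' k)) k (r k))"
    unfolding red_gram Gn_gram by (simp add: W_pow_def)
  also have "\<dots> = (\<Prod>k<n. \<Sum>s\<in>UNIV. W (x k) (s, b k) (s, b' k))"
    by (rule sum_seqs_prod)
  also have "\<dots> = (\<Prod>k<n. spec UNIV (UB (x k)) (dB (x k)) (b k) (b' k))"
    unfolding WB[symmetric] trR_def ..
  also have "\<dots> = spec (seqs n) (UBn n x) (dBn n x) b b'"
    unfolding UBn_def dBn_def by (simp only: spec_tpow[where d="\<lambda>k. dB (x k)"])
  finally show "(red (Gn n x) \<star>\<^bsub>seqs n \<times> seqs n\<^esub> adj (red (Gn n x))) b b' = spec (seqs n) (UBn n x) (dBn n x) b b'" .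
qed

lemma mixture_B_n:
  "(\<Sum>x\<in>seqs n. smul (complex_of_real (pn n x)) (red (Gn n x) \<star>\<^bsub>seqs n \<times> seqs n\<^esub> adj (red (Gn n x)))) = spec (seqs n) (VBn n) (eBn n)"
proof (intro ext)
  fix i j
  have "spec (seqs n) (UBn n x) (dBn n x) i j = (\<Prod>k<n. trR (W (x k)) (i k) (j k))" for x
    unfolding UBn_def dBn_def WB by (simp only: spec_tpow[where d="\<lambda>k. dB (x k)"])
  then have "(\<Sum>x\<in>seqs n. smul (complex_of_real (pn n x)) (red (Gn n x) \<star>\<^bsub>seqs n \<times> seqs n\<^esub> adj (red (Gn n x)))) i j
     = (\<Sum>x\<in>seqs n. \<Prod>k<n. (\<lambda>k s. complex_of_real (P s) * trR (W s) (i k) (j k)) k (x k))"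
    by (simp add: sum_fun_apply red_Gn_gram pn_def prod.distrib)
  also have "\<dots> = (\<Prod>k<n. \<Sum>s\<in>UNIV. complex_of_real (P s) * trR (W s) (i k) (j k))"
    by (rule sum_seqs_prod)
  also have "\<dots> = spec (seqs n) (VBn n) (eBn n) i j"
    unfolding mixB VBn_def eBn_def by (simp only: spec_tpow[where d="\<lambda>_. eB"])
  finally show "(\<Sum>x\<in>seqs n. smul (complex_of_real (pn n x)) (red (Gn n x) \<star>\<^bsub>seqs n \<times> seqs n\<^esub> adj (red (Gn n x)))) i j
     = spec (seqs n) (VBn n) (eBn n) i j" .
qed

text \<open>Large eigenvalues are kept for the mixture on \<open>RB\<close> (\<open>Zg\<close>) and the codeword states on \<open>B\<close>
  (\<open>ZQ\<close>), where ranks have to be bounded; small ones for the codeword states on \<open>RB\<close> (\<open>small\<close>) and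
  the mixture on \<open>B\<close> (\<open>ZB\<close>), where operator norms have to be bounded.\<close>

definition Zg :: "nat \<Rightarrow> real \<Rightarrow> (nat \<Rightarrow> 'm) set" where "Zg n g = {z \<in> seqs n. 2 powr (- (n * g)) \<le> en n z}"
definition small :: "nat \<Rightarrow> real \<Rightarrow> (nat \<Rightarrow> 'x) \<Rightarrow> (nat \<Rightarrow> 'k) \<Rightarrow> bool" where "small n g x z \<longleftrightarrow> dn n x z \<le> 2 powr (- (n * g))"
definition ZB :: "nat \<Rightarrow> real \<Rightarrow> (nat \<Rightarrow> 'o) set" where "ZB n g = {z \<in> seqs n. eBn n z \<le> 2 powr (- (n * g))}"
definition ZQ :: "nat \<Rightarrow> real \<Rightarrow> (nat \<Rightarrow> 'x) \<Rightarrow> (nat \<Rightarrow> 'l) set" where "ZQ n g x = {z \<in> seqs n. 2 powr (- (n * g)) \<le> dBn n x z}"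

definition Pn where "Pn n g = Vn n \<star>\<^bsub>Zg n g\<^esub> adj (Vn n)"
definition PBn where "PBn n g = VBn n \<star>\<^bsub>ZB n g\<^esub> adj (VBn n)"
definition QBn where "QBn n g x = UBn n x \<star>\<^bsub>ZQ n g x\<^esub> adj (UBn n x)"
text \<open>\<open>Ln\<close> and \<open>Hn\<close> consist of complementary columns of the factor
  \<open>Gn\<close>, so their mixed products over the column index vanish, and the codeword state is
  \<open>Tn\<close>, the Gram matrix of \<open>Ln\<close>, plus that of \<open>Hn\<close>.\<close>

definition Tn where "Tn n g x = spec (seqs n) (Uc n x) (\<lambda>z. if small n g x z then dn n x z else 0)"
definition Ln where "Ln n g x = root_factor (Uc n x) (\<lambda>z. if small n g x z then dn n x z else 0)"
definition Hn where "Hn n g x = root_factor (Uc n x) (\<lambda>z. if small n g x z then 0 else dn n x z)"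

lemma finite_Z [simp]: "finite (Zg n g)" "finite (ZB n g)" "finite (ZQ n g x)"
  by (simp_all add: Zg_def ZB_def ZQ_def)

lemma sub_Z: "Zg n g \<subseteq> seqs n" "ZB n g \<subseteq> seqs n" "ZQ n g x \<subseteq> seqs n"
  by (auto simp: Zg_def ZB_def ZQ_def)

lemma isoms_Z: "isom (J n) (Zg n g) (Vn n)" "isom (seqs n) (ZB n g) (VBn n)" "isom (seqs n) (ZQ n g x) (UBn n x)"
  by (rule isom_mono[OF isoms(2) sub_Z(1)] isom_mono[OF isoms(4) sub_Z(2)] isom_mono[OF isoms(3) sub_Z(3)])+

lemma projns: "projn (J n) (Pn n g)" "projn (seqs n) (PBn n g)" "projn (seqs n) (QBn n g x)"
  unfolding Pn_def PBn_def QBn_def by (intro projn_isom isoms_Z finite_Z)+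

lemma card_Zg: "real (card (Zg n g)) \<le> 2 powr (n * g)"
  unfolding Zg_def by (intro card_typical_le) (simp_all add: nonneg sums_1)

lemma card_ZQ: "real (card (ZQ n g x)) \<le> 2 powr (n * g)"
  unfolding ZQ_def by (intro card_typical_le) (simp_all add: nonneg sums_1)

lemma Gn_split: "Gn n x = Ln n g x + Hn n g x"
  by (auto simp: Gn_def Ln_def Hn_def root_factor_def fun_eq_iff)

lemma W_split: "W_pow W n x = Tn n g x + Hn n g x \<star>\<^bsub>seqs n\<^esub> adj (Hn n g x)"
proof -
  have "Hn n g x \<star>\<^bsub>seqs n\<^esub> adj (Hn n g x) = spec (seqs n) (Uc n x) (\<lambda>z. if small n g x z then 0 else dn n x z)"
    unfolding Hn_def by (intro spec_gram[symmetric]) (simp add: nonneg)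
  moreover have "spec (seqs n) (Uc n x) (dn n x) = Tn n g x + spec (seqs n) (Uc n x) (\<lambda>z. if small n g x z then 0 else dn n x z)"
    unfolding Tn_def spec_def by (intro ext) (auto simp: sum.distrib[symmetric] intro!: sum.cong)
  ultimately show ?thesis by (simp add: spec_Uc)
qed

lemma hs_Hn: "hs (J n) (seqs n) (Hn n g x) = (\<Sum>z\<in>{z\<in>seqs n. dn n x z > 2 powr (- (n * g))}. dn n x z)"
proof -
  have "hs (J n) (seqs n) (Hn n g x) = (\<Sum>z\<in>seqs n. if small n g x z then 0 else dn n x z)"
    unfolding Hn_def by (intro hs_root_factor isoms) (simp add: nonneg)
  also have "\<dots> = (\<Sum>z\<in>{z\<in>seqs n. dn n x z > 2 powr (- (n * g))}. dn n x z)"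
    by (intro sum.mono_neutral_cong_right) (auto simp: small_def)
  finally show ?thesis .
qed

lemma outside_P: "(\<Sum>x\<in>seqs n. pn n x * hs (J n) (seqs n) (Gn n x - Pn n g \<star>\<^bsub>J n\<^esub> Gn n x))
    = (\<Sum>z\<in>{z\<in>seqs n. en n z < 2 powr (- (n * g))}. en n z)"
proof -
  have "op_eq_on (J n) (\<Sum>x\<in>seqs n. smul (complex_of_real (pn n x)) (Gn n x \<star>\<^bsub>seqs n\<^esub> adj (Gn n x))) (spec (seqs n) (Vn n) (en n))"
    unfolding Gn_gram mixture_n by (rule op_eq_on_refl)
  then have "(\<Sum>x\<in>seqs n. pn n x * hs (J n) (seqs n) (Gn n x - Pn n g \<star>\<^bsub>J n\<^esub> Gn n x)) = (\<Sum>z\<in>seqs n - Zg n g. en n z)"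
    unfolding Pn_def by (intro mixture_outside_projection isoms sub_Z hs_Gn sums_1 finite_seqs)
  also have "seqs n - Zg n g = {z\<in>seqs n. en n z < 2 powr (- (n * g))}" by (auto simp: Zg_def)
  finally show ?thesis .
qed

lemma hs_red_Gn: "hs (seqs n) (seqs n \<times> seqs n) (red (Gn n x)) = 1"
  unfolding hs_red by (rule hs_Gn)

lemma outside_PB: "(\<Sum>x\<in>seqs n. pn n x * hs (seqs n) (seqs n \<times> seqs n) (red (Gn n x) - PBn n g \<star>\<^bsub>seqs n\<^esub> red (Gn n x)))
    = (\<Sum>z\<in>{z\<in>seqs n. eBn n z > 2 powr (- (n * g))}. eBn n z)"
proof -
  have "op_eq_on (seqs n) (\<Sum>x\<in>seqs n. smul (complex_of_real (pn n x)) (red (Gn n x) \<star>\<^bsub>seqs n \<times> seqs n\<^esub> adj (red (Gn n x)))) (spec (seqs n) (VBn n) (eBn n))"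
    unfolding mixture_B_n by (rule op_eq_on_refl)
  then have "(\<Sum>x\<in>seqs n. pn n x * hs (seqs n) (seqs n \<times> seqs n) (red (Gn n x) - PBn n g \<star>\<^bsub>seqs n\<^esub> red (Gn n x))) = (\<Sum>z\<in>seqs n - ZB n g. eBn n z)"
    unfolding PBn_def by (intro mixture_outside_projection isoms sub_Z hs_red_Gn sums_1 finite_seqs)
  also have "seqs n - ZB n g = {z\<in>seqs n. eBn n z > 2 powr (- (n * g))}" by (auto simp: ZB_def)
  finally show ?thesis .
qed

lemma outside_QB: "hs (seqs n) (seqs n \<times> seqs n) (red (Gn n x) - QBn n g x \<star>\<^bsub>seqs n\<^esub> red (Gn n x))
    = (\<Sum>z\<in>{z\<in>seqs n. dBn n x z < 2 powr (- (n * g))}. dBn n x z)"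
proof -
  \<comment> \<open>A one-element ensemble of weight 1 makes the statement on mixtures apply to a
    single codeword state.\<close>
  have "op_eq_on (seqs n) (\<Sum>y\<in>{x}. smul (complex_of_real 1) (red (Gn n y) \<star>\<^bsub>seqs n \<times> seqs n\<^esub> adj (red (Gn n y)))) (spec (seqs n) (UBn n x) (dBn n x))"
    by (simp add: red_Gn_gram op_eq_on_def)
  then have "(\<Sum>y\<in>{x}. 1 * hs (seqs n) (seqs n \<times> seqs n) (red (Gn n y) - QBn n g x \<star>\<^bsub>seqs n\<^esub> red (Gn n y))) = (\<Sum>z\<in>seqs n - ZQ n g x. dBn n x z)"
    unfolding QBn_def by (intro mixture_outside_projection isoms sub_Z hs_red_Gn sums_1 finite_seqs) auto
  also have "seqs n - ZQ n g x = {z\<in>seqs n. dBn n x z < 2 powr (- (n * g))}" by (auto simp: ZQ_def)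
  finally have "(\<Sum>y\<in>{x}. 1 * hs (seqs n) (seqs n \<times> seqs n) (red (Gn n y) - QBn n g x \<star>\<^bsub>seqs n\<^esub> red (Gn n y)))
      = (\<Sum>z\<in>{z\<in>seqs n. dBn n x z < 2 powr (- (n * g))}. dBn n x z)" .
  moreover have "(\<Sum>y\<in>{x}. 1 * F y) = F x" for F :: "_ \<Rightarrow> real" by simp
  ultimately show ?thesis by (simp only:)
qed

text \<open>Rank times second moment: the squared norm of the truncated state is at most its largest
  eigenvalue, \<open>2 powr (- (n * g'))\<close>, times its trace, and the rank is at most
  \<open>2 powr (n * g)\<close>.\<close>

lemma covering_variance:
  "card (Zg n g) * (\<Sum>x\<in>seqs n. pn n x * hs (Zg n g) (Zg n g) (adj (Vn n) \<star>\<^bsub>J n\<^esub> Tn n g' x \<star>\<^bsub>J n\<^esub> Vn n)) \<le> 2 powr (n * (g - g'))"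
proof -
  have T: "hs (Zg n g) (Zg n g) (adj (Vn n) \<star>\<^bsub>J n\<^esub> Tn n g' x \<star>\<^bsub>J n\<^esub> Vn n) \<le> 2 powr (- (n * g'))" for x
  proof -
    have "hs (Zg n g) (Zg n g) (adj (Vn n) \<star>\<^bsub>J n\<^esub> Tn n g' x \<star>\<^bsub>J n\<^esub> Vn n) \<le> hs (J n) (Zg n g) (Tn n g' x \<star>\<^bsub>J n\<^esub> Vn n)"
      by (intro hs_contr contr_adj contr_isom isoms_Z finite_Z)
    also have "\<dots> \<le> hs (J n) (J n) (Tn n g' x)" by (intro hs_mm_isom_right isoms_Z finite_Z)
    also have "\<dots> = (\<Sum>z\<in>seqs n. (if small n g' x z then dn n x z else 0)\<^sup>2)"
      unfolding Tn_def by (intro hs_spec isoms finite_seqs)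
    also have "\<dots> \<le> (\<Sum>z\<in>seqs n. 2 powr (- (n * g')) * dn n x z)"
      by (intro sum_mono) (auto simp: small_def power2_eq_square nonneg intro!: mult_right_mono)
    also have "\<dots> = 2 powr (- (n * g'))" by (simp add: sums_1 flip: sum_distrib_left)
    finally show ?thesis .
  qed
  have "(\<Sum>x\<in>seqs n. pn n x * hs (Zg n g) (Zg n g) (adj (Vn n) \<star>\<^bsub>J n\<^esub> Tn n g' x \<star>\<^bsub>J n\<^esub> Vn n)) \<le> (\<Sum>x\<in>seqs n. pn n x * 2 powr (- (n * g')))"
    by (intro sum_mono mult_left_mono T nonneg)
  also have "\<dots> = 2 powr (- (n * g'))" by (simp add: sums_1 flip: sum_distrib_right)
  finally have "card (Zg n g) * (\<Sum>x\<in>seqs n. pn n x * hs (Zg n g) (Zg n g) (adj (Vn n) \<star>\<^bsub>J n\<^esub> Tn n g' x \<star>\<^bsub>J n\<^esub> Vn n)) \<le> 2 powr (n * g) * 2 powr (- (n * g'))"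
    by (intro mult_mono card_Zg) (auto intro!: sum_nonneg simp: nonneg)
  also have "\<dots> = 2 powr (n * (g - g'))" by (simp add: powr_add[symmetric] algebra_simps)
  finally show ?thesis .
qed

text \<open>Averaging over the independent codeword \<open>y\<close> replaces its state by the
  mixture on B. \<open>PBn\<close> cuts the eigenvalues of that mixture down to
  \<open>2 powr (- (n * g))\<close>, and the test of \<open>x\<close> has rank at most
  \<open>2 powr (n * g')\<close>.\<close>

lemma false_decoding:
  "(\<Sum>y\<in>seqs n. pn n y * hs (seqs n) (seqs n \<times> seqs n) (QBn n g' x \<star>\<^bsub>seqs n\<^esub> PBn n g \<star>\<^bsub>seqs n\<^esub> red (Gn n y))) \<le> 2 powr (n * (g' - g))"
proof -
  let ?Q = "QBn n g' x" and ?B = "PBn n g" and ?R = "\<lambda>y. red (Gn n y)" and ?Z = "seqs n \<times> seqs n :: ((nat \<Rightarrow> 'r) \<times> (nat \<Rightarrow> 'k)) set"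
  have B: "?B = spec (seqs n) (VBn n) (\<lambda>z. if z \<in> ZB n g then 1 else 0)"
    unfolding PBn_def proj_spec by (rule spec_subset[OF finite_seqs sub_Z(2)])
  have adjs: "adj ?B = ?B" "adj ?Q = ?Q" using projns by (auto simp: projn_def)
  have gram: "complex_of_real (hs (seqs n) ?Z (?Q \<star>\<^bsub>seqs n\<^esub> ?B \<star>\<^bsub>seqs n\<^esub> ?R y))
      = tr (seqs n) (?Q \<star>\<^bsub>seqs n\<^esub> (?B \<star>\<^bsub>seqs n\<^esub> ?R y) \<star>\<^bsub>?Z\<^esub> adj (?B \<star>\<^bsub>seqs n\<^esub> ?R y))" for y
    unfolding QBn_def by (rule hs_proj_mm[OF isoms_Z(3) finite_Z(3)])
  have "complex_of_real (\<Sum>y\<in>seqs n. pn n y * hs (seqs n) ?Z (?Q \<star>\<^bsub>seqs n\<^esub> ?B \<star>\<^bsub>seqs n\<^esub> ?R y))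
     = (\<Sum>y\<in>seqs n. complex_of_real (pn n y) * tr (seqs n) (?Q \<star>\<^bsub>seqs n\<^esub> (?B \<star>\<^bsub>seqs n\<^esub> (?R y \<star>\<^bsub>?Z\<^esub> adj (?R y)) \<star>\<^bsub>seqs n\<^esub> ?B)))"
    unfolding of_real_sum of_real_mult
    by (intro sum.cong refl) (simp only: gram adj_mm adjs mm_assoc)
  also have "\<dots> = tr (seqs n) (?Q \<star>\<^bsub>seqs n\<^esub> (?B \<star>\<^bsub>seqs n\<^esub> (\<Sum>y\<in>seqs n. smul (complex_of_real (pn n y)) (?R y \<star>\<^bsub>?Z\<^esub> adj (?R y))) \<star>\<^bsub>seqs n\<^esub> ?B))"
    unfolding mm_sum_left mm_sum_right mm_smul_left mm_smul_right tr_sum tr_smul ..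
  also have "\<dots> = tr (seqs n) (?Q \<star>\<^bsub>seqs n\<^esub> spec (seqs n) (VBn n) (\<lambda>z. if z \<in> ZB n g then eBn n z else 0))"
    unfolding mixture_B_n unfolding B spec_mult[OF isoms(4) finite_seqs]
    by (intro arg_cong[where f="\<lambda>M. tr (seqs n) (?Q \<star>\<^bsub>seqs n\<^esub> M)"] spec_cong) simp
  finally have "(\<Sum>y\<in>seqs n. pn n y * hs (seqs n) ?Z (?Q \<star>\<^bsub>seqs n\<^esub> ?B \<star>\<^bsub>seqs n\<^esub> ?R y))
     = Re (tr (seqs n) (?Q \<star>\<^bsub>seqs n\<^esub> spec (seqs n) (VBn n) (\<lambda>z. if z \<in> ZB n g then eBn n z else 0)))"
    by (rule eq_ReI)
  also have "\<dots> \<le> 2 powr (- (n * g)) * card (ZQ n g' x)"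
    unfolding QBn_def
    by (rule tr_proj_spec_le[OF isoms_Z(3) finite_Z(3) isoms(4) finite_seqs]) (auto simp: nonneg ZB_def)
  also have "\<dots> \<le> 2 powr (- (n * g)) * 2 powr (n * g')"
    by (intro mult_left_mono card_ZQ) simp
  also have "\<dots> = 2 powr (n * (g' - g))" by (simp add: powr_add[symmetric] algebra_simps)
  finally show ?thesis .
qed

text \<open>The truncated codeword state is at most \<open>2 powr (- (n * g'))\<close> times the
  identity, and on the range of \<open>Pn\<close> the identity is at most
  \<open>2 powr (n * g)\<close> times the mixture.\<close>

lemma test_dominated:
  "hs (J n) (seqs n) (amp S \<star>\<^bsub>J n\<^esub> Pn n g \<star>\<^bsub>J n\<^esub> Ln n g' x)
     \<le> 2 powr (n * (g - g')) * (\<Sum>y\<in>seqs n. pn n y * hs (J n) (seqs n) (amp S \<star>\<^bsub>J n\<^esub> Gn n y))"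
proof -
  let ?S = "amp S :: (nat \<Rightarrow> 'r) \<times> (nat \<Rightarrow> 'b) \<Rightarrow> (nat \<Rightarrow> 'r) \<times> (nat \<Rightarrow> 'b) \<Rightarrow> complex"
  have "hs (J n) (seqs n) (?S \<star>\<^bsub>J n\<^esub> Pn n g \<star>\<^bsub>J n\<^esub> Ln n g' x) = hs (J n) (seqs n) ((?S \<star>\<^bsub>J n\<^esub> Pn n g) \<star>\<^bsub>J n\<^esub> Ln n g' x)"
    by simp
  also have "\<dots> = (\<Sum>z\<in>seqs n. (if small n g' x z then dn n x z else 0) * (\<Sum>i\<in>J n. (cmod (((?S \<star>\<^bsub>J n\<^esub> Pn n g) \<star>\<^bsub>J n\<^esub> Uc n x) i z))\<^sup>2))"
    unfolding Ln_def by (intro hs_mm_root_factor) (simp add: nonneg)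
  also have "\<dots> \<le> (\<Sum>z\<in>seqs n. 2 powr (- (n * g')) * (\<Sum>i\<in>J n. (cmod (((?S \<star>\<^bsub>J n\<^esub> Pn n g) \<star>\<^bsub>J n\<^esub> Uc n x) i z))\<^sup>2))"
    by (intro sum_mono mult_right_mono sum_nonneg) (auto simp: small_def)
  also have "\<dots> = 2 powr (- (n * g')) * hs (J n) (seqs n) ((?S \<star>\<^bsub>J n\<^esub> Pn n g) \<star>\<^bsub>J n\<^esub> Uc n x)"
    unfolding hs_def sum_distrib_left[symmetric] by (subst sum.swap) simp
  also have "\<dots> \<le> 2 powr (- (n * g')) * hs (J n) (J n) (?S \<star>\<^bsub>J n\<^esub> Pn n g)"
    by (intro mult_left_mono hs_mm_isom_right isoms finite_seqs) simp
  also have "hs (J n) (J n) (?S \<star>\<^bsub>J n\<^esub> Pn n g) = hs (J n) (Zg n g) (?S \<star>\<^bsub>J n\<^esub> Vn n)"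
    unfolding Pn_def using hs_mm_isom_adj_right[OF isoms_Z(1)[of n g] finite_Z(1), where K="J n" and M="?S \<star>\<^bsub>J n\<^esub> Vn n"] by simp
  finally have 1: "hs (J n) (seqs n) (?S \<star>\<^bsub>J n\<^esub> Pn n g \<star>\<^bsub>J n\<^esub> Ln n g' x) \<le> 2 powr (- (n * g')) * hs (J n) (Zg n g) (?S \<star>\<^bsub>J n\<^esub> Vn n)" .
  let ?c = "\<lambda>z. \<Sum>i\<in>J n. (cmod ((?S \<star>\<^bsub>J n\<^esub> Vn n) i z))\<^sup>2"
  have c0: "?c z \<ge> 0" for z by (intro sum_nonneg) auto
  have "hs (J n) (Zg n g) (?S \<star>\<^bsub>J n\<^esub> Vn n) = (\<Sum>z\<in>Zg n g. 1 * ?c z)"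
    unfolding hs_def by (subst sum.swap) simp
  also have "\<dots> \<le> (\<Sum>z\<in>Zg n g. 2 powr (n * g) * en n z * ?c z)"
  proof (intro sum_mono mult_right_mono c0)
    fix z assume "z \<in> Zg n g"
    then have "2 powr (n * g) * 2 powr (- (n * g)) \<le> 2 powr (n * g) * en n z"
      by (intro mult_left_mono) (auto simp: Zg_def)
    then show "1 \<le> 2 powr (n * g) * en n z" by (simp add: powr_add[symmetric])
  qed
  also have "\<dots> \<le> (\<Sum>z\<in>seqs n. 2 powr (n * g) * en n z * ?c z)"
    using c0 by (intro sum_mono2 sub_Z finite_seqs) (simp add: nonneg)
  also have "\<dots> = 2 powr (n * g) * (\<Sum>z\<in>seqs n. en n z * ?c z)" by (simp add: sum_distrib_left mult.assoc)
  also have "(\<Sum>z\<in>seqs n. en n z * ?c z) = hs (J n) (seqs n) (?S \<star>\<^bsub>J n\<^esub> root_factor (Vn n) (en n))"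
    by (subst hs_mm_root_factor) (simp_all add: nonneg)
  finally have 2: "hs (J n) (Zg n g) (?S \<star>\<^bsub>J n\<^esub> Vn n) \<le> 2 powr (n * g) * hs (J n) (seqs n) (?S \<star>\<^bsub>J n\<^esub> root_factor (Vn n) (en n))" .
  have 3: "hs (J n) (seqs n) (?S \<star>\<^bsub>J n\<^esub> root_factor (Vn n) (en n)) = (\<Sum>y\<in>seqs n. pn n y * hs (J n) (seqs n) (?S \<star>\<^bsub>J n\<^esub> Gn n y))"
  proof -
    have "complex_of_real (hs (J n) (seqs n) (?S \<star>\<^bsub>J n\<^esub> root_factor (Vn n) (en n)))
       = tr (J n) (?S \<star>\<^bsub>J n\<^esub> (root_factor (Vn n) (en n) \<star>\<^bsub>seqs n\<^esub> adj (root_factor (Vn n) (en n))) \<star>\<^bsub>J n\<^esub> adj ?S)"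
      unfolding hs_tr'[symmetric] by simp
    also have "\<dots> = tr (J n) (?S \<star>\<^bsub>J n\<^esub> (\<Sum>y\<in>seqs n. smul (complex_of_real (pn n y)) (Gn n y \<star>\<^bsub>seqs n\<^esub> adj (Gn n y))) \<star>\<^bsub>J n\<^esub> adj ?S)"
      unfolding Gn_gram mixture_n by (subst spec_gram[symmetric]) (simp_all add: nonneg)
    also have "\<dots> = complex_of_real (\<Sum>y\<in>seqs n. pn n y * hs (J n) (seqs n) (?S \<star>\<^bsub>J n\<^esub> Gn n y))"
      unfolding mm_sum_left mm_sum_right mm_smul_left mm_smul_right tr_sum tr_smul of_real_sum of_real_mult hs_tr'[symmetric]
      by (simp only: adj_mm mm_assoc)
    finally show ?thesis by (simp only: of_real_eq_iff)
  qed
  have "hs (J n) (seqs n) (?S \<star>\<^bsub>J n\<^esub> Pn n g \<star>\<^bsub>J n\<^esub> Ln n g' x) \<le> 2 powr (- (n * g')) * (2 powr (n * g) * (\<Sum>y\<in>seqs n. pn n y * hs (J n) (seqs n) (?S \<star>\<^bsub>J n\<^esub> Gn n y)))"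
    using 1 2 unfolding 3 by (meson mult_left_mono order_trans powr_ge_zero)
  also have "\<dots> = 2 powr (n * (g - g')) * (\<Sum>y\<in>seqs n. pn n y * hs (J n) (seqs n) (?S \<star>\<^bsub>J n\<^esub> Gn n y))"
    by (simp add: powr_add[symmetric] algebra_simps mult.assoc[symmetric])
  finally show ?thesis .
qed

text \<open>Data processing for the Holevo information, without strong subadditivity: the typicality test
  of a codeword on \<open>B\<close> accepts that codeword state, whose typical part on \<open>RB\<close> is dominated by a
  multiple of the mixture, which the test rarely accepts. The two scales are compatible only if the
  Holevo information on \<open>B\<close> is at most that on \<open>RB\<close>.\<close>

lemma holevo_monotone_aux:
  assumes b1: "(\<Sum>x\<in>seqs n. pn n x * hs (J n) (seqs n) (Gn n x - Pn n g1 \<star>\<^bsub>J n\<^esub> Gn n x)) \<le> t"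
    and b2: "(\<Sum>x\<in>seqs n. pn n x * hs (J n) (seqs n) (Hn n g2 x)) \<le> t"
    and b4: "(\<Sum>x\<in>seqs n. pn n x * hs (seqs n) (seqs n \<times> seqs n) (red (Gn n x) - PBn n g3 \<star>\<^bsub>seqs n\<^esub> red (Gn n x))) \<le> t"
    and b5: "(\<Sum>x\<in>seqs n. pn n x * hs (seqs n) (seqs n \<times> seqs n) (red (Gn n x) - QBn n g4 x \<star>\<^bsub>seqs n\<^esub> red (Gn n x))) \<le> t"
  shows "1 \<le> 5 * sqrt t + sqrt (2 powr (n * (g1 - g2)) * 2 powr (n * (g4 - g3)))"
proof -
  let ?Z = "seqs n \<times> seqs n :: ((nat \<Rightarrow> 'r) \<times> (nat \<Rightarrow> 'k)) set"
  let ?S = "\<lambda>x. QBn n g4 x \<star>\<^bsub>seqs n\<^esub> PBn n g3"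
  let ?h = "hs (J n) (seqs n)"
  define a1 where "a1 x = ?h (Gn n x - Pn n g1 \<star>\<^bsub>J n\<^esub> Gn n x)" for x
  define a2 where "a2 x = ?h (Hn n g2 x)" for x
  define a4 where "a4 x = hs (seqs n) ?Z (red (Gn n x) - PBn n g3 \<star>\<^bsub>seqs n\<^esub> red (Gn n x))" for x
  define a5 where "a5 x = hs (seqs n) ?Z (red (Gn n x) - QBn n g4 x \<star>\<^bsub>seqs n\<^esub> red (Gn n x))" for x
  define a6 where "a6 x = ?h (amp (?S x) \<star>\<^bsub>J n\<^esub> Pn n g1 \<star>\<^bsub>J n\<^esub> Ln n g2 x)" for x
  \<comment> \<open>The factor of the state has norm 1 and is split by the triangle inequality.
    \<open>a5\<close>, \<open>a4\<close> and \<open>a1\<close> are the losses at the three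
    projections. \<open>Hn\<close> counts twice: once as the discarded part, once in passing from
    \<open>Gn\<close> to \<open>Ln\<close> in the loss at \<open>Pn\<close>. The rest is
    \<open>a6\<close>.\<close>
  have pt: "1 \<le> sqrt (a5 x) + sqrt (a4 x) + sqrt (a1 x) + 2 * sqrt (a2 x) + sqrt (a6 x)" for x
  proof -
    let ?R = "red (Gn n x)" and ?Q = "QBn n g4 x" and ?B = "PBn n g3"
    let ?hB = "hs (seqs n) ?Z"
    have "1 = sqrt (?hB ((?R - ?Q \<star>\<^bsub>seqs n\<^esub> ?R) + (?Q \<star>\<^bsub>seqs n\<^esub> (?R - ?B \<star>\<^bsub>seqs n\<^esub> ?R) + ?Q \<star>\<^bsub>seqs n\<^esub> ?B \<star>\<^bsub>seqs n\<^esub> ?R)))"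
      by (simp add: mm_diff_right hs_red_Gn)
    also have "\<dots> \<le> sqrt (a5 x) + (sqrt (?hB (?Q \<star>\<^bsub>seqs n\<^esub> (?R - ?B \<star>\<^bsub>seqs n\<^esub> ?R))) + sqrt (?hB (?Q \<star>\<^bsub>seqs n\<^esub> ?B \<star>\<^bsub>seqs n\<^esub> ?R)))"
      unfolding a5_def by (intro order_trans[OF sqrt_hs_triangle] add_left_mono sqrt_hs_triangle)
    also have "\<dots> \<le> sqrt (a5 x) + (sqrt (a4 x) + sqrt (?hB (?Q \<star>\<^bsub>seqs n\<^esub> ?B \<star>\<^bsub>seqs n\<^esub> ?R)))"
      unfolding a4_def by (intro add_left_mono add_right_mono real_sqrt_le_mono hs_projn_le projns)
    finally have i: "1 \<le> sqrt (a5 x) + (sqrt (a4 x) + sqrt (?hB (?Q \<star>\<^bsub>seqs n\<^esub> ?B \<star>\<^bsub>seqs n\<^esub> ?R)))" .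
    let ?A = "amp (?S x) :: (nat \<Rightarrow> 'r) \<times> (nat \<Rightarrow> 'b) \<Rightarrow> (nat \<Rightarrow> 'r) \<times> (nat \<Rightarrow> 'b) \<Rightarrow> complex"
    have cA: "contr (J n) (J n) ?A"
      by (intro contr_amp contr_mm[of "seqs n" "seqs n"] contr_projn projns finite_seqs)
    let ?L = "Ln n g2 x" and ?H = "Hn n g2 x" and ?P = "Pn n g1"
    have "?hB (?Q \<star>\<^bsub>seqs n\<^esub> ?B \<star>\<^bsub>seqs n\<^esub> ?R) = ?h (?A \<star>\<^bsub>J n\<^esub> Gn n x)"
      unfolding hs_amp_mm[OF finite_seqs] by simp
    moreover have "?A \<star>\<^bsub>J n\<^esub> Gn n x = ?A \<star>\<^bsub>J n\<^esub> ?P \<star>\<^bsub>J n\<^esub> ?L + (?A \<star>\<^bsub>J n\<^esub> (?L - ?P \<star>\<^bsub>J n\<^esub> ?L) + ?A \<star>\<^bsub>J n\<^esub> ?H)"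
      unfolding Gn_split[of n x g2] by (simp add: mm_diff_right mm_add_right)
    ultimately have ii: "sqrt (?hB (?Q \<star>\<^bsub>seqs n\<^esub> ?B \<star>\<^bsub>seqs n\<^esub> ?R))
        \<le> sqrt (?h (?A \<star>\<^bsub>J n\<^esub> ?P \<star>\<^bsub>J n\<^esub> ?L)) + (sqrt (?h (?A \<star>\<^bsub>J n\<^esub> (?L - ?P \<star>\<^bsub>J n\<^esub> ?L))) + sqrt (?h (?A \<star>\<^bsub>J n\<^esub> ?H)))"
      by (simp only:) (intro order_trans[OF sqrt_hs_triangle] add_left_mono sqrt_hs_triangle)
    have iii: "sqrt (?h (?A \<star>\<^bsub>J n\<^esub> ?H)) \<le> sqrt (a2 x)"
      unfolding a2_def by (intro real_sqrt_le_mono hs_contr cA)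
    have iv: "sqrt (?h (?A \<star>\<^bsub>J n\<^esub> (?L - ?P \<star>\<^bsub>J n\<^esub> ?L))) \<le> sqrt (a1 x) + sqrt (a2 x)"
    proof -
      have e: "?L - ?P \<star>\<^bsub>J n\<^esub> ?L = (Gn n x - ?P \<star>\<^bsub>J n\<^esub> Gn n x) - (?H - ?P \<star>\<^bsub>J n\<^esub> ?H)"
        unfolding Gn_split[of n x g2] by (simp add: mm_add_right)
      have "sqrt (?h (?A \<star>\<^bsub>J n\<^esub> (?L - ?P \<star>\<^bsub>J n\<^esub> ?L))) \<le> sqrt (?h (?L - ?P \<star>\<^bsub>J n\<^esub> ?L))"
        by (intro real_sqrt_le_mono hs_contr cA)
      also have "\<dots> \<le> sqrt (a1 x) + sqrt (?h (?H - ?P \<star>\<^bsub>J n\<^esub> ?H))"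
        unfolding a1_def e by (rule sqrt_hs_triangle_diff)
      also have "\<dots> \<le> sqrt (a1 x) + sqrt (a2 x)"
        unfolding a2_def by (intro add_left_mono real_sqrt_le_mono hs_projn_diff_le projns)
      finally show ?thesis .
    qed
    show ?thesis using i ii iii iv unfolding a6_def by linarith
  qed
  have nn: "a1 x \<ge> 0" "a2 x \<ge> 0" "a4 x \<ge> 0" "a5 x \<ge> 0" "a6 x \<ge> 0" for x
    by (simp_all add: a1_def a2_def a4_def a5_def a6_def)
  have avg: "(\<Sum>x\<in>seqs n. pn n x * sqrt (a x)) \<le> sqrt b" if "\<And>x. a x \<ge> 0" "(\<Sum>x\<in>seqs n. pn n x * a x) \<le> b" for a b
    using weighted_sqrt_le[of "seqs n" "pn n" a] that real_sqrt_le_mono[OF that(2)] nonneg sums_1 by (simp add: order_trans)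
  have a6: "(\<Sum>x\<in>seqs n. pn n x * a6 x) \<le> 2 powr (n * (g1 - g2)) * 2 powr (n * (g4 - g3))"
  proof -
    have "a6 x \<le> 2 powr (n * (g1 - g2)) * 2 powr (n * (g4 - g3))" for x
    proof -
      have "(\<Sum>y\<in>seqs n. pn n y * ?h (amp (?S x) \<star>\<^bsub>J n\<^esub> Gn n y)) \<le> 2 powr (n * (g4 - g3))"
        unfolding hs_amp_mm[OF finite_seqs] mm_assoc by (rule false_decoding)
      then show ?thesis
        unfolding a6_def by (intro order_trans[OF test_dominated] mult_left_mono) auto
    qed
    then have "(\<Sum>x\<in>seqs n. pn n x * a6 x) \<le> (\<Sum>x\<in>seqs n. pn n x * (2 powr (n * (g1 - g2)) * 2 powr (n * (g4 - g3))))"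
      by (intro sum_mono mult_left_mono nonneg)
    then show ?thesis by (simp add: sums_1 flip: sum_distrib_right)
  qed
  have "1 = (\<Sum>x\<in>seqs n. pn n x * 1)" by (simp add: sums_1)
  also have "\<dots> \<le> (\<Sum>x\<in>seqs n. pn n x * (sqrt (a5 x) + sqrt (a4 x) + sqrt (a1 x) + 2 * sqrt (a2 x) + sqrt (a6 x)))"
    by (intro sum_mono mult_left_mono nonneg pt)
  also have "\<dots> = (\<Sum>x\<in>seqs n. pn n x * sqrt (a5 x)) + (\<Sum>x\<in>seqs n. pn n x * sqrt (a4 x)) + (\<Sum>x\<in>seqs n. pn n x * sqrt (a1 x))
      + 2 * (\<Sum>x\<in>seqs n. pn n x * sqrt (a2 x)) + (\<Sum>x\<in>seqs n. pn n x * sqrt (a6 x))"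
    unfolding sum_distrib_left sum.distrib[symmetric] by (intro sum.cong refl) (simp add: algebra_simps)
  also have "\<dots> \<le> sqrt t + sqrt t + sqrt t + 2 * sqrt t + sqrt (2 powr (n * (g1 - g2)) * 2 powr (n * (g4 - g3)))"
    using b1 b2 b4 b5 a6 by (intro add_mono mult_left_mono avg nn) (auto simp: a1_def a2_def a4_def a5_def)
  finally show ?thesis by simp
qed

end

section \<open>Typicality for large block lengths\<close>

lemma sum_Sigma_filter:
  assumes "finite A" "finite B"
  shows "(\<Sum>x\<in>A. \<Sum>z\<in>{z\<in>B. Q x z}. f x z) = (\<Sum>i\<in>{i\<in>A \<times> B. Q (fst i) (snd i)}. f (fst i) (snd i))"
proof -
  have "(\<Sum>x\<in>A. \<Sum>z\<in>{z\<in>B. Q x z}. f x z) = (\<Sum>i\<in>Sigma A (\<lambda>x. {z\<in>B. Q x z}). f (fst i) (snd i))"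
    using assms by (subst sum.Sigma) (auto simp: case_prod_beta)
  also have "Sigma A (\<lambda>x. {z\<in>B. Q x z}) = {i\<in>A \<times> B. Q (fst i) (snd i)}" by auto
  finally show ?thesis .
qed

lemma eventually_powr_small:
  assumes "a > 0" "t > 0"
  shows "\<exists>N. \<forall>n\<ge>N. 2 powr (- (real n * a)) \<le> t"
proof -
  have "(\<lambda>n. (2 powr (- a)) ^ n) \<longlonglongrightarrow> 0"
    using assms by (intro LIMSEQ_realpow_zero) (auto simp: powr_less_one)
  then have "\<forall>\<^sub>F n in sequentially. (2 powr (- a)) ^ n < t" using assms(2) by (rule order_tendstoD)
  then obtain N where "\<forall>n\<ge>N. (2 powr (- a)) ^ n < t" unfolding eventually_sequentially by blast
  moreover have "(2 powr (- a)) ^ n = 2 powr (- (real n * a))" for n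
    by (subst powr_realpow[symmetric]) (simp_all add: powr_powr mult.commute)
  ultimately show ?thesis by (intro exI[of _ N]) (auto intro: less_imp_le)
qed

context letter_spectra
begin

text \<open>The entropies H(RB), H(RB|X), H(B) and H(B|X), in this order; \<open>H1 - H2\<close> is
  I(X;RB) and \<open>H3 - H4\<close> is I(X;B).\<close>

definition H1 :: real where "H1 = (\<Sum>s\<in>UNIV. - (e s * log 2 (e s)))"
definition H2 :: real where "H2 = (\<Sum>x\<in>UNIV. P x * (\<Sum>k\<in>UNIV. - (d x k * log 2 (d x k))))"
definition H3 :: real where "H3 = (\<Sum>s\<in>UNIV. - (eB s * log 2 (eB s)))"
definition H4 :: real where "H4 = (\<Sum>x\<in>UNIV. P x * (\<Sum>k\<in>UNIV. - (dB x k * log 2 (dB x k))))"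

text \<open>For the two conditional entropies the letters are pairs of an input symbol and an
  eigenvalue index, with the joint weight as probability and the eigenvalue alone as likelihood.
  Codeword and eigenvalue sequence are thus averaged in one large-deviation bound.\<close>

lemma typical_eventually:
  assumes t: "t > 0" and g: "H1 < g1" "g2 < H2" "g3 < H3" "H4 < g4"
  shows "\<exists>N. \<forall>n\<ge>N.
     (\<Sum>x\<in>seqs n. pn n x * hs (J n) (seqs n) (Gn n x - Pn n g1 \<star>\<^bsub>J n\<^esub> Gn n x)) \<le> t \<and>
     (\<Sum>x\<in>seqs n. pn n x * hs (J n) (seqs n) (Hn n g2 x)) \<le> t \<and>
     (\<Sum>x\<in>seqs n. pn n x * hs (seqs n) (seqs n \<times> seqs n) (red (Gn n x) - PBn n g3 \<star>\<^bsub>seqs n\<^esub> red (Gn n x))) \<le> t \<and>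
     (\<Sum>x\<in>seqs n. pn n x * hs (seqs n) (seqs n \<times> seqs n) (red (Gn n x) - QBn n g4 x \<star>\<^bsub>seqs n\<^esub> red (Gn n x))) \<le> t"
proof -
  have pair: "(\<Sum>s\<in>UNIV. - (P (fst s) * D (fst s) (snd s) * log 2 (D (fst s) (snd s)))) = (\<Sum>x\<in>UNIV. P x * (\<Sum>k\<in>UNIV. - (D x k * log 2 (D x k))))"
    for D :: "'x \<Rightarrow> 'y::finite \<Rightarrow> real"
  proof -
    have "(\<Sum>x\<in>UNIV. P x * (\<Sum>k\<in>UNIV. - (D x k * log 2 (D x k)))) = (\<Sum>x\<in>UNIV. \<Sum>k\<in>UNIV. - (P x * D x k * log 2 (D x k)))"
      by (simp add: sum_distrib_left mult.assoc)
    also have "\<dots> = (\<Sum>(x, k)\<in>UNIV \<times> UNIV. - (P x * D x k * log 2 (D x k)))" by (rule sum.cartesian_product)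
    finally show ?thesis by (simp add: case_prod_beta)
  qed
  have pair1: "(\<Sum>s\<in>UNIV. P (fst s) * D (fst s) (snd s)) = 1" if "\<And>x. (\<Sum>k\<in>UNIV. D x k) = 1" for D :: "'x \<Rightarrow> 'y::finite \<Rightarrow> real"
  proof -
    have "(\<Sum>s\<in>UNIV \<times> UNIV. P (fst s) * D (fst s) (snd s)) = (\<Sum>x\<in>UNIV. \<Sum>k\<in>UNIV. P x * D x k)"
      by (simp add: sum.cartesian_product case_prod_beta)
    also have "\<dots> = 1" by (simp add: that P1 flip: sum_distrib_left)
    finally show ?thesis by simp
  qed
  have zl: "zip_letters i k = (fst i k, snd i k)" for i :: "(nat \<Rightarrow> 'x) \<times> (nat \<Rightarrow> 'y)" and k
    by (simp add: zip_letters_def case_prod_beta)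
  have triv: "\<forall>s. f s = 0 \<longrightarrow> f s = (0::real)" for f :: "'y \<Rightarrow> real" by simp
  have PD0: "P (fst s) * D (fst s) (snd s) \<ge> 0" if "\<And>x k. D x k \<ge> 0" for D :: "'x \<Rightarrow> 'y \<Rightarrow> real" and s
    using that P0 by simp
  have PDz: "\<forall>s. D (fst s) (snd s) = 0 \<longrightarrow> P (fst s) * D (fst s) (snd s) = 0" for D :: "'x \<Rightarrow> 'y \<Rightarrow> real"
    by simp
  obtain N1 where N1: "\<forall>n\<ge>N1. \<forall>(I :: (nat \<Rightarrow> 'm) set) cf. tensor_index n I cf \<longrightarrow>
       (\<Sum>i\<in>{i\<in>I. (\<Prod>k<n. e (cf i k)) < 2 powr (- (n * g1))}. \<Prod>k<n. e (cf i k)) \<le> t"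
    using typical_tails(1)[where 'i="nat \<Rightarrow> 'm", OF e0 e1 e0 triv[of e] t g(1)[unfolded H1_def]] by blast
  obtain N3 where N3: "\<forall>n\<ge>N3. \<forall>(I :: (nat \<Rightarrow> 'o) set) cf. tensor_index n I cf \<longrightarrow>
       (\<Sum>i\<in>{i\<in>I. (\<Prod>k<n. eB (cf i k)) > 2 powr (- (n * g3))}. \<Prod>k<n. eB (cf i k)) \<le> t"
    using typical_tails(2)[where 'i="nat \<Rightarrow> 'o", OF eB0 eB1 eB0 triv[of eB] t g(3)[unfolded H3_def]] by blast
  obtain N2 where N2: "\<forall>n\<ge>N2. \<forall>(I :: ((nat \<Rightarrow> 'x) \<times> (nat \<Rightarrow> 'k)) set) cf. tensor_index n I cf \<longrightarrow>
       (\<Sum>i\<in>{i\<in>I. (\<Prod>k<n. (\<lambda>s. d (fst s) (snd s)) (cf i k)) > 2 powr (- (n * g2))}. \<Prod>k<n. (\<lambda>s. P (fst s) * d (fst s) (snd s)) (cf i k)) \<le> t"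
    using typical_tails(2)[where 'i="(nat \<Rightarrow> 'x) \<times> (nat \<Rightarrow> 'k)" and q="\<lambda>s. P (fst s) * d (fst s) (snd s)" and h="\<lambda>s. d (fst s) (snd s)",
       OF PD0[of d, OF d0] pair1[of d, OF d1] d0 PDz[of d] t g(2)[unfolded H2_def pair[symmetric]]] by blast
  obtain N4 where N4: "\<forall>n\<ge>N4. \<forall>(I :: ((nat \<Rightarrow> 'x) \<times> (nat \<Rightarrow> 'l)) set) cf. tensor_index n I cf \<longrightarrow>
       (\<Sum>i\<in>{i\<in>I. (\<Prod>k<n. (\<lambda>s. dB (fst s) (snd s)) (cf i k)) < 2 powr (- (n * g4))}. \<Prod>k<n. (\<lambda>s. P (fst s) * dB (fst s) (snd s)) (cf i k)) \<le> t"
    using typical_tails(1)[where 'i="(nat \<Rightarrow> 'x) \<times> (nat \<Rightarrow> 'l)" and q="\<lambda>s. P (fst s) * dB (fst s) (snd s)" and h="\<lambda>s. dB (fst s) (snd s)",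
       OF PD0[of dB, OF dB0] pair1[of dB, OF dB1] dB0 PDz[of dB] t g(4)[unfolded H4_def pair[symmetric]]] by blast
  show ?thesis
  proof (intro exI[of _ "max (max N1 N2) (max N3 N4)"] allI impI conjI)
    fix n assume n: "n \<ge> max (max N1 N2) (max N3 N4)"
    show "(\<Sum>x\<in>seqs n. pn n x * hs (J n) (seqs n) (Gn n x - Pn n g1 \<star>\<^bsub>J n\<^esub> Gn n x)) \<le> t"
      unfolding outside_P en_def using N1 n tensor_index_seqs by force
    show "(\<Sum>x\<in>seqs n. pn n x * hs (seqs n) (seqs n \<times> seqs n) (red (Gn n x) - PBn n g3 \<star>\<^bsub>seqs n\<^esub> red (Gn n x))) \<le> t"
      unfolding outside_PB eBn_def using N3 n tensor_index_seqs by force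
    have "(\<Sum>x\<in>seqs n. pn n x * hs (J n) (seqs n) (Hn n g2 x)) =
        (\<Sum>x\<in>seqs n. \<Sum>z\<in>{z\<in>seqs n. dn n x z > 2 powr (- (n * g2))}. pn n x * dn n x z)"
      unfolding hs_Hn sum_distrib_left ..
    also have "\<dots> = (\<Sum>i\<in>{i\<in>seqs n \<times> seqs n. dn n (fst i) (snd i) > 2 powr (- (n * g2))}. pn n (fst i) * dn n (fst i) (snd i))"
      by (rule sum_Sigma_filter) simp_all
    also have "\<dots> = (\<Sum>i\<in>{i\<in>seqs n \<times> seqs n. (\<Prod>k<n. (\<lambda>s. d (fst s) (snd s)) (zip_letters i k)) > 2 powr (- (n * g2))}. \<Prod>k<n. (\<lambda>s. P (fst s) * d (fst s) (snd s)) (zip_letters i k))"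
      by (simp add: zl dn_def pn_def prod.distrib)
    also have "\<dots> \<le> t" using N2 n tensor_index_pairs by force
    finally show "(\<Sum>x\<in>seqs n. pn n x * hs (J n) (seqs n) (Hn n g2 x)) \<le> t" .
    have "(\<Sum>x\<in>seqs n. pn n x * hs (seqs n) (seqs n \<times> seqs n) (red (Gn n x) - QBn n g4 x \<star>\<^bsub>seqs n\<^esub> red (Gn n x))) =
        (\<Sum>x\<in>seqs n. \<Sum>z\<in>{z\<in>seqs n. dBn n x z < 2 powr (- (n * g4))}. pn n x * dBn n x z)"
      unfolding outside_QB sum_distrib_left ..
    also have "\<dots> = (\<Sum>i\<in>{i\<in>seqs n \<times> seqs n. dBn n (fst i) (snd i) < 2 powr (- (n * g4))}. pn n (fst i) * dBn n (fst i) (snd i))"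
      by (rule sum_Sigma_filter) simp_all
    also have "\<dots> = (\<Sum>i\<in>{i\<in>seqs n \<times> seqs n. (\<Prod>k<n. (\<lambda>s. dB (fst s) (snd s)) (zip_letters i k)) < 2 powr (- (n * g4))}. \<Prod>k<n. (\<lambda>s. P (fst s) * dB (fst s) (snd s)) (zip_letters i k))"
      by (simp add: zl dBn_def pn_def prod.distrib)
    also have "\<dots> \<le> t" using N4 n tensor_index_pairs by force
    finally show "(\<Sum>x\<in>seqs n. pn n x * hs (seqs n) (seqs n \<times> seqs n) (red (Gn n x) - QBn n g4 x \<star>\<^bsub>seqs n\<^esub> red (Gn n x))) \<le> t" .
  qed
qed

lemma holevo_monotone: "H3 - H4 \<le> H1 - H2"
proof (rule ccontr)
  assume not: "\<not> ?thesis"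
  define D where "D = (H3 - H4) - (H1 - H2)"
  have D: "D > 0" using not by (simp add: D_def)
  \<comment> \<open>The four shifts by \<open>\<delta>\<close> use up half of the gap, leaving the
    exponent \<open>- D / 2\<close>.\<close>
  define \<delta> where "\<delta> = D / 8"
  have \<delta>: "\<delta> > 0" using D by (simp add: \<delta>_def)
  obtain N where N: "\<forall>n\<ge>N.
     (\<Sum>x\<in>seqs n. pn n x * hs (J n) (seqs n) (Gn n x - Pn n (H1 + \<delta>) \<star>\<^bsub>J n\<^esub> Gn n x)) \<le> 1/400 \<and>
     (\<Sum>x\<in>seqs n. pn n x * hs (J n) (seqs n) (Hn n (H2 - \<delta>) x)) \<le> 1/400 \<and>
     (\<Sum>x\<in>seqs n. pn n x * hs (seqs n) (seqs n \<times> seqs n) (red (Gn n x) - PBn n (H3 - \<delta>) \<star>\<^bsub>seqs n\<^esub> red (Gn n x))) \<le> 1/400 \<and>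
     (\<Sum>x\<in>seqs n. pn n x * hs (seqs n) (seqs n \<times> seqs n) (red (Gn n x) - QBn n (H4 + \<delta>) x \<star>\<^bsub>seqs n\<^esub> red (Gn n x))) \<le> 1/400"
    using typical_eventually[of "1/400" "H1 + \<delta>" "H2 - \<delta>" "H3 - \<delta>" "H4 + \<delta>"] \<delta> by auto
  obtain N' where N': "\<forall>n\<ge>N'. 2 powr (- (real n * (D / 2))) \<le> 1/4"
    using eventually_powr_small[of "D / 2" "1/4"] D by auto
  define n where "n = max N N'"
  \<comment> \<open>With these constants the right-hand side is at most 5/20 + 1/2 = 3/4.\<close>
  have "1 \<le> 5 * sqrt (1/400) + sqrt (2 powr (n * ((H1 + \<delta>) - (H2 - \<delta>))) * 2 powr (n * ((H4 + \<delta>) - (H3 - \<delta>))))"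
    using N by (intro holevo_monotone_aux) (auto simp: n_def)
  also have "2 powr (n * ((H1 + \<delta>) - (H2 - \<delta>))) * 2 powr (n * ((H4 + \<delta>) - (H3 - \<delta>))) = 2 powr (- (real n * (D / 2)))"
    unfolding powr_add[symmetric] by (rule arg_cong[where f="\<lambda>y. 2 powr y"]) (simp add: \<delta>_def D_def field_simps)
  also have "5 * sqrt (1/400) + sqrt (2 powr (- (real n * (D / 2)))) \<le> 5 * (1/20) + sqrt (1/4)"
    using N' by (intro add_mono mult_left_mono real_sqrt_le_mono) (auto simp: n_def real_sqrt_divide intro: real_le_lsqrt)
  also have "\<dots> = 3/4" by (simp add: real_sqrt_divide)
  finally show False by simp
qed

text \<open>The typicality thresholds each cost \<open>\<delta>\<close>, two per exponent; the third
  \<open>\<delta>\<close> in the rates leaves the decaying factor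
  \<open>2 powr (- (n * \<delta>))\<close>. Decoding is constrained by the number
  \<open>K - 1\<close> of competitors, so a bin with one codeword is allowed even when the exponent
  is negative. \<open>N\<close> is uniform in the code sizes and the purification.\<close>

theorem coding_eventually:
  assumes \<epsilon>: "0 < \<epsilon>" "\<epsilon> \<le> 1/441" and \<delta>: "\<delta> > 0"
  shows "\<exists>N. \<forall>n\<ge>N. \<forall>M K (Phi :: (nat \<Rightarrow> 'r) \<times> (nat \<Rightarrow> 'b) \<Rightarrow> (nat \<Rightarrow> 'a::finite) \<Rightarrow> complex).
    M \<ge> 1 \<longrightarrow> K \<ge> 1 \<longrightarrow> real K - 1 \<le> 2 powr (n * (H3 - H4 - 3 * \<delta>)) \<longrightarrow> 2 powr (n * (H1 - H2 + 3 * \<delta>)) \<le> real M * real K \<longrightarrow>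
    Phi \<star>\<^bsub>seqs n\<^esub> adj Phi = (\<Sum>x\<in>seqs n. smul (complex_of_real (pn n x)) (W_pow W n x)) \<longrightarrow>
    (\<exists>Om \<Lambda> f. povm_on (seqs n) {1..M} Om \<and> (\<forall>m\<in>{1..M}. povm_on (seqs n) {1..K} (\<Lambda> m)) \<and>
       (\<forall>m\<in>{1..M}. \<forall>k\<in>{1..K}. f m k \<in> seqs n) \<and>
       (\<forall>C. (\<forall>m\<in>{1..M}. \<forall>k\<in>{1..K}. contr (J n) (J n) (C m k)) \<longrightarrow>
         cmod (\<Sum>m\<in>{1..M}. \<Sum>k\<in>{1..K}. tr (J n) (C m k \<star>\<^bsub>J n\<^esub>
        (amp (psd_sqrt (seqs n) (\<Lambda> m k)) \<star>\<^bsub>J n\<^esub> (Phi \<star>\<^bsub>seqs n\<^esub> Om m \<star>\<^bsub>seqs n\<^esub> adj Phi) \<star>\<^bsub>J n\<^esub> amp (psd_sqrt (seqs n) (\<Lambda> m k))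
         - smul (complex_of_real (1 / (real M * real K))) (W_pow W n (f m k))))) \<le> 50 * sqrt (sqrt \<epsilon>)))"
proof -
  let ?g1 = "H1 + \<delta>" and ?g2 = "H2 - \<delta>" and ?g3 = "H3 - \<delta>" and ?g4 = "H4 + \<delta>"
  obtain N where N: "\<forall>n\<ge>N.
     (\<Sum>x\<in>seqs n. pn n x * hs (J n) (seqs n) (Gn n x - Pn n ?g1 \<star>\<^bsub>J n\<^esub> Gn n x)) \<le> \<epsilon> \<and>
     (\<Sum>x\<in>seqs n. pn n x * hs (J n) (seqs n) (Hn n ?g2 x)) \<le> \<epsilon> \<and>
     (\<Sum>x\<in>seqs n. pn n x * hs (seqs n) (seqs n \<times> seqs n) (red (Gn n x) - PBn n ?g3 \<star>\<^bsub>seqs n\<^esub> red (Gn n x))) \<le> \<epsilon> \<and>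
     (\<Sum>x\<in>seqs n. pn n x * hs (seqs n) (seqs n \<times> seqs n) (red (Gn n x) - QBn n ?g4 x \<star>\<^bsub>seqs n\<^esub> red (Gn n x))) \<le> \<epsilon>"
    using typical_eventually[of \<epsilon> ?g1 ?g2 ?g3 ?g4] \<epsilon> \<delta> by auto
  obtain N' where N': "\<forall>n\<ge>N'. 2 powr (- (real n * \<delta>)) \<le> \<epsilon>"
    using eventually_powr_small[OF \<delta> \<epsilon>(1)] by auto
  show ?thesis
  proof (intro exI[of _ "max N N'"] allI impI)
    fix n M K and Phi :: "(nat \<Rightarrow> 'r) \<times> (nat \<Rightarrow> 'b) \<Rightarrow> (nat \<Rightarrow> 'a) \<Rightarrow> complex"
    assume n: "n \<ge> max N N'" and MK: "M \<ge> 1" "K \<ge> 1" and K: "real K - 1 \<le> 2 powr (n * (H3 - H4 - 3 * \<delta>))"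
      and L: "2 powr (n * (H1 - H2 + 3 * \<delta>)) \<le> real M * real K"
      and Phi: "Phi \<star>\<^bsub>seqs n\<^esub> adj Phi = (\<Sum>x\<in>seqs n. smul (complex_of_real (pn n x)) (W_pow W n x))"
    have small: "2 powr (- (real n * \<delta>)) \<le> \<epsilon>" using N' n by simp
    have Phi': "op_eq_on (J n) (Phi \<star>\<^bsub>seqs n\<^esub> adj Phi) (\<Sum>x\<in>seqs n. smul (complex_of_real (pn n x)) (Gn n x \<star>\<^bsub>seqs n\<^esub> adj (Gn n x)))"
      unfolding Phi Gn_gram by (rule op_eq_on_refl)
    have split: "op_eq_on (J n) (Gn n x \<star>\<^bsub>seqs n\<^esub> adj (Gn n x)) (Tn n ?g2 x + Hn n ?g2 x \<star>\<^bsub>seqs n\<^esub> adj (Hn n ?g2 x))" for x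
      unfolding Gn_gram W_split[symmetric] by (rule op_eq_on_refl)
    have a1: "(\<Sum>x\<in>seqs n. pn n x * hs (J n) (seqs n) (Gn n x - (Vn n \<star>\<^bsub>Zg n ?g1\<^esub> adj (Vn n)) \<star>\<^bsub>J n\<^esub> Gn n x)) \<le> \<epsilon>"
      using N n unfolding Pn_def[symmetric] by simp
    have a2: "(\<Sum>x\<in>seqs n. pn n x * hs (J n) (seqs n) (Hn n ?g2 x)) \<le> \<epsilon>"
      and a4: "(\<Sum>x\<in>seqs n. pn n x * hs (seqs n) (seqs n \<times> seqs n) (red (Gn n x) - PBn n ?g3 \<star>\<^bsub>seqs n\<^esub> red (Gn n x))) \<le> \<epsilon>"
      and a5: "(\<Sum>x\<in>seqs n. pn n x * hs (seqs n) (seqs n \<times> seqs n) (red (Gn n x) - QBn n ?g4 x \<star>\<^bsub>seqs n\<^esub> red (Gn n x))) \<le> \<epsilon>"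
      using N n by simp_all
    have a3: "card (Zg n ?g1) * (\<Sum>x\<in>seqs n. pn n x * hs (Zg n ?g1) (Zg n ?g1) (adj (Vn n) \<star>\<^bsub>J n\<^esub> Tn n ?g2 x \<star>\<^bsub>J n\<^esub> Vn n)) \<le> \<epsilon> * (real M * real K)"
    proof -
      have "card (Zg n ?g1) * (\<Sum>x\<in>seqs n. pn n x * hs (Zg n ?g1) (Zg n ?g1) (adj (Vn n) \<star>\<^bsub>J n\<^esub> Tn n ?g2 x \<star>\<^bsub>J n\<^esub> Vn n)) \<le> 2 powr (n * (?g1 - ?g2))"
        by (rule covering_variance)
      also have "\<dots> = 2 powr (- (real n * \<delta>)) * 2 powr (n * (H1 - H2 + 3 * \<delta>))"
        unfolding powr_add[symmetric] by (rule arg_cong[where f="\<lambda>y. 2 powr y"]) (simp add: algebra_simps)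
      also have "\<dots> \<le> \<epsilon> * (real M * real K)" using small L \<epsilon> by (intro mult_mono) auto
      finally show ?thesis .
    qed
    have a6: "(real K - 1) * (\<Sum>x\<in>seqs n. \<Sum>y\<in>seqs n. pn n x * pn n y * hs (seqs n) (seqs n \<times> seqs n) (QBn n ?g4 x \<star>\<^bsub>seqs n\<^esub> PBn n ?g3 \<star>\<^bsub>seqs n\<^esub> red (Gn n y))) \<le> \<epsilon>"
    proof -
      have "(\<Sum>x\<in>seqs n. \<Sum>y\<in>seqs n. pn n x * pn n y * hs (seqs n) (seqs n \<times> seqs n) (QBn n ?g4 x \<star>\<^bsub>seqs n\<^esub> PBn n ?g3 \<star>\<^bsub>seqs n\<^esub> red (Gn n y)))
        = (\<Sum>x\<in>seqs n. pn n x * (\<Sum>y\<in>seqs n. pn n y * hs (seqs n) (seqs n \<times> seqs n) (QBn n ?g4 x \<star>\<^bsub>seqs n\<^esub> PBn n ?g3 \<star>\<^bsub>seqs n\<^esub> red (Gn n y))))"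
        by (simp add: sum_distrib_left mult.assoc)
      also have "\<dots> \<le> (\<Sum>x\<in>seqs n. pn n x * 2 powr (n * (?g4 - ?g3)))"
        by (intro sum_mono mult_left_mono false_decoding nonneg)
      also have "\<dots> = 2 powr (n * (?g4 - ?g3))" by (simp add: sums_1 flip: sum_distrib_right)
      finally have "(real K - 1) * (\<Sum>x\<in>seqs n. \<Sum>y\<in>seqs n. pn n x * pn n y * hs (seqs n) (seqs n \<times> seqs n) (QBn n ?g4 x \<star>\<^bsub>seqs n\<^esub> PBn n ?g3 \<star>\<^bsub>seqs n\<^esub> red (Gn n y)))
         \<le> 2 powr (n * (H3 - H4 - 3 * \<delta>)) * 2 powr (n * (?g4 - ?g3))"
        using K MK by (intro mult_mono) (auto intro!: sum_nonneg simp: nonneg)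
      also have "\<dots> = 2 powr (- (real n * \<delta>))"
        unfolding powr_add[symmetric] by (rule arg_cong[where f="\<lambda>y. 2 powr y"]) (simp add: algebra_simps)
      finally show ?thesis using small by linarith
    qed
    obtain Om \<Lambda> f where *: "povm_on (seqs n) {1..M} Om" "\<And>m. m \<in> {1..M} \<Longrightarrow> povm_on (seqs n) {1..K} (\<Lambda> m)"
      "\<And>m k. m \<in> {1..M} \<Longrightarrow> k \<in> {1..K} \<Longrightarrow> f m k \<in> seqs n"
      "\<And>C. (\<And>m k. m \<in> {1..M} \<Longrightarrow> k \<in> {1..K} \<Longrightarrow> contr (J n) (J n) (C m k)) \<Longrightarrow>
         cmod (\<Sum>m\<in>{1..M}. \<Sum>k\<in>{1..K}. tr (J n) (C m k \<star>\<^bsub>J n\<^esub>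
        (amp (psd_sqrt (seqs n) (\<Lambda> m k)) \<star>\<^bsub>J n\<^esub> (Phi \<star>\<^bsub>seqs n\<^esub> Om m \<star>\<^bsub>seqs n\<^esub> adj Phi) \<star>\<^bsub>J n\<^esub> amp (psd_sqrt (seqs n) (\<Lambda> m k))
         - smul (complex_of_real (1 / (real M * real K))) (Gn n (f m k) \<star>\<^bsub>seqs n\<^esub> adj (Gn n (f m k)))))) \<le> 50 * sqrt (sqrt \<epsilon>)"
      by (rule one_shot_coding[OF finite_seqs finite_seqs finite_seqs finite_seqs finite_Z(1)[of n ?g1] nonneg(1) sums_1(1) hs_Gn Phi' isoms_Z(1)
           split projns(2)[of n ?g3] projns(3)[of n ?g4] MK \<epsilon> a1 a2 a3 a4 a5 a6]) blast
    show "\<exists>Om \<Lambda> f. povm_on (seqs n) {1..M} Om \<and> (\<forall>m\<in>{1..M}. povm_on (seqs n) {1..K} (\<Lambda> m)) \<and>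
       (\<forall>m\<in>{1..M}. \<forall>k\<in>{1..K}. f m k \<in> seqs n) \<and>
       (\<forall>C. (\<forall>m\<in>{1..M}. \<forall>k\<in>{1..K}. contr (J n) (J n) (C m k)) \<longrightarrow>
         cmod (\<Sum>m\<in>{1..M}. \<Sum>k\<in>{1..K}. tr (J n) (C m k \<star>\<^bsub>J n\<^esub>
        (amp (psd_sqrt (seqs n) (\<Lambda> m k)) \<star>\<^bsub>J n\<^esub> (Phi \<star>\<^bsub>seqs n\<^esub> Om m \<star>\<^bsub>seqs n\<^esub> adj Phi) \<star>\<^bsub>J n\<^esub> amp (psd_sqrt (seqs n) (\<Lambda> m k))
         - smul (complex_of_real (1 / (real M * real K))) (W_pow W n (f m k))))) \<le> 50 * sqrt (sqrt \<epsilon>))"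
      by (rule exI[of _ Om], rule exI[of _ \<Lambda>], rule exI[of _ f]) (intro conjI ballI allI impI *[unfolded Gn_gram], auto)
  qed
qed

end

subsection \<open>Single-letter spectra and entropies\<close>

lemma op_eq_on_UNIV: "op_eq_on UNIV A B \<Longrightarrow> A = B"
  unfolding op_eq_on_def by (intro ext) blast

lemma density_spectrum:
  fixes A :: "'i::finite op"
  assumes "density_on UNIV A"
  shows "\<exists>(U :: 'i op) d. isom UNIV UNIV U \<and> A = spec UNIV U d \<and> (\<forall>k. d k \<ge> 0) \<and> (\<Sum>k\<in>UNIV. d k) = 1"
proof -
  have psd: "psd_on UNIV A" and tr1: "tr UNIV A = 1" using assms by (auto simp: density_on_def)
  obtain U :: "'i op" and d where U: "isom UNIV UNIV U" "op_eq_on UNIV A (spec UNIV U d)" "\<And>k. k \<in> UNIV \<Longrightarrow> d k \<ge> 0"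
    by (rule psd_spectral[OF finite_class.finite_UNIV psd]) blast
  have A: "A = spec UNIV U d" by (rule op_eq_on_UNIV[OF U(2)])
  have "complex_of_real (\<Sum>k\<in>UNIV. d k) = 1" using tr_spec[OF U(1), of d] tr1 by (simp add: A)
  then have "(\<Sum>k\<in>UNIV. d k) = 1" by (metis of_real_eq_1_iff)
  with U A show ?thesis by blast
qed

lemma trR_gram: "trR (M \<star>\<^bsub>Z\<^esub> adj M) = red M \<star>\<^bsub>UNIV \<times> Z\<^esub> adj (red M)"
  by (auto simp: fun_eq_iff trR_def mm_def adj_def red_def sum.cartesian_product case_prod_beta)

lemma density_trR:
  fixes A :: "('r::finite \<times> 'b::finite) op"
  assumes "density_on UNIV A"
  shows "density_on UNIV (trR A)"
proof -
  have psd: "psd_on UNIV A" and tr1: "tr UNIV A = 1" using assms by (auto simp: density_on_def)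
  obtain g :: "('r \<times> 'b) op" where "op_eq_on UNIV A (g \<star>\<^bsub>UNIV\<^esub> adj g)"
    by (rule psd_gram[OF finite_class.finite_UNIV psd])
  then have "A = g \<star>\<^bsub>UNIV\<^esub> adj g" by (rule op_eq_on_UNIV)
  then have "psd_on UNIV (trR A)" by (simp only: trR_gram psd_on_gram)
  moreover have "tr UNIV (trR A) = tr UNIV A"
  proof -
    have "tr UNIV (trR A) = (\<Sum>r\<in>UNIV. \<Sum>b\<in>UNIV. A (r, b) (r, b))"
      unfolding op_trace_def trR_def by (rule sum.swap)
    also have "\<dots> = tr UNIV A" by (simp add: op_trace_def sum.cartesian_product case_prod_beta)
    finally show ?thesis .
  qed
  ultimately show ?thesis using tr1 by (simp add: density_on_def)
qed

lemma density_mixture: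
  fixes A :: "'x::finite \<Rightarrow> 'i::finite op"
  assumes P: "\<And>x. P x \<ge> 0" "(\<Sum>x\<in>UNIV. P x) = 1" and A: "\<And>x. density_on UNIV (A x)"
  shows "density_on UNIV (\<lambda>u v. \<Sum>x\<in>UNIV. complex_of_real (P x) * A x u v)"
proof -
  have eq: "(\<lambda>u v. \<Sum>x\<in>UNIV. complex_of_real (P x) * A x u v) = (\<Sum>x\<in>UNIV. smul (complex_of_real (P x)) (A x))"
    by (simp add: fun_eq_iff sum_fun_apply)
  have "tr UNIV (\<Sum>x\<in>UNIV. smul (complex_of_real (P x)) (A x)) = complex_of_real (\<Sum>x\<in>UNIV. P x)"
    using A by (simp add: tr_sum tr_smul density_on_def)
  moreover have "psd_on UNIV (\<Sum>x\<in>UNIV. smul (complex_of_real (P x)) (A x))"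
    using A P by (intro psd_on_sum psd_on_smul) (auto simp: density_on_def)
  ultimately show ?thesis unfolding eq density_on_def using P by simp
qed

text \<open>Chain rule: the eigenvectors are the pairs of a basis state \<open>x\<close> with an
  eigenvector of \<open>A x\<close>, and the logarithm of the product of weights separates.\<close>

lemma entropy_cq:
  fixes A :: "'x::finite \<Rightarrow> 'i::finite op" and U :: "'x \<Rightarrow> 'i \<Rightarrow> 'k::finite \<Rightarrow> complex"
  assumes P: "\<And>x. P x \<ge> 0" and U: "\<And>x. isom UNIV UNIV (U x)" and A: "\<And>x. A x = spec UNIV (U x) (d x)"
    and d: "\<And>x k. d x k \<ge> 0" "\<And>x. (\<Sum>k\<in>UNIV. d x k) = 1"
  shows "vn_entropy UNIV (\<lambda>(x, u) (x', u'). if x = x' then complex_of_real (P x) * A x u u' else 0)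
    = (\<Sum>x\<in>UNIV. - (P x * log 2 (P x))) + (\<Sum>x\<in>UNIV. P x * (\<Sum>k\<in>UNIV. - (d x k * log 2 (d x k))))"
proof -
  define V :: "'x \<times> 'i \<Rightarrow> 'x \<times> 'k \<Rightarrow> complex" where "V = (\<lambda>(x, u) (y, k). if x = y then U x u k else 0)"
  have split_sum: "(\<Sum>z\<in>UNIV. f z) = (\<Sum>x\<in>UNIV. \<Sum>k\<in>UNIV. f (x, k))" for f :: "'v::finite \<times> 'w::finite \<Rightarrow> 'c::comm_monoid_add"
    by (simp add: sum.cartesian_product flip: UNIV_Times_UNIV)
  have ifd: "(\<Sum>y\<in>UNIV. if y = x then f y else 0) = f x" for f :: "'x \<Rightarrow> complex" and x by simp
  have iso: "isom UNIV UNIV V"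
    unfolding isom_def op_eq_on_def
  proof (intro ballI)
    fix z z' :: "'x \<times> 'k"
    obtain x k x' k' where z: "z = (x, k)" "z' = (x', k')" by fastforce
    have "(adj V \<star>\<^bsub>UNIV\<^esub> V) z z' = (\<Sum>y\<in>UNIV. if y = x then (if x = x' then (\<Sum>u\<in>UNIV. cnj (U x u k) * U x u k') else 0) else 0)"
      unfolding z mm_def adj_def split_sum V_def by (intro sum.cong refl) auto
    also have "\<dots> = (if x = x' then (adj (U x) \<star>\<^bsub>UNIV\<^esub> U x) k k' else 0)"
      by (simp add: ifd mm_def adj_def)
    also have "\<dots> = op_id z z'"
      using U[of x] by (auto simp: z isom_def op_eq_on_def op_id_def)
    finally show "(adj V \<star>\<^bsub>UNIV\<^esub> V) z z' = op_id z z'" .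
  qed
  have eq: "op_eq_on UNIV (\<lambda>(x, u) (x', u'). if x = x' then complex_of_real (P x) * A x u u' else 0) (spec UNIV V (\<lambda>(x, k). P x * d x k))"
    unfolding op_eq_on_def
  proof (intro ballI)
    fix z z' :: "'x \<times> 'i"
    obtain x u x' u' where z: "z = (x, u)" "z' = (x', u')" by fastforce
    have "spec UNIV V (\<lambda>(x, k). P x * d x k) z z' =
        (\<Sum>y\<in>UNIV. if y = x then (if x = x' then complex_of_real (P x) * spec UNIV (U x) (d x) u u' else 0) else 0)"
      unfolding z spec_def split_sum V_def
      by (intro sum.cong refl) (auto simp: sum_distrib_left mult_ac)
    then show "(case z of (x, u) \<Rightarrow> \<lambda>(x', u'). if x = x' then complex_of_real (P x) * A x u u' else 0) z' = spec UNIV V (\<lambda>(x, k). P x * d x k) z z'"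
      by (simp add: z ifd A)
  qed
  have "vn_entropy UNIV (\<lambda>(x, u) (x', u'). if x = x' then complex_of_real (P x) * A x u u' else 0)
     = (\<Sum>z\<in>UNIV. - ((case z of (x, k) \<Rightarrow> P x * d x k) * log 2 (case z of (x, k) \<Rightarrow> P x * d x k)))"
    by (rule vn_entropy_spec[OF _ _ iso eq]) auto
  also have "\<dots> = (\<Sum>x\<in>UNIV. \<Sum>k\<in>UNIV. - (P x * d x k * log 2 (P x * d x k)))"
    unfolding split_sum by simp
  also have "\<dots> = (\<Sum>x\<in>UNIV. - (P x * log 2 (P x)) + P x * (\<Sum>k\<in>UNIV. - (d x k * log 2 (d x k))))"
  proof (intro sum.cong refl)
    fix x
    \<comment> \<open>If a weight is zero, both sides vanish with the convention
      \<open>log 2 0 = 0\<close>.\<close>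
    have "- (P x * d x k * log 2 (P x * d x k)) = - (P x * log 2 (P x)) * d x k + P x * - (d x k * log 2 (d x k))" for k
      using P[of x] d(1)[of x k] by (simp add: log_mult algebra_simps)
    then have "(\<Sum>k\<in>UNIV. - (P x * d x k * log 2 (P x * d x k)))
       = - (P x * log 2 (P x)) * (\<Sum>k\<in>UNIV. d x k) + P x * (\<Sum>k\<in>UNIV. - (d x k * log 2 (d x k)))"
      by (simp only: sum.distrib sum_distrib_left)
    then show "(\<Sum>k\<in>UNIV. - (P x * d x k * log 2 (P x * d x k)))
       = - (P x * log 2 (P x)) + P x * (\<Sum>k\<in>UNIV. - (d x k * log 2 (d x k)))"
      by (simp add: d(2))
  qed
  finally show ?thesis by (simp only: sum.distrib)
qed

subsection \<open>Protocols in matrix form\<close>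

text \<open>The quadratic form of the transpose at \<open>v\<close> is that of \<open>A\<close> at
  the conjugate vector.\<close>

lemma psd_on_transpose:
  assumes "psd_on I A"
  shows "psd_on I (\<lambda>i j. A j i)"
  unfolding psd_on_alt
proof (intro conjI allI)
  have "hermitian_on I A" using assms by (rule psd_hermitian)
  then show "hermitian_on I (\<lambda>i j. A j i)" unfolding hermitian_on_def by blast
  fix v :: "'a \<Rightarrow> complex"
  obtain r where r: "r \<ge> 0" "(\<Sum>i\<in>I. \<Sum>j\<in>I. cnj (cnj (v i)) * A i j * cnj (v j)) = complex_of_real r"
    using assms[unfolded psd_on_alt, THEN conjunct2, rule_format, of "\<lambda>i. cnj (v i)"] by blast
  have "(\<Sum>i\<in>I. \<Sum>j\<in>I. cnj (v i) * A j i * v j) = (\<Sum>j\<in>I. \<Sum>i\<in>I. cnj (v i) * A j i * v j)" by (rule sum.swap)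
  also have "\<dots> = complex_of_real r" using r(2) by (simp add: mult_ac)
  finally show "\<exists>t\<ge>0. (\<Sum>i\<in>I. \<Sum>j\<in>I. cnj (v i) * A j i * v j) = complex_of_real t" using r(1) by blast
qed

lemma povm_on_transpose: "povm_on I M E \<Longrightarrow> povm_on I M (\<lambda>m i j. E m j i)"
  by (auto simp: povm_on_def op_eq_on_def op_id_def intro: psd_on_transpose)

text \<open>The n-fold purification vector read as a matrix with columns indexed by A, so that its
  Gram matrix is the reduced state on RB.\<close>

definition purif_mat :: "('a::finite \<times> 'b::finite) op \<Rightarrow> nat \<Rightarrow> (nat \<Rightarrow> 'a \<times> 'b) \<times> (nat \<Rightarrow> 'b) \<Rightarrow> (nat \<Rightarrow> 'a) \<Rightarrow> complex" where
  "purif_mat \<rho> n = (\<lambda>(r, b) a. \<Prod>k<n. purif_vec \<rho> (r k, a k, b k))"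

text \<open>Tracing out \<open>A\<^sup>n\<close> transposes the measurement operator.\<close>

lemma enc_state_mm: "enc_state \<rho> n (\<lambda>a a''. Om a'' a) = purif_mat \<rho> n \<star>\<^bsub>seqs n\<^esub> Om \<star>\<^bsub>seqs n\<^esub> adj (purif_mat \<rho> n)"
proof (intro ext)
  fix i j :: "(nat \<Rightarrow> 'a \<times> 'b) \<times> (nat \<Rightarrow> 'b)"
  obtain r b r' b' where ij: "i = (r, b)" "j = (r', b')" by fastforce
  have "enc_state \<rho> n (\<lambda>a a''. Om a'' a) i j
     = (\<Sum>a\<in>seqs n. \<Sum>a''\<in>seqs n. purif_mat \<rho> n i a'' * (Om a'' a * cnj (purif_mat \<rho> n j a)))"
    by (simp add: ij enc_state_def purif_pow_def purif_def purif_mat_def prod.distrib mult_ac)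
  also have "\<dots> = (\<Sum>a''\<in>seqs n. \<Sum>a\<in>seqs n. purif_mat \<rho> n i a'' * (Om a'' a * cnj (purif_mat \<rho> n j a)))"
    by (rule sum.swap)
  also have "\<dots> = (purif_mat \<rho> n \<star>\<^bsub>seqs n\<^esub> Om \<star>\<^bsub>seqs n\<^esub> adj (purif_mat \<rho> n)) i j"
    by (simp add: mm_def adj_def sum_distrib_left)
  finally show "enc_state \<rho> n (\<lambda>a a''. Om a'' a) i j = (purif_mat \<rho> n \<star>\<^bsub>seqs n\<^esub> Om \<star>\<^bsub>seqs n\<^esub> adj (purif_mat \<rho> n)) i j" .
qed

lemma purif_mat_gram:
  "purif_mat \<rho> n \<star>\<^bsub>seqs n\<^esub> adj (purif_mat \<rho> n) = (\<lambda>i j. \<Prod>k<n. purif_RB \<rho> (zip_letters i k) (zip_letters j k))"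
proof (intro ext)
  fix i j :: "(nat \<Rightarrow> 'a \<times> 'b) \<times> (nat \<Rightarrow> 'b)"
  obtain r b r' b' where ij: "i = (r, b)" "j = (r', b')" by fastforce
  have "(purif_mat \<rho> n \<star>\<^bsub>seqs n\<^esub> adj (purif_mat \<rho> n)) i j
     = (\<Sum>a\<in>seqs n. \<Prod>k<n. (\<lambda>k s. purif_vec \<rho> (r k, s, b k) * cnj (purif_vec \<rho> (r' k, s, b' k))) k (a k))"
    by (simp add: ij mm_def adj_def purif_mat_def prod.distrib)
  also have "\<dots> = (\<Prod>k<n. \<Sum>s\<in>UNIV. purif_vec \<rho> (r k, s, b k) * cnj (purif_vec \<rho> (r' k, s, b' k)))"
    by (rule sum_seqs_prod)
  also have "\<dots> = (\<Prod>k<n. purif_RB \<rho> (zip_letters i k) (zip_letters j k))"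
    by (simp add: ij purif_RB_def purif_def zip_letters_def)
  finally show "(purif_mat \<rho> n \<star>\<^bsub>seqs n\<^esub> adj (purif_mat \<rho> n)) i j = (\<Prod>k<n. purif_RB \<rho> (zip_letters i k) (zip_letters j k))" .
qed

lemma post_state_mm:
  fixes T :: "((nat \<Rightarrow> 'r::finite) \<times> (nat \<Rightarrow> 'b::finite)) op"
  shows "op_eq_on (seqs n \<times> seqs n) (post_state n T Lam)
    (amp (psd_sqrt (seqs n) Lam) \<star>\<^bsub>seqs n \<times> seqs n\<^esub> T \<star>\<^bsub>seqs n \<times> seqs n\<^esub> amp (psd_sqrt (seqs n) Lam))"
  unfolding op_eq_on_def
proof (intro ballI)
  fix i j :: "(nat \<Rightarrow> 'r) \<times> (nat \<Rightarrow> 'b)" assume ij: "i \<in> seqs n \<times> seqs n" "j \<in> seqs n \<times> seqs n"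
  obtain r b r' b' where e: "i = (r, b)" "j = (r', b')" by fastforce
  have rr: "r \<in> seqs n" "r' \<in> seqs n" using ij by (auto simp: e)
  let ?S = "psd_sqrt (seqs n) Lam"
  have right: "(T \<star>\<^bsub>seqs n \<times> seqs n\<^esub> amp ?S) x (r', b') = (\<Sum>c'\<in>seqs n. T x (r', c') * ?S c' b')" for x
  proof -
    have "(T \<star>\<^bsub>seqs n \<times> seqs n\<^esub> amp ?S) x (r', b') = (\<Sum>s\<in>seqs n. \<Sum>c'\<in>seqs n. T x (s, c') * (if s = r' then ?S c' b' else 0))"
      by (simp add: mm_def amp_def sum.cartesian_product case_prod_beta cong: if_cong)
    also have "\<dots> = (\<Sum>s\<in>seqs n. if s = r' then (\<Sum>c'\<in>seqs n. T x (r', c') * ?S c' b') else 0)"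
      by (intro sum.cong) auto
    finally show ?thesis using rr by simp
  qed
  show "post_state n T Lam i j = (amp ?S \<star>\<^bsub>seqs n \<times> seqs n\<^esub> T \<star>\<^bsub>seqs n \<times> seqs n\<^esub> amp ?S) i j"
    unfolding e amp_mm[OF finite_seqs rr(1)] right
    by (simp add: post_state_def Let_def sum_distrib_left mult.assoc)
qed

text \<open>The deviations of the outcome probabilities from the uniform weight \<^term>\<open>c\<close> are themselves
  controlled by the hypothesis, used with scalar test contractions.\<close>

lemma normalize_outcomes:
  fixes \<tau> :: "'l \<Rightarrow> 'i op" and G :: "'l \<Rightarrow> 'i \<Rightarrow> 'z \<Rightarrow> complex"
  assumes fin: "finite J" and hsG: "\<And>l. l \<in> L \<Longrightarrow> hs J Z (G l) = 1"
    and bound: "\<And>C. (\<And>l. l \<in> L \<Longrightarrow> contr J J (C l)) \<Longrightarrow>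
      cmod (\<Sum>l\<in>L. tr J (C l \<star>\<^bsub>J\<^esub> (\<tau> l - smul c (G l \<star>\<^bsub>Z\<^esub> adj (G l))))) \<le> b"
    and C: "\<And>l. l \<in> L \<Longrightarrow> contr J J (C l)"
  shows "cmod (\<Sum>l\<in>L. tr J (C l \<star>\<^bsub>J\<^esub> (\<tau> l - smul (tr J (\<tau> l)) (G l \<star>\<^bsub>Z\<^esub> adj (G l))))) \<le> 2 * b"
proof -
  let ?W = "\<lambda>l. G l \<star>\<^bsub>Z\<^esub> adj (G l)"
  define \<alpha> where "\<alpha> l = tr J (C l \<star>\<^bsub>J\<^esub> ?W l)" for l
  have \<alpha>: "cmod (\<alpha> l) \<le> 1" if "l \<in> L" for l
    using contr_tr_gram[OF C[OF that], of "G l" Z] hsG[OF that] by (simp add: \<alpha>_def)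
  have trW: "tr J (?W l) = 1" if "l \<in> L" for l using hsG[OF that] by (simp add: hs_tr')
  have tr_id: "tr J (op_id \<star>\<^bsub>J\<^esub> M) = tr J M" for M by (intro tr_cong mm_op_id_left fin)
  \<comment> \<open>As each \<open>?W l\<close> has trace 1, changing its weight from
    \<open>c\<close> to \<open>tr J (\<tau> l)\<close> is the difference in \<open>bound\<close>
    tested against \<open>\<alpha> l\<close> times the identity, a contraction since
    \<open>cmod (\<alpha> l) \<le> 1\<close>.\<close>
  have "tr J (C l \<star>\<^bsub>J\<^esub> (\<tau> l - smul (tr J (\<tau> l)) (?W l))) =
      tr J (C l \<star>\<^bsub>J\<^esub> (\<tau> l - smul c (?W l))) - tr J (smul (\<alpha> l) op_id \<star>\<^bsub>J\<^esub> (\<tau> l - smul c (?W l)))" if "l \<in> L" for l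
    by (simp only: mm_diff_right mm_smul_right mm_smul_left tr_diff tr_smul tr_id trW[OF that] \<alpha>_def[symmetric])
       (simp add: algebra_simps)
  then have "cmod (\<Sum>l\<in>L. tr J (C l \<star>\<^bsub>J\<^esub> (\<tau> l - smul (tr J (\<tau> l)) (?W l)))) =
      cmod ((\<Sum>l\<in>L. tr J (C l \<star>\<^bsub>J\<^esub> (\<tau> l - smul c (?W l)))) - (\<Sum>l\<in>L. tr J (smul (\<alpha> l) op_id \<star>\<^bsub>J\<^esub> (\<tau> l - smul c (?W l)))))"
    unfolding sum_subtractf[symmetric] by (intro arg_cong[where f=cmod] sum.cong refl) blast
  also have "\<dots> \<le> b + b"
    by (intro order_trans[OF norm_triangle_ineq4] add_mono bound C contr_smul \<alpha> contr_id fin)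
  finally show ?thesis by simp
qed

text \<open>The error is a trace norm on X, R and B with one block per reconstruction word.
  \<open>cq_trace_norm\<close> turns it into tests on RB, one for each pair \<open>(m, k)\<close>,
  and \<open>normalize_outcomes\<close> replaces the uniform weight by the outcome
  probabilities.\<close>

lemma protocol_error_le:
  fixes \<rho> :: "('a::finite \<times> 'b::finite) op" and W :: "'x::finite \<Rightarrow> (('a \<times> 'b) \<times> 'b) op"
    and G :: "(nat \<Rightarrow> 'x) \<Rightarrow> (nat \<Rightarrow> 'a \<times> 'b) \<times> (nat \<Rightarrow> 'b) \<Rightarrow> 'z \<Rightarrow> complex"
  assumes Om: "\<And>m. m \<in> {1..M} \<Longrightarrow> psd_on (seqs n) (Om m)" and \<Lambda>: "\<And>m. m \<in> {1..M} \<Longrightarrow> povm_on (seqs n) {1..K} (\<Lambda> m)"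
    and f: "\<And>m k. m \<in> {1..M} \<Longrightarrow> k \<in> {1..K} \<Longrightarrow> f m k \<in> seqs n"
    and G: "\<And>x. G x \<star>\<^bsub>Z\<^esub> adj (G x) = W_pow W n x" "\<And>x. hs (seqs n \<times> seqs n) Z (G x) = 1"
    and bound: "\<And>C. (\<And>m k. m \<in> {1..M} \<Longrightarrow> k \<in> {1..K} \<Longrightarrow> contr (seqs n \<times> seqs n) (seqs n \<times> seqs n) (C m k)) \<Longrightarrow>
      cmod (\<Sum>m\<in>{1..M}. \<Sum>k\<in>{1..K}. tr (seqs n \<times> seqs n) (C m k \<star>\<^bsub>seqs n \<times> seqs n\<^esub>
        (amp (psd_sqrt (seqs n) (\<Lambda> m k)) \<star>\<^bsub>seqs n \<times> seqs n\<^esub> (purif_mat \<rho> n \<star>\<^bsub>seqs n\<^esub> Om m \<star>\<^bsub>seqs n\<^esub> adj (purif_mat \<rho> n)) \<star>\<^bsub>seqs n \<times> seqs n\<^esub> amp (psd_sqrt (seqs n) (\<Lambda> m k))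
         - smul c (W_pow W n (f m k))))) \<le> b"
  shows "protocol_error \<rho> W n M K (\<lambda>m a a''. Om m a'' a) \<Lambda> f \<le> 2 * b"
proof -
  let ?J = "seqs n \<times> seqs n :: ((nat \<Rightarrow> 'a \<times> 'b) \<times> (nat \<Rightarrow> 'b)) set" and ?L = "{1..M} \<times> {1..K}"
  define S where "S l = (amp (psd_sqrt (seqs n) (\<Lambda> (fst l) (snd l))) :: ((nat \<Rightarrow> 'a \<times> 'b) \<times> (nat \<Rightarrow> 'b)) op)" for l
  define T where "T l = purif_mat \<rho> n \<star>\<^bsub>seqs n\<^esub> Om (fst l) \<star>\<^bsub>seqs n\<^esub> adj (purif_mat \<rho> n)" for l :: "nat \<times> nat"
  define \<tau> where "\<tau> l = S l \<star>\<^bsub>?J\<^esub> T l \<star>\<^bsub>?J\<^esub> S l" for l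
  define post where "post l = post_state n (enc_state \<rho> n (\<lambda>a a''. Om (fst l) a'' a)) (\<Lambda> (fst l) (snd l))" for l
  define F where "F l = f (fst l) (snd l)" for l
  define D where "D l = post l - smul (tr ?J (post l)) (W_pow W n (F l))" for l
  have finJ: "finite ?J" by simp
  have post: "op_eq_on ?J (post l) (\<tau> l)" for l
    unfolding post_def \<tau>_def S_def T_def enc_state_mm by (rule post_state_mm)
  have tr_post: "tr ?J (post l) = tr ?J (\<tau> l)" for l by (rule op_eq_on_tr[OF post])
  have psd\<tau>: "psd_on ?J (\<tau> l)" if l: "l \<in> ?L" for l
  proof -
    have a: "adj (S l) = S l"
      unfolding S_def using povm_sqrt(2)[OF finite_seqs finite_atLeastAtMost \<Lambda>] l by auto
    have "psd_on (seqs n) (Om (fst l))" using Om l by auto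
    then have "psd_on ?J (adj (adj (purif_mat \<rho> n)) \<star>\<^bsub>seqs n\<^esub> Om (fst l) \<star>\<^bsub>seqs n\<^esub> adj (purif_mat \<rho> n))"
      by (intro psd_on_conj finite_seqs)
    then have "psd_on ?J (T l)" by (simp add: T_def)
    then have "psd_on ?J (adj (S l) \<star>\<^bsub>?J\<^esub> T l \<star>\<^bsub>?J\<^esub> S l)" by (intro psd_on_conj finJ)
    then show ?thesis by (simp only: \<tau>_def a)
  qed
  have psdW: "psd_on ?J (W_pow W n x)" for x
    using psd_on_gram[of ?J "G x" Z] by (simp only: G)
  \<comment> \<open>Duality is available for Hermitian operators only. The outcome weight is real
    because \<open>\<tau> l\<close> is positive semidefinite.\<close>
  have herm: "hermitian_on ?J (D l)" if l: "l \<in> ?L" for l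
  proof -
    have "cnj (tr ?J (\<tau> l)) = tr ?J (adj (\<tau> l))" by (simp only: tr_adj)
    also have "\<dots> = tr ?J (\<tau> l)"
      using psd_hermitian[OF psd\<tau>[OF l]] unfolding hermitian_mm_adj by (rule op_eq_on_tr)
    finally have real: "cnj (tr ?J (\<tau> l)) = tr ?J (\<tau> l)" .
    have "psd_on ?J (post l)" using op_eq_on_sym[OF post] psd\<tau>[OF l] by (rule psd_on_cong)
    moreover have "hermitian_on ?J (smul (tr ?J (post l)) (W_pow W n (F l)))"
      using psd_hermitian[OF psdW] unfolding hermitian_mm_adj by (simp add: tr_post real op_eq_on_def)
    ultimately show ?thesis unfolding D_def by (rule hermitian_on_diff[OF psd_hermitian])
  qed
  have fF: "F l \<in> seqs n" if "l \<in> ?L" for l using f that by (auto simp: F_def)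
  obtain C where C: "\<And>l. l \<in> ?L \<Longrightarrow> contr ?J ?J (C l)"
    and tn: "trace_norm (seqs n \<times> ?J) (\<lambda>(y, u) (y', u'). \<Sum>l\<in>?L. if y = F l \<and> y' = F l then D l u u' else 0)
      = Re (\<Sum>l\<in>?L. tr ?J (C l \<star>\<^bsub>?J\<^esub> D l))"
    by (rule cq_trace_norm[OF finite_seqs finJ herm fF]) (assumption | rule that)+
  have "protocol_error \<rho> W n M K (\<lambda>m a a''. Om m a'' a) \<Lambda> f
     = trace_norm (seqs n \<times> ?J) (\<lambda>(y, u) (y', u'). \<Sum>l\<in>?L. if y = F l \<and> y' = F l then D l u u' else 0)"
    unfolding protocol_error_def Let_def
    by (intro arg_cong[where f="trace_norm _"] ext)
       (simp add: sum.cartesian_product case_prod_beta D_def post_def F_def cong: if_cong)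
  also have "\<dots> \<le> cmod (\<Sum>l\<in>?L. tr ?J (C l \<star>\<^bsub>?J\<^esub> D l))" unfolding tn by (rule complex_Re_le_cmod)
  finally have pe: "protocol_error \<rho> W n M K (\<lambda>m a a''. Om m a'' a) \<Lambda> f \<le> cmod (\<Sum>l\<in>?L. tr ?J (C l \<star>\<^bsub>?J\<^esub> D l))" .
  have D: "op_eq_on ?J (D l) (\<tau> l - smul (tr ?J (\<tau> l)) (G (F l) \<star>\<^bsub>Z\<^esub> adj (G (F l))))" for l
    unfolding D_def tr_post G(1) by (intro op_eq_on_diff op_eq_on_refl post)
  have eq: "(\<Sum>l\<in>?L. tr ?J (C l \<star>\<^bsub>?J\<^esub> D l)) = (\<Sum>l\<in>?L. tr ?J (C l \<star>\<^bsub>?J\<^esub> (\<tau> l - smul (tr ?J (\<tau> l)) (G (F l) \<star>\<^bsub>Z\<^esub> adj (G (F l))))))"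
    by (rule sum.cong[OF refl], rule op_eq_on_tr, rule op_eq_on_mm[OF op_eq_on_refl D])
  have "cmod (\<Sum>l\<in>?L. tr ?J (C l \<star>\<^bsub>?J\<^esub> (\<tau> l - smul (tr ?J (\<tau> l)) (G (F l) \<star>\<^bsub>Z\<^esub> adj (G (F l)))))) \<le> 2 * b"
  proof (rule normalize_outcomes[OF finJ G(2) _ C])
    fix C' :: "nat \<times> nat \<Rightarrow> ((nat \<Rightarrow> 'a \<times> 'b) \<times> (nat \<Rightarrow> 'b)) op"
    assume C': "\<And>l. l \<in> ?L \<Longrightarrow> contr ?J ?J (C' l)"
    have e: "(\<Sum>l\<in>?L. tr ?J (C' l \<star>\<^bsub>?J\<^esub> (\<tau> l - smul c (W_pow W n (F l)))))
      = (\<Sum>m\<in>{1..M}. \<Sum>k\<in>{1..K}. tr ?J (C' (m, k) \<star>\<^bsub>?J\<^esub> (\<tau> (m, k) - smul c (W_pow W n (F (m, k))))))"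
      unfolding sum.cartesian_product by (rule sum.cong[OF refl]) auto
    have "contr ?J ?J (C' (m, k))" if "m \<in> {1..M}" "k \<in> {1..K}" for m k
      using that by (intro C') simp
    from bound[of "\<lambda>m k. C' (m, k)", OF this]
    show "cmod (\<Sum>l\<in>?L. tr ?J (C' l \<star>\<^bsub>?J\<^esub> (\<tau> l - smul c (G (F l) \<star>\<^bsub>Z\<^esub> adj (G (F l)))))) \<le> b"
      unfolding G(1) e unfolding \<tau>_def S_def T_def F_def fst_conv snd_conv .
  qed
  then show ?thesis using pe unfolding eq by linarith
qed

theorem theorem1:
  fixes \<rho> :: "('a::finite \<times> 'b::finite) op"
    and W :: "'x::finite \<Rightarrow> (('a \<times> 'b) \<times> 'b) op"
    and P :: "'x \<Rightarrow> real"
    and R :: real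
  assumes "density_on UNIV \<rho>"
    and "\<forall>x. density_on UNIV (W x)"
    and "P \<in> admissible \<rho> W"
    and "R \<ge> mi_X_RB (cq_state P W) - mi_X_B (cq_state P W)"
  shows "achievable \<rho> W R"
proof -
  have pP: "\<And>x. P x \<ge> 0" "(\<Sum>x\<in>UNIV. P x) = 1"
    and om': "op_eq_on UNIV (\<lambda>u u'. \<Sum>x\<in>UNIV. complex_of_real (P x) * W x u u') (purif_RB \<rho>)"
    using assms(3) by (auto simp: admissible_def prob_dist_def)
  have om: "(\<Sum>x\<in>UNIV. complex_of_real (P x) * W x u v) = purif_RB \<rho> u v" for u v
    using fun_cong[OF fun_cong[OF op_eq_on_UNIV[OF om']]] .
  have dW: "density_on UNIV (W x)" for x using assms(2) by blast
  have dWB: "density_on UNIV (trR (W x))" for x by (intro density_trR dW)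
  obtain U :: "'x \<Rightarrow> (('a \<times> 'b) \<times> 'b) op" and d where
    sU: "\<And>x. isom UNIV UNIV (U x)" "\<And>x. W x = spec UNIV (U x) (d x)" "\<And>x k. d x k \<ge> 0" "\<And>x. (\<Sum>k\<in>UNIV. d x k) = 1"
    using density_spectrum[OF dW] by metis
  obtain UB :: "'x \<Rightarrow> 'b op" and dB where
    sUB: "\<And>x. isom UNIV UNIV (UB x)" "\<And>x. trR (W x) = spec UNIV (UB x) (dB x)" "\<And>x k. dB x k \<ge> 0" "\<And>x. (\<Sum>k\<in>UNIV. dB x k) = 1"
    using density_spectrum[OF dWB] by metis
  obtain V :: "(('a \<times> 'b) \<times> 'b) op" and e where
    sV: "isom UNIV UNIV V" "(\<lambda>u v. \<Sum>x\<in>UNIV. complex_of_real (P x) * W x u v) = spec UNIV V e" "\<And>k. e k \<ge> 0" "(\<Sum>k\<in>UNIV. e k) = 1"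
  proof -
    have "\<exists>(V :: (('a \<times> 'b) \<times> 'b) op) e. isom UNIV UNIV V \<and> (\<lambda>u v. \<Sum>x\<in>UNIV. complex_of_real (P x) * W x u v) = spec UNIV V e
      \<and> (\<forall>k. e k \<ge> 0) \<and> (\<Sum>k\<in>UNIV. e k) = 1"
      by (rule density_spectrum[OF density_mixture[OF pP dW]])
    then show thesis by (elim exE conjE) (rule that, assumption+, erule HOL.spec, assumption)
  qed
  obtain VB :: "'b op" and eB where
    sVB: "isom UNIV UNIV VB" "(\<lambda>u v. \<Sum>x\<in>UNIV. complex_of_real (P x) * trR (W x) u v) = spec UNIV VB eB" "\<And>k. eB k \<ge> 0" "(\<Sum>k\<in>UNIV. eB k) = 1"
  proof -
    have "\<exists>(V :: 'b op) e. isom UNIV UNIV V \<and> (\<lambda>u v. \<Sum>x\<in>UNIV. complex_of_real (P x) * trR (W x) u v) = spec UNIV V e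
      \<and> (\<forall>k. e k \<ge> 0) \<and> (\<Sum>k\<in>UNIV. e k) = 1"
      by (rule density_spectrum[OF density_mixture[OF pP dWB]])
    then show thesis by (elim exE conjE) (rule that, assumption+, erule HOL.spec, assumption)
  qed
  interpret letter_spectra P W U d UB dB V e VB eB
    by unfold_locales (use pP sU sUB sV sVB in \<open>auto dest: fun_cong\<close>)
  have "marg_RB (cq_state P W) = spec UNIV V e"
    unfolding sV(2)[symmetric] by (simp add: marg_RB_def cq_state_def)
  then have E1: "vn_entropy UNIV (marg_RB (cq_state P W)) = H1"
    unfolding H1_def by (intro vn_entropy_spec[OF _ _ sV(1)]) (auto simp: op_eq_on_def)
  have "marg_B (cq_state P W) = spec UNIV VB eB"
    unfolding sVB(2)[symmetric] by (simp add: marg_B_def cq_state_def trR_def sum_distrib_left)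
  then have E3: "vn_entropy UNIV (marg_B (cq_state P W)) = H3"
    unfolding H3_def by (intro vn_entropy_spec[OF _ _ sVB(1)]) (auto simp: op_eq_on_def)
  have E2: "vn_entropy UNIV (cq_state P W) = (\<Sum>x\<in>UNIV. - (P x * log 2 (P x))) + H2"
    unfolding H2_def cq_state_def by (rule entropy_cq[OF pP(1) sU])
  have "marg_XB (cq_state P W) = (\<lambda>(x, b) (x', b'). if x = x' then complex_of_real (P x) * trR (W x) b b' else 0)"
    by (auto simp: fun_eq_iff marg_XB_def cq_state_def trR_def sum_distrib_left)
  then have E4: "vn_entropy UNIV (marg_XB (cq_state P W)) = (\<Sum>x\<in>UNIV. - (P x * log 2 (P x))) + H4"
    unfolding H4_def by (simp only: entropy_cq[OF pP(1) sUB])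
  \<comment> \<open>The entropy of X occurs in both mutual informations and in both joint entropies
    and cancels.\<close>
  have R: "R \<ge> (H1 - H2) - (H3 - H4)"
    using assms(4) by (simp add: mi_X_RB_def mi_X_B_def E1 E2 E3 E4)
  \<comment> \<open>Admissibility of \<open>P\<close> enters here: the reduced state of the n-fold
    purification is the average codeword state.\<close>
  have Phi: "purif_mat \<rho> n \<star>\<^bsub>seqs n\<^esub> adj (purif_mat \<rho> n) = (\<Sum>x\<in>seqs n. smul (complex_of_real (pn n x)) (W_pow W n x))" for n
  proof -
    have "purif_RB \<rho> u v = spec UNIV V e u v" for u v unfolding om[symmetric] by (rule mix)
    then show ?thesis
      unfolding mixture_n purif_mat_gram Vn_def en_def
      by (intro ext) (simp only: spec_tpow[where d="\<lambda>_. e"])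
  qed
  show ?thesis
    unfolding achievable_def
  proof (intro allI impI)
    fix \<epsilon> :: real assume \<epsilon>: "\<epsilon> > 0"
    \<comment> \<open>The fourth power undoes the double root: 50 times
      \<open>\<epsilon> / 100\<close> is \<open>\<epsilon> / 2\<close>, and normalizing the outcomes
      doubles this to \<open>\<epsilon>\<close>.\<close>
    define \<epsilon>' where "\<epsilon>' = min (1 / 441) ((\<epsilon> / 100) ^ 4)"
    have \<epsilon>': "0 < \<epsilon>'" "\<epsilon>' \<le> 1 / 441" using \<epsilon> by (auto simp: \<epsilon>'_def)
    have root: "50 * sqrt (sqrt \<epsilon>') \<le> \<epsilon> / 2"
    proof -
      have "sqrt (sqrt \<epsilon>') \<le> sqrt (sqrt ((\<epsilon> / 100) ^ 4))" by (simp add: \<epsilon>'_def)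
      also have "(\<epsilon> / 100) ^ 4 = (((\<epsilon> / 100)\<^sup>2))\<^sup>2" by simp
      also have "sqrt (sqrt ((((\<epsilon> / 100)\<^sup>2))\<^sup>2)) = \<epsilon> / 100" using \<epsilon> by (simp only: real_sqrt_abs) simp
      finally show ?thesis by simp
    qed
    \<comment> \<open>The rate exceeds the mutual information difference by
      \<open>6 * \<delta> = \<epsilon> / 2\<close>.\<close>
    define \<delta> where "\<delta> = \<epsilon> / 12"
    have \<delta>: "\<delta> > 0" using \<epsilon> by (simp add: \<delta>_def)
    obtain N where N: "\<forall>n\<ge>N. \<forall>M K (Phi :: (nat \<Rightarrow> 'a \<times> 'b) \<times> (nat \<Rightarrow> 'b) \<Rightarrow> (nat \<Rightarrow> 'a) \<Rightarrow> complex).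
      M \<ge> 1 \<longrightarrow> K \<ge> 1 \<longrightarrow> real K - 1 \<le> 2 powr (n * (H3 - H4 - 3 * \<delta>)) \<longrightarrow> 2 powr (n * (H1 - H2 + 3 * \<delta>)) \<le> real M * real K \<longrightarrow>
      Phi \<star>\<^bsub>seqs n\<^esub> adj Phi = (\<Sum>x\<in>seqs n. smul (complex_of_real (pn n x)) (W_pow W n x)) \<longrightarrow>
      (\<exists>Om \<Lambda> f. povm_on (seqs n) {1..M} Om \<and> (\<forall>m\<in>{1..M}. povm_on (seqs n) {1..K} (\<Lambda> m)) \<and>
       (\<forall>m\<in>{1..M}. \<forall>k\<in>{1..K}. f m k \<in> seqs n) \<and>
       (\<forall>C. (\<forall>m\<in>{1..M}. \<forall>k\<in>{1..K}. contr (J n) (J n) (C m k)) \<longrightarrow>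
         cmod (\<Sum>m\<in>{1..M}. \<Sum>k\<in>{1..K}. tr (J n) (C m k \<star>\<^bsub>J n\<^esub>
        (amp (psd_sqrt (seqs n) (\<Lambda> m k)) \<star>\<^bsub>J n\<^esub> (Phi \<star>\<^bsub>seqs n\<^esub> Om m \<star>\<^bsub>seqs n\<^esub> adj Phi) \<star>\<^bsub>J n\<^esub> amp (psd_sqrt (seqs n) (\<Lambda> m k))
         - smul (complex_of_real (1 / (real M * real K))) (W_pow W n (f m k))))) \<le> 50 * sqrt (sqrt \<epsilon>')))"
      using coding_eventually[OF \<epsilon>' \<delta>, where 'a='a] by blast
    show "\<exists>N. \<forall>n\<ge>N. \<exists>Th Thb Om Lam f. is_protocol n Th Thb Om Lam (f :: nat \<Rightarrow> nat \<Rightarrow> (nat \<Rightarrow> 'x)) \<and>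
        log 2 (real Th) / real n \<le> R + \<epsilon> \<and> protocol_error \<rho> W n Th Thb Om Lam f \<le> \<epsilon>"
    proof (rule exI[of _ "max N (nat \<lceil>2 / \<epsilon>\<rceil>)"], intro allI impI)
      fix n assume n: "n \<ge> max N (nat \<lceil>2 / \<epsilon>\<rceil>)"
      \<comment> \<open>The other half of the rate allowance,
        \<open>\<epsilon> / 2 \<ge> 1 / n\<close>, pays for one bit lost in rounding
        \<open>M\<close> up.\<close>
      have n2: "real n \<ge> 2 / \<epsilon>" using n by linarith
      then have n0: "real n > 0" using \<epsilon> by (meson divide_pos_pos less_le_trans zero_less_numeral)
      define r where "r = (H1 - H2) - (H3 - H4) + 6 * \<delta>"
      \<comment> \<open>Without this, rounding up to \<open>M \<ge> 1\<close> could raise the rate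
        by more than a vanishing amount.\<close>
      have r0: "r \<ge> 0" using holevo_monotone \<delta> by (simp add: r_def)
      define M where "M = nat \<lceil>2 powr (n * r)\<rceil>"
      define K where "K = nat \<lceil>2 powr (n * (H3 - H4 - 3 * \<delta>))\<rceil>"
      have ceil: "nat \<lceil>2 powr y\<rceil> \<ge> 1" "2 powr y \<le> real (nat \<lceil>2 powr y\<rceil>)" "real (nat \<lceil>2 powr y\<rceil>) - 1 \<le> 2 powr y" for y :: real
      proof -
        have "(0::real) < 2 powr y" by simp
        then show "nat \<lceil>2 powr y\<rceil> \<ge> 1" by (simp add: Suc_le_eq)
        show "2 powr y \<le> real (nat \<lceil>2 powr y\<rceil>)" by (rule real_nat_ceiling_ge)
        show "real (nat \<lceil>2 powr y\<rceil>) - 1 \<le> 2 powr y" using \<open>0 < 2 powr y\<close> by linarith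
      qed
      have MK: "M \<ge> 1" "K \<ge> 1" "real K - 1 \<le> 2 powr (n * (H3 - H4 - 3 * \<delta>))"
        unfolding M_def K_def by (rule ceil)+
      have L: "2 powr (n * (H1 - H2 + 3 * \<delta>)) \<le> real M * real K"
      proof -
        have "2 powr (n * (H1 - H2 + 3 * \<delta>)) = 2 powr (n * r) * 2 powr (n * (H3 - H4 - 3 * \<delta>))"
          unfolding powr_add[symmetric] by (rule arg_cong[where f="\<lambda>y. 2 powr y"]) (simp add: r_def algebra_simps)
        also have "\<dots> \<le> real M * real K" unfolding M_def K_def by (rule mult_mono[OF ceil(2) ceil(2) of_nat_0_le_iff powr_ge_zero])
        finally show ?thesis .
      qed
      obtain Om \<Lambda> f where Om: "povm_on (seqs n) {1..M} Om" and \<Lambda>: "\<forall>m\<in>{1..M}. povm_on (seqs n) {1..K} (\<Lambda> m)"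
       and f: "\<forall>m\<in>{1..M}. \<forall>k\<in>{1..K}. f m k \<in> seqs n"
       and err: "\<forall>C. (\<forall>m\<in>{1..M}. \<forall>k\<in>{1..K}. contr (J n) (J n) (C m k)) \<longrightarrow>
         cmod (\<Sum>m\<in>{1..M}. \<Sum>k\<in>{1..K}. tr (J n) (C m k \<star>\<^bsub>J n\<^esub>
        (amp (psd_sqrt (seqs n) (\<Lambda> m k)) \<star>\<^bsub>J n\<^esub> (purif_mat \<rho> n \<star>\<^bsub>seqs n\<^esub> Om m \<star>\<^bsub>seqs n\<^esub> adj (purif_mat \<rho> n)) \<star>\<^bsub>J n\<^esub> amp (psd_sqrt (seqs n) (\<Lambda> m k))
         - smul (complex_of_real (1 / (real M * real K))) (W_pow W n (f m k))))) \<le> 50 * sqrt (sqrt \<epsilon>')"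
        using N[rule_format, OF _ MK L Phi[of n]] n by auto
      \<comment> \<open>The protocol receives the transposes of the constructed operators, which
        undoes the transposition caused by tracing out A.\<close>
      have "protocol_error \<rho> W n M K (\<lambda>m a a''. Om m a'' a) \<Lambda> f \<le> 2 * (50 * sqrt (sqrt \<epsilon>'))"
      proof (rule protocol_error_le[where G="Gn n" and Z="seqs n" and c="complex_of_real (1 / (real M * real K))"])
        show "psd_on (seqs n) (Om m)" if "m \<in> {1..M}" for m using Om that by (auto simp only: povm_on_def)
        show "povm_on (seqs n) {1..K} (\<Lambda> m)" if "m \<in> {1..M}" for m using \<Lambda> that by (rule bspec)
        show "f m k \<in> seqs n" if "m \<in> {1..M}" "k \<in> {1..K}" for m k using bspec[OF bspec[OF f that(1)] that(2)] .
      qed (rule Gn_gram, rule hs_Gn, rule err[rule_format], blast)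
      then have E: "protocol_error \<rho> W n M K (\<lambda>m a a''. Om m a'' a) \<Lambda> f \<le> \<epsilon>" using root by linarith
      have prot: "is_protocol n M K (\<lambda>m a a''. Om m a'' a) \<Lambda> f"
        unfolding is_protocol_def using MK povm_on_transpose[OF Om] \<Lambda> f by blast
      have "log 2 (real M) \<le> 1 + n * r"
      proof -
        have "real M \<le> 2 powr (n * r) + 1" using ceil(3)[of "n * r"] by (simp add: M_def)
        \<comment> \<open>As \<open>r \<ge> 0\<close>, the 1 from rounding is at most
          \<open>2 powr (n * r)\<close>, so rounding at most doubles the bound on
          \<open>M\<close>.\<close>
        also have "\<dots> \<le> 2 powr (n * r) + 2 powr (n * r)"
          using r0 by (intro add_left_mono ge_one_powr_ge_zero) auto
        also have "\<dots> = 2 powr (1 + n * r)" by (simp add: powr_add)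
        finally have "log 2 (real M) \<le> log 2 (2 powr (1 + n * r))" using MK(1) by (subst log_le_cancel_iff) auto
        then show ?thesis by simp
      qed
      then have "log 2 (real M) / n \<le> (1 + n * r) / n" using n0 by (intro divide_right_mono) auto
      also have "\<dots> = 1 / n + r" using n0 by (simp add: add_divide_distrib)
      also have "\<dots> \<le> \<epsilon> / 2 + r"
        using n2 n0 \<epsilon> by (simp add: field_simps)
      also have "\<dots> \<le> R + \<epsilon>" using R by (simp add: r_def \<delta>_def)
      finally have "log 2 (real M) / real n \<le> R + \<epsilon>" .
      with prot E show "\<exists>Th Thb Om Lam f. is_protocol n Th Thb Om Lam (f :: nat \<Rightarrow> nat \<Rightarrow> (nat \<Rightarrow> 'x)) \<and>
        log 2 (real Th) / real n \<le> R + \<epsilon> \<and> protocol_error \<rho> W n Th Thb Om Lam f \<le> \<epsilon>" by blast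
    qed
  qed
qed

end
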